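(* Let $(\Sigma,\mathbb T)$ be a regular theory. Let $(\mathbb C_{\mathbb T},F_{\mathbb T})$ be its associated regular calculus, let $\mathrm{Syn}(\mathbb C_{\mathbb T},F_{\mathbb T})$ be the syntactic po-category of that regular calculus, let $\mathcal C^{\mathrm{reg}}_{\mathbb T}$ be the classical syntactic regular category of $(\Sigma,\mathbb T)$, and let $\mathrm{Rel}(\mathcal C^{\mathrm{reg}}_{\mathbb T})$ be its po-category of relations. Then $\mathrm{Syn}(\mathbb C_{\mathbb T},F_{\mathbb T})$ is equivalent to $\mathrm{Rel}(\mathcal C^{\mathrm{reg}}_{\mathbb T})$ as a po-category. That is, under the equivalence between relational po-categories and regular categories (which sends a regular category $\mathcal R$ to $\mathrm{Rel}(\mathcal R)$, and a relational po-category to its category of left adjoints) the two constructions agree: $\mathcal C^{\mathrm{reg}}_{\mathbb T}$ is equivalent to the category $\mathrm{LAdj}\,\mathrm{Syn}(\mathbb C_{\mathbb T},F_{\mathbb T})$ whose objects are those of $\mathrm{Syn}(\mathbb C_{\mathbb T},F_{\mathbb T})$ and whose morphisms are the left adjoint morphisms.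
   Context: Composition is written diagrammatically, $f;g$. A po-category is a 2-category whose hom-categories are posets; a po-functor is a functor that is monotone on homs. An equivalence of po-categories is a po-functor that is an isomorphism of posets on each hom and is essentially surjective on objects. The po-prop $\mathbb W$: objects are the natural numbers $n$ (identified with $\underline n=\{1,\dots,n\}$). Its hom-posets are the poset reflections of the categories of cospans of finite sets $\underline m\to S\leftarrow\underline n$, where $\omega\le\omega'$ iff there is a function from the apex of $\omega'$ to the apex of $\omega$ commuting with the legs. Composition is by pushout; the tensor is disjoint union $+$ with unit $0$. It is generated by $\epsilon:1\to0$, $\delta:1\to2$, $\eta:0\to1$, $\mu:2\to1$, given by the cospans with apex $\underline 1$. Regular theory $(\Sigma,\mathbb T)$: a set of sorts, a set of relation symbols each with a finite list of sorts as arity (no function symbols), and a set $\mathbb T$ of axioms, which are sequents $\varphi\vdash\psi$ between regular formulae in context. Regular formulae are built from relation symbols using $\top,\wedge,=,\exists$. Regular calculus of a theory: $\mathbb C_{\mathbb T}=\bigsqcup_{\Sigma\text{-sort}}\mathbb W$, the coproduct of symmetric monoidal po-categories. Its objects are families $(n_\sigma)_\sigma$ of natural numbers with all but finitely many $n_\sigma=0$; its morphisms are families of morphisms of $\mathbb W$, all but finitely many being $\mathrm{id}_0$; the tensor is componentwise. An object $\Gamma=(n_\sigma)$ is viewed as the context having $n_\sigma$ variables of each sort $\sigma$. $F_{\mathbb T}(\Gamma)$ is the poset of regular formulae in context $\Gamma$ modulo $\alpha$-equivalence and interprovability, ordered by provability from $\mathbb T$ in regular logic in that context. $F_{\mathbb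 T}$ is the po-functor to posets determined on a generator at sort $\sigma$, tensored with identities, by: - $\eta_\sigma$ weakens $\varphi(\vec x)$ by a fresh variable $y:\sigma$; - $\epsilon_\sigma$ sends $\varphi(\vec x,y)$ to $\exists y\,\varphi(\vec x,y)$; - $\mu_\sigma$ sends $\varphi(\vec x,y,y')$ to $\varphi(\vec x,y,y)$; - $\delta_\sigma$ sends $\varphi(\vec x,y)$ to $\varphi(\vec x,y)\wedge y=y'$. Its lax monoidal structure is $\mathrm{true}=\top$ in the empty context, and $\varphi(\vec x)\boxplus\psi(\vec y)=\varphi(\vec x)\wedge\psi(\vec y)$ with disjoint variables. Each object $\Gamma$ of $\mathbb C_{\mathbb T}$ has componentwise induced maps $\epsilon_\Gamma:\Gamma\to I$, $\delta_\Gamma:\Gamma\to\Gamma\otimes\Gamma$, $\eta_\Gamma$, $\mu_\Gamma$ (via symmetries), and $\mathrm{cap}_\Gamma=\mu_\Gamma;\epsilon_\Gamma$. Syntactic po-category of $(\mathbb C,P)=(\mathbb C_{\mathbb T},F_{\mathbb T})$: objects are pairs $(\Gamma,p)$ with $\Gamma\in\mathbb C$ and $p\in P(\Gamma)$. The hom-poset from $(\Gamma_1,p_1)$ to $(\Gamma_2,p_2)$ is $\{\theta\in P(\Gamma_1\otimes\Gamma_2)\mid\theta\le p_1\boxplus p_2\}$ with the induced order. The identity on $(\Gamma,p)$ is $P(\delta_\Gamma)(p)$. The composite is $\theta_{12};\theta_{23}=P(\mathrm{id}_{\Gamma_1}\otimes\mathrm{cap}_{\Gamma_2}\otimes\mathrm{id}_{\Gamma_3})(\theta_{12}\boxplus\theta_{23})$.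 $\mathcal C^{\mathrm{reg}}_{\mathbb T}$ is the usual syntactic category of the regular theory: objects are regular formulae in context up to $\alpha$-equivalence; morphisms are $\mathbb T$-provable-equivalence classes of $\mathbb T$-provably functional regular formulae. For a regular category $\mathcal R$, $\mathrm{Rel}(\mathcal R)$ has the objects of $\mathcal R$, hom-posets $\mathrm{Sub}_{\mathcal R}(r_1\times r_2)$, and the usual composition of relations. A relational po-category is a po-category arising, up to equivalence, as $\mathrm{Rel}(\mathcal R)$. *)

theory Defs
  imports "HOL-Library.FuncSet"
begin

section \<open>Categories and po-categories\<close>

text \<open>Composition is diagrammatic: \<^term>\<open>comp C a b c f g\<close> is the composite
  of \<open>f : a \<rightarrow> b\<close> followed by \<open>g : b \<rightarrow> c\<close>. Hom-sets need not be disjoint.\<close>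

record ('o, 'a) cat =
  obj :: "'o set"
  hom :: "'o \<Rightarrow> 'o \<Rightarrow> 'a set"
  ident :: "'o \<Rightarrow> 'a"
  comp :: "'o \<Rightarrow> 'o \<Rightarrow> 'o \<Rightarrow> 'a \<Rightarrow> 'a \<Rightarrow> 'a"

record ('o, 'a) pocat = "('o, 'a) cat" +
  le :: "'o \<Rightarrow> 'o \<Rightarrow> 'a \<Rightarrow> 'a \<Rightarrow> bool"

definition category :: "('o, 'a, 'z) cat_scheme \<Rightarrow> bool" where
  "category C \<longleftrightarrow>
     (\<forall>a\<in>obj C. ident C a \<in> hom C a a) \<and>
     (\<forall>a\<in>obj C. \<forall>b\<in>obj C. \<forall>c\<in>obj C. \<forall>f\<in>hom C a b. \<forall>g\<in>hom C b c.
        comp C a b c f g \<in> hom C a c) \<and>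
     (\<forall>a\<in>obj C. \<forall>b\<in>obj C. \<forall>f\<in>hom C a b.
        comp C a a b (ident C a) f = f \<and> comp C a b b f (ident C b) = f) \<and>
     (\<forall>a\<in>obj C. \<forall>b\<in>obj C. \<forall>c\<in>obj C. \<forall>d\<in>obj C.
        \<forall>f\<in>hom C a b. \<forall>g\<in>hom C b c. \<forall>h\<in>hom C c d.
        comp C a c d (comp C a b c f g) h = comp C a b d f (comp C b c d g h))"

definition poset_on :: "'x set \<Rightarrow> ('x \<Rightarrow> 'x \<Rightarrow> bool) \<Rightarrow> bool" where
  "poset_on A r \<longleftrightarrow>
     (\<forall>x\<in>A. r x x) \<and>
     (\<forall>x\<in>A. \<forall>y\<in>A. \<forall>z\<in>A. r x y \<longrightarrow> r y z \<longrightarrow> r x z) \<and>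
     (\<forall>x\<in>A. \<forall>y\<in>A. r x y \<longrightarrow> r y x \<longrightarrow> x = y)"

definition po_category :: "('o, 'a, 'z) pocat_scheme \<Rightarrow> bool" where
  "po_category C \<longleftrightarrow> category C \<and>
     (\<forall>a\<in>obj C. \<forall>b\<in>obj C. poset_on (hom C a b) (le C a b)) \<and>
     (\<forall>a\<in>obj C. \<forall>b\<in>obj C. \<forall>c\<in>obj C.
        \<forall>f\<in>hom C a b. \<forall>f'\<in>hom C a b. \<forall>g\<in>hom C b c. \<forall>g'\<in>hom C b c.
        le C a b f f' \<longrightarrow> le C b c g g' \<longrightarrow>
        le C a c (comp C a b c f g) (comp C a b c f' g'))"

definition is_functor ::
  "('o, 'a, 'y) cat_scheme \<Rightarrow> ('p, 'b, 'z) cat_scheme \<Rightarrow>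
   ('o \<Rightarrow> 'p) \<Rightarrow> ('o \<Rightarrow> 'o \<Rightarrow> 'a \<Rightarrow> 'b) \<Rightarrow> bool" where
  "is_functor C D Fo Fa \<longleftrightarrow>
     (\<forall>a\<in>obj C. Fo a \<in> obj D) \<and>
     (\<forall>a\<in>obj C. \<forall>b\<in>obj C. \<forall>f\<in>hom C a b. Fa a b f \<in> hom D (Fo a) (Fo b)) \<and>
     (\<forall>a\<in>obj C. Fa a a (ident C a) = ident D (Fo a)) \<and>
     (\<forall>a\<in>obj C. \<forall>b\<in>obj C. \<forall>c\<in>obj C. \<forall>f\<in>hom C a b. \<forall>g\<in>hom C b c.
        Fa a c (comp C a b c f g) = comp D (Fo a) (Fo b) (Fo c) (Fa a b f) (Fa b c g))"

definition po_functor ::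
  "('o, 'a, 'y) pocat_scheme \<Rightarrow> ('p, 'b, 'z) pocat_scheme \<Rightarrow>
   ('o \<Rightarrow> 'p) \<Rightarrow> ('o \<Rightarrow> 'o \<Rightarrow> 'a \<Rightarrow> 'b) \<Rightarrow> bool" where
  "po_functor C D Fo Fa \<longleftrightarrow> is_functor C D Fo Fa \<and>
     (\<forall>a\<in>obj C. \<forall>b\<in>obj C. \<forall>f\<in>hom C a b. \<forall>g\<in>hom C a b.
        le C a b f g \<longrightarrow> le D (Fo a) (Fo b) (Fa a b f) (Fa a b g))"

definition isomorphic :: "('o, 'a, 'z) cat_scheme \<Rightarrow> 'o \<Rightarrow> 'o \<Rightarrow> bool" where
  "isomorphic C a b \<longleftrightarrow> (\<exists>f\<in>hom C a b. \<exists>g\<in>hom C b a.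
     comp C a b a f g = ident C a \<and> comp C b a b g f = ident C b)"

definition cat_equivalent ::
  "('o, 'a, 'y) cat_scheme \<Rightarrow> ('p, 'b, 'z) cat_scheme \<Rightarrow> bool" where
  "cat_equivalent C D \<longleftrightarrow> category C \<and> category D \<and>
     (\<exists>Fo Fa. is_functor C D Fo Fa \<and>
        (\<forall>a\<in>obj C. \<forall>b\<in>obj C. bij_betw (Fa a b) (hom C a b) (hom D (Fo a) (Fo b))) \<and>
        (\<forall>d\<in>obj D. \<exists>c\<in>obj C. isomorphic D (Fo c) d))"

definition po_equivalent ::
  "('o, 'a, 'y) pocat_scheme \<Rightarrow> ('p, 'b, 'z) pocat_scheme \<Rightarrow> bool" where
  "po_equivalent C D \<longleftrightarrow> po_category C \<and> po_category D \<and>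
     (\<exists>Fo Fa. po_functor C D Fo Fa \<and>
        (\<forall>a\<in>obj C. \<forall>b\<in>obj C.
           bij_betw (Fa a b) (hom C a b) (hom D (Fo a) (Fo b)) \<and>
           (\<forall>f\<in>hom C a b. \<forall>g\<in>hom C a b.
              le D (Fo a) (Fo b) (Fa a b f) (Fa a b g) \<longrightarrow> le C a b f g)) \<and>
        (\<forall>d\<in>obj D. \<exists>c\<in>obj C. isomorphic D (Fo c) d))"

definition left_adjoint :: "('o, 'a, 'z) pocat_scheme \<Rightarrow> 'o \<Rightarrow> 'o \<Rightarrow> 'a \<Rightarrow> bool" where
  "left_adjoint C a b f \<longleftrightarrow> f \<in> hom C a b \<and>
     (\<exists>g\<in>hom C b a. le C a a (ident C a) (comp C a b a f g) \<and>
                    le C b b (comp C b a b g f) (ident C b))"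

definition LAdj :: "('o, 'a, 'z) pocat_scheme \<Rightarrow> ('o, 'a) cat" where
  "LAdj C = \<lparr>obj = obj C, hom = (\<lambda>a b. {f. left_adjoint C a b f}),
             ident = ident C, comp = comp C\<rparr>"

section \<open>Regular categories and relations\<close>

definition is_mono :: "('o, 'a, 'z) cat_scheme \<Rightarrow> 'o \<Rightarrow> 'o \<Rightarrow> 'a \<Rightarrow> bool" where
  "is_mono C a b f \<longleftrightarrow> f \<in> hom C a b \<and>
     (\<forall>x\<in>obj C. \<forall>g\<in>hom C x a. \<forall>h\<in>hom C x a.
        comp C x a b g f = comp C x a b h f \<longrightarrow> g = h)"

definition is_terminal :: "('o, 'a, 'z) cat_scheme \<Rightarrow> 'o \<Rightarrow> bool" where
  "is_terminal C t \<longleftrightarrow> t \<in> obj C \<and> (\<forall>x\<in>obj C. \<exists>!h. h \<in> hom C x t)"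

definition is_product ::
  "('o, 'a, 'z) cat_scheme \<Rightarrow> 'o \<Rightarrow> 'o \<Rightarrow> 'o \<Rightarrow> 'a \<Rightarrow> 'a \<Rightarrow> bool" where
  "is_product C a b p u v \<longleftrightarrow> p \<in> obj C \<and> u \<in> hom C p a \<and> v \<in> hom C p b \<and>
     (\<forall>x\<in>obj C. \<forall>f\<in>hom C x a. \<forall>g\<in>hom C x b.
        \<exists>!h. h \<in> hom C x p \<and> comp C x p a h u = f \<and> comp C x p b h v = g)"

definition is_pullback ::
  "('o, 'a, 'z) cat_scheme \<Rightarrow> 'o \<Rightarrow> 'o \<Rightarrow> 'o \<Rightarrow> 'a \<Rightarrow> 'a \<Rightarrow> 'o \<Rightarrow> 'a \<Rightarrow> 'a \<Rightarrow> bool" where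
  "is_pullback C a b c f g p u v \<longleftrightarrow>
     p \<in> obj C \<and> u \<in> hom C p a \<and> v \<in> hom C p b \<and>
     comp C p a c u f = comp C p b c v g \<and>
     (\<forall>x\<in>obj C. \<forall>s\<in>hom C x a. \<forall>t\<in>hom C x b. comp C x a c s f = comp C x b c t g \<longrightarrow>
        (\<exists>!h. h \<in> hom C x p \<and> comp C x p a h u = s \<and> comp C x p b h v = t))"

definition is_coequalizer ::
  "('o, 'a, 'z) cat_scheme \<Rightarrow> 'o \<Rightarrow> 'o \<Rightarrow> 'o \<Rightarrow> 'a \<Rightarrow> 'a \<Rightarrow> 'a \<Rightarrow> bool" where
  "is_coequalizer C k a b f g e \<longleftrightarrow>
     e \<in> hom C a b \<and> comp C k a b f e = comp C k a b g e \<and>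
     (\<forall>x\<in>obj C. \<forall>t\<in>hom C a x. comp C k a x f t = comp C k a x g t \<longrightarrow>
        (\<exists>!h. h \<in> hom C b x \<and> comp C a b x e h = t))"

definition is_regular_epi :: "('o, 'a, 'z) cat_scheme \<Rightarrow> 'o \<Rightarrow> 'o \<Rightarrow> 'a \<Rightarrow> bool" where
  "is_regular_epi C a b e \<longleftrightarrow>
     (\<exists>k\<in>obj C. \<exists>f\<in>hom C k a. \<exists>g\<in>hom C k a. is_coequalizer C k a b f g e)"

definition is_image ::
  "('o, 'a, 'z) cat_scheme \<Rightarrow> 'o \<Rightarrow> 'o \<Rightarrow> 'a \<Rightarrow> 'o \<Rightarrow> 'a \<Rightarrow> bool" where
  "is_image C a b f d m \<longleftrightarrow> d \<in> obj C \<and> is_mono C d b m \<and>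
     (\<exists>e. is_regular_epi C a d e \<and> comp C a d b e m = f)"

definition regular_category :: "('o, 'a, 'z) cat_scheme \<Rightarrow> bool" where
  "regular_category C \<longleftrightarrow> category C \<and>
     (\<exists>t. is_terminal C t) \<and>
     (\<forall>a\<in>obj C. \<forall>b\<in>obj C. \<forall>c\<in>obj C. \<forall>f\<in>hom C a c. \<forall>g\<in>hom C b c.
        \<exists>p u v. is_pullback C a b c f g p u v) \<and>
     (\<forall>a\<in>obj C. \<forall>b\<in>obj C. \<forall>f\<in>hom C a b. \<exists>d m. is_image C a b f d m) \<and>
     (\<forall>a\<in>obj C. \<forall>b\<in>obj C. \<forall>c\<in>obj C. \<forall>f\<in>hom C a c. \<forall>g\<in>hom C b c. \<forall>p u v.
        is_pullback C a b c f g p u v \<longrightarrow> is_regular_epi C b c g \<longrightarrow> is_regular_epi C p a u)"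

text \<open>A subobject of \<open>x\<close> is an equivalence class of pairs \<open>(d, m)\<close>
  with \<open>m : d \<rightarrow> x\<close> a monomorphism.\<close>

definition monos_into :: "('o, 'a, 'z) cat_scheme \<Rightarrow> 'o \<Rightarrow> ('o \<times> 'a) set" where
  "monos_into C x = {(d, m). d \<in> obj C \<and> is_mono C d x m}"

definition factors_through ::
  "('o, 'a, 'z) cat_scheme \<Rightarrow> 'o \<Rightarrow> 'o \<times> 'a \<Rightarrow> 'o \<times> 'a \<Rightarrow> bool" where
  "factors_through C x s t \<longleftrightarrow>
     (\<exists>h\<in>hom C (fst s) (fst t). comp C (fst s) (fst t) x h (snd t) = snd s)"

definition sub_class :: "('o, 'a, 'z) cat_scheme \<Rightarrow> 'o \<Rightarrow> 'o \<times> 'a \<Rightarrow> ('o \<times> 'a) set" where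
  "sub_class C x s =
     {t \<in> monos_into C x. factors_through C x s t \<and> factors_through C x t s}"

definition Sub :: "('o, 'a, 'z) cat_scheme \<Rightarrow> 'o \<Rightarrow> ('o \<times> 'a) set set" where
  "Sub C x = sub_class C x ` monos_into C x"

definition sub_le ::
  "('o, 'a, 'z) cat_scheme \<Rightarrow> 'o \<Rightarrow> ('o \<times> 'a) set \<Rightarrow> ('o \<times> 'a) set \<Rightarrow> bool" where
  "sub_le C x M N \<longleftrightarrow> (\<exists>s\<in>M. \<exists>t\<in>N. factors_through C x s t)"

definition chosen_product :: "('o, 'a, 'z) cat_scheme \<Rightarrow> 'o \<Rightarrow> 'o \<Rightarrow> 'o \<times> 'a \<times> 'a" where
  "chosen_product C a b = (SOME (p, u, v). is_product C a b p u v)"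

definition prd :: "('o, 'a, 'z) cat_scheme \<Rightarrow> 'o \<Rightarrow> 'o \<Rightarrow> 'o" where
  "prd C a b = fst (chosen_product C a b)"

definition prj1 :: "('o, 'a, 'z) cat_scheme \<Rightarrow> 'o \<Rightarrow> 'o \<Rightarrow> 'a" where
  "prj1 C a b = fst (snd (chosen_product C a b))"

definition prj2 :: "('o, 'a, 'z) cat_scheme \<Rightarrow> 'o \<Rightarrow> 'o \<Rightarrow> 'a" where
  "prj2 C a b = snd (snd (chosen_product C a b))"

definition pairing ::
  "('o, 'a, 'z) cat_scheme \<Rightarrow> 'o \<Rightarrow> 'o \<Rightarrow> 'o \<Rightarrow> 'a \<Rightarrow> 'a \<Rightarrow> 'a" where
  "pairing C x a b f g = (THE h. h \<in> hom C x (prd C a b) \<and>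
     comp C x (prd C a b) a h (prj1 C a b) = f \<and>
     comp C x (prd C a b) b h (prj2 C a b) = g)"

text \<open>The composite of relations \<open>r \<rightarrowtail> a \<times> b\<close> and \<open>s \<rightarrowtail> b \<times> c\<close>: the image in
  \<open>a \<times> c\<close> of the pullback of \<open>r\<close> and \<open>s\<close> over \<open>b\<close>.\<close>

definition rel_comp ::
  "('o, 'a, 'z) cat_scheme \<Rightarrow> 'o \<Rightarrow> 'o \<Rightarrow> 'o \<Rightarrow>
   ('o \<times> 'a) set \<Rightarrow> ('o \<times> 'a) set \<Rightarrow> ('o \<times> 'a) set" where
  "rel_comp C a b c M N = {(d, i). \<exists>(r, m)\<in>M. \<exists>(s, n)\<in>N. \<exists>p u v.
     is_pullback C r s b
       (comp C r (prd C a b) b m (prj2 C a b)) (comp C s (prd C b c) b n (prj1 C b c)) p u v \<and>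
     is_image C p (prd C a c)
       (pairing C p a c
          (comp C p r a u (comp C r (prd C a b) a m (prj1 C a b)))
          (comp C p s c v (comp C s (prd C b c) c n (prj2 C b c)))) d i}"

definition Rel :: "('o, 'a, 'z) cat_scheme \<Rightarrow> ('o, ('o \<times> 'a) set) pocat" where
  "Rel C = \<lparr>obj = obj C,
            hom = (\<lambda>a b. Sub C (prd C a b)),
            ident = (\<lambda>a. sub_class C (prd C a a) (a, pairing C a a a (ident C a) (ident C a))),
            comp = rel_comp C,
            le = (\<lambda>a b. sub_le C (prd C a b))\<rparr>"

section \<open>The po-prop of cospans\<close>

text \<open>The finite set with \<open>n\<close> elements is \<open>{..<n}\<close>. A cospan \<open>(k, f, g)\<close> has apex \<open>{..<k}\<close>,
  left leg \<open>f\<close> and right leg \<open>g\<close>; every finite apex is isomorphic to one of this form, so the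
  restriction does not affect the poset reflection.\<close>

type_synonym cospan = "nat \<times> (nat \<Rightarrow> nat) \<times> (nat \<Rightarrow> nat)"

definition cospans :: "nat \<Rightarrow> nat \<Rightarrow> cospan set" where
  "cospans m n = {(k, f, g). f \<in> {..<m} \<rightarrow>\<^sub>E {..<k} \<and> g \<in> {..<n} \<rightarrow>\<^sub>E {..<k}}"

fun cospan_le :: "nat \<Rightarrow> nat \<Rightarrow> cospan \<Rightarrow> cospan \<Rightarrow> bool" where
  "cospan_le m n (k, f, g) (k', f', g') \<longleftrightarrow>
     (\<exists>h\<in>{..<k'} \<rightarrow> {..<k}. (\<forall>i<m. h (f' i) = f i) \<and> (\<forall>j<n. h (g' j) = g j))"

definition cospan_class :: "nat \<Rightarrow> nat \<Rightarrow> cospan \<Rightarrow> cospan set" where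
  "cospan_class m n c = {d \<in> cospans m n. cospan_le m n c d \<and> cospan_le m n d c}"

definition is_pushout ::
  "nat \<Rightarrow> nat \<Rightarrow> nat \<Rightarrow> (nat \<Rightarrow> nat) \<Rightarrow> (nat \<Rightarrow> nat) \<Rightarrow>
   nat \<Rightarrow> (nat \<Rightarrow> nat) \<Rightarrow> (nat \<Rightarrow> nat) \<Rightarrow> bool" where
  "is_pushout n k l g f q i j \<longleftrightarrow>
     i \<in> {..<k} \<rightarrow>\<^sub>E {..<q} \<and> j \<in> {..<l} \<rightarrow>\<^sub>E {..<q} \<and> (\<forall>x<n. i (g x) = j (f x)) \<and>
     (\<forall>r::nat. \<forall>u\<in>{..<k} \<rightarrow>\<^sub>E {..<r}. \<forall>v\<in>{..<l} \<rightarrow>\<^sub>E {..<r}. (\<forall>x<n. u (g x) = v (f x)) \<longrightarrow>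
        (\<exists>!h. h \<in> {..<q} \<rightarrow>\<^sub>E {..<r} \<and> (\<forall>x<k. h (i x) = u x) \<and> (\<forall>y<l. h (j y) = v y)))"

definition W_comp ::
  "nat \<Rightarrow> nat \<Rightarrow> nat \<Rightarrow> cospan set \<Rightarrow> cospan set \<Rightarrow> cospan set" where
  "W_comp m n p M N = (\<Union>(k, f, g)\<in>M. \<Union>(l, f', g')\<in>N. \<Union>(q, i, j)\<in>{(q, i, j). is_pushout n k l g f' q i j}.
     cospan_class m p (q, \<lambda>x\<in>{..<m}. i (f x), \<lambda>y\<in>{..<p}. j (g' y)))"

definition W_id :: "nat \<Rightarrow> cospan set" where
  "W_id n = cospan_class n n (n, \<lambda>i\<in>{..<n}. i, \<lambda>i\<in>{..<n}. i)"

definition Wcat :: "(nat, cospan set) pocat" where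
  "Wcat = \<lparr>obj = UNIV,
        hom = (\<lambda>m n. cospan_class m n ` cospans m n),
        ident = W_id,
        comp = W_comp,
        le = (\<lambda>m n M N. \<exists>c\<in>M. \<exists>d\<in>N. cospan_le m n c d)\<rparr>"

text \<open>The tensor of \<open>M : m \<rightarrow> n\<close> and \<open>M' : m' \<rightarrow> n'\<close>; the elements of the first
  summand come first.\<close>

definition W_tensor ::
  "nat \<Rightarrow> nat \<Rightarrow> nat \<Rightarrow> nat \<Rightarrow> cospan set \<Rightarrow> cospan set \<Rightarrow> cospan set" where
  "W_tensor m n m' n' M M' = (\<Union>(k, f, g)\<in>M. \<Union>(k', f', g')\<in>M'.
     cospan_class (m + m') (n + n')
       (k + k', \<lambda>i\<in>{..<m + m'}. if i < m then f i else k + f' (i - m),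
                \<lambda>j\<in>{..<n + n'}. if j < n then g j else k + g' (j - n)))"

definition W_swap :: "nat \<Rightarrow> nat \<Rightarrow> cospan set" where
  "W_swap m n = cospan_class (m + n) (n + m)
     (m + n, \<lambda>i\<in>{..<m + n}. i, \<lambda>j\<in>{..<n + m}. if j < n then m + j else j - n)"

definition eps1 :: "cospan set" where
  "eps1 = cospan_class 1 0 (1, \<lambda>i\<in>{..<1}. 0, \<lambda>j\<in>{..<0}. 0)"

definition del1 :: "cospan set" where
  "del1 = cospan_class 1 2 (1, \<lambda>i\<in>{..<1}. 0, \<lambda>j\<in>{..<2}. 0)"

definition eta1 :: "cospan set" where
  "eta1 = cospan_class 0 1 (1, \<lambda>i\<in>{..<0}. 0, \<lambda>j\<in>{..<1}. 0)"

definition mu1 :: "cospan set" where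
  "mu1 = cospan_class 2 1 (1, \<lambda>i\<in>{..<2}. 0, \<lambda>j\<in>{..<1}. 0)"

fun W_eps :: "nat \<Rightarrow> cospan set" where
  "W_eps 0 = W_id 0"
| "W_eps (Suc n) = W_tensor n 0 1 0 (W_eps n) eps1"

text \<open>The middle symmetry interleaves the blocks: \<open>(x, x', y, y') \<mapsto> (x, y, x', y')\<close> for
  the comultiplication, and conversely for the multiplication.\<close>

fun W_del :: "nat \<Rightarrow> cospan set" where
  "W_del 0 = W_id 0"
| "W_del (Suc n) = W_comp (n + 1) (n + n + 2) (Suc n + Suc n)
     (W_tensor n (n + n) 1 2 (W_del n) del1)
     (W_tensor n n (n + 1 + 1) (1 + n + 1) (W_id n)
        (W_tensor (n + 1) (1 + n) 1 1 (W_swap n 1) (W_id 1)))"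

fun W_mu :: "nat \<Rightarrow> cospan set" where
  "W_mu 0 = W_id 0"
| "W_mu (Suc n) = W_comp (Suc n + Suc n) (n + n + 2) (n + 1)
     (W_tensor n n (1 + n + 1) (n + 1 + 1) (W_id n)
        (W_tensor (1 + n) (n + 1) 1 1 (W_swap 1 n) (W_id 1)))
     (W_tensor (n + n) n 2 1 (W_mu n) mu1)"

definition W_cap :: "nat \<Rightarrow> cospan set" where
  "W_cap n = W_comp (n + n) n 0 (W_mu n) (W_eps n)"

section \<open>Regular theories\<close>

text \<open>Variables are pairs of a sort and an index, and a context is a family \<open>n\<close> giving the number
  \<open>n \<sigma>\<close> of variables of each sort: its variables are \<open>(\<sigma>, i)\<close> with \<open>i < n \<sigma>\<close>.
  Formulae are taken up to \<open>\<alpha>\<close>-equivalence by using de Bruijn indices, counted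
  separately for each sort: in \<open>Ex \<sigma> \<phi>\<close> the bound variable is \<open>(\<sigma>, 0)\<close>, a variable \<open>(\<sigma>, i)\<close> of
  the surrounding context is \<open>(\<sigma>, Suc i)\<close> in \<open>\<phi>\<close>, and variables of other sorts keep
  their index.\<close>

type_synonym 's ctx = "'s \<Rightarrow> nat"

datatype ('s, 'r) fm =
    Atom 'r "('s \<times> nat) list"
  | Eq 's nat nat
  | Top
  | Conj "('s, 'r) fm" "('s, 'r) fm"
  | Ex 's "('s, 'r) fm"

record ('s, 'r) thy =
  sorts :: "'s set"
  rels :: "'r set"
  arity :: "'r \<Rightarrow> 's list"
  axs :: "('s ctx \<times> ('s, 'r) fm \<times> ('s, 'r) fm) set"

definition ctxs :: "('s, 'r) thy \<Rightarrow> 's ctx set" where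
  "ctxs T = {n. finite {\<sigma>. n \<sigma> \<noteq> 0} \<and> {\<sigma>. n \<sigma> \<noteq> 0} \<subseteq> sorts T}"

definition empty_ctx :: "'s ctx" where
  "empty_ctx = (\<lambda>\<sigma>. 0)"

definition sort_ctx :: "'s \<Rightarrow> nat \<Rightarrow> 's ctx" where
  "sort_ctx \<sigma> k = (\<lambda>\<tau>. if \<tau> = \<sigma> then k else 0)"

text \<open>In \<^term>\<open>ctx_add n m\<close> the variables of \<open>n\<close> keep their index and \<open>(\<sigma>, j)\<close> of \<open>m\<close>
  becomes \<open>(\<sigma>, n \<sigma> + j)\<close>.\<close>

definition ctx_add :: "'s ctx \<Rightarrow> 's ctx \<Rightarrow> 's ctx" (infixl "\<otimes>" 70) where
  "n \<otimes> m = (\<lambda>\<sigma>. n \<sigma> + m \<sigma>)"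

fun fm_in :: "('s, 'r) thy \<Rightarrow> 's ctx \<Rightarrow> ('s, 'r) fm \<Rightarrow> bool" where
  "fm_in T n (Atom R vs) \<longleftrightarrow> R \<in> rels T \<and> map fst vs = arity T R \<and> (\<forall>(\<sigma>, i)\<in>set vs. i < n \<sigma>)"
| "fm_in T n (Eq \<sigma> i j) \<longleftrightarrow> i < n \<sigma> \<and> j < n \<sigma>"
| "fm_in T n Top \<longleftrightarrow> True"
| "fm_in T n (Conj \<phi> \<psi>) \<longleftrightarrow> fm_in T n \<phi> \<and> fm_in T n \<psi>"
| "fm_in T n (Ex \<sigma> \<phi>) \<longleftrightarrow> \<sigma> \<in> sorts T \<and> fm_in T (n(\<sigma> := Suc (n \<sigma>))) \<phi>"

text \<open>As there are no function symbols, a substitution is a sort-preserving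
  map of variables.\<close>

definition under_binder :: "'s \<Rightarrow> ('s \<Rightarrow> nat \<Rightarrow> nat) \<Rightarrow> 's \<Rightarrow> nat \<Rightarrow> nat" where
  "under_binder \<sigma> r \<tau> i =
     (if \<tau> = \<sigma> then (case i of 0 \<Rightarrow> 0 | Suc j \<Rightarrow> Suc (r \<sigma> j)) else r \<tau> i)"

fun subst :: "('s \<Rightarrow> nat \<Rightarrow> nat) \<Rightarrow> ('s, 'r) fm \<Rightarrow> ('s, 'r) fm" where
  "subst r (Atom R vs) = Atom R (map (\<lambda>(\<sigma>, i). (\<sigma>, r \<sigma> i)) vs)"
| "subst r (Eq \<sigma> i j) = Eq \<sigma> (r \<sigma> i) (r \<sigma> j)"
| "subst r Top = Top"
| "subst r (Conj \<phi> \<psi>) = Conj (subst r \<phi>) (subst r \<psi>)"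
| "subst r (Ex \<sigma> \<phi>) = Ex \<sigma> (subst (under_binder \<sigma> r) \<phi>)"

definition weaken :: "'s \<Rightarrow> ('s, 'r) fm \<Rightarrow> ('s, 'r) fm" where
  "weaken \<sigma> \<phi> = subst (\<lambda>\<tau> i. if \<tau> = \<sigma> then Suc i else i) \<phi>"

definition shift :: "'s ctx \<Rightarrow> ('s, 'r) fm \<Rightarrow> ('s, 'r) fm" where
  "shift n \<phi> = subst (\<lambda>\<tau> i. n \<tau> + i) \<phi>"

definition swap_vars :: "'s ctx \<Rightarrow> 's ctx \<Rightarrow> 's \<Rightarrow> nat \<Rightarrow> nat" where
  "swap_vars n m \<tau> i = (if i < n \<tau> then m \<tau> + i else if i < n \<tau> + m \<tau> then i - n \<tau> else i)"

definition regular_theory :: "('s, 'r) thy \<Rightarrow> bool" where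
  "regular_theory T \<longleftrightarrow>
     (\<forall>R\<in>rels T. set (arity T R) \<subseteq> sorts T) \<and>
     (\<forall>(n, \<phi>, \<psi>)\<in>axs T. n \<in> ctxs T \<and> fm_in T n \<phi> \<and> fm_in T n \<psi>)"

inductive prv :: "('s, 'r) thy \<Rightarrow> 's ctx \<Rightarrow> ('s, 'r) fm \<Rightarrow> ('s, 'r) fm \<Rightarrow> bool"
  for T :: "('s, 'r) thy" where
  Ax: "(n, \<phi>, \<psi>) \<in> axs T \<Longrightarrow> prv T n \<phi> \<psi>"
| Refl: "n \<in> ctxs T \<Longrightarrow> fm_in T n \<phi> \<Longrightarrow> prv T n \<phi> \<phi>"
| Cut: "prv T n \<phi> \<psi> \<Longrightarrow> prv T n \<psi> \<chi> \<Longrightarrow> prv T n \<phi> \<chi>"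
| Subst: "prv T n \<phi> \<psi> \<Longrightarrow> m \<in> ctxs T \<Longrightarrow> (\<And>\<sigma> i. i < n \<sigma> \<Longrightarrow> r \<sigma> i < m \<sigma>) \<Longrightarrow>
     prv T m (subst r \<phi>) (subst r \<psi>)"
| EqI: "n \<in> ctxs T \<Longrightarrow> i < n \<sigma> \<Longrightarrow> prv T n Top (Eq \<sigma> i i)"
| EqE: "n \<in> ctxs T \<Longrightarrow> i < n \<sigma> \<Longrightarrow> j < n \<sigma> \<Longrightarrow> fm_in T n \<phi> \<Longrightarrow>
     prv T n (Conj (Eq \<sigma> i j) \<phi>) (subst (\<lambda>\<tau> k. if \<tau> = \<sigma> \<and> k = i then j else k) \<phi>)"
| TopI: "n \<in> ctxs T \<Longrightarrow> fm_in T n \<phi> \<Longrightarrow> prv T n \<phi> Top"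
| ConjE1: "n \<in> ctxs T \<Longrightarrow> fm_in T n \<phi> \<Longrightarrow> fm_in T n \<psi> \<Longrightarrow> prv T n (Conj \<phi> \<psi>) \<phi>"
| ConjE2: "n \<in> ctxs T \<Longrightarrow> fm_in T n \<phi> \<Longrightarrow> fm_in T n \<psi> \<Longrightarrow> prv T n (Conj \<phi> \<psi>) \<psi>"
| ConjI: "prv T n \<chi> \<phi> \<Longrightarrow> prv T n \<chi> \<psi> \<Longrightarrow> prv T n \<chi> (Conj \<phi> \<psi>)"
| ExL: "n \<in> ctxs T \<Longrightarrow> \<sigma> \<in> sorts T \<Longrightarrow> fm_in T n \<psi> \<Longrightarrow>
     prv T (n(\<sigma> := Suc (n \<sigma>))) \<phi> (weaken \<sigma> \<psi>) \<Longrightarrow> prv T n (Ex \<sigma> \<phi>) \<psi>"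
| ExR: "prv T n (Ex \<sigma> \<phi>) \<psi> \<Longrightarrow> prv T (n(\<sigma> := Suc (n \<sigma>))) \<phi> (weaken \<sigma> \<psi>)"
| Frob: "n \<in> ctxs T \<Longrightarrow> fm_in T n \<phi> \<Longrightarrow> fm_in T n (Ex \<sigma> \<psi>) \<Longrightarrow>
     prv T n (Conj \<phi> (Ex \<sigma> \<psi>)) (Ex \<sigma> (Conj (weaken \<sigma> \<phi>) \<psi>))"

definition fm_class ::
  "('s, 'r) thy \<Rightarrow> 's ctx \<Rightarrow> ('s, 'r) fm \<Rightarrow> ('s, 'r) fm set" where
  "fm_class T n \<phi> = {\<psi>. fm_in T n \<psi> \<and> prv T n \<phi> \<psi> \<and> prv T n \<psi> \<phi>}"

section \<open>The regular calculus of a theory\<close>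

type_synonym 's ct_mor = "'s \<Rightarrow> cospan set"

definition CT :: "('s, 'r) thy \<Rightarrow> ('s ctx, 's ct_mor) pocat" where
  "CT T = \<lparr>obj = ctxs T,
           hom = (\<lambda>n m. {w. (\<forall>\<sigma>. w \<sigma> \<in> hom Wcat (n \<sigma>) (m \<sigma>)) \<and>
                            finite {\<sigma>. w \<sigma> \<noteq> W_id 0} \<and> {\<sigma>. w \<sigma> \<noteq> W_id 0} \<subseteq> sorts T}),
           ident = (\<lambda>n \<sigma>. W_id (n \<sigma>)),
           comp = (\<lambda>n m p u v \<sigma>. W_comp (n \<sigma>) (m \<sigma>) (p \<sigma>) (u \<sigma>) (v \<sigma>)),
           le = (\<lambda>n m u v. \<forall>\<sigma>. le Wcat (n \<sigma>) (m \<sigma>) (u \<sigma>) (v \<sigma>))\<rparr>"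

definition CT_tensor ::
  "'s ctx \<Rightarrow> 's ctx \<Rightarrow> 's ctx \<Rightarrow> 's ctx \<Rightarrow> 's ct_mor \<Rightarrow> 's ct_mor \<Rightarrow> 's ct_mor" where
  "CT_tensor n m n' m' u v = (\<lambda>\<sigma>. W_tensor (n \<sigma>) (m \<sigma>) (n' \<sigma>) (m' \<sigma>) (u \<sigma>) (v \<sigma>))"

definition CT_id :: "'s ctx \<Rightarrow> 's ct_mor" where
  "CT_id n = (\<lambda>\<sigma>. W_id (n \<sigma>))"

definition CT_swap :: "'s ctx \<Rightarrow> 's ctx \<Rightarrow> 's ct_mor" where
  "CT_swap n m = (\<lambda>\<sigma>. W_swap (n \<sigma>) (m \<sigma>))"

definition CT_del :: "'s ctx \<Rightarrow> 's ct_mor" where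
  "CT_del n = (\<lambda>\<sigma>. W_del (n \<sigma>))"

definition CT_cap :: "'s ctx \<Rightarrow> 's ct_mor" where
  "CT_cap n = (\<lambda>\<sigma>. W_cap (n \<sigma>))"

definition at_sort :: "'s \<Rightarrow> cospan set \<Rightarrow> 's ct_mor" where
  "at_sort \<sigma> g = (\<lambda>\<tau>. if \<tau> = \<sigma> then g else W_id 0)"

text \<open>A generator \<open>g : k \<rightarrow> l\<close> of \<^const>\<open>Wcat\<close> at sort \<open>\<sigma>\<close>, tensored with the identity of \<open>n\<close>. The
  variables \<open>y\<close> on which it acts are those of sort \<open>\<sigma>\<close> with least index.\<close>

definition gen_tensor :: "'s \<Rightarrow> nat \<Rightarrow> nat \<Rightarrow> cospan set \<Rightarrow> 's ctx \<Rightarrow> 's ct_mor" where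
  "gen_tensor \<sigma> k l g n =
     CT_tensor (sort_ctx \<sigma> k) (sort_ctx \<sigma> l) n n (at_sort \<sigma> g) (CT_id n)"

definition FT_obj :: "('s, 'r) thy \<Rightarrow> 's ctx \<Rightarrow> ('s, 'r) fm set set" where
  "FT_obj T n = fm_class T n ` {\<phi>. fm_in T n \<phi>}"

definition FT_le ::
  "('s, 'r) thy \<Rightarrow> 's ctx \<Rightarrow> ('s, 'r) fm set \<Rightarrow> ('s, 'r) fm set \<Rightarrow> bool" where
  "FT_le T n p q \<longleftrightarrow> (\<exists>\<phi>\<in>p. \<exists>\<psi>\<in>q. prv T n \<phi> \<psi>)"

definition boxplus ::
  "('s, 'r) thy \<Rightarrow> 's ctx \<Rightarrow> 's ctx \<Rightarrow>
   ('s, 'r) fm set \<Rightarrow> ('s, 'r) fm set \<Rightarrow> ('s, 'r) fm set" where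
  "boxplus T n m p q = (\<Union>\<phi>\<in>p. \<Union>\<psi>\<in>q. fm_class T (n \<otimes> m) (Conj \<phi> (shift n \<psi>)))"

type_synonym ('s, 'r) calculus =
  "'s ctx \<Rightarrow> 's ctx \<Rightarrow> 's ct_mor \<Rightarrow> ('s, 'r) fm set \<Rightarrow> ('s, 'r) fm set"

text \<open>\<open>P\<close> is the action on morphisms of a po-functor from \<^term>\<open>CT T\<close> to posets that is given on
  objects by \<^term>\<open>FT_obj T\<close>. It is normalised to \<^const>\<open>undefined\<close> outside its domain
  so that equality of such functors is equality of functions.\<close>

definition po_functor_to_posets :: "('s, 'r) thy \<Rightarrow> ('s, 'r) calculus \<Rightarrow> bool" where
  "po_functor_to_posets T P \<longleftrightarrow>
     (\<forall>n\<in>obj (CT T). poset_on (FT_obj T n) (FT_le T n)) \<and>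
     (\<forall>n m w. \<not> (n \<in> obj (CT T) \<and> m \<in> obj (CT T) \<and> w \<in> hom (CT T) n m) \<longrightarrow> P n m w = undefined) \<and>
     (\<forall>n\<in>obj (CT T). \<forall>m\<in>obj (CT T). \<forall>w\<in>hom (CT T) n m.
        P n m w \<in> FT_obj T n \<rightarrow>\<^sub>E FT_obj T m \<and>
        (\<forall>p\<in>FT_obj T n. \<forall>q\<in>FT_obj T n. FT_le T n p q \<longrightarrow> FT_le T m (P n m w p) (P n m w q))) \<and>
     (\<forall>n\<in>obj (CT T). \<forall>p\<in>FT_obj T n. P n n (ident (CT T) n) p = p) \<and>
     (\<forall>n\<in>obj (CT T). \<forall>m\<in>obj (CT T). \<forall>l\<in>obj (CT T).
        \<forall>u\<in>hom (CT T) n m. \<forall>v\<in>hom (CT T) m l. \<forall>p\<in>FT_obj T n.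
        P n l (comp (CT T) n m l u v) p = P m l v (P n m u p)) \<and>
     (\<forall>n\<in>obj (CT T). \<forall>m\<in>obj (CT T). \<forall>u\<in>hom (CT T) n m. \<forall>v\<in>hom (CT T) n m.
        le (CT T) n m u v \<longrightarrow> (\<forall>p\<in>FT_obj T n. FT_le T m (P n m u p) (P n m v p)))"

text \<open>As \<^const>\<open>Wcat\<close> is generated as a prop, its
  symmetries are also part of the data; they act by permuting the variables.\<close>

definition is_FT :: "('s, 'r) thy \<Rightarrow> ('s, 'r) calculus \<Rightarrow> bool" where
  "is_FT T P \<longleftrightarrow> po_functor_to_posets T P \<and>
     (\<forall>n\<in>ctxs T. \<forall>\<sigma>\<in>sorts T.
        (\<forall>\<phi>. fm_in T n \<phi> \<longrightarrow>
           P n (sort_ctx \<sigma> 1 \<otimes> n) (gen_tensor \<sigma> 0 1 eta1 n) (fm_class T n \<phi>) =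
             fm_class T (sort_ctx \<sigma> 1 \<otimes> n) (weaken \<sigma> \<phi>)) \<and>
        (\<forall>\<phi>. fm_in T (sort_ctx \<sigma> 1 \<otimes> n) \<phi> \<longrightarrow>
           P (sort_ctx \<sigma> 1 \<otimes> n) n (gen_tensor \<sigma> 1 0 eps1 n) (fm_class T (sort_ctx \<sigma> 1 \<otimes> n) \<phi>) =
             fm_class T n (Ex \<sigma> \<phi>)) \<and>
        (\<forall>\<phi>. fm_in T (sort_ctx \<sigma> 2 \<otimes> n) \<phi> \<longrightarrow>
           P (sort_ctx \<sigma> 2 \<otimes> n) (sort_ctx \<sigma> 1 \<otimes> n) (gen_tensor \<sigma> 2 1 mu1 n)
             (fm_class T (sort_ctx \<sigma> 2 \<otimes> n) \<phi>) =
             fm_class T (sort_ctx \<sigma> 1 \<otimes> n) (subst (\<lambda>\<tau> i. if \<tau> = \<sigma> then i - 1 else i) \<phi>)) \<and>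
        (\<forall>\<phi>. fm_in T (sort_ctx \<sigma> 1 \<otimes> n) \<phi> \<longrightarrow>
           P (sort_ctx \<sigma> 1 \<otimes> n) (sort_ctx \<sigma> 2 \<otimes> n) (gen_tensor \<sigma> 1 2 del1 n)
             (fm_class T (sort_ctx \<sigma> 1 \<otimes> n) \<phi>) =
             fm_class T (sort_ctx \<sigma> 2 \<otimes> n)
               (Conj (subst (\<lambda>\<tau> i. if \<tau> = \<sigma> \<and> 0 < i then Suc i else i) \<phi>) (Eq \<sigma> 0 1)))) \<and>
     (\<forall>n\<in>ctxs T. \<forall>m\<in>ctxs T. \<forall>l\<in>ctxs T. \<forall>\<phi>. fm_in T (n \<otimes> m \<otimes> l) \<phi> \<longrightarrow>
        P (n \<otimes> m \<otimes> l) (m \<otimes> n \<otimes> l)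
          (CT_tensor (n \<otimes> m) (m \<otimes> n) l l (CT_swap n m) (CT_id l)) (fm_class T (n \<otimes> m \<otimes> l) \<phi>) =
          fm_class T (m \<otimes> n \<otimes> l) (subst (swap_vars n m) \<phi>))"

definition FT :: "('s, 'r) thy \<Rightarrow> ('s, 'r) calculus" where
  "FT T = (THE P. is_FT T P)"

definition Syn ::
  "('s, 'r) thy \<Rightarrow> ('s, 'r) calculus \<Rightarrow>
   ('s ctx \<times> ('s, 'r) fm set, ('s, 'r) fm set) pocat" where
  "Syn T P =
     \<lparr>obj = {(n, p). n \<in> obj (CT T) \<and> p \<in> FT_obj T n},
      hom = (\<lambda>(n, p) (m, q). {\<theta> \<in> FT_obj T (n \<otimes> m). FT_le T (n \<otimes> m) \<theta> (boxplus T n m p q)}),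
      ident = (\<lambda>(n, p). P n (n \<otimes> n) (CT_del n) p),
      comp = (\<lambda>(n, _) (m, _) (l, _) \<theta> \<theta>'.
        P (n \<otimes> m \<otimes> (m \<otimes> l)) (n \<otimes> l)
          (CT_tensor n n (m \<otimes> m \<otimes> l) l (CT_id n)
             (CT_tensor (m \<otimes> m) empty_ctx l l (CT_cap m) (CT_id l)))
          (boxplus T (n \<otimes> m) (m \<otimes> l) \<theta> \<theta>')),
      le = (\<lambda>(n, _) (m, _). FT_le T (n \<otimes> m))\<rparr>"

section \<open>The classical syntactic category\<close>

text \<open>Here contexts are lists of variables. Up to renaming, the context is the list \<open>ss\<close> of sorts
  and the variable at position \<open>p\<close> is \<open>(\<sigma>, i)\<close>, where \<open>\<sigma> = ss ! p\<close> and \<open>i\<close> is the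
  number of earlier occurrences of \<open>\<sigma>\<close>. So the formulae in context \<open>ss\<close> are those in the
  family \<^term>\<open>count_list ss\<close>, and \<open>\<alpha>\<close>-equivalence is equality.\<close>

definition list_vars :: "'s list \<Rightarrow> ('s \<times> nat) list" where
  "list_vars ss = map (\<lambda>p. (ss ! p, count_list (take p ss) (ss ! p))) [0..<length ss]"

definition vec_eq ::
  "'s list \<Rightarrow> ('s \<Rightarrow> nat \<Rightarrow> nat) \<Rightarrow> ('s \<Rightarrow> nat \<Rightarrow> nat) \<Rightarrow> ('s, 'r) fm" where
  "vec_eq ss r r' = foldr (\<lambda>(\<sigma>, i). Conj (Eq \<sigma> (r \<sigma> i) (r' \<sigma> i))) (list_vars ss) Top"

text \<open>Binds, at each sort, the \<^term>\<open>count_list ts \<sigma>\<close> variables of least index.\<close>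

definition vec_ex :: "'s list \<Rightarrow> ('s, 'r) fm \<Rightarrow> ('s, 'r) fm" where
  "vec_ex ts \<phi> = foldr Ex ts \<phi>"

text \<open>A formula \<open>\<theta>(x, y)\<close> lives in the context \<open>x, y\<close>; the three clauses are
  \<open>\<theta>(x, y) \<turnstile> \<phi>(x) \<and> \<psi>(y)\<close>, \<open>\<phi>(x) \<turnstile> \<exists>y. \<theta>(x, y)\<close> and
  \<open>\<theta>(x, y) \<and> \<theta>(x, y') \<turnstile> y = y'\<close>.\<close>

definition functional ::
  "('s, 'r) thy \<Rightarrow> 's list \<Rightarrow> ('s, 'r) fm \<Rightarrow> 's list \<Rightarrow> ('s, 'r) fm \<Rightarrow> ('s, 'r) fm \<Rightarrow> bool" where
  "functional T ss \<phi> ts \<psi> \<theta> \<longleftrightarrow>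
     (let n = count_list ss; m = count_list ts in
      fm_in T (n \<otimes> m) \<theta> \<and>
      prv T (n \<otimes> m) \<theta> (Conj \<phi> (shift n \<psi>)) \<and>
      prv T n \<phi> (vec_ex ts (subst (swap_vars n m) \<theta>)) \<and>
      prv T (n \<otimes> m \<otimes> m)
        (Conj \<theta> (subst (\<lambda>\<sigma> i. if i < n \<sigma> then i else m \<sigma> + i) \<theta>))
        (vec_eq ts (\<lambda>\<sigma> j. n \<sigma> + j) (\<lambda>\<sigma> j. n \<sigma> + m \<sigma> + j)))"

text \<open>The composite of \<open>\<theta>(x, y)\<close> and \<open>\<chi>(y, z)\<close> is \<open>\<exists>y. \<theta>(x, y) \<and> \<chi>(y, z)\<close>, with the matrix in
  the context \<open>y, x, z\<close>.\<close>

definition Creg ::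
  "('s, 'r) thy \<Rightarrow> ('s list \<times> ('s, 'r) fm, ('s, 'r) fm set) cat" where
  "Creg T =
     \<lparr>obj = {(ss, \<phi>). set ss \<subseteq> sorts T \<and> fm_in T (count_list ss) \<phi>},
      hom = (\<lambda>(ss, \<phi>) (ts, \<psi>).
        fm_class T (count_list ss \<otimes> count_list ts) ` {\<theta>. functional T ss \<phi> ts \<psi> \<theta>}),
      ident = (\<lambda>(ss, \<phi>). fm_class T (count_list ss \<otimes> count_list ss)
        (Conj \<phi> (vec_eq ss (\<lambda>\<sigma> i. i) (\<lambda>\<sigma> i. count_list ss \<sigma> + i)))),
      comp = (\<lambda>(ss, _) (ts, _) (us, _) f g.
        let n = count_list ss; m = count_list ts; l = count_list us in
        \<Union>\<theta>\<in>f. \<Union>\<chi>\<in>g. fm_class T (n \<otimes> l)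
          (vec_ex ts (Conj (subst (swap_vars n m) \<theta>)
             (subst (\<lambda>\<sigma> j. if j < m \<sigma> then j else n \<sigma> + j) \<chi>))))\<rparr>"

end

theory Submission
  imports Defs
begin

text \<open>Regular logic is complete for set-valued models: the Henkin model of a formula \<open>\<phi>\<close> is generated by
  generic elements satisfying \<open>\<phi>\<close> and by witnesses, and each of its finite pieces is described by a
  formula conservative over \<open>\<phi>\<close>. So a formula up to interprovability is its family of
  extensions in all models, and every claim about provability becomes one about points.

  A cospan \<open>(k, f, g)\<close> relates the tuples \<open>z \<circ> f\<close> and \<open>z \<circ> g\<close>; taking direct images under these relations
  gives the functor \<open>F\<close>. It is unique because maps of contexts are generated by \<open>\<eta>\<close>, \<open>\<mu>\<close> and
  symmetries, every morphism is a map followed by a reversed map, and a reversed map is adjoint to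
  that map, so its value is forced by the order.

  Morphisms of the classical syntactic category are the definable maps between definable sets. In any
  such category with tabulations of definable relations, finite limits and images are computed
  pointwise, so it is regular and its subobjects of products are the definable relations. The
  syntactic po-category also consists of definable relations, with the relational composition, and
  a relation has a right adjoint iff it is a map in every model.\<close>

section \<open>Substitution\<close>

text \<open>Composition in \<open>Syn\<close> and \<open>Creg\<close> is given on classes of
  formulae, by unions over representatives, and in \<open>Rel\<close> by pullbacks and images;
  verifying laws by derivations in \<open>prv\<close> would be unwieldy. Read on points, all three
  are composition of relations, which is why completeness comes first. No category law is checked
  separately for \<open>Syn\<close> or \<open>Rel\<close>: each receives, from the po-category
  \<open>DRel\<close> of definable relations, a comparison that is bijective on homs and surjective
  on objects, and the laws travel along it.

  Two features of the calculus shape the completeness proof. Sorts may be empty, so a witness enters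
  only together with a new variable of the context, and the Frobenius rule is what makes this
  conservative. And a formula cannot quantify over types, so all Henkin models must share one
  carrier type, which depends on the sorts and relation symbols but on no sequent.

  \<open>FT\<close> is a definite description, so existence and uniqueness of the functor must both
  be settled before anything can be said about \<open>Syn\<close>. For uniqueness the obstacle is
  that the generators touch only the variables of least index.\<close>

lemma fm_in_mono: "fm_in T n \<phi> \<Longrightarrow> (\<And>\<sigma>. n \<sigma> \<le> m \<sigma>) \<Longrightarrow> fm_in T m \<phi>"
proof (induction \<phi> arbitrary: n m)
  case (Atom R vs)
  then show ?case by (fastforce dest: order.strict_trans2)
next
  case (Eq \<sigma> i j)
  then show ?case by (auto intro: order.strict_trans2)
next
  case (Ex \<sigma> \<phi>)
  have "(n(\<sigma> := Suc (n \<sigma>))) \<tau> \<le> (m(\<sigma> := Suc (m \<sigma>))) \<tau>" for \<tau>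
    using Ex.prems(2) by simp
  with Ex.prems(1) Ex.IH show ?case by auto
qed auto

lemma under_binder_less:
  "(\<And>\<tau> i. i < n \<tau> \<Longrightarrow> r \<tau> i < m \<tau>) \<Longrightarrow> i < (n(\<sigma> := Suc (n \<sigma>))) \<tau> \<Longrightarrow>
   under_binder \<sigma> r \<tau> i < (m(\<sigma> := Suc (m \<sigma>))) \<tau>"
  by (auto simp: under_binder_def split: nat.splits if_splits)

lemma fm_in_subst:
  "fm_in T n \<phi> \<Longrightarrow> (\<And>\<sigma> i. i < n \<sigma> \<Longrightarrow> r \<sigma> i < m \<sigma>) \<Longrightarrow> fm_in T m (subst r \<phi>)"
proof (induction \<phi> arbitrary: n m r)
  case (Atom R vs)
  then show ?case by (auto simp: case_prod_beta o_def)
next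
  case (Ex \<sigma> \<phi>)
  have "fm_in T (m(\<sigma> := Suc (m \<sigma>))) (subst (under_binder \<sigma> r) \<phi>)"
  proof (rule Ex.IH)
    show "fm_in T (n(\<sigma> := Suc (n \<sigma>))) \<phi>" using Ex.prems(1) by simp
  qed (rule under_binder_less[OF Ex.prems(2)])
  then show ?case using Ex.prems(1) by simp
qed auto

lemma subst_cong:
  "fm_in T n \<phi> \<Longrightarrow> (\<And>\<sigma> i. i < n \<sigma> \<Longrightarrow> r \<sigma> i = r' \<sigma> i) \<Longrightarrow> subst r \<phi> = subst r' \<phi>"
proof (induction \<phi> arbitrary: n r r')
  case (Atom R vs)
  have "map (\<lambda>(\<sigma>, i). (\<sigma>, r \<sigma> i)) vs = map (\<lambda>(\<sigma>, i). (\<sigma>, r' \<sigma> i)) vs"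
    using Atom.prems by (intro map_cong refl) auto
  then show ?case by simp
next
  case (Eq \<sigma> i j)
  then show ?case by simp
next
  case (Conj \<phi> \<psi>)
  from Conj.IH[of n r r'] Conj.prems show ?case by simp
next
  case (Ex \<sigma> \<phi>)
  have "subst (under_binder \<sigma> r) \<phi> = subst (under_binder \<sigma> r') \<phi>"
  proof (rule Ex.IH)
    show "fm_in T (n(\<sigma> := Suc (n \<sigma>))) \<phi>" using Ex.prems(1) by simp
  qed (use Ex.prems(2) in \<open>auto simp: under_binder_def split: nat.splits if_splits\<close>)
  then show ?case by simp
qed auto

lemma under_binder_comp:
  "under_binder \<sigma> (\<lambda>\<tau> i. r \<tau> (s \<tau> i)) = (\<lambda>\<tau> i. under_binder \<sigma> r \<tau> (under_binder \<sigma> s \<tau> i))"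
  by (auto simp: under_binder_def fun_eq_iff split: nat.splits)

lemma subst_subst: "subst r (subst s \<phi>) = subst (\<lambda>\<sigma> i. r \<sigma> (s \<sigma> i)) \<phi>"
  by (induction \<phi> arbitrary: r s) (auto simp: under_binder_comp)

lemma subst_id [simp]: "subst (\<lambda>\<sigma> i. i) \<phi> = \<phi>"
proof (induction \<phi>)
  case (Atom R vs)
  then show ?case by (auto intro: map_idI)
next
  case (Ex \<sigma> \<phi>)
  have "under_binder \<sigma> (\<lambda>\<sigma> i. i) = (\<lambda>\<sigma> i. i)"
    by (auto simp: under_binder_def fun_eq_iff split: nat.splits)
  with Ex show ?case by simp
qed auto

lemma fm_in_weaken: "fm_in T n \<phi> \<Longrightarrow> fm_in T (n(\<sigma> := Suc (n \<sigma>))) (weaken \<sigma> \<phi>)"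
  unfolding weaken_def by (erule fm_in_subst) auto

lemma ctxs_Suc: "n \<in> ctxs T \<Longrightarrow> \<sigma> \<in> sorts T \<Longrightarrow> n(\<sigma> := Suc (n \<sigma>)) \<in> ctxs T"
proof -
  assume n: "n \<in> ctxs T" and s: "\<sigma> \<in> sorts T"
  have "{\<tau>. (n(\<sigma> := Suc (n \<sigma>))) \<tau> \<noteq> 0} \<subseteq> insert \<sigma> {\<tau>. n \<tau> \<noteq> 0}" by auto
  then have "finite {\<tau>. (n(\<sigma> := Suc (n \<sigma>))) \<tau> \<noteq> 0}"
    by (rule finite_subset) (use n in \<open>simp add: ctxs_def\<close>)
  moreover have "{\<tau>. (n(\<sigma> := Suc (n \<sigma>))) \<tau> \<noteq> 0} \<subseteq> sorts T"
    using n s by (auto simp: ctxs_def)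
  ultimately show ?thesis unfolding ctxs_def by blast
qed

text \<open>Rules such as \<open>Cut\<close>, \<open>ConjI\<close> and \<open>ExR\<close> carry no
  well-formedness premises; it is recovered here by induction, the axioms being covered by
  \<open>regular_theory\<close>.\<close>

lemma prv_wf:
  assumes "regular_theory T" "prv T n \<phi> \<psi>"
  shows "n \<in> ctxs T \<and> fm_in T n \<phi> \<and> fm_in T n \<psi>"
  using assms(2)
proof (induction rule: prv.induct)
  case (Ax n \<phi> \<psi>)
  then show ?case using assms(1) unfolding regular_theory_def by auto
next
  case (Subst n \<phi> \<psi> m r)
  then show ?case using fm_in_subst[of T n _ r m] by auto
next
  case (EqE n i \<sigma> j \<phi>)
  then show ?case
    using fm_in_subst[of T n \<phi> "\<lambda>\<tau> k. if \<tau> = \<sigma> \<and> k = i then j else k" n] by auto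
next
  case (ExL n \<sigma> \<psi> \<phi>)
  then show ?case by (simp only: fm_in.simps)
next
  case (ExR n \<sigma> \<phi> \<psi>)
  then show ?case using ctxs_Suc[of n T \<sigma>] fm_in_weaken[of T n \<psi> \<sigma>]
    by (simp only: fm_in.simps)
next
  case (Frob n \<phi> \<sigma> \<psi>)
  then show ?case using fm_in_weaken[of T n \<phi> \<sigma>] by auto
qed auto

section \<open>Models\<close>

text \<open>Carriers may be empty, in step with a calculus that tracks contexts and never assumes a
  sort to be inhabited.\<close>

record ('s, 'r, 'u) str =
  crr :: "'s \<Rightarrow> 'u set"
  itp :: "'r \<Rightarrow> 'u list \<Rightarrow> bool"

text \<open>Semantic counterpart of entering a binder under the per-sort de Bruijn
  convention.\<close>

definition push :: "'s \<Rightarrow> 'u \<Rightarrow> ('s \<Rightarrow> nat \<Rightarrow> 'u) \<Rightarrow> 's \<Rightarrow> nat \<Rightarrow> 'u" where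
  "push \<sigma> x e \<tau> i = (if \<tau> = \<sigma> then (case i of 0 \<Rightarrow> x | Suc j \<Rightarrow> e \<sigma> j) else e \<tau> i)"

fun sat :: "('s, 'r, 'u) str \<Rightarrow> ('s, 'r) fm \<Rightarrow> ('s \<Rightarrow> nat \<Rightarrow> 'u) \<Rightarrow> bool" where
  "sat M (Atom R vs) e \<longleftrightarrow> itp M R (map (\<lambda>(\<sigma>, i). e \<sigma> i) vs)"
| "sat M (Eq \<sigma> i j) e \<longleftrightarrow> e \<sigma> i = e \<sigma> j"
| "sat M Top e \<longleftrightarrow> True"
| "sat M (Conj \<phi> \<psi>) e \<longleftrightarrow> sat M \<phi> e \<and> sat M \<psi> e"
| "sat M (Ex \<sigma> \<phi>) e \<longleftrightarrow> (\<exists>x\<in>crr M \<sigma>. sat M \<phi> (push \<sigma> x e))"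

definition assigns :: "('s, 'r, 'u) str \<Rightarrow> 's ctx \<Rightarrow> ('s \<Rightarrow> nat \<Rightarrow> 'u) \<Rightarrow> bool" where
  "assigns M n e \<longleftrightarrow> (\<forall>\<sigma> i. i < n \<sigma> \<longrightarrow> e \<sigma> i \<in> crr M \<sigma>)"

definition valid ::
  "('s, 'r, 'u) str \<Rightarrow> 's ctx \<Rightarrow> ('s, 'r) fm \<Rightarrow> ('s, 'r) fm \<Rightarrow> bool" where
  "valid M n \<phi> \<psi> \<longleftrightarrow> (\<forall>e. assigns M n e \<longrightarrow> sat M \<phi> e \<longrightarrow> sat M \<psi> e)"

definition model :: "('s, 'r) thy \<Rightarrow> ('s, 'r, 'u) str \<Rightarrow> bool" where
  "model T M \<longleftrightarrow> (\<forall>(n, \<phi>, \<psi>)\<in>axs T. valid M n \<phi> \<psi>)"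

lemma push_simps [simp]:
  "push \<sigma> x e \<sigma> 0 = x" "push \<sigma> x e \<sigma> (Suc i) = e \<sigma> i" "\<tau> \<noteq> \<sigma> \<Longrightarrow> push \<sigma> x e \<tau> i = e \<tau> i"
  by (auto simp: push_def)

lemma sat_cong:
  "fm_in T n \<phi> \<Longrightarrow> (\<And>\<sigma> i. i < n \<sigma> \<Longrightarrow> e \<sigma> i = e' \<sigma> i) \<Longrightarrow> sat M \<phi> e = sat M \<phi> e'"
proof (induction \<phi> arbitrary: n e e')
  case (Atom R vs)
  then have "map (\<lambda>(\<sigma>, i). e \<sigma> i) vs = map (\<lambda>(\<sigma>, i). e' \<sigma> i) vs" by auto
  then show ?case unfolding sat.simps by (rule arg_cong)
next
  case (Conj \<phi> \<psi>)
  then show ?case by (metis fm_in.simps(4) sat.simps(4))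
next
  case (Ex \<sigma> \<phi>)
  have "sat M \<phi> (push \<sigma> x e) = sat M \<phi> (push \<sigma> x e')" for x
  proof (rule Ex.IH)
    show "fm_in T (n(\<sigma> := Suc (n \<sigma>))) \<phi>" using Ex.prems(1) by simp
  qed (use Ex.prems(2) in \<open>auto simp: push_def split: nat.splits if_splits\<close>)
  then show ?case by simp
qed auto

lemma push_under_binder:
  "(\<lambda>\<tau> i. push \<sigma> x e \<tau> (under_binder \<sigma> r \<tau> i)) = push \<sigma> x (\<lambda>\<tau> i. e \<tau> (r \<tau> i))"
  by (auto simp: push_def under_binder_def fun_eq_iff split: nat.splits)

text \<open>Substitutions only rename variables, so substituting is precomposing the valuation;
  \<open>push_under_binder\<close> says that this commutes with entering a binder.\<close>

lemma sat_subst: "sat M (subst r \<phi>) e \<longleftrightarrow> sat M \<phi> (\<lambda>\<sigma> i. e \<sigma> (r \<sigma> i))"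
proof (induction \<phi> arbitrary: r e)
  case (Atom R vs)
  have "map (\<lambda>(\<sigma>, i). e \<sigma> i) (map (\<lambda>(\<sigma>, i). (\<sigma>, r \<sigma> i)) vs) = map (\<lambda>(\<sigma>, i). e \<sigma> (r \<sigma> i)) vs"
    by auto
  then show ?case unfolding subst.simps sat.simps by (rule arg_cong)
qed (auto simp: push_under_binder)

lemma sat_weaken [simp]: "sat M (weaken \<sigma> \<phi>) (push \<sigma> x e) \<longleftrightarrow> sat M \<phi> e"
proof -
  have "(\<lambda>\<tau> i. push \<sigma> x e \<tau> (if \<tau> = \<sigma> then Suc i else i)) = e"
    by (auto simp: fun_eq_iff push_def)
  then show ?thesis by (simp add: weaken_def sat_subst)
qed

lemma assigns_push:
  "assigns M n e \<Longrightarrow> x \<in> crr M \<sigma> \<Longrightarrow> assigns M (n(\<sigma> := Suc (n \<sigma>))) (push \<sigma> x e)"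
  by (auto simp: assigns_def push_def split: nat.splits)

lemma soundness:
  assumes "regular_theory T" "model T M" "prv T n \<phi> \<psi>"
  shows "valid M n \<phi> \<psi>"
  using assms(3)
proof (induction rule: prv.induct)
  case (Ax n \<phi> \<psi>)
  then show ?case using assms(2) unfolding model_def by auto
next
  case (Subst n \<phi> \<psi> m r)
  show ?case unfolding valid_def
  proof (intro allI impI)
    fix e assume e: "assigns M m e" and s: "sat M (subst r \<phi>) e"
    have "assigns M n (\<lambda>\<sigma> i. e \<sigma> (r \<sigma> i))" using e Subst.hyps by (auto simp: assigns_def)
    with Subst.IH s show "sat M (subst r \<psi>) e" by (auto simp: valid_def sat_subst)
  qed
next
  case (EqE n i \<sigma> j \<phi>)
  \<comment> \<open>When the two variables have equal values, renaming one to the other leaves the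
    valuation unchanged.\<close>
  have "(\<lambda>\<tau> k. e \<tau> (if \<tau> = \<sigma> \<and> k = i then j else k)) = e" if "e \<sigma> i = e \<sigma> j"
    for e :: "'a \<Rightarrow> nat \<Rightarrow> 'c"
    using that by (auto simp: fun_eq_iff)
  then show ?case by (auto simp: valid_def sat_subst)
next
  case (ExL n \<sigma> \<psi> \<phi>)
  then show ?case
    unfolding valid_def by (metis assigns_push sat.simps(5) sat_weaken)
next
  case (ExR n \<sigma> \<phi> \<psi>)
  show ?case unfolding valid_def
  proof (intro allI impI)
    fix e assume e: "assigns M (n(\<sigma> := Suc (n \<sigma>))) e" and s: "sat M \<phi> e"
    \<comment> \<open>Every valuation of the extended context is \<open>push\<close> of its value at
      index 0 onto the remaining values.\<close>
    define e' where "e' = (\<lambda>\<tau> i. if \<tau> = \<sigma> then e \<tau> (Suc i) else e \<tau> i)"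
    have ee: "e = push \<sigma> (e \<sigma> 0) e'"
      by (auto simp: e'_def push_def fun_eq_iff split: nat.splits)
    have "e \<sigma> 0 \<in> crr M \<sigma>" "assigns M n e'" using e by (auto simp: assigns_def e'_def)
    then have "sat M \<psi> e'" using ExR.IH s ee unfolding valid_def by (metis sat.simps(5))
    then show "sat M (weaken \<sigma> \<psi>) e" by (subst ee) simp
  qed
qed (auto simp: valid_def)

section \<open>Completeness\<close>

lemma ctxs_sort: "\<sigma> \<in> sorts T \<Longrightarrow> sort_ctx \<sigma> k \<in> ctxs T"
  by (auto simp: ctxs_def sort_ctx_def)

text \<open>The universe of the Henkin model: generic elements for the variables of the left hand side, and
  a witness for every existential formula with parameters.\<close>

datatype ('s, 'r) tm = Gen 's nat | Wit 's "('s, 'r) fm" "'s ctx" "'s \<Rightarrow> nat \<Rightarrow> ('s, 'r) tm"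

locale henkin =
  fixes T :: "('s, 'r) thy" and n0 :: "'s ctx" and \<phi>0 :: "('s, 'r) fm"
  assumes reg: "regular_theory T" and n0: "n0 \<in> ctxs T" and \<phi>0: "fm_in T n0 \<phi>0"
begin

text \<open>A witness carries its formula, context and parameters, so that the term alone tells what
  has to hold of it. \<open>Fact_pull\<close> and \<open>Fact_push\<close> restate a fact in another
  context that names the same elements; every variable of the new context must stand for an element
  that is already there, because sorts may be empty. \<open>Fact_cong\<close> forgets the values
  outside the context.\<close>

inductive El :: "'s \<Rightarrow> ('s, 'r) tm \<Rightarrow> bool"
  and Fact :: "'s ctx \<Rightarrow> ('s, 'r) fm \<Rightarrow> ('s \<Rightarrow> nat \<Rightarrow> ('s, 'r) tm) \<Rightarrow> bool" where
  El_Gen: "i < n0 \<sigma> \<Longrightarrow> El \<sigma> (Gen \<sigma> i)"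
| El_Wit: "Fact m (Ex \<sigma> \<theta>) e \<Longrightarrow> El \<sigma> (Wit \<sigma> \<theta> m e)"
| Fact_Gen: "Fact n0 \<phi>0 Gen"
| Fact_Wit: "Fact m (Ex \<sigma> \<theta>) e \<Longrightarrow> Fact (m(\<sigma> := Suc (m \<sigma>))) \<theta> (push \<sigma> (Wit \<sigma> \<theta> m e) e)"
| Fact_Top: "m \<in> ctxs T \<Longrightarrow> (\<And>\<sigma> i. i < m \<sigma> \<Longrightarrow> El \<sigma> (e \<sigma> i)) \<Longrightarrow> Fact m Top e"
| Fact_Conj: "Fact m \<theta> e \<Longrightarrow> Fact m \<chi> e \<Longrightarrow> Fact m (Conj \<theta> \<chi>) e"
| Fact_prv: "Fact m \<theta> e \<Longrightarrow> prv T m \<theta> \<chi> \<Longrightarrow> Fact m \<chi> e"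
| Fact_pull: "Fact m (subst r \<theta>) e \<Longrightarrow> fm_in T l \<theta> \<Longrightarrow> l \<in> ctxs T \<Longrightarrow>
    (\<And>\<sigma> i. i < l \<sigma> \<Longrightarrow> r \<sigma> i < m \<sigma>) \<Longrightarrow> Fact l \<theta> (\<lambda>\<sigma> i. e \<sigma> (r \<sigma> i))"
| Fact_push: "Fact l \<theta> (\<lambda>\<sigma> i. e \<sigma> (r \<sigma> i)) \<Longrightarrow> m \<in> ctxs T \<Longrightarrow>
    (\<And>\<sigma> i. i < l \<sigma> \<Longrightarrow> r \<sigma> i < m \<sigma>) \<Longrightarrow> (\<And>\<sigma> i. i < m \<sigma> \<Longrightarrow> El \<sigma> (e \<sigma> i)) \<Longrightarrow>
    Fact m (subst r \<theta>) e"
| Fact_cong: "Fact m \<theta> e \<Longrightarrow> (\<And>\<sigma> i. i < m \<sigma> \<Longrightarrow> e \<sigma> i = e' \<sigma> i) \<Longrightarrow> Fact m \<theta> e'"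

lemma
  shows "El \<sigma> t \<Longrightarrow> True"
    and Fact_wf: "Fact m \<theta> e \<Longrightarrow>
      m \<in> ctxs T \<and> fm_in T m \<theta> \<and> (\<forall>\<sigma> i. i < m \<sigma> \<longrightarrow> El \<sigma> (e \<sigma> i))"
proof (induction rule: El_Fact.inducts)
  case (Fact_Gen)
  then show ?case using n0 \<phi>0 El_Gen by auto
next
  case (Fact_Wit m \<sigma> \<theta> e)
  have "\<forall>\<tau> i. i < (m(\<sigma> := Suc (m \<sigma>))) \<tau> \<longrightarrow> El \<tau> (push \<sigma> (Wit \<sigma> \<theta> m e) e \<tau> i)"
    using Fact_Wit El_Wit[of m \<sigma> \<theta> e] by (auto simp: push_def split: nat.splits)
  then show ?case using Fact_Wit ctxs_Suc[of m T \<sigma>] by (simp only: fm_in.simps)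
next
  case (Fact_prv m \<theta> e \<chi>)
  then show ?case using prv_wf[OF reg] by blast
next
  case (Fact_push l \<theta> e r m)
  then show ?case using fm_in_subst[of T l \<theta> r m] by blast
next
  case (Fact_cong m \<theta> e e')
  then show ?case by metis
qed auto

text \<open>A world \<open>(k, \<gamma>, I)\<close> is a finite piece of the Henkin model: \<open>I\<close> names some
  elements by variables of the context \<open>k\<close>, and \<open>\<gamma>\<close> is what is known about them.\<close>

definition forces ::
  "'s ctx \<Rightarrow> ('s, 'r) fm \<Rightarrow> ('s \<Rightarrow> ('s, 'r) tm \<Rightarrow> nat option) \<Rightarrow>
   's ctx \<Rightarrow> ('s, 'r) fm \<Rightarrow> ('s \<Rightarrow> nat \<Rightarrow> ('s, 'r) tm) \<Rightarrow> bool" where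
  "forces k \<gamma> I m \<theta> e \<longleftrightarrow> (\<forall>\<tau> j. j < m \<tau> \<longrightarrow> I \<tau> (e \<tau> j) \<noteq> None) \<and>
     prv T k \<gamma> (subst (\<lambda>\<tau> j. the (I \<tau> (e \<tau> j))) \<theta>)"

text \<open>The last conjunct keeps, for each named witness, the fact that introduced it. Since that
  fact is forced, the parameters of the witness are named as well.\<close>

definition world ::
  "'s ctx \<Rightarrow> ('s, 'r) fm \<Rightarrow> ('s \<Rightarrow> ('s, 'r) tm \<Rightarrow> nat option) \<Rightarrow> bool" where
  "world k \<gamma> I \<longleftrightarrow> k \<in> ctxs T \<and> fm_in T k \<gamma> \<and> (\<forall>\<sigma> t x. I \<sigma> t = Some x \<longrightarrow> x < k \<sigma>) \<and>
     forces k \<gamma> I n0 \<phi>0 Gen \<and>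
     (\<forall>\<sigma> \<theta> m e. I \<sigma> (Wit \<sigma> \<theta> m e) \<noteq> None \<longrightarrow> fm_in T (m(\<sigma> := Suc (m \<sigma>))) \<theta> \<and>
        forces k \<gamma> I (m(\<sigma> := Suc (m \<sigma>))) \<theta> (push \<sigma> (Wit \<sigma> \<theta> m e) e))"

text \<open>The second clause is conservativity: it carries provability at the end of a chain of
  extensions back to the first world. The other clauses make names and forced facts persist.\<close>

definition extends ::
  "'s ctx \<Rightarrow> ('s, 'r) fm \<Rightarrow> ('s \<Rightarrow> ('s, 'r) tm \<Rightarrow> nat option) \<Rightarrow>
   's ctx \<Rightarrow> ('s, 'r) fm \<Rightarrow> ('s \<Rightarrow> ('s, 'r) tm \<Rightarrow> nat option) \<Rightarrow> bool" where
  "extends k \<gamma> I k' \<gamma>' I' \<longleftrightarrow> (\<exists>r. (\<forall>\<sigma> i. i < k \<sigma> \<longrightarrow> r \<sigma> i < k' \<sigma>) \<and>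
     (\<forall>\<psi>. fm_in T k \<psi> \<longrightarrow> prv T k' \<gamma>' (subst r \<psi>) \<longrightarrow> prv T k \<gamma> \<psi>) \<and>
     (\<forall>\<psi>. prv T k \<gamma> \<psi> \<longrightarrow> prv T k' \<gamma>' (subst r \<psi>)) \<and>
     (\<forall>\<sigma> t x. I \<sigma> t = Some x \<longrightarrow> I' \<sigma> t = Some (r \<sigma> x)))"

lemma extends_refl: "extends k \<gamma> I k \<gamma> I"
  unfolding extends_def by (rule exI[of _ "\<lambda>\<sigma> i. i"]) auto

lemma extends_trans:
  assumes "extends k \<gamma> I k' \<gamma>' I'" "extends k' \<gamma>' I' k'' \<gamma>'' I''"
  shows "extends k \<gamma> I k'' \<gamma>'' I''"
proof -
  from assms(1) obtain r where r: "\<And>\<sigma> i. i < k \<sigma> \<Longrightarrow> r \<sigma> i < k' \<sigma>"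
    "\<And>\<psi>. fm_in T k \<psi> \<Longrightarrow> prv T k' \<gamma>' (subst r \<psi>) \<Longrightarrow> prv T k \<gamma> \<psi>"
    "\<And>\<psi>. prv T k \<gamma> \<psi> \<Longrightarrow> prv T k' \<gamma>' (subst r \<psi>)"
    "\<And>\<sigma> t x. I \<sigma> t = Some x \<Longrightarrow> I' \<sigma> t = Some (r \<sigma> x)"
    unfolding extends_def by blast
  from assms(2) obtain s where s: "\<And>\<sigma> i. i < k' \<sigma> \<Longrightarrow> s \<sigma> i < k'' \<sigma>"
    "\<And>\<psi>. fm_in T k' \<psi> \<Longrightarrow> prv T k'' \<gamma>'' (subst s \<psi>) \<Longrightarrow> prv T k' \<gamma>' \<psi>"
    "\<And>\<psi>. prv T k' \<gamma>' \<psi> \<Longrightarrow> prv T k'' \<gamma>'' (subst s \<psi>)"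
    "\<And>\<sigma> t x. I' \<sigma> t = Some x \<Longrightarrow> I'' \<sigma> t = Some (s \<sigma> x)"
    unfolding extends_def by blast
  show ?thesis unfolding extends_def
  proof (intro exI[of _ "\<lambda>\<sigma> i. s \<sigma> (r \<sigma> i)"] conjI allI impI)
    fix \<psi> assume a: "fm_in T k \<psi>" "prv T k'' \<gamma>'' (subst (\<lambda>\<sigma> i. s \<sigma> (r \<sigma> i)) \<psi>)"
    have "prv T k'' \<gamma>'' (subst s (subst r \<psi>))" using a(2) by (simp add: subst_subst)
    then have "prv T k' \<gamma>' (subst r \<psi>)" using s(2) a(1) r(1) fm_in_subst by blast
    then show "prv T k \<gamma> \<psi>" using r(2) a(1) by blast
  next
    fix \<psi> assume "prv T k \<gamma> \<psi>"
    then show "prv T k'' \<gamma>'' (subst (\<lambda>\<sigma> i. s \<sigma> (r \<sigma> i)) \<psi>)"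
      using r(3) s(3) by (fastforce simp: subst_subst)
  qed (use r s in auto)
qed

lemma forces_extends:
  assumes "forces k \<gamma> I m \<theta> e" "extends k \<gamma> I k' \<gamma>' I'" "fm_in T m \<theta>"
  shows "forces k' \<gamma>' I' m \<theta> e"
proof -
  from assms(2) obtain r where r: "\<And>\<psi>. prv T k \<gamma> \<psi> \<Longrightarrow> prv T k' \<gamma>' (subst r \<psi>)"
    "\<And>\<sigma> t x. I \<sigma> t = Some x \<Longrightarrow> I' \<sigma> t = Some (r \<sigma> x)"
    unfolding extends_def by blast
  have d: "\<And>\<tau> j. j < m \<tau> \<Longrightarrow> I \<tau> (e \<tau> j) \<noteq> None"
    and p: "prv T k \<gamma> (subst (\<lambda>\<tau> j. the (I \<tau> (e \<tau> j))) \<theta>)"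
    using assms(1) unfolding forces_def by auto
  have d': "I' \<tau> (e \<tau> j) = Some (r \<tau> (the (I \<tau> (e \<tau> j))))" if "j < m \<tau>" for \<tau> j
    using d[OF that] r(2) by auto
  have "subst r (subst (\<lambda>\<tau> j. the (I \<tau> (e \<tau> j))) \<theta>) = subst (\<lambda>\<tau> j. the (I' \<tau> (e \<tau> j))) \<theta>"
    unfolding subst_subst using d' by (intro subst_cong[OF assms(3)]) auto
  then show ?thesis using r(1)[OF p] d' unfolding forces_def by auto
qed

text \<open>The witness becomes a fresh variable, and the matrix of the existential formula is added
  to what is known. This is the only step that enlarges a world.\<close>

lemma world_witness:
  assumes w: "world k \<gamma> I" and f: "forces k \<gamma> I m (Ex \<sigma> \<theta>) e" and \<theta>: "fm_in T m (Ex \<sigma> \<theta>)"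
    and new: "I \<sigma> (Wit \<sigma> \<theta> m e) = None"
  shows "\<exists>k' \<gamma>' I'. world k' \<gamma>' I' \<and> extends k \<gamma> I k' \<gamma>' I' \<and> I' \<sigma> (Wit \<sigma> \<theta> m e) \<noteq> None"
proof -
  let ?W = "Wit \<sigma> \<theta> m e" and ?m = "m(\<sigma> := Suc (m \<sigma>))"
  define wk where "wk = (\<lambda>\<tau> i. if \<tau> = \<sigma> then Suc i else i)"
  define k' where "k' = k(\<sigma> := Suc (k \<sigma>))"
  define I' where "I' = (\<lambda>\<tau> t. if \<tau> = \<sigma> \<and> t = ?W then Some 0 else map_option (wk \<tau>) (I \<tau> t))"
  \<comment> \<open>The matrix \<open>\<theta>\<close> with its parameters replaced by their names;
    the bound variable stays at index 0, which is the fresh variable of \<open>k'\<close>.\<close>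
  define \<chi> where "\<chi> = subst (under_binder \<sigma> (\<lambda>\<tau> j. the (I \<tau> (e \<tau> j)))) \<theta>"
  define \<gamma>' where "\<gamma>' = Conj (weaken \<sigma> \<gamma>) \<chi>"
  have k: "k \<in> ctxs T" and \<gamma>: "fm_in T k \<gamma>" and I: "\<And>\<sigma> t x. I \<sigma> t = Some x \<Longrightarrow> x < k \<sigma>"
    using w unfolding world_def by auto
  have dd: "I \<tau> (e \<tau> j) \<noteq> None" if "j < m \<tau>" for \<tau> j using f that unfolding forces_def by auto
  have pE: "prv T k \<gamma> (Ex \<sigma> \<chi>)" using f unfolding forces_def \<chi>_def by simp
  have \<sigma>: "\<sigma> \<in> sorts T" using \<theta> by simp
  have k': "k' \<in> ctxs T" unfolding k'_def using k \<sigma> by (rule ctxs_Suc)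
  have \<chi>_in: "fm_in T k (Ex \<sigma> \<chi>)" using prv_wf[OF reg pE] by simp
  have \<chi>_in': "fm_in T k' \<chi>" using \<chi>_in by (simp add: k'_def)
  have w\<gamma>: "fm_in T k' (weaken \<sigma> \<gamma>)" unfolding k'_def using \<gamma> by (rule fm_in_weaken)
  have ext: "extends k \<gamma> I k' \<gamma>' I'" unfolding extends_def
  proof (intro exI[of _ wk] conjI allI impI)
    fix \<tau> i assume "i < k \<tau>" then show "wk \<tau> i < k' \<tau>" by (auto simp: wk_def k'_def)
  next
    fix \<psi> assume \<psi>: "fm_in T k \<psi>" and p: "prv T k' \<gamma>' (subst wk \<psi>)"
    \<comment> \<open>Conservativity: \<open>\<gamma>\<close> already proves
      \<open>Ex \<sigma> \<chi>\<close>, the Frobenius rule moves \<open>\<gamma>\<close> under the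
      quantifier, and eliminating the quantifier against \<open>\<psi>\<close> removes the fresh
      variable.\<close>
    have "prv T k \<gamma> (Conj \<gamma> (Ex \<sigma> \<chi>))" by (intro prv.ConjI prv.Refl k \<gamma> pE)
    moreover have "prv T k (Conj \<gamma> (Ex \<sigma> \<chi>)) (Ex \<sigma> \<gamma>')" unfolding \<gamma>'_def
      by (rule prv.Frob[OF k \<gamma> \<chi>_in])
    moreover have "prv T k (Ex \<sigma> \<gamma>') \<psi>"
      using p by (intro prv.ExL k \<sigma> \<psi>) (simp add: k'_def weaken_def wk_def)
    ultimately show "prv T k \<gamma> \<psi>" by (blast intro: prv.Cut)
  next
    fix \<psi> assume "prv T k \<gamma> \<psi>"
    then have "prv T k' (subst wk \<gamma>) (subst wk \<psi>)"
      by (rule prv.Subst[OF _ k']) (auto simp: wk_def k'_def)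
    moreover have "prv T k' \<gamma>' (subst wk \<gamma>)" unfolding \<gamma>'_def
      using prv.ConjE1[OF k' w\<gamma> \<chi>_in'] by (simp add: weaken_def wk_def)
    ultimately show "prv T k' \<gamma>' (subst wk \<psi>)" by (blast intro: prv.Cut)
  next
    fix \<tau> t x assume "I \<tau> t = Some x" then show "I' \<tau> t = Some (wk \<tau> x)" using new by (auto simp: I'_def)
  qed
  \<comment> \<open>The parameters are already named and \<open>?W\<close> is not, so no parameter
    coincides with the new witness and the two clauses of \<open>I'\<close> do not
    interfere.\<close>
  have at: "I' \<tau> (push \<sigma> ?W e \<tau> j) = Some (under_binder \<sigma> (\<lambda>\<tau> j. the (I \<tau> (e \<tau> j))) \<tau> j)"
    if j: "j < ?m \<tau>" for \<tau> j
  proof (cases "\<tau> = \<sigma> \<and> j = 0")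
    case True
    then show ?thesis by (simp add: I'_def under_binder_def)
  next
    case False
    then obtain j' where j': "j' < m \<tau>" "push \<sigma> ?W e \<tau> j = e \<tau> j'" "\<tau> = \<sigma> \<and> j = Suc j' \<or> \<tau> \<noteq> \<sigma> \<and> j = j'"
      using j by (cases j) (auto simp: push_def split: if_splits)
    from dd[OF j'(1)] j'(2,3) new show ?thesis
      by (auto simp: I'_def under_binder_def wk_def)
  qed
  have fW: "forces k' \<gamma>' I' ?m \<theta> (push \<sigma> ?W e)"
  proof -
    have "subst (\<lambda>\<tau> j. the (I' \<tau> (push \<sigma> ?W e \<tau> j))) \<theta> = \<chi>"
      unfolding \<chi>_def using at \<theta> by (intro subst_cong[of T ?m]) auto
    moreover have "prv T k' \<gamma>' \<chi>" unfolding \<gamma>'_def by (rule prv.ConjE2[OF k' w\<gamma> \<chi>_in'])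
    ultimately show ?thesis unfolding forces_def using at by auto
  qed
  have "world k' \<gamma>' I'" unfolding world_def
  proof (intro conjI allI impI)
    show "fm_in T k' \<gamma>'" using w\<gamma> \<chi>_in' by (simp add: \<gamma>'_def)
    show "forces k' \<gamma>' I' n0 \<phi>0 Gen" using w ext \<phi>0 forces_extends unfolding world_def by blast
  next
    fix \<tau> t x assume "I' \<tau> t = Some x"
    then show "x < k' \<tau>" using I by (auto simp: I'_def k'_def wk_def split: if_splits)
  next
    fix \<tau> \<theta>' m' e' assume a: "I' \<tau> (Wit \<tau> \<theta>' m' e') \<noteq> None"
    show "fm_in T (m'(\<tau> := Suc (m' \<tau>))) \<theta>'"
    proof (cases "Wit \<tau> \<theta>' m' e' = ?W")
      case True
      then show ?thesis using \<theta> by simp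
    next
      case False
      then have "I \<tau> (Wit \<tau> \<theta>' m' e') \<noteq> None" using a by (auto simp: I'_def)
      then show ?thesis using w unfolding world_def by blast
    qed
  next
    fix \<tau> \<theta>' m' e' assume a: "I' \<tau> (Wit \<tau> \<theta>' m' e') \<noteq> None"
    show "forces k' \<gamma>' I' (m'(\<tau> := Suc (m' \<tau>))) \<theta>' (push \<tau> (Wit \<tau> \<theta>' m' e') e')"
    proof (cases "Wit \<tau> \<theta>' m' e' = ?W")
      case True
      then show ?thesis using fW by auto
    next
      case False
      then have "I \<tau> (Wit \<tau> \<theta>' m' e') \<noteq> None" using a by (auto simp: I'_def)
      then show ?thesis using w forces_extends[OF _ ext] unfolding world_def by blast
    qed
  qed (rule k')
  moreover have "I' \<sigma> ?W \<noteq> None" by (simp add: I'_def)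
  ultimately show ?thesis using ext by blast
qed

lemma finite_ctx_vars: "m \<in> ctxs T \<Longrightarrow> finite {(\<sigma>, i). i < m \<sigma>}"
proof -
  assume "m \<in> ctxs T"
  then have "finite (SIGMA \<sigma>:{\<sigma>. m \<sigma> \<noteq> 0}. {..<m \<sigma>})" unfolding ctxs_def by auto
  moreover have "{(\<sigma>, i). i < m \<sigma>} \<subseteq> (SIGMA \<sigma>:{\<sigma>. m \<sigma> \<noteq> 0}. {..<m \<sigma>})" by auto
  ultimately show ?thesis by (rule rev_finite_subset)
qed

lemma extends_defined: "extends k \<gamma> I k' \<gamma>' I' \<Longrightarrow> I \<sigma> t \<noteq> None \<Longrightarrow> I' \<sigma> t \<noteq> None"
  unfolding extends_def by auto

text \<open>A context has finitely many variables and names persist along extensions, so the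
  elements can be named one after another.\<close>

lemma world_defined:
  assumes m: "m \<in> ctxs T" and w: "world k \<gamma> I"
    and step: "\<And>\<sigma> i k \<gamma> I. i < m \<sigma> \<Longrightarrow> world k \<gamma> I \<Longrightarrow>
      \<exists>k' \<gamma>' I'. world k' \<gamma>' I' \<and> extends k \<gamma> I k' \<gamma>' I' \<and> I' \<sigma> (e \<sigma> i) \<noteq> None"
  shows "\<exists>k' \<gamma>' I'. world k' \<gamma>' I' \<and> extends k \<gamma> I k' \<gamma>' I' \<and>
     (\<forall>\<sigma> i. i < m \<sigma> \<longrightarrow> I' \<sigma> (e \<sigma> i) \<noteq> None)"
proof -
  have "finite X \<Longrightarrow> X \<subseteq> {(\<sigma>, i). i < m \<sigma>} \<Longrightarrow> \<exists>k' \<gamma>' I'. world k' \<gamma>' I' \<and>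
      extends k \<gamma> I k' \<gamma>' I' \<and> (\<forall>(\<sigma>, i)\<in>X. I' \<sigma> (e \<sigma> i) \<noteq> None)" for X
  proof (induction X rule: finite_induct)
    case empty
    then show ?case using w extends_refl by blast
  next
    case (insert x X)
    obtain \<sigma> i where x: "x = (\<sigma>, i)" "i < m \<sigma>" using insert.prems by auto
    from insert obtain k1 \<gamma>1 I1 where 1: "world k1 \<gamma>1 I1" "extends k \<gamma> I k1 \<gamma>1 I1"
      "\<forall>(\<sigma>, i)\<in>X. I1 \<sigma> (e \<sigma> i) \<noteq> None" by auto
    from step[OF x(2) 1(1)] obtain k2 \<gamma>2 I2 where 2: "world k2 \<gamma>2 I2"
      "extends k1 \<gamma>1 I1 k2 \<gamma>2 I2" "I2 \<sigma> (e \<sigma> i) \<noteq> None" by blast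
    have "\<forall>(\<sigma>, i)\<in>insert x X. I2 \<sigma> (e \<sigma> i) \<noteq> None"
      using 1(3) 2(3) x(1) extends_defined[OF 2(2)] by fast
    then show ?case using 2(1) extends_trans[OF 1(2) 2(2)] by blast
  qed
  from this[OF finite_ctx_vars[OF m] subset_refl] show ?thesis by blast
qed

text \<open>The claim starts from an arbitrary world, so that the extensions obtained for several
  premises can be chained; what was forced earlier survives by
  \<open>forces_extends\<close>.\<close>

lemma
  shows El_forced: "El \<sigma> t \<Longrightarrow> \<forall>k \<gamma> I. world k \<gamma> I \<longrightarrow>
      (\<exists>k' \<gamma>' I'. world k' \<gamma>' I' \<and> extends k \<gamma> I k' \<gamma>' I' \<and> I' \<sigma> t \<noteq> None)"
    and Fact_forced: "Fact m \<theta> e \<Longrightarrow> \<forall>k \<gamma> I. world k \<gamma> I \<longrightarrow>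
      (\<exists>k' \<gamma>' I'. world k' \<gamma>' I' \<and> extends k \<gamma> I k' \<gamma>' I' \<and> forces k' \<gamma>' I' m \<theta> e)"
proof (induction rule: El_Fact.inducts)
  case (El_Gen i \<sigma>)
  then show ?case using extends_refl unfolding world_def forces_def by blast
next
  case (El_Wit m \<sigma> \<theta> e)
  show ?case
  proof (intro allI impI)
    fix k \<gamma> I assume "world k \<gamma> I"
    with El_Wit.IH obtain k' \<gamma>' I' where 1: "world k' \<gamma>' I'" "extends k \<gamma> I k' \<gamma>' I'"
      "forces k' \<gamma>' I' m (Ex \<sigma> \<theta>) e" by blast
    show "\<exists>k' \<gamma>' I'. world k' \<gamma>' I' \<and> extends k \<gamma> I k' \<gamma>' I' \<and> I' \<sigma> (Wit \<sigma> \<theta> m e) \<noteq> None"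
    proof (cases "I' \<sigma> (Wit \<sigma> \<theta> m e) = None")
      case True
      from Fact_wf El_Wit have "fm_in T m (Ex \<sigma> \<theta>)" by blast
      from world_witness[OF 1(1,3) this True] show ?thesis using extends_trans[OF 1(2)] by blast
    qed (use 1 in blast)
  qed
next
  case Fact_Gen
  then show ?case using extends_refl unfolding world_def by blast
next
  case (Fact_Wit m \<sigma> \<theta> e)
  show ?case
  proof (intro allI impI)
    fix k \<gamma> I assume "world k \<gamma> I"
    with Fact_Wit.IH obtain k' \<gamma>' I' where 1: "world k' \<gamma>' I'" "extends k \<gamma> I k' \<gamma>' I'"
      "forces k' \<gamma>' I' m (Ex \<sigma> \<theta>) e" by blast
    have fm: "fm_in T m (Ex \<sigma> \<theta>)" using Fact_wf Fact_Wit by blast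
    obtain k2 \<gamma>2 I2 where 2: "world k2 \<gamma>2 I2" "extends k' \<gamma>' I' k2 \<gamma>2 I2"
      "I2 \<sigma> (Wit \<sigma> \<theta> m e) \<noteq> None"
      using world_witness[OF 1(1,3) fm] 1 extends_refl by blast
    have "forces k2 \<gamma>2 I2 (m(\<sigma> := Suc (m \<sigma>))) \<theta> (push \<sigma> (Wit \<sigma> \<theta> m e) e)"
      using 2(1,3) unfolding world_def by blast
    then show "\<exists>k' \<gamma>' I'. world k' \<gamma>' I' \<and> extends k \<gamma> I k' \<gamma>' I' \<and>
        forces k' \<gamma>' I' (m(\<sigma> := Suc (m \<sigma>))) \<theta> (push \<sigma> (Wit \<sigma> \<theta> m e) e)"
      using 2 extends_trans[OF 1(2) 2(2)] by blast
  qed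
next
  case (Fact_Top m e)
  have m: "m \<in> ctxs T" using Fact_Top by blast
  show ?case
  proof (intro allI impI)
    fix k \<gamma> I assume w: "world k \<gamma> I"
    have d: "\<exists>k' \<gamma>' I'. world k' \<gamma>' I' \<and> extends k \<gamma> I k' \<gamma>' I' \<and>
        (\<forall>\<sigma> i. i < m \<sigma> \<longrightarrow> I' \<sigma> (e \<sigma> i) \<noteq> None)"
      using Fact_Top.IH by (intro world_defined[OF m w]) blast
    have "forces k' \<gamma>' I' m Top e"
      if "world k' \<gamma>' I'" "\<forall>\<sigma> i. i < m \<sigma> \<longrightarrow> I' \<sigma> (e \<sigma> i) \<noteq> None" for k' \<gamma>' I'
      using that unfolding forces_def world_def subst.simps by (blast intro: prv.TopI)
    then show "\<exists>k' \<gamma>' I'. world k' \<gamma>' I' \<and> extends k \<gamma> I k' \<gamma>' I' \<and> forces k' \<gamma>' I' m Top e"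
      using d by blast
  qed
next
  case (Fact_Conj m \<theta> e \<chi>)
  show ?case
  proof (intro allI impI)
    fix k \<gamma> I assume "world k \<gamma> I"
    with Fact_Conj.IH obtain k1 \<gamma>1 I1 where 1: "world k1 \<gamma>1 I1" "extends k \<gamma> I k1 \<gamma>1 I1"
      "forces k1 \<gamma>1 I1 m \<theta> e" by blast
    with Fact_Conj.IH obtain k2 \<gamma>2 I2 where 2: "world k2 \<gamma>2 I2" "extends k1 \<gamma>1 I1 k2 \<gamma>2 I2"
      "forces k2 \<gamma>2 I2 m \<chi> e" by blast
    have "forces k2 \<gamma>2 I2 m \<theta> e" using forces_extends[OF 1(3) 2(2)] Fact_wf Fact_Conj by blast
    with 2(3) have "forces k2 \<gamma>2 I2 m (Conj \<theta> \<chi>) e" unfolding forces_def by (auto intro: prv.ConjI)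
    then show "\<exists>k' \<gamma>' I'. world k' \<gamma>' I' \<and> extends k \<gamma> I k' \<gamma>' I' \<and> forces k' \<gamma>' I' m (Conj \<theta> \<chi>) e"
      using 2 extends_trans[OF 1(2) 2(2)] by blast
  qed
next
  case (Fact_prv m \<theta> e \<chi>)
  have p: "prv T m \<theta> \<chi>" using Fact_prv by blast
  have "forces k \<gamma> I m \<chi> e" if "world k \<gamma> I" "forces k \<gamma> I m \<theta> e" for k \<gamma> I
  proof -
    have "prv T k (subst (\<lambda>\<tau> j. the (I \<tau> (e \<tau> j))) \<theta>) (subst (\<lambda>\<tau> j. the (I \<tau> (e \<tau> j))) \<chi>)"
      using that unfolding world_def forces_def
      by (intro prv.Subst[OF p]) fastforce+
    then show ?thesis using that(2) unfolding forces_def by (blast intro: prv.Cut)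
  qed
  then show ?case using Fact_prv.IH by blast
next
  case (Fact_pull m r \<theta> e l)
  have "forces k \<gamma> I l \<theta> (\<lambda>\<sigma> i. e \<sigma> (r \<sigma> i))" if "forces k \<gamma> I m (subst r \<theta>) e" for k \<gamma> I
    using that Fact_pull unfolding forces_def by (auto simp: subst_subst)
  then show ?case using Fact_pull.IH by blast
next
  case (Fact_push l \<theta> e r m)
  have m: "m \<in> ctxs T" using Fact_push by blast
  show ?case
  proof (intro allI impI)
    fix k \<gamma> I assume "world k \<gamma> I"
    with Fact_push.IH obtain k1 \<gamma>1 I1 where 1: "world k1 \<gamma>1 I1" "extends k \<gamma> I k1 \<gamma>1 I1"
      "forces k1 \<gamma>1 I1 l \<theta> (\<lambda>\<sigma> i. e \<sigma> (r \<sigma> i))" by blast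
    have "\<exists>k' \<gamma>' I'. world k' \<gamma>' I' \<and> extends k1 \<gamma>1 I1 k' \<gamma>' I' \<and>
        (\<forall>\<sigma> i. i < m \<sigma> \<longrightarrow> I' \<sigma> (e \<sigma> i) \<noteq> None)"
      using Fact_push.IH by (intro world_defined[OF m 1(1)]) blast
    then obtain k2 \<gamma>2 I2 where 2: "world k2 \<gamma>2 I2" "extends k1 \<gamma>1 I1 k2 \<gamma>2 I2"
      "\<forall>\<sigma> i. i < m \<sigma> \<longrightarrow> I2 \<sigma> (e \<sigma> i) \<noteq> None" by blast
    have "forces k2 \<gamma>2 I2 l \<theta> (\<lambda>\<sigma> i. e \<sigma> (r \<sigma> i))"
      using forces_extends[OF 1(3) 2(2)] Fact_wf Fact_push by blast
    with 2(3) have "forces k2 \<gamma>2 I2 m (subst r \<theta>) e" unfolding forces_def by (auto simp: subst_subst)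
    then show "\<exists>k' \<gamma>' I'. world k' \<gamma>' I' \<and> extends k \<gamma> I k' \<gamma>' I' \<and> forces k' \<gamma>' I' m (subst r \<theta>) e"
      using 2 extends_trans[OF 1(2) 2(2)] by blast
  qed
next
  case (Fact_cong m \<theta> e e')
  have fm: "fm_in T m \<theta>" using Fact_wf Fact_cong by blast
  have "forces k \<gamma> I m \<theta> e'" if "forces k \<gamma> I m \<theta> e" for k \<gamma> I
  proof -
    have "subst (\<lambda>\<tau> j. the (I \<tau> (e \<tau> j))) \<theta> = subst (\<lambda>\<tau> j. the (I \<tau> (e' \<tau> j))) \<theta>"
      using Fact_cong by (intro subst_cong[OF fm]) auto
    then show ?thesis using that Fact_cong unfolding forces_def by auto
  qed
  then show ?case using Fact_cong.IH by blast
qed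

text \<open>The initial world names each generic element by its own variable and knows only
  \<open>\<phi>0\<close>. Some extension of it forces \<open>\<psi>\<close>, and conservativity
  brings this back to provability from \<open>\<phi>0\<close>.\<close>

lemma Fact_Gen_prv:
  assumes "Fact n0 \<psi> Gen" shows "prv T n0 \<phi>0 \<psi>"
proof -
  define I :: "'s \<Rightarrow> ('s, 'r) tm \<Rightarrow> nat option" where "I = (\<lambda>\<sigma> t. case t of Gen \<tau> i \<Rightarrow> if \<tau> = \<sigma> \<and> i < n0 \<sigma> then Some i else None
    | Wit _ _ _ _ \<Rightarrow> None)"
  have \<psi>: "fm_in T n0 \<psi>" using Fact_wf assms by blast
  have sid: "subst (\<lambda>\<tau> j. the (I \<tau> (Gen \<tau> j))) \<phi> = \<phi>" if "fm_in T n0 \<phi>" for \<phi>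
    using subst_cong[OF that, of "\<lambda>\<tau> j. the (I \<tau> (Gen \<tau> j))" "\<lambda>\<tau> j. j"] by (simp add: I_def)
  have "world n0 \<phi>0 I"
    using n0 \<phi>0 sid unfolding world_def forces_def
    by (auto simp: I_def intro: prv.Refl split: tm.splits if_splits)
  then obtain k' \<gamma>' I' where 1: "extends n0 \<phi>0 I k' \<gamma>' I'" "forces k' \<gamma>' I' n0 \<psi> Gen"
    using Fact_forced assms by blast
  from 1(1) obtain r where r:
    "\<And>\<psi>. fm_in T n0 \<psi> \<Longrightarrow> prv T k' \<gamma>' (subst r \<psi>) \<Longrightarrow> prv T n0 \<phi>0 \<psi>"
    "\<And>\<sigma> t x. I \<sigma> t = Some x \<Longrightarrow> I' \<sigma> t = Some (r \<sigma> x)"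
    unfolding extends_def by blast
  have "subst (\<lambda>\<tau> j. the (I' \<tau> (Gen \<tau> j))) \<psi> = subst r \<psi>"
    using r(2) by (intro subst_cong[OF \<psi>]) (auto simp: I_def)
  then show ?thesis using 1(2) r(1)[OF \<psi>] unfolding forces_def by simp
qed

end

section \<open>The variables of a list of sorts\<close>

lemma distinct_list_vars: "distinct (list_vars ss)"
proof -
  have "count_list (take i ss) (ss ! i) < count_list (take j ss) (ss ! i)"
    if "i < j" "j < length ss" for i j
  proof -
    have "take j ss = take i ss @ drop i (take j ss)" by (metis append_take_drop_id min.absorb1 less_imp_le take_take that(1))
    moreover have "drop i (take j ss) = ss ! i # drop (Suc i) (take j ss)"
      using that by (subst Cons_nth_drop_Suc[symmetric]) auto
    ultimately have "count_list (take j ss) (ss ! i) =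
        count_list (take i ss) (ss ! i) + count_list (ss ! i # drop (Suc i) (take j ss)) (ss ! i)"
      by (metis count_list_append)
    then show ?thesis by simp
  qed
  then have "inj_on (\<lambda>p. (ss ! p, count_list (take p ss) (ss ! p))) {0..<length ss}"
    by (intro linorder_inj_onI') (auto, metis less_irrefl)
  then show ?thesis by (simp add: list_vars_def distinct_map)
qed

lemma map_fst_list_vars: "map fst (list_vars ss) = ss"
  by (simp add: list_vars_def o_def map_nth)

lemma set_list_vars: "set (list_vars ss) = {(\<sigma>, i). i < count_list ss \<sigma>}"
proof (induction ss rule: rev_induct)
  case Nil
  then show ?case by (simp add: list_vars_def)
next
  case (snoc s ss)
  have "list_vars (ss @ [s]) = list_vars ss @ [(s, count_list ss s)]"
    by (auto simp: list_vars_def nth_append)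
  moreover have "count_list (ss @ [s]) \<sigma> = count_list ss \<sigma> + (if \<sigma> = s then 1 else 0)" for \<sigma>
    by simp
  ultimately show ?case using snoc by (auto simp: less_Suc_eq split: if_splits)
qed

lemma count_list_ctxs: "set ss \<subseteq> sorts T \<Longrightarrow> count_list ss \<in> ctxs T"
proof -
  assume "set ss \<subseteq> sorts T"
  moreover have "{\<sigma>. count_list ss \<sigma> \<noteq> 0} = set ss" by (auto simp: count_list_0_iff)
  ultimately show ?thesis by (simp add: ctxs_def)
qed

text \<open>Every tuple of variables with the sorts of an arity is a renaming of the generic tuple.
  Distinctness of \<open>xs\<close> makes the renaming well defined, even if \<open>ys\<close>
  repeats a variable.\<close>

lemma distinct_retarget:
  "distinct xs \<Longrightarrow> map fst xs = map fst ys \<Longrightarrow> \<exists>r. map (\<lambda>(\<sigma>, i). (\<sigma>, r \<sigma> i)) xs = ys"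
proof (induction xs arbitrary: ys)
  case (Cons x xs)
  obtain y ys' where ys: "ys = y # ys'" "fst x = fst y" "map fst xs = map fst ys'"
    using Cons.prems(2) by (cases ys) auto
  obtain r where r: "map (\<lambda>(\<sigma>, i). (\<sigma>, r \<sigma> i)) xs = ys'" using Cons.IH[OF _ ys(3)] Cons.prems(1) by auto
  let ?r = "\<lambda>\<sigma> i. if (\<sigma>, i) = x then snd y else r \<sigma> i"
  have "map (\<lambda>(\<sigma>, i). (\<sigma>, ?r \<sigma> i)) xs = map (\<lambda>(\<sigma>, i). (\<sigma>, r \<sigma> i)) xs"
    using Cons.prems(1) by (intro map_cong) auto
  then have "map (\<lambda>(\<sigma>, i). (\<sigma>, ?r \<sigma> i)) (x # xs) = ys"
    using ys r by (cases x; cases y) auto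
  then show ?case by (intro exI[of _ ?r])
qed simp

section \<open>The canonical model: elements modulo provable equality\<close>

context henkin
begin

text \<open>Equality in the Henkin model, stated in the smallest context that can name both
  elements.\<close>

definition sim :: "'s \<Rightarrow> ('s, 'r) tm \<Rightarrow> ('s, 'r) tm \<Rightarrow> bool" where
  "sim \<sigma> t u \<longleftrightarrow> Fact (sort_ctx \<sigma> 2) (Eq \<sigma> 0 1) (\<lambda>_ i. if i = 0 then t else u)"

lemma El_sort: "El \<sigma> t \<Longrightarrow> \<sigma> \<in> sorts T"
proof (induction rule: El.cases)
  case (El_Gen i \<tau>)
  then show ?case using n0 by (auto simp: ctxs_def)
next
  case (El_Wit m \<tau> \<theta> e)
  then show ?case using Fact_wf by fastforce
qed

lemma sim_El: "sim \<sigma> t u \<Longrightarrow> El \<sigma> t \<and> El \<sigma> u"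
proof -
  assume "sim \<sigma> t u"
  then have "\<forall>\<tau> i. i < sort_ctx \<sigma> 2 \<tau> \<longrightarrow> El \<tau> (if i = 0 then t else u)"
    using Fact_wf unfolding sim_def by blast
  from this[rule_format, of 0 \<sigma>] this[rule_format, of 1 \<sigma>] show ?thesis by (simp add: sort_ctx_def)
qed

text \<open>Both directions move along the renaming of 0 to \<open>i\<close> and of 1 to
  \<open>j\<close>; it need not be injective, so \<open>i = j\<close> is covered.\<close>

lemma Fact_Eq_iff:
  assumes m: "m \<in> ctxs T" and e: "\<And>\<tau> i. i < m \<tau> \<Longrightarrow> El \<tau> (e \<tau> i)" and ij: "i < m \<sigma>" "j < m \<sigma>"
  shows "Fact m (Eq \<sigma> i j) e \<longleftrightarrow> sim \<sigma> (e \<sigma> i) (e \<sigma> j)"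
proof -
  let ?r = "\<lambda>(_ :: 's) k. if k = 0 then i else j"
  have \<sigma>: "\<sigma> \<in> sorts T" using El_sort e ij(1) by blast
  have eq: "Eq \<sigma> i j = (subst ?r (Eq \<sigma> 0 1) :: ('s, 'r) fm)" by simp
  have r: "?r \<tau> k < m \<tau>" if "k < sort_ctx \<sigma> 2 \<tau>" for \<tau> k
    using ij that by (auto simp: sort_ctx_def split: if_splits)
  have fm: "fm_in T (sort_ctx \<sigma> 2) (Eq \<sigma> 0 1)" by (simp add: sort_ctx_def)
  let ?e = "\<lambda>_ k. if k = 0 then e \<sigma> i else e \<sigma> j"
  have ag: "e \<tau> (?r \<tau> k) = ?e \<tau> k" if "k < sort_ctx \<sigma> 2 \<tau>" for \<tau> k
    using that by (auto simp: sort_ctx_def split: if_splits)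
  show ?thesis
  proof
    assume "Fact m (Eq \<sigma> i j) e"
    then have "Fact (sort_ctx \<sigma> 2) (Eq \<sigma> 0 1) (\<lambda>\<tau> k. e \<tau> (?r \<tau> k))"
      unfolding eq by (rule Fact_pull[OF _ fm ctxs_sort[OF \<sigma>] r])
    then show "sim \<sigma> (e \<sigma> i) (e \<sigma> j)" unfolding sim_def by (rule Fact_cong) (rule ag)
  next
    assume "sim \<sigma> (e \<sigma> i) (e \<sigma> j)"
    then have "Fact (sort_ctx \<sigma> 2) (Eq \<sigma> 0 1) (\<lambda>\<tau> k. e \<tau> (?r \<tau> k))"
      unfolding sim_def by (rule Fact_cong) (rule ag[symmetric])
    then show "Fact m (Eq \<sigma> i j) e" unfolding eq by (rule Fact_push[OF _ m r e])
  qed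
qed

text \<open>Leibniz's law: \<open>t\<close> receives a fresh variable of index
  \<open>m \<sigma>\<close> at the end of the context, \<open>EqE\<close> renames variable
  \<open>i\<close> to it, and pulling back along the same renaming returns to the context
  \<open>m\<close>.\<close>

lemma Fact_replace1:
  assumes F: "Fact m \<theta> e" and i: "i < m \<sigma>" and s: "sim \<sigma> (e \<sigma> i) t"
  shows "Fact m \<theta> (\<lambda>\<tau> k. if \<tau> = \<sigma> \<and> k = i then t else e \<tau> k)"
proof -
  have wf: "m \<in> ctxs T" "fm_in T m \<theta>" "\<And>\<tau> k. k < m \<tau> \<Longrightarrow> El \<tau> (e \<tau> k)"
    using Fact_wf[OF F] by auto
  have \<sigma>: "\<sigma> \<in> sorts T" using El_sort wf(3) i by blast
  have t: "El \<sigma> t" using sim_El[OF s] by simp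
  let ?m = "m(\<sigma> := Suc (m \<sigma>))"
  let ?e = "\<lambda>\<tau> k. if \<tau> = \<sigma> \<and> k = m \<sigma> then t else e \<tau> k"
  let ?r = "\<lambda>\<tau> k. if \<tau> = \<sigma> \<and> k = i then m \<sigma> else k"
  have m': "?m \<in> ctxs T" using wf(1) \<sigma> by (rule ctxs_Suc)
  have e': "El \<tau> (?e \<tau> k)" if "k < ?m \<tau>" for \<tau> k
    using that wf(3) t by (auto split: if_splits simp: less_Suc_eq)
  have \<theta>': "fm_in T ?m \<theta>" using wf(2) by (rule fm_in_mono) simp
  have "Fact m \<theta> (\<lambda>\<tau> k. ?e \<tau> k)" using F by (rule Fact_cong) auto
  then have "Fact ?m (subst (\<lambda>\<tau> k. k) \<theta>) ?e"
    by (rule Fact_push[OF _ m' _ e']) auto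
  moreover have "Fact ?m (Eq \<sigma> i (m \<sigma>)) ?e"
    using s i by (subst Fact_Eq_iff[OF m' e']) auto
  ultimately have "Fact ?m (Conj (Eq \<sigma> i (m \<sigma>)) \<theta>) ?e" by (auto intro: Fact_Conj)
  then have "Fact ?m (subst ?r \<theta>) ?e"
    by (rule Fact_prv) (use i in \<open>auto intro!: prv.EqE m' \<theta>'\<close>)
  then have "Fact m \<theta> (\<lambda>\<tau> k. ?e \<tau> (?r \<tau> k))"
    by (rule Fact_pull) (use wf in auto)
  then show ?thesis by (rule Fact_cong) auto
qed

lemma Fact_replace:
  assumes F: "Fact m \<theta> e" and s: "\<And>\<tau> i. i < m \<tau> \<Longrightarrow> sim \<tau> (e \<tau> i) (e' \<tau> i)"
  shows "Fact m \<theta> e'"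
proof -
  have "finite X \<Longrightarrow> X \<subseteq> {(\<sigma>, i). i < m \<sigma>} \<Longrightarrow>
      Fact m \<theta> (\<lambda>\<tau> k. if (\<tau>, k) \<in> X then e' \<tau> k else e \<tau> k)" for X
  proof (induction X rule: finite_induct)
    case empty
    then show ?case using F by simp
  next
    case (insert x X)
    obtain \<sigma> i where x: "x = (\<sigma>, i)" "i < m \<sigma>" using insert.prems by auto
    let ?e = "\<lambda>\<tau> k. if (\<tau>, k) \<in> X then e' \<tau> k else e \<tau> k"
    have "Fact m \<theta> ?e" using insert by auto
    then have "Fact m \<theta> (\<lambda>\<tau> k. if \<tau> = \<sigma> \<and> k = i then e' \<sigma> i else ?e \<tau> k)"
      by (rule Fact_replace1) (use x s insert.hyps in auto)
    then show ?case by (rule Fact_cong) (auto simp: x)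
  qed
  from this[OF finite_ctx_vars subset_refl] Fact_wf[OF F]
  have "Fact m \<theta> (\<lambda>\<tau> k. if (\<tau>, k) \<in> {(\<sigma>, i). i < m \<sigma>} then e' \<tau> k else e \<tau> k)" by blast
  then show ?thesis by (rule Fact_cong) auto
qed

lemma sim_refl: "El \<sigma> t \<Longrightarrow> sim \<sigma> t t"
proof -
  assume t: "El \<sigma> t"
  have m: "sort_ctx \<sigma> 1 \<in> ctxs T" using El_sort[OF t] by (rule ctxs_sort)
  have "Fact (sort_ctx \<sigma> 1) Top (\<lambda>_ _. t)"
    using m t by (auto intro: Fact_Top simp: sort_ctx_def split: if_splits)
  then have "Fact (sort_ctx \<sigma> 1) (Eq \<sigma> 0 0) (\<lambda>_ _. t)"
    by (rule Fact_prv) (rule prv.EqI[OF m], simp add: sort_ctx_def)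
  then show ?thesis
    using Fact_Eq_iff[OF m, of "\<lambda>_ _. t" 0 \<sigma> 0] t by (auto simp: sort_ctx_def split: if_splits)
qed

text \<open>Replacement inside an equality; symmetry and transitivity are the special cases in which
  reflexivity supplies the missing premises.\<close>

lemma sim_replace:
  assumes "sim \<sigma> t u" "sim \<sigma> t t'" "sim \<sigma> u u'" shows "sim \<sigma> t' u'"
  using assms(1) unfolding sim_def
  by (rule Fact_replace) (use assms(2,3) in \<open>auto simp: sort_ctx_def split: if_splits\<close>)

lemma sim_sym: "sim \<sigma> t u \<Longrightarrow> sim \<sigma> u t"
  using sim_replace[of \<sigma> t t u t] sim_refl sim_El by blast

lemma sim_trans: "sim \<sigma> t u \<Longrightarrow> sim \<sigma> u v \<Longrightarrow> sim \<sigma> t v"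
  using sim_replace[of \<sigma> u u t v] sim_refl sim_El sim_sym by blast

definition cls :: "'s \<Rightarrow> ('s, 'r) tm \<Rightarrow> ('s, 'r) tm set" where
  "cls \<sigma> t = {u. sim \<sigma> t u}"

lemma cls_eq_iff: "El \<sigma> t \<Longrightarrow> El \<sigma> u \<Longrightarrow> cls \<sigma> t = cls \<sigma> u \<longleftrightarrow> sim \<sigma> t u"
  unfolding cls_def using sim_refl sim_sym sim_trans by blast

text \<open>A relation is read off the atom whose variables are the pairwise distinct
  \<open>list_vars\<close> of its arity; \<open>canonical_Atom\<close> extends this to arbitrary
  variables.\<close>

definition canonical :: "('s, 'r, ('s, 'r) tm set) str" where
  "canonical = \<lparr>crr = \<lambda>\<sigma>. cls \<sigma> ` {t. El \<sigma> t},
     itp = \<lambda>R us. \<exists>e. Fact (count_list (arity T R)) (Atom R (list_vars (arity T R))) e \<and>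
       us = map (\<lambda>(\<sigma>, i). cls \<sigma> (e \<sigma> i)) (list_vars (arity T R))\<rparr>"

text \<open>One direction pulls the fact back to the distinct variables. The other first exchanges
  representatives within their classes by \<open>Fact_replace\<close> and then pushes
  forward.\<close>

lemma canonical_Atom:
  assumes m: "m \<in> ctxs T" and e: "\<And>\<tau> i. i < m \<tau> \<Longrightarrow> El \<tau> (e \<tau> i)" and at: "fm_in T m (Atom R vs)"
  shows "itp canonical R (map (\<lambda>(\<sigma>, i). cls \<sigma> (e \<sigma> i)) vs) \<longleftrightarrow> Fact m (Atom R vs) e"
proof -
  let ?xs = "list_vars (arity T R)" and ?c = "count_list (arity T R)"
  have R: "R \<in> rels T" and vs: "map fst vs = arity T R" "\<And>\<sigma> i. (\<sigma>, i) \<in> set vs \<Longrightarrow> i < m \<sigma>"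
    using at by auto
  have c: "?c \<in> ctxs T" using reg R by (intro count_list_ctxs) (auto simp: regular_theory_def)
  have at': "fm_in T ?c (Atom R ?xs)" using R by (auto simp: map_fst_list_vars set_list_vars)
  obtain r where r: "map (\<lambda>(\<sigma>, i). (\<sigma>, r \<sigma> i)) ?xs = vs"
    using distinct_retarget[OF distinct_list_vars] vs(1) by (metis map_fst_list_vars)
  have rb: "r \<sigma> i < m \<sigma>" if "i < ?c \<sigma>" for \<sigma> i
  proof -
    have "(\<sigma>, r \<sigma> i) \<in> (\<lambda>(\<sigma>, i). (\<sigma>, r \<sigma> i)) ` set ?xs" using that set_list_vars by fastforce
    then show ?thesis using vs(2) r by (metis list.set_map)
  qed
  have eq: "Atom R vs = subst r (Atom R ?xs)" using r by simp
  have me: "map (\<lambda>(\<sigma>, i). cls \<sigma> (e \<sigma> i)) vs = map (\<lambda>(\<sigma>, i). cls \<sigma> (e \<sigma> (r \<sigma> i))) ?xs"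
    by (subst r[symmetric]) auto
  show ?thesis
  proof
    assume "Fact m (Atom R vs) e"
    then have "Fact ?c (Atom R ?xs) (\<lambda>\<sigma> i. e \<sigma> (r \<sigma> i))"
      unfolding eq by (rule Fact_pull) (use at' c rb in auto)
    then show "itp canonical R (map (\<lambda>(\<sigma>, i). cls \<sigma> (e \<sigma> i)) vs)"
      unfolding me canonical_def by auto
  next
    assume "itp canonical R (map (\<lambda>(\<sigma>, i). cls \<sigma> (e \<sigma> i)) vs)"
    then obtain e' where e': "Fact ?c (Atom R ?xs) e'"
      "map (\<lambda>(\<sigma>, i). cls \<sigma> (e \<sigma> (r \<sigma> i))) ?xs = map (\<lambda>(\<sigma>, i). cls \<sigma> (e' \<sigma> i)) ?xs"
      unfolding me canonical_def by auto
    have "sim \<sigma> (e' \<sigma> i) (e \<sigma> (r \<sigma> i))" if "i < ?c \<sigma>" for \<sigma> i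
    proof -
      have "cls \<sigma> (e \<sigma> (r \<sigma> i)) = cls \<sigma> (e' \<sigma> i)"
        using e'(2) that set_list_vars[of "arity T R"] by auto
      moreover have "El \<sigma> (e \<sigma> (r \<sigma> i))" "El \<sigma> (e' \<sigma> i)" using e rb that Fact_wf[OF e'(1)] by auto
      ultimately show ?thesis using cls_eq_iff sim_sym by blast
    qed
    with e'(1) have "Fact ?c (Atom R ?xs) (\<lambda>\<sigma> i. e \<sigma> (r \<sigma> i))" by (rule Fact_replace)
    then show "Fact m (Atom R vs) e" unfolding eq by (rule Fact_push[OF _ m rb e])
  qed
qed

text \<open>The truth lemma. Its existential case is what the witnesses were added for: each
  existential fact has one among the elements.\<close>

lemma canonical_truth:
  "m \<in> ctxs T \<Longrightarrow> (\<And>\<tau> i. i < m \<tau> \<Longrightarrow> El \<tau> (e \<tau> i)) \<Longrightarrow> fm_in T m \<theta> \<Longrightarrow>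
   sat canonical \<theta> (\<lambda>\<sigma> i. cls \<sigma> (e \<sigma> i)) \<longleftrightarrow> Fact m \<theta> e"
proof (induction \<theta> arbitrary: m e)
  case (Atom R vs)
  show ?case using canonical_Atom[OF Atom] by simp
next
  case (Eq \<sigma> i j)
  then show ?case using Fact_Eq_iff[OF Eq(1,2), where i = i and \<sigma> = \<sigma> and j = j] cls_eq_iff by auto
next
  case Top
  then show ?case by (auto intro: Fact_Top)
next
  case (Conj \<theta> \<chi>)
  have "Fact m \<theta> e \<and> Fact m \<chi> e \<longleftrightarrow> Fact m (Conj \<theta> \<chi>) e"
    using Conj.prems by (auto intro: Fact_Conj Fact_prv prv.ConjE1 prv.ConjE2)
  then show ?case using Conj by auto
next
  case (Ex \<sigma> \<theta>)
  let ?m = "m(\<sigma> := Suc (m \<sigma>))"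
  have \<sigma>: "\<sigma> \<in> sorts T" and \<theta>: "fm_in T ?m \<theta>" using Ex.prems by auto
  have m': "?m \<in> ctxs T" using Ex.prems(1) \<sigma> by (rule ctxs_Suc)
  have pc: "push \<sigma> (cls \<sigma> t) (\<lambda>\<sigma> i. cls \<sigma> (e \<sigma> i)) = (\<lambda>\<tau> i. cls \<tau> (push \<sigma> t e \<tau> i))" for t
    by (auto simp: fun_eq_iff push_def split: nat.splits)
  have IH: "sat canonical \<theta> (\<lambda>\<tau> i. cls \<tau> (push \<sigma> t e \<tau> i)) \<longleftrightarrow> Fact ?m \<theta> (push \<sigma> t e)"
    if "El \<sigma> t" for t
    by (rule Ex.IH[OF m' _ \<theta>]) (use that Ex.prems(2) in \<open>auto simp: push_def split: nat.splits if_splits\<close>)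
  have "sat canonical (Ex \<sigma> \<theta>) (\<lambda>\<sigma> i. cls \<sigma> (e \<sigma> i)) \<longleftrightarrow> (\<exists>t. El \<sigma> t \<and> Fact ?m \<theta> (push \<sigma> t e))"
    using IH by (auto simp: canonical_def pc)
  also have "\<dots> \<longleftrightarrow> Fact m (Ex \<sigma> \<theta>) e"
  proof
    assume "Fact m (Ex \<sigma> \<theta>) e"
    then show "\<exists>t. El \<sigma> t \<and> Fact ?m \<theta> (push \<sigma> t e)" using Fact_Wit El_Wit by blast
  next
    assume "\<exists>t. El \<sigma> t \<and> Fact ?m \<theta> (push \<sigma> t e)"
    then obtain t where t: "El \<sigma> t" "Fact ?m \<theta> (push \<sigma> t e)" by blast
    let ?r = "\<lambda>\<tau> i. if \<tau> = \<sigma> then Suc i else i"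
    \<comment> \<open>Applied to the identity sequent of the existential formula, \<open>ExR\<close>
      yields the introduction rule. It speaks of the weakened formula, and the pull-back drops the
      extra variable again.\<close>
    have "Fact ?m (subst ?r (Ex \<sigma> \<theta>)) (push \<sigma> t e)"
      using t(2) prv.ExR[OF prv.Refl[OF Ex.prems(1,3)]] unfolding weaken_def by (rule Fact_prv)
    then have "Fact m (Ex \<sigma> \<theta>) (\<lambda>\<tau> i. push \<sigma> t e \<tau> (?r \<tau> i))"
      by (rule Fact_pull[OF _ Ex.prems(3,1)]) auto
    then show "Fact m (Ex \<sigma> \<theta>) e" by (rule Fact_cong) (auto simp: push_def)
  qed
  finally show ?case .
qed

text \<open>Representatives can be chosen for all variables of a valuation at once, so validity in
  the quotient becomes closure of the facts under the sequent.\<close>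

lemma canonical_valid_iff:
  assumes "m \<in> ctxs T" "fm_in T m \<theta>" "fm_in T m \<chi>"
  shows "valid canonical m \<theta> \<chi> \<longleftrightarrow>
    (\<forall>e. (\<forall>\<tau> i. i < m \<tau> \<longrightarrow> El \<tau> (e \<tau> i)) \<longrightarrow> Fact m \<theta> e \<longrightarrow> Fact m \<chi> e)"
proof
  assume v: "valid canonical m \<theta> \<chi>"
  show "\<forall>e. (\<forall>\<tau> i. i < m \<tau> \<longrightarrow> El \<tau> (e \<tau> i)) \<longrightarrow> Fact m \<theta> e \<longrightarrow> Fact m \<chi> e"
  proof (intro allI impI)
    fix e assume e: "\<forall>\<tau> i. i < m \<tau> \<longrightarrow> El \<tau> (e \<tau> i)" and F: "Fact m \<theta> e"
    have "assigns canonical m (\<lambda>\<sigma> i. cls \<sigma> (e \<sigma> i))" using e by (auto simp: assigns_def canonical_def)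
    then show "Fact m \<chi> e"
      using v F canonical_truth[OF assms(1) _ assms(2), of e] canonical_truth[OF assms(1) _ assms(3), of e] e
      unfolding valid_def by blast
  qed
next
  assume *: "\<forall>e. (\<forall>\<tau> i. i < m \<tau> \<longrightarrow> El \<tau> (e \<tau> i)) \<longrightarrow> Fact m \<theta> e \<longrightarrow> Fact m \<chi> e"
  show "valid canonical m \<theta> \<chi>" unfolding valid_def
  proof (intro allI impI)
    fix u assume u: "assigns canonical m u" and s: "sat canonical \<theta> u"
    have "\<forall>\<tau> i. \<exists>t. i < m \<tau> \<longrightarrow> El \<tau> t \<and> u \<tau> i = cls \<tau> t"
      using u unfolding assigns_def canonical_def by fastforce
    then obtain e where e: "\<And>\<tau> i. i < m \<tau> \<Longrightarrow> El \<tau> (e \<tau> i) \<and> u \<tau> i = cls \<tau> (e \<tau> i)" by metis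
    have "sat canonical \<theta> (\<lambda>\<sigma> i. cls \<sigma> (e \<sigma> i))"
      using s sat_cong[OF assms(2), of u "\<lambda>\<sigma> i. cls \<sigma> (e \<sigma> i)"] e by auto
    then have "Fact m \<chi> e" using * e canonical_truth[OF assms(1) _ assms(2), of e] by blast
    then have "sat canonical \<chi> (\<lambda>\<sigma> i. cls \<sigma> (e \<sigma> i))"
      using e canonical_truth[OF assms(1) _ assms(3), of e] by blast
    then show "sat canonical \<chi> u"
      using sat_cong[OF assms(3), of u "\<lambda>\<sigma> i. cls \<sigma> (e \<sigma> i)"] e by auto
  qed
qed

lemma model_canonical: "model T canonical"
  unfolding model_def
proof (intro ballI, clarify)
  fix n \<phi> \<psi> assume ax: "(n, \<phi>, \<psi>) \<in> axs T"
  then have "n \<in> ctxs T" "fm_in T n \<phi>" "fm_in T n \<psi>"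
    using reg unfolding regular_theory_def by auto
  from canonical_valid_iff[OF this] show "valid canonical n \<phi> \<psi>"
    using Fact_prv[OF _ prv.Ax[OF ax]] by blast
qed

end

text \<open>The Henkin model depends on \<open>n\<close> and \<open>\<phi>\<close>, but its carrier
  type does not; therefore quantifying over structures on this single type is enough for
  completeness.\<close>

theorem prv_iff_valid:
  fixes T :: "('s, 'r) thy"
  assumes "regular_theory T"
  shows "prv T n \<phi> \<psi> \<longleftrightarrow> n \<in> ctxs T \<and> fm_in T n \<phi> \<and> fm_in T n \<psi> \<and>
    (\<forall>M :: ('s, 'r, ('s, 'r) tm set) str. model T M \<longrightarrow> valid M n \<phi> \<psi>)"
    (is "_ \<longleftrightarrow> ?R")
proof
  assume "prv T n \<phi> \<psi>"
  then show ?R using prv_wf[OF assms] soundness[OF assms] by blast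
next
  assume R: ?R
  then interpret henkin T n \<phi> using assms by unfold_locales auto
  have "valid canonical n \<phi> \<psi>" using R model_canonical by blast
  then have "Fact n \<psi> Gen" using canonical_valid_iff[of n \<phi> \<psi>] R Fact_Gen El_Gen by blast
  then show "prv T n \<phi> \<psi>" by (rule Fact_Gen_prv)
qed

section \<open>Cospans as relations\<close>

text \<open>The order of cospans is inclusion of these relations for all \<open>D\<close>, the identity valuation of
  the apex being the generic one.\<close>

fun crel :: "nat \<Rightarrow> nat \<Rightarrow> cospan \<Rightarrow> 'u set \<Rightarrow> (nat \<Rightarrow> 'u) \<Rightarrow> (nat \<Rightarrow> 'u) \<Rightarrow> bool" where
  "crel m n (k, f, g) D x y \<longleftrightarrow>
     (\<exists>z. (\<forall>i<k. z i \<in> D) \<and> (\<forall>i<m. x i = z (f i)) \<and> (\<forall>j<n. y j = z (g j)))"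

definition wrel ::
  "nat \<Rightarrow> nat \<Rightarrow> cospan set \<Rightarrow> 'u set \<Rightarrow> (nat \<Rightarrow> 'u) \<Rightarrow> (nat \<Rightarrow> 'u) \<Rightarrow> bool" where
  "wrel m n M D x y \<longleftrightarrow> (\<exists>c\<in>M. crel m n c D x y)"

lemma hom_Wcat: "hom Wcat m n = cospan_class m n ` cospans m n"
  by (simp add: Wcat_def)

lemma cospan_le_crel:
  assumes "cospan_le m n c d" "crel m n c D x y" shows "crel m n d D x y"
proof -
  obtain k f g k' f' g' where cd: "c = (k, f, g)" "d = (k', f', g')" by (metis prod_cases3)
  obtain h where h: "h \<in> {..<k'} \<rightarrow> {..<k}" "\<And>i. i < m \<Longrightarrow> h (f' i) = f i" "\<And>j. j < n \<Longrightarrow> h (g' j) = g j"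
    using assms(1) unfolding cd by auto
  obtain z where "\<forall>i<k. z i \<in> D" "\<forall>i<m. x i = z (f i)" "\<forall>j<n. y j = z (g j)"
    using assms(2) unfolding cd by auto
  with h show ?thesis unfolding cd by (auto intro!: exI[of _ "\<lambda>i. z (h i)"])
qed

text \<open>The generic value set is the apex \<open>{..<k}\<close> itself, so sets of naturals are
  enough for the test.\<close>

lemma crel_cospan_le:
  assumes "\<And>(D :: nat set) x y. crel m n c D x y \<Longrightarrow> crel m n d D x y"
  shows "cospan_le m n c d"
proof -
  obtain k f g k' f' g' where cd: "c = (k, f, g)" "d = (k', f', g')" by (metis prod_cases3)
  have "crel m n c {..<k} f g" unfolding cd by (auto intro!: exI[of _ "\<lambda>i. i"])
  then have "crel m n d {..<k} f g" by (rule assms)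
  then show ?thesis unfolding cd by (auto simp: Pi_def)
qed

lemma cospan_class_refl: "c \<in> cospans m n \<Longrightarrow> c \<in> cospan_class m n c"
  by (auto simp: cospan_class_def intro!: crel_cospan_le)

lemma cospan_class_cong:
  assumes "\<And>(D :: nat set) x y. crel m n c D x y \<longleftrightarrow> crel m n d D x y"
  shows "cospan_class m n c = cospan_class m n d"
proof -
  have "cospan_le m n c e \<longleftrightarrow> cospan_le m n d e" "cospan_le m n e c \<longleftrightarrow> cospan_le m n e d" for e
    using crel_cospan_le cospan_le_crel assms by metis+
  then show ?thesis by (simp add: cospan_class_def)
qed

lemma wrel_class:
  "c \<in> cospans m n \<Longrightarrow> wrel m n (cospan_class m n c) D x y \<longleftrightarrow> crel m n c D x y"
proof -
  assume c: "c \<in> cospans m n"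
  have "crel m n c D x y" if "d \<in> cospan_class m n c" "crel m n d D x y" for d
    using that(1) by (intro cospan_le_crel[OF _ that(2)]) (simp add: cospan_class_def)
  then show ?thesis unfolding wrel_def using cospan_class_refl[OF c] by blast
qed

lemma in_W_hom:
  assumes "M \<in> hom Wcat m n" "c \<in> M"
  shows "c \<in> cospans m n" "cospan_class m n c = M" "wrel m n M D x y \<longleftrightarrow> crel m n c D x y"
proof -
  obtain d where d: "d \<in> cospans m n" "M = cospan_class m n d" using assms(1) by (auto simp: hom_Wcat)
  show c: "c \<in> cospans m n" using assms d by (auto simp: cospan_class_def)
  have "cospan_le m n c d" "cospan_le m n d c" using assms d by (auto simp: cospan_class_def)
  then show e: "cospan_class m n c = M"
    unfolding d(2) by (intro cospan_class_cong) (metis cospan_le_crel)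
  show "wrel m n M D x y \<longleftrightarrow> crel m n c D x y" unfolding e[symmetric] by (rule wrel_class[OF c])
qed

lemma W_hom_nonempty: "M \<in> hom Wcat m n \<Longrightarrow> \<exists>c. c \<in> M"
  using cospan_class_refl unfolding hom_Wcat by blast

lemma W_le_iff:
  assumes "M \<in> hom Wcat m n" "N \<in> hom Wcat m n"
  shows "le Wcat m n M N \<longleftrightarrow> (\<forall>(D :: nat set) x y. wrel m n M D x y \<longrightarrow> wrel m n N D x y)"
proof -
  obtain c d where cd: "c \<in> M" "d \<in> N" using assms W_hom_nonempty by blast
  have le: "le Wcat m n M N \<longleftrightarrow> (\<exists>c\<in>M. \<exists>d\<in>N. cospan_le m n c d)" by (simp add: Wcat_def)
  show ?thesis
    unfolding le using cd in_W_hom(3)[OF assms(1)] in_W_hom(3)[OF assms(2)]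
    by (metis crel_cospan_le cospan_le_crel)
qed

lemma wrel_mono:
  assumes "M \<in> hom Wcat m n" "N \<in> hom Wcat m n" "le Wcat m n M N" "wrel m n M D x y"
  shows "wrel m n N D x y"
proof -
  obtain c d where cd: "c \<in> M" "d \<in> N" "cospan_le m n c d"
    using assms(3) by (auto simp: Wcat_def)
  then show ?thesis using assms(4) in_W_hom(3)[OF assms(1) cd(1)] in_W_hom(3)[OF assms(2) cd(2)]
    cospan_le_crel by blast
qed

lemma W_eqI:
  assumes "M \<in> hom Wcat m n" "N \<in> hom Wcat m n"
    "\<And>(D :: nat set) x y. wrel m n M D x y \<longleftrightarrow> wrel m n N D x y"
  shows "M = N"
proof -
  obtain c d where cd: "c \<in> M" "d \<in> N" using assms W_hom_nonempty by blast
  have "cospan_class m n c = cospan_class m n d"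
    using assms(3) in_W_hom(3)[OF assms(1) cd(1)] in_W_hom(3)[OF assms(2) cd(2)]
    by (intro cospan_class_cong) blast
  then show ?thesis using in_W_hom(2)[OF assms(1) cd(1)] in_W_hom(2)[OF assms(2) cd(2)] by simp
qed

text \<open>\<open>W_comp\<close> and \<open>W_tensor\<close> are unions over all representatives.
  Such a union is a single class as soon as any two representatives define the same
  relation.\<close>

lemma W_hom_Union:
  assumes "S \<noteq> {}" "S \<subseteq> cospans m n"
    "\<And>c d (D :: nat set) x y. c \<in> S \<Longrightarrow> d \<in> S \<Longrightarrow> crel m n c D x y \<Longrightarrow> crel m n d D x y"
  shows "\<exists>c\<in>S. (\<Union>c\<in>S. cospan_class m n c) = cospan_class m n c \<and> (\<Union>c\<in>S. cospan_class m n c) \<in> hom Wcat m n"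
proof -
  obtain c where c: "c \<in> S" using assms(1) by blast
  have "cospan_class m n d = cospan_class m n c" if "d \<in> S" for d
  proof (rule cospan_class_cong)
    fix D :: "nat set" and x y
    show "crel m n d D x y \<longleftrightarrow> crel m n c D x y"
      using assms(3)[OF that c, of D x y] assms(3)[OF c that, of D x y] by (rule iffI)
  qed
  then have "(\<Union>c\<in>S. cospan_class m n c) = cospan_class m n c" using c by blast
  then show ?thesis using c assms(2) by (auto simp: hom_Wcat)
qed

lemma crel_cong:
  "(\<And>i. i < m \<Longrightarrow> x i = x' i) \<Longrightarrow> (\<And>j. j < n \<Longrightarrow> y j = y' j) \<Longrightarrow>
   crel m n c D x y \<longleftrightarrow> crel m n c D x' y'"
  by (cases c) auto

lemma wrel_cong:
  "(\<And>i. i < m \<Longrightarrow> x i = x' i) \<Longrightarrow> (\<And>j. j < n \<Longrightarrow> y j = y' j) \<Longrightarrow>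
   wrel m n M D x y \<longleftrightarrow> wrel m n M D x' y'"
  unfolding wrel_def using crel_cong by blast

lemma wrel_dom:
  assumes "M \<in> hom Wcat m n" "wrel m n M D x y"
  shows "i < m \<Longrightarrow> x i \<in> D" "j < n \<Longrightarrow> y j \<in> D"
proof -
  obtain k f g where c: "(k, f, g) \<in> M" using W_hom_nonempty[OF assms(1)] by auto
  note r = in_W_hom[OF assms(1) c]
  have "f \<in> {..<m} \<rightarrow>\<^sub>E {..<k}" "g \<in> {..<n} \<rightarrow>\<^sub>E {..<k}" using r(1) by (auto simp: cospans_def)
  moreover have "crel m n (k, f, g) D x y" using assms(2) r(3) by blast
  then obtain z where "\<forall>i<k. z i \<in> D" "\<forall>i<m. x i = z (f i)" "\<forall>j<n. y j = z (g j)" by auto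
  ultimately show "i < m \<Longrightarrow> x i \<in> D" "j < n \<Longrightarrow> y j \<in> D" by (auto simp: PiE_iff)
qed

subsection \<open>Pushouts of finite sets\<close>

lemma is_pushoutD:
  fixes r :: nat
  assumes "is_pushout n k l g f q i j" "u \<in> {..<k} \<rightarrow>\<^sub>E {..<r}" "v \<in> {..<l} \<rightarrow>\<^sub>E {..<r}"
    "\<forall>x<n. u (g x) = v (f x)"
  shows "\<exists>!h. h \<in> {..<q} \<rightarrow>\<^sub>E {..<r} \<and> (\<forall>x<k. h (i x) = u x) \<and> (\<forall>y<l. h (j y) = v y)"
proof -
  have "\<forall>r :: nat. \<forall>u\<in>{..<k} \<rightarrow>\<^sub>E {..<r}. \<forall>v\<in>{..<l} \<rightarrow>\<^sub>E {..<r}. (\<forall>x<n. u (g x) = v (f x)) \<longrightarrow>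
        (\<exists>!h. h \<in> {..<q} \<rightarrow>\<^sub>E {..<r} \<and> (\<forall>x<k. h (i x) = u x) \<and> (\<forall>y<l. h (j y) = v y))"
    using assms(1) unfolding is_pushout_def by (elim conjE)
  then have "(\<forall>x<n. u (g x) = v (f x)) \<longrightarrow>
        (\<exists>!h. h \<in> {..<q} \<rightarrow>\<^sub>E {..<r} \<and> (\<forall>x<k. h (i x) = u x) \<and> (\<forall>y<l. h (j y) = v y))"
    using assms(2,3) by (elim allE[of _ r] ballE[of _ _ u] ballE[of _ _ v]) simp_all
  then show ?thesis using assms(4) by (rule mp)
qed

text \<open>\<open>is_pushout\<close> tests only against the finite targets \<open>{..<r}\<close>.
  The valuations \<open>u\<close> and \<open>v\<close> take finitely many values; numbering these,
  applying the universal property and decoding transfers it to an arbitrary value set.\<close>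

lemma is_pushout_extend:
  fixes u v :: "nat \<Rightarrow> 'u"
  assumes po: "is_pushout n k l g f q i j"
    and g: "\<And>x. x < n \<Longrightarrow> g x < k" and f: "\<And>x. x < n \<Longrightarrow> f x < l"
    and u: "\<And>x. x < k \<Longrightarrow> u x \<in> D" and v: "\<And>x. x < l \<Longrightarrow> v x \<in> D"
    and uv: "\<And>x. x < n \<Longrightarrow> u (g x) = v (f x)"
  shows "\<exists>h. (\<forall>x<q. h x \<in> D) \<and> (\<forall>x<k. h (i x) = u x) \<and> (\<forall>y<l. h (j y) = v y)"
proof -
  define A where "A = u ` {..<k} \<union> v ` {..<l}"
  have "finite A" by (simp add: A_def)
  then obtain b where b: "bij_betw b A {0..<card A}" using ex_bij_betw_finite_nat by blast
  let ?u = "\<lambda>x\<in>{..<k}. b (u x)" and ?v = "\<lambda>x\<in>{..<l}. b (v x)"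
  have bA: "b (u x) < card A" if "x < k" for x using bij_betwE[OF b] that by (auto simp: A_def)
  have bA': "b (v x) < card A" if "x < l" for x using bij_betwE[OF b] that by (auto simp: A_def)
  have "?u \<in> {..<k} \<rightarrow>\<^sub>E {..<card A}" "?v \<in> {..<l} \<rightarrow>\<^sub>E {..<card A}" using bA bA' by auto
  moreover have "\<forall>x<n. ?u (g x) = ?v (f x)" using g f uv by simp
  ultimately have "\<exists>!h. h \<in> {..<q} \<rightarrow>\<^sub>E {..<card A} \<and> (\<forall>x<k. h (i x) = ?u x) \<and> (\<forall>y<l. h (j y) = ?v y)"
    by (rule is_pushoutD[OF po])
  then obtain h where h: "h \<in> {..<q} \<rightarrow>\<^sub>E {..<card A}" "\<forall>x<k. h (i x) = ?u x" "\<forall>y<l. h (j y) = ?v y"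
    by blast
  let ?h = "\<lambda>x. inv_into A b (h x)"
  have inv: "inv_into A b (b a) = a" if "a \<in> A" for a using b that by (auto simp: bij_betw_def)
  have hA: "?h x \<in> A" if "x < q" for x
  proof -
    have "h x \<in> b ` A" using h(1) that b by (auto simp: bij_betw_def)
    then show ?thesis by (rule inv_into_into)
  qed
  have "A \<subseteq> D" using u v by (auto simp: A_def)
  with hA have hD: "?h x \<in> D" if "x < q" for x using that by blast
  have hu: "?h (i x) = u x" if "x < k" for x using h(2) that inv by (simp add: A_def)
  have hv: "?h (j y) = v y" if "y < l" for y using h(3) that inv by (simp add: A_def)
  show ?thesis by (rule exI[of _ ?h]) (simp add: hD hu hv)
qed

text \<open>The quotient of the disjoint union \<open>{..<k + l}\<close> in which two elements are
  identified when every compatible pair of functions agrees on them. This impredicative relation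
  avoids generating an equivalence; least representatives, numbered consecutively, turn the quotient
  into an initial segment.\<close>

lemma pushout_exists: "\<exists>q i j. is_pushout n k l g f q i j"
  if g: "\<And>x. x < n \<Longrightarrow> g x < k" and f: "\<And>x. x < n \<Longrightarrow> f x < l"
proof -
  define val :: "(nat \<Rightarrow> nat) \<Rightarrow> (nat \<Rightarrow> nat) \<Rightarrow> nat \<Rightarrow> nat" where
    "val = (\<lambda>u v t. if t < k then u t else v (t - k))"
  define compat :: "(nat \<Rightarrow> nat) \<Rightarrow> (nat \<Rightarrow> nat) \<Rightarrow> bool" where
    "compat = (\<lambda>u v. \<forall>x<n. u (g x) = v (f x))"
  define rel where "rel = (\<lambda>s t. \<forall>u v. compat u v \<longrightarrow> val u v s = val u v t)"
  define rep where "rep = (\<lambda>t. LEAST s. rel s t)"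
  have rep: "rel (rep t) t" for t unfolding rep_def by (rule LeastI[of _ t]) (simp add: rel_def)
  have rep_eq: "rep s = rep t" if "rel s t" for s t
  proof -
    have "rel a s \<longleftrightarrow> rel a t" for a using that by (auto simp: rel_def)
    then show ?thesis by (simp add: rep_def)
  qed
  have val_rep: "val u v (rep t) = val u v t" if "compat u v" for u v t
    using rep[of t] that unfolding rel_def by blast
  define Y where "Y = rep ` {..<k + l}"
  define q where "q = card Y"
  have "finite Y" by (simp add: Y_def)
  then obtain b where b: "bij_betw b Y {0..<q}" unfolding q_def using ex_bij_betw_finite_nat by blast
  have inv: "inv_into Y b (b y) = y" if "y \<in> Y" for y using b that by (auto simp: bij_betw_def)
  have bY: "b (rep t) < q" if "t < k + l" for t using bij_betwE[OF b] that by (auto simp: Y_def)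
  let ?i = "\<lambda>x\<in>{..<k}. b (rep x)" and ?j = "\<lambda>y\<in>{..<l}. b (rep (k + y))"
  \<comment> \<open>Joint surjectivity of the two legs: it bounds the values of the mediating map
    and makes that map unique.\<close>
  have sur: "(\<exists>x<k. c = ?i x) \<or> (\<exists>y<l. c = ?j y)" if c: "c < q" for c
  proof -
    have "c \<in> b ` Y" using c b by (simp add: bij_betw_def)
    then obtain t where t: "t < k + l" "c = b (rep t)" unfolding Y_def by blast
    show ?thesis
    proof (cases "t < k")
      case False
      then have "t - k < l" "c = ?j (t - k)" using t by auto
      then show ?thesis by blast
    qed (use t in auto)
  qed
  have "is_pushout n k l g f q ?i ?j" unfolding is_pushout_def
  proof (intro conjI allI ballI impI)
    show "?i \<in> {..<k} \<rightarrow>\<^sub>E {..<q}" "?j \<in> {..<l} \<rightarrow>\<^sub>E {..<q}" using bY by auto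
  next
    fix x assume x: "x < n"
    have "rel (g x) (k + f x)" using x g by (auto simp: rel_def compat_def val_def)
    then show "?i (g x) = ?j (f x)" using x g f rep_eq by simp
  next
    fix r u v assume uv: "u \<in> {..<k} \<rightarrow>\<^sub>E {..<r :: nat}" "v \<in> {..<l} \<rightarrow>\<^sub>E {..<r}" "\<forall>x<n. u (g x) = v (f x)"
    have c: "compat u v" using uv(3) by (simp add: compat_def)
    let ?h = "\<lambda>c\<in>{..<q}. val u v (inv_into Y b c)"
    have hi: "?h (?i x) = u x" if "x < k" for x
    proof -
      have "rep x \<in> Y" "val u v x = u x" using that by (auto simp: Y_def val_def)
      then show ?thesis using that bY[of x] inv[of "rep x"] val_rep[OF c, of x] by simp
    qed
    have hj: "?h (?j y) = v y" if "y < l" for y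
    proof -
      have "rep (k + y) \<in> Y" "val u v (k + y) = v y" using that by (auto simp: Y_def val_def)
      then show ?thesis
        using that bY[of "k + y"] inv[of "rep (k + y)"] val_rep[OF c, of "k + y"] by simp
    qed
    have "?h c < r" if "c < q" for c
      using sur[OF that] hi hj uv(1,2) by (auto simp del: restrict_apply)
    then have hq: "?h \<in> {..<q} \<rightarrow>\<^sub>E {..<r}" by auto
    show "\<exists>!h. h \<in> {..<q} \<rightarrow>\<^sub>E {..<r} \<and> (\<forall>x<k. h (?i x) = u x) \<and> (\<forall>y<l. h (?j y) = v y)"
    proof (rule ex1I[of _ ?h])
      show "?h \<in> {..<q} \<rightarrow>\<^sub>E {..<r} \<and> (\<forall>x<k. ?h (?i x) = u x) \<and> (\<forall>y<l. ?h (?j y) = v y)"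
        using hq hi hj by blast
    next
      fix h assume h: "h \<in> {..<q} \<rightarrow>\<^sub>E {..<r} \<and> (\<forall>x<k. h (?i x) = u x) \<and> (\<forall>y<l. h (?j y) = v y)"
      show "h = ?h"
      proof (rule PiE_ext[of _ "{..<q}" "\<lambda>_. {..<r}"])
        fix c assume "c \<in> {..<q}"
        then have "(\<exists>x<k. c = ?i x) \<or> (\<exists>y<l. c = ?j y)" using sur by simp
        then show "h c = ?h c" using h hi hj by metis
      qed (use h hq in auto)
    qed
  qed
  then show ?thesis by blast
qed

subsection \<open>The structure of the po-prop\<close>

text \<open>From left to right the middle tuple is read off the pushout. From right to left the two
  valuations agree along the shared boundary, so \<open>is_pushout_extend\<close> glues
  them.\<close>

lemma crel_pushout:
  assumes c: "(k, f, g) \<in> cospans m n" and d: "(l, f', g') \<in> cospans n p"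
    and po: "is_pushout n k l g f' q i j"
  shows "(q, \<lambda>x\<in>{..<m}. i (f x), \<lambda>y\<in>{..<p}. j (g' y)) \<in> cospans m p"
    "crel m p (q, \<lambda>x\<in>{..<m}. i (f x), \<lambda>y\<in>{..<p}. j (g' y)) D x z \<longleftrightarrow>
     (\<exists>y. crel m n (k, f, g) D x y \<and> crel n p (l, f', g') D y z)"
proof -
  have fg: "\<And>x. x < m \<Longrightarrow> f x < k" "\<And>x. x < n \<Longrightarrow> g x < k" "\<And>x. x < n \<Longrightarrow> f' x < l" "\<And>x. x < p \<Longrightarrow> g' x < l"
    using c d by (auto simp: cospans_def)
  have ij: "\<And>x. x < k \<Longrightarrow> i x < q" "\<And>x. x < l \<Longrightarrow> j x < q" "\<And>x. x < n \<Longrightarrow> i (g x) = j (f' x)"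
    using po by (auto simp: is_pushout_def)
  show "(q, \<lambda>x\<in>{..<m}. i (f x), \<lambda>y\<in>{..<p}. j (g' y)) \<in> cospans m p"
    using fg ij by (auto simp: cospans_def)
  show "crel m p (q, \<lambda>x\<in>{..<m}. i (f x), \<lambda>y\<in>{..<p}. j (g' y)) D x z \<longleftrightarrow>
     (\<exists>y. crel m n (k, f, g) D x y \<and> crel n p (l, f', g') D y z)"
  proof
    assume "crel m p (q, \<lambda>x\<in>{..<m}. i (f x), \<lambda>y\<in>{..<p}. j (g' y)) D x z"
    then obtain w where w: "\<forall>t<q. w t \<in> D" "\<forall>t<m. x t = w (i (f t))" "\<forall>t<p. z t = w (j (g' t))" by auto
    have "crel m n (k, f, g) D x (\<lambda>t. w (i (g t)))"
      using w ij by (auto intro!: exI[of _ "\<lambda>t. w (i t)"])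
    moreover have "crel n p (l, f', g') D (\<lambda>t. w (i (g t))) z"
      using w ij by (auto intro!: exI[of _ "\<lambda>t. w (j t)"])
    ultimately show "\<exists>y. crel m n (k, f, g) D x y \<and> crel n p (l, f', g') D y z" by blast
  next
    assume "\<exists>y. crel m n (k, f, g) D x y \<and> crel n p (l, f', g') D y z"
    then obtain y u v where uv: "\<forall>t<k. u t \<in> D" "\<forall>t<m. x t = u (f t)" "\<forall>t<n. y t = u (g t)"
      "\<forall>t<l. v t \<in> D" "\<forall>t<n. y t = v (f' t)" "\<forall>t<p. z t = v (g' t)" by auto
    have "\<exists>h. (\<forall>t<q. h t \<in> D) \<and> (\<forall>t<k. h (i t) = u t) \<and> (\<forall>t<l. h (j t) = v t)"
      by (rule is_pushout_extend[OF po]) (use fg uv in auto)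
    then obtain h where "\<forall>t<q. h t \<in> D" "\<forall>t<k. h (i t) = u t" "\<forall>t<l. h (j t) = v t" by blast
    then show "crel m p (q, \<lambda>x\<in>{..<m}. i (f x), \<lambda>y\<in>{..<p}. j (g' y)) D x z"
      using fg uv by (auto intro!: exI[of _ h])
  qed
qed

definition glue ::
  "nat \<Rightarrow> nat \<Rightarrow> (nat \<Rightarrow> nat) \<Rightarrow> (nat \<Rightarrow> nat) \<Rightarrow> nat \<Rightarrow> (nat \<Rightarrow> nat) \<Rightarrow> (nat \<Rightarrow> nat) \<Rightarrow> cospan" where
  "glue m p f g' q i j = (q, \<lambda>x\<in>{..<m}. i (f x), \<lambda>y\<in>{..<p}. j (g' y))"

lemma
  assumes M: "M \<in> hom Wcat m n" and N: "N \<in> hom Wcat n p"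
  shows W_comp_hom: "W_comp m n p M N \<in> hom Wcat m p"
    and wrel_W_comp: "wrel m p (W_comp m n p M N) D x z \<longleftrightarrow> (\<exists>y. wrel m n M D x y \<and> wrel n p N D y z)"
proof -
  define S where "S = {glue m p f g' q i j | k f g l f' g' q i j.
    (k, f, g) \<in> M \<and> (l, f', g') \<in> N \<and> is_pushout n k l g f' q i j}"
  have S: "W_comp m n p M N = (\<Union>c\<in>S. cospan_class m p c)"
    unfolding W_comp_def S_def glue_def by fast
  have props: "c \<in> cospans m p \<and>
      (crel m p c D x z \<longleftrightarrow> (\<exists>y. wrel m n M D x y \<and> wrel n p N D y z))" if cS: "c \<in> S" for c and D :: "'u set" and x z
  proof -
    obtain k f g l f' g' q i j where c: "c = glue m p f g' q i j"
      "(k, f, g) \<in> M" "(l, f', g') \<in> N" "is_pushout n k l g f' q i j"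
      using cS unfolding S_def by (elim CollectE exE conjE) (rule that)
    show ?thesis unfolding c(1) glue_def
      using crel_pushout[OF in_W_hom(1)[OF M c(2)] in_W_hom(1)[OF N c(3)] c(4)]
        in_W_hom(3)[OF M c(2)] in_W_hom(3)[OF N c(3)] by blast
  qed
  have ne: "S \<noteq> {}"
  proof -
    obtain k f g l f' g' where c: "(k, f, g) \<in> M" "(l, f', g') \<in> N"
      using W_hom_nonempty[OF M] W_hom_nonempty[OF N] by auto
    have "\<exists>q i j. is_pushout n k l g f' q i j"
      by (rule pushout_exists)
        (use in_W_hom(1)[OF M c(1)] in_W_hom(1)[OF N c(2)] in \<open>auto simp: cospans_def\<close>)
    then obtain q i j where "is_pushout n k l g f' q i j" by blast
    with c have "glue m p f g' q i j \<in> S" unfolding S_def by blast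
    then show ?thesis by blast
  qed
  \<comment> \<open>The same as \<open>props\<close> at values in \<open>nat\<close>: a local fact
    is not polymorphic, and \<open>W_hom_Union\<close> tests over sets of naturals.\<close>
  have props': "c \<in> cospans m p \<and>
      (crel m p c D x z \<longleftrightarrow> (\<exists>y. wrel m n M D x y \<and> wrel n p N D y z))" if cS: "c \<in> S" for c and D :: "nat set" and x z
  proof -
    obtain k f g l f' g' q i j where c: "c = glue m p f g' q i j"
      "(k, f, g) \<in> M" "(l, f', g') \<in> N" "is_pushout n k l g f' q i j"
      using cS unfolding S_def by (elim CollectE exE conjE) (rule that)
    show ?thesis unfolding c(1) glue_def
      using crel_pushout[OF in_W_hom(1)[OF M c(2)] in_W_hom(1)[OF N c(3)] c(4)]
        in_W_hom(3)[OF M c(2)] in_W_hom(3)[OF N c(3)] by blast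
  qed
  obtain c where c: "c \<in> S" "W_comp m n p M N = cospan_class m p c" "W_comp m n p M N \<in> hom Wcat m p"
    using W_hom_Union[of S m p] ne props' unfolding S by blast
  show "W_comp m n p M N \<in> hom Wcat m p" by (rule c(3))
  show "wrel m p (W_comp m n p M N) D x z \<longleftrightarrow> (\<exists>y. wrel m n M D x y \<and> wrel n p N D y z)"
    unfolding c(2) using props[OF c(1)] wrel_class by blast
qed

lemma crel_tensor:
  assumes c: "(k, f, g) \<in> cospans m n" and d: "(k', f', g') \<in> cospans m' n'"
  defines "t \<equiv> (k + k', \<lambda>i\<in>{..<m + m'}. if i < m then f i else k + f' (i - m),
                \<lambda>j\<in>{..<n + n'}. if j < n then g j else k + g' (j - n))"
  shows "t \<in> cospans (m + m') (n + n')"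
    "crel (m + m') (n + n') t D x y \<longleftrightarrow> crel m n (k, f, g) D x y \<and>
     crel m' n' (k', f', g') D (\<lambda>i. x (m + i)) (\<lambda>j. y (n + j))"
proof -
  have fg: "\<And>x. x < m \<Longrightarrow> f x < k" "\<And>x. x < n \<Longrightarrow> g x < k" "\<And>x. x < m' \<Longrightarrow> f' x < k'" "\<And>x. x < n' \<Longrightarrow> g' x < k'"
    using c d by (auto simp: cospans_def)
  show "t \<in> cospans (m + m') (n + n')"
    using fg by (fastforce simp: cospans_def t_def)
  show "crel (m + m') (n + n') t D x y \<longleftrightarrow> crel m n (k, f, g) D x y \<and>
     crel m' n' (k', f', g') D (\<lambda>i. x (m + i)) (\<lambda>j. y (n + j))" (is "?L \<longleftrightarrow> ?A \<and> ?B")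
  proof
    assume ?L
    then obtain z where z: "\<forall>i<k + k'. z i \<in> D"
      "\<forall>i<m + m'. x i = z (if i < m then f i else k + f' (i - m))"
      "\<forall>j<n + n'. y j = z (if j < n then g j else k + g' (j - n))"
      unfolding t_def by auto
    have ?A using z by (auto intro!: exI[of _ z])
    moreover have ?B using z by (auto intro!: exI[of _ "\<lambda>i. z (k + i)"])
    ultimately show "?A \<and> ?B" ..
  next
    assume "?A \<and> ?B"
    then obtain u v where uv: "\<forall>i<k. u i \<in> D" "\<forall>i<m. x i = u (f i)" "\<forall>j<n. y j = u (g j)"
      "\<forall>i<k'. v i \<in> D" "\<forall>i<m'. x (m + i) = v (f' i)" "\<forall>j<n'. y (n + j) = v (g' j)" by auto
    let ?z = "\<lambda>i. if i < k then u i else v (i - k)"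
    have "\<forall>i<k + k'. ?z i \<in> D" using uv by auto
    moreover have "x i = ?z (if i < m then f i else k + f' (i - m))" if "i < m + m'" for i
      using uv(2) uv(5)[rule_format, of "i - m"] that fg by auto
    moreover have "y i = ?z (if i < n then g i else k + g' (i - n))" if "i < n + n'" for i
      using uv(3) uv(6)[rule_format, of "i - n"] that fg by auto
    ultimately show ?L unfolding t_def crel.simps by (intro exI[of _ ?z]) auto
  qed
qed

lemma
  assumes M: "M \<in> hom Wcat m n" and N: "N \<in> hom Wcat m' n'"
  shows W_tensor_hom: "W_tensor m n m' n' M N \<in> hom Wcat (m + m') (n + n')"
    and wrel_W_tensor: "wrel (m + m') (n + n') (W_tensor m n m' n' M N) D x y \<longleftrightarrow>
      wrel m n M D x y \<and> wrel m' n' N D (\<lambda>i. x (m + i)) (\<lambda>j. y (n + j))"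
proof -
  define t :: "nat \<Rightarrow> (nat \<Rightarrow> nat) \<Rightarrow> (nat \<Rightarrow> nat) \<Rightarrow> nat \<Rightarrow> (nat \<Rightarrow> nat) \<Rightarrow> (nat \<Rightarrow> nat) \<Rightarrow> cospan" where
    "t k f g k' f' g' = (k + k', \<lambda>i\<in>{..<m + m'}. if i < m then f i else k + f' (i - m),
                \<lambda>j\<in>{..<n + n'}. if j < n then g j else k + g' (j - n))" for k f g k' f' g'
  define S where "S = {t k f g k' f' g' | k f g k' f' g'. (k, f, g) \<in> M \<and> (k', f', g') \<in> N}"
  have S: "W_tensor m n m' n' M N = (\<Union>c\<in>S. cospan_class (m + m') (n + n') c)"
    unfolding W_tensor_def S_def t_def by fast
  have props: "c \<in> cospans (m + m') (n + n') \<and> (crel (m + m') (n + n') c D x y \<longleftrightarrow>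
      wrel m n M D x y \<and> wrel m' n' N D (\<lambda>i. x (m + i)) (\<lambda>j. y (n + j)))"
    if cS: "c \<in> S" for c and D :: "'u set" and x y
  proof -
    obtain k f g k' f' g' where c: "c = t k f g k' f' g'" "(k, f, g) \<in> M" "(k', f', g') \<in> N"
      using cS unfolding S_def by (elim CollectE exE conjE) (rule that)
    show ?thesis unfolding c(1) t_def
      using crel_tensor[OF in_W_hom(1)[OF M c(2)] in_W_hom(1)[OF N c(3)]]
        in_W_hom(3)[OF M c(2)] in_W_hom(3)[OF N c(3)] by blast
  qed
  have props': "c \<in> cospans (m + m') (n + n') \<and> (crel (m + m') (n + n') c D x y \<longleftrightarrow>
      wrel m n M D x y \<and> wrel m' n' N D (\<lambda>i. x (m + i)) (\<lambda>j. y (n + j)))"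
    if cS: "c \<in> S" for c and D :: "nat set" and x y
  proof -
    obtain k f g k' f' g' where c: "c = t k f g k' f' g'" "(k, f, g) \<in> M" "(k', f', g') \<in> N"
      using cS unfolding S_def by (elim CollectE exE conjE) (rule that)
    show ?thesis unfolding c(1) t_def
      using crel_tensor[OF in_W_hom(1)[OF M c(2)] in_W_hom(1)[OF N c(3)]]
        in_W_hom(3)[OF M c(2)] in_W_hom(3)[OF N c(3)] by blast
  qed
  have ne: "S \<noteq> {}"
  proof -
    obtain k f g k' f' g' where "(k, f, g) \<in> M" "(k', f', g') \<in> N"
      using W_hom_nonempty[OF M] W_hom_nonempty[OF N] by auto
    then have "t k f g k' f' g' \<in> S" unfolding S_def by blast
    then show ?thesis by blast
  qed
  obtain c where c: "c \<in> S" "W_tensor m n m' n' M N = cospan_class (m + m') (n + n') c"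
    "W_tensor m n m' n' M N \<in> hom Wcat (m + m') (n + n')"
    using W_hom_Union[of S "m + m'" "n + n'"] ne props' unfolding S by blast
  show "W_tensor m n m' n' M N \<in> hom Wcat (m + m') (n + n')" by (rule c(3))
  show "wrel (m + m') (n + n') (W_tensor m n m' n' M N) D x y \<longleftrightarrow>
      wrel m n M D x y \<and> wrel m' n' N D (\<lambda>i. x (m + i)) (\<lambda>j. y (n + j))"
    unfolding c(2) using props[OF c(1)] wrel_class by blast
qed

text \<open>The embedding of functions of finite sets into cospans, with an identity as right leg.
  The relation is \<open>x = y o f\<close> on the indices below \<open>m\<close>, hence acts on
  formulae by substitution.\<close>

definition fn_cospan :: "nat \<Rightarrow> nat \<Rightarrow> (nat \<Rightarrow> nat) \<Rightarrow> cospan set" where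
  "fn_cospan m k f = cospan_class m k (k, \<lambda>i\<in>{..<m}. f i, \<lambda>j\<in>{..<k}. j)"

definition cofn_cospan :: "nat \<Rightarrow> nat \<Rightarrow> (nat \<Rightarrow> nat) \<Rightarrow> cospan set" where
  "cofn_cospan k n g = cospan_class k n (k, \<lambda>j\<in>{..<k}. j, \<lambda>i\<in>{..<n}. g i)"

lemma
  assumes "\<forall>i<m. f i < k"
  shows fn_cospan_hom: "fn_cospan m k f \<in> hom Wcat m k"
    and wrel_fn_cospan: "wrel m k (fn_cospan m k f) D x y \<longleftrightarrow> (\<forall>j<k. y j \<in> D) \<and> (\<forall>i<m. x i = y (f i))"
    and cofn_cospan_hom: "cofn_cospan k m f \<in> hom Wcat k m"
    and wrel_cofn_cospan: "wrel k m (cofn_cospan k m f) D y x \<longleftrightarrow> (\<forall>j<k. y j \<in> D) \<and> (\<forall>i<m. x i = y (f i))"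
proof -
  have c: "(k, \<lambda>i\<in>{..<m}. f i, \<lambda>j\<in>{..<k}. j) \<in> cospans m k" "(k, \<lambda>j\<in>{..<k}. j, \<lambda>i\<in>{..<m}. f i) \<in> cospans k m"
    using assms by (auto simp: cospans_def)
  then show "fn_cospan m k f \<in> hom Wcat m k" "cofn_cospan k m f \<in> hom Wcat k m"
    by (auto simp: hom_Wcat fn_cospan_def cofn_cospan_def)
  show "wrel m k (fn_cospan m k f) D x y \<longleftrightarrow> (\<forall>j<k. y j \<in> D) \<and> (\<forall>i<m. x i = y (f i))"
    unfolding fn_cospan_def wrel_class[OF c(1)] using assms by auto
  show "wrel k m (cofn_cospan k m f) D y x \<longleftrightarrow> (\<forall>j<k. y j \<in> D) \<and> (\<forall>i<m. x i = y (f i))"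
    unfolding cofn_cospan_def wrel_class[OF c(2)] using assms by auto
qed

lemma W_id_fn: "W_id n = fn_cospan n n (\<lambda>i. i)"
  by (simp add: W_id_def fn_cospan_def)

lemma W_id_hom: "W_id n \<in> hom Wcat n n"
  unfolding W_id_fn by (rule fn_cospan_hom) simp

lemma wrel_W_id: "wrel n n (W_id n) D x y \<longleftrightarrow> (\<forall>i<n. y i \<in> D \<and> x i = y i)"
  unfolding W_id_fn by (subst wrel_fn_cospan) auto

text \<open>The definition of the symmetry has an identity as left leg, so it first appears as a
  reversed map; \<open>tensor_swap\<close> gives the forward reading.\<close>

lemma W_swap_cofn: "W_swap m n = cofn_cospan (m + n) (n + m) (\<lambda>j. if j < n then m + j else j - n)"
  by (simp add: W_swap_def cofn_cospan_def)

lemma W_swap_hom: "W_swap m n \<in> hom Wcat (m + n) (n + m)"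
  unfolding W_swap_cofn by (rule cofn_cospan_hom) auto

lemma wrel_W_swap: "wrel (m + n) (n + m) (W_swap m n) D x y \<longleftrightarrow>
  (\<forall>j<m + n. x j \<in> D) \<and> (\<forall>i<m. y (n + i) = x i) \<and> (\<forall>j<n. y j = x (m + j))"
proof -
  have "(\<forall>i<n + m. y i = x (if i < n then m + i else i - n)) \<longleftrightarrow>
      (\<forall>i<m. y (n + i) = x i) \<and> (\<forall>j<n. y j = x (m + j))" (is "?A \<longleftrightarrow> ?B")
  proof
    assume ?B
    show ?A
    proof (intro allI impI)
      fix i assume "i < n + m"
      then show "y i = x (if i < n then m + i else i - n)"
        using \<open>?B\<close>[THEN conjunct1, rule_format, of "i - n"] \<open>?B\<close>[THEN conjunct2] by auto
    qed
  qed auto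
  then show ?thesis unfolding W_swap_cofn by (subst wrel_cofn_cospan) auto
qed

lemma eps1_cofn: "eps1 = cofn_cospan 1 0 (\<lambda>_. 0)"
  unfolding eps1_def cofn_cospan_def
  by (rule arg_cong[where f = "cospan_class 1 0"]) (auto simp: fun_eq_iff)

lemma eps1: "eps1 \<in> hom Wcat 1 0" "wrel 1 0 eps1 D x y \<longleftrightarrow> x 0 \<in> D"
  unfolding eps1_cofn by (rule cofn_cospan_hom, simp) (subst wrel_cofn_cospan, auto)

lemma eta1_fn: "eta1 = fn_cospan 0 1 (\<lambda>_. 0)"
  unfolding eta1_def fn_cospan_def
  by (rule arg_cong[where f = "cospan_class 0 1"]) (auto simp: fun_eq_iff)

lemma eta1: "eta1 \<in> hom Wcat 0 1" "wrel 0 1 eta1 D x y \<longleftrightarrow> y 0 \<in> D"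
  unfolding eta1_fn by (rule fn_cospan_hom, simp) (subst wrel_fn_cospan, auto)

lemma del1_cofn: "del1 = cofn_cospan 1 2 (\<lambda>_. 0)"
  unfolding del1_def cofn_cospan_def
  by (rule arg_cong[where f = "cospan_class 1 2"]) (auto simp: fun_eq_iff)

lemma less_2_all: "(\<forall>i<2. P i) \<longleftrightarrow> P 0 \<and> P (1 :: nat)"
  by (auto simp: numeral_2_eq_2 less_Suc_eq)

lemma del1: "del1 \<in> hom Wcat 1 2" "wrel 1 2 del1 D x y \<longleftrightarrow> x 0 \<in> D \<and> y 0 = x 0 \<and> y 1 = x 0"
  unfolding del1_cofn by (rule cofn_cospan_hom, simp) (subst wrel_cofn_cospan, auto simp: less_2_all)

lemma mu1_fn: "mu1 = fn_cospan 2 1 (\<lambda>_. 0)"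
  unfolding mu1_def fn_cospan_def
  by (rule arg_cong[where f = "cospan_class 2 1"]) (auto simp: fun_eq_iff)

lemma mu1: "mu1 \<in> hom Wcat 2 1" "wrel 2 1 mu1 D x y \<longleftrightarrow> y 0 \<in> D \<and> x 0 = y 0 \<and> x 1 = y 0"
  unfolding mu1_fn by (rule fn_cospan_hom, simp) (subst wrel_fn_cospan, auto simp: less_2_all)

lemma all_less_add: "(\<forall>i<m + n. P i) \<longleftrightarrow> (\<forall>i<m. P i) \<and> (\<forall>i<n. P (m + i :: nat))"
proof
  assume R: "(\<forall>i<m. P i) \<and> (\<forall>i<n. P (m + i))"
  show "\<forall>i<m + n. P i"
  proof (intro allI impI)
    fix i assume "i < m + n"
    then show "P i" using R R[THEN conjunct2, rule_format, of "i - m"] by (cases "i < m") auto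
  qed
qed auto

lemma W_eps: "W_eps n \<in> hom Wcat n 0 \<and> (wrel n 0 (W_eps n) D x y \<longleftrightarrow> (\<forall>i<n. x i \<in> D))"
proof (induction n)
  case 0
  then show ?case using W_id_hom[of 0] wrel_W_id[of 0 D x y] by simp
next
  case (Suc n)
  have h: "W_eps n \<in> hom Wcat n 0" and r: "wrel n 0 (W_eps n) D x y \<longleftrightarrow> (\<forall>i<n. x i \<in> D)"
    using Suc by auto
  show ?case
    using W_tensor_hom[OF h eps1(1)] wrel_W_tensor[OF h eps1(1), of D x y] r
    by (auto simp: eps1(2)[unfolded One_nat_def] less_Suc_eq)
qed

text \<open>Typing and relation are proved together, since \<open>wrel_W_comp\<close> and
  \<open>wrel_W_tensor\<close> presuppose the typing of the smaller case.\<close>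

lemma W_del: "W_del n \<in> hom Wcat n (n + n) \<and>
  (\<forall>D x y. wrel n (n + n) (W_del n) D x y \<longleftrightarrow> (\<forall>i<n. x i \<in> D \<and> y i = x i \<and> y (n + i) = x i))"
proof (induction n)
  case 0
  have "wrel 0 0 (W_id 0) D x y" for D and x y :: "nat \<Rightarrow> 'a" using wrel_W_id[of 0 D x y] by simp
  then show ?case using W_id_hom[of 0] by simp
next
  case (Suc n)
  let ?A = "W_tensor n (n + n) 1 2 (W_del n) del1"
  let ?C = "W_tensor (n + 1) (1 + n) 1 1 (W_swap n 1) (W_id 1)"
  let ?B = "W_tensor n n (n + 1 + 1) (1 + n + 1) (W_id n) ?C"
  have h: "W_del n \<in> hom Wcat n (n + n)" using Suc by auto
  have A: "?A \<in> hom Wcat (n + 1) (n + n + 2)" by (rule W_tensor_hom[OF h del1(1)])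
  have C: "?C \<in> hom Wcat (n + 1 + 1) (1 + n + 1)" by (rule W_tensor_hom[OF W_swap_hom W_id_hom])
  have B: "?B \<in> hom Wcat (n + n + 2) (Suc n + Suc n)"
    using W_tensor_hom[OF W_id_hom C, of n] by (simp add: algebra_simps numeral_2_eq_2)
  have rA: "wrel (n + 1) (n + n + 2) ?A D x y \<longleftrightarrow>
      (\<forall>i<n. x i \<in> D \<and> y i = x i \<and> y (n + i) = x i) \<and> x n \<in> D \<and> y (n + n) = x n \<and> y (n + n + 1) = x n"
    for D and x y :: "nat \<Rightarrow> 'a"
    using Suc by (subst wrel_W_tensor[OF h del1(1)]) (simp add: del1(2)[unfolded One_nat_def])
  have rC: "wrel (n + 1 + 1) (1 + n + 1) ?C D x y \<longleftrightarrow>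
      (\<forall>i<Suc n. x i \<in> D) \<and> (\<forall>i<n. y (Suc i) = x i) \<and> y 0 = x n \<and> y (Suc n) \<in> D \<and> x (Suc n) = y (Suc n)"
    for D and x y :: "nat \<Rightarrow> 'a"
    by (subst wrel_W_tensor[OF W_swap_hom W_id_hom])
      (auto simp: wrel_W_swap[of n 1, simplified] wrel_W_id[of 1, simplified])
  have rB: "wrel (n + (n + 1 + 1)) (n + (1 + n + 1)) ?B D x y \<longleftrightarrow>
      (\<forall>i<n. y i \<in> D \<and> x i = y i) \<and> wrel (n + 1 + 1) (1 + n + 1) ?C D (\<lambda>i. x (n + i)) (\<lambda>i. y (n + i))"
    for D and x y :: "nat \<Rightarrow> 'a"
    by (subst wrel_W_tensor[OF W_id_hom C]) (simp add: wrel_W_id)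
  have "wrel (Suc n) (Suc n + Suc n) (W_del (Suc n)) D x z \<longleftrightarrow>
      (\<forall>i<Suc n. x i \<in> D \<and> z i = x i \<and> z (Suc n + i) = x i)" (is "?L \<longleftrightarrow> ?R")
    for D and x z :: "nat \<Rightarrow> 'a"
  proof -
    have "?L \<longleftrightarrow> (\<exists>y. wrel (n + 1) (n + n + 2) ?A D x y \<and> wrel (n + n + 2) (Suc n + Suc n) ?B D y z)"
      using wrel_W_comp[OF A B] by simp
    also have "\<dots> \<longleftrightarrow> (\<exists>y. ((\<forall>i<n. x i \<in> D \<and> y i = x i \<and> y (n + i) = x i) \<and> x n \<in> D \<and>
        y (n + n) = x n \<and> y (n + n + 1) = x n) \<and> (\<forall>i<n. z i \<in> D \<and> y i = z i) \<and>
        (\<forall>i<Suc n. y (n + i) \<in> D) \<and> (\<forall>i<n. z (n + Suc i) = y (n + i)) \<and> z (n + 0) = y (n + n) \<and>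
        z (n + Suc n) \<in> D \<and> y (n + Suc n) = z (n + Suc n))" (is "_ \<longleftrightarrow> (\<exists>y. ?P y)")
      using rA rB[unfolded rC] by (simp add: algebra_simps numeral_2_eq_2)
    also have "\<dots> \<longleftrightarrow> ?R"
    proof
      assume "\<exists>y. ?P y"
      then show ?R by (auto simp: less_Suc_eq)
    next
      assume r: ?R
      have rr: "x i \<in> D \<and> z i = x i \<and> z (Suc n + i) = x i" if "i \<le> n" for i
        by (rule r[rule_format]) (use that in simp)
      have r1: "x i \<in> D" if "i \<le> n" for i using rr[OF that] by (elim conjE)
      have r2: "z i = x i" if "i \<le> n" for i using rr[OF that] by (elim conjE)
      have r3: "z (Suc (n + i)) = x i" if "i \<le> n" for i using rr[OF that] by simp
      \<comment> \<open>The tuple before interleaving: two copies of the first \<open>n\<close>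
        entries, followed by two copies of the last entry.\<close>
      have "?P (\<lambda>i. if i < n then x i else if i < n + n then x (i - n) else x n)"
        using r3[of n] by (simp add: r1 r2 r3)
      then show "\<exists>y. ?P y" by (rule exI[where P = ?P])
    qed
    finally show ?thesis .
  qed
  moreover have "W_del (Suc n) \<in> hom Wcat (Suc n) (Suc n + Suc n)"
    using W_comp_hom[OF A B] by simp
  ultimately show ?case by blast
qed

lemma W_mu: "W_mu n \<in> hom Wcat (n + n) n \<and>
  (\<forall>D x y. wrel (n + n) n (W_mu n) D x y \<longleftrightarrow> (\<forall>i<n. y i \<in> D \<and> x i = y i \<and> x (n + i) = y i))"
proof (induction n)
  case 0
  have "wrel 0 0 (W_id 0) D x y" for D and x y :: "nat \<Rightarrow> 'a" using wrel_W_id[of 0 D x y] by simp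
  then show ?case using W_id_hom[of 0] by simp
next
  case (Suc n)
  let ?A = "W_tensor (n + n) n 2 1 (W_mu n) mu1"
  let ?C = "W_tensor (1 + n) (n + 1) 1 1 (W_swap 1 n) (W_id 1)"
  let ?B = "W_tensor n n (1 + n + 1) (n + 1 + 1) (W_id n) ?C"
  have h: "W_mu n \<in> hom Wcat (n + n) n" using Suc by auto
  have A: "?A \<in> hom Wcat (n + n + 2) (n + 1)" by (rule W_tensor_hom[OF h mu1(1)])
  have C: "?C \<in> hom Wcat (1 + n + 1) (n + 1 + 1)" by (rule W_tensor_hom[OF W_swap_hom W_id_hom])
  have B: "?B \<in> hom Wcat (Suc n + Suc n) (n + n + 2)"
    using W_tensor_hom[OF W_id_hom C, of n] by (simp add: algebra_simps numeral_2_eq_2)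
  have rA: "wrel (n + n + 2) (n + 1) ?A D y x \<longleftrightarrow>
      (\<forall>i<n. x i \<in> D \<and> y i = x i \<and> y (n + i) = x i) \<and> x n \<in> D \<and> y (n + n) = x n \<and> y (n + n + 1) = x n"
    for D and x y :: "nat \<Rightarrow> 'a"
    using Suc by (subst wrel_W_tensor[OF h mu1(1)]) (simp add: mu1(2)[unfolded One_nat_def])
  have rC: "wrel (1 + n + 1) (n + 1 + 1) ?C D y x \<longleftrightarrow>
      (\<forall>i<Suc n. y i \<in> D) \<and> (\<forall>i<n. x i = y (Suc i)) \<and> x n = y 0 \<and> x (Suc n) \<in> D \<and> y (Suc n) = x (Suc n)"
    for D and x y :: "nat \<Rightarrow> 'a"
    by (subst wrel_W_tensor[OF W_swap_hom W_id_hom])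
      (auto simp: wrel_W_swap[of 1 n, simplified] wrel_W_id[of 1, simplified])
  have rB: "wrel (n + (1 + n + 1)) (n + (n + 1 + 1)) ?B D y x \<longleftrightarrow>
      (\<forall>i<n. x i \<in> D \<and> y i = x i) \<and> wrel (1 + n + 1) (n + 1 + 1) ?C D (\<lambda>i. y (n + i)) (\<lambda>i. x (n + i))"
    for D and x y :: "nat \<Rightarrow> 'a"
    by (subst wrel_W_tensor[OF W_id_hom C]) (simp add: wrel_W_id)
  have "wrel (Suc n + Suc n) (Suc n) (W_mu (Suc n)) D z x \<longleftrightarrow>
      (\<forall>i<Suc n. x i \<in> D \<and> z i = x i \<and> z (Suc n + i) = x i)" (is "?L \<longleftrightarrow> ?R")
    for D and x z :: "nat \<Rightarrow> 'a"
  proof -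
    have "?L \<longleftrightarrow> (\<exists>y. wrel (Suc n + Suc n) (n + n + 2) ?B D z y \<and> wrel (n + n + 2) (n + 1) ?A D y x)"
      using wrel_W_comp[OF B A] by simp
    also have "\<dots> \<longleftrightarrow> (\<exists>y. ((\<forall>i<n. y i \<in> D \<and> z i = y i) \<and> (\<forall>i<Suc n. z (n + i) \<in> D) \<and>
        (\<forall>i<n. y (n + i) = z (n + Suc i)) \<and> y (n + n) = z (n + 0) \<and> y (n + Suc n) \<in> D \<and>
        z (n + Suc n) = y (n + Suc n)) \<and> (\<forall>i<n. x i \<in> D \<and> y i = x i \<and> y (n + i) = x i) \<and> x n \<in> D \<and>
        y (n + n) = x n \<and> y (n + n + 1) = x n)" (is "_ \<longleftrightarrow> (\<exists>y. ?P y)")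
      using rA rB[unfolded rC] by (simp add: algebra_simps numeral_2_eq_2)
    also have "\<dots> \<longleftrightarrow> ?R"
    proof
      assume "\<exists>y. ?P y"
      then show ?R by (auto simp: less_Suc_eq)
    next
      assume r: ?R
      have rr: "x i \<in> D \<and> z i = x i \<and> z (Suc n + i) = x i" if "i \<le> n" for i
        by (rule r[rule_format]) (use that in simp)
      have r1: "x i \<in> D" if "i \<le> n" for i using rr[OF that] by (elim conjE)
      have r2: "z i = x i" if "i \<le> n" for i using rr[OF that] by (elim conjE)
      have r3: "z (Suc (n + i)) = x i" if "i \<le> n" for i using rr[OF that] by simp
      \<comment> \<open>The block from index \<open>n\<close> on straddles the two copies:
        \<open>z n\<close> is the last entry of the first copy, and the second copy starts right
        after it.\<close>
      have r4: "z (n + i) \<in> D" if "i < Suc n" for i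
        using r1[of n] r2[of n] r1[of "i - 1"] r3[of "i - 1"] that by (cases i) auto
      \<comment> \<open>The same layout of blocks as for the comultiplication, now lying between the
        symmetry and the multiplications.\<close>
      have "?P (\<lambda>i. if i < n then x i else if i < n + n then x (i - n) else x n)"
        using r3[of n] by (simp add: r1 r2 r3 r4)
      then show "\<exists>y. ?P y" by (rule exI[where P = ?P])
    qed
    finally show ?thesis .
  qed
  moreover have "W_mu (Suc n) \<in> hom Wcat (Suc n + Suc n) (Suc n)"
    using W_comp_hom[OF B A] by simp
  ultimately show ?case by blast
qed

lemma W_cap_hom: "W_cap n \<in> hom Wcat (n + n) 0"
  unfolding W_cap_def
  using W_comp_hom[OF W_mu[THEN conjunct1] W_eps[THEN conjunct1]] .

lemma wrel_W_cap: "wrel (n + n) 0 (W_cap n) D x y \<longleftrightarrow> (\<forall>i<n. x i \<in> D \<and> x (n + i) = x i)"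
proof -
  have h: "W_mu n \<in> hom Wcat (n + n) n" "W_eps n \<in> hom Wcat n 0"
    by (rule W_mu[THEN conjunct1], rule W_eps[THEN conjunct1])
  have m: "wrel (n + n) n (W_mu n) D x z \<longleftrightarrow> (\<forall>i<n. z i \<in> D \<and> x i = z i \<and> x (n + i) = z i)" for z
    by (rule W_mu[THEN conjunct2, rule_format])
  have e: "wrel n 0 (W_eps n) D z y \<longleftrightarrow> (\<forall>i<n. z i \<in> D)" for z
    by (rule W_eps[THEN conjunct2])
  show ?thesis unfolding W_cap_def wrel_W_comp[OF h] m e
    by (rule iffI, force) (rule exI[of _ x], auto)
qed

lemma wrel_W_del: "wrel n (n + n) (W_del n) D x y \<longleftrightarrow> (\<forall>i<n. x i \<in> D \<and> y i = x i \<and> y (n + i) = x i)"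
  by (rule W_del[THEN conjunct2, rule_format])

section \<open>Denotations\<close>

text \<open>Valuations are normalised outside the context, so that points of a definable set are tuples.\<close>

definition env :: "('s, 'r, 'u) str \<Rightarrow> 's ctx \<Rightarrow> ('s \<Rightarrow> nat \<Rightarrow> 'u) \<Rightarrow> bool" where
  "env M n e \<longleftrightarrow> (\<forall>\<sigma> i. if i < n \<sigma> then e \<sigma> i \<in> crr M \<sigma> else e \<sigma> i = undefined)"

definition restr :: "'s ctx \<Rightarrow> ('s \<Rightarrow> nat \<Rightarrow> 'u) \<Rightarrow> 's \<Rightarrow> nat \<Rightarrow> 'u" where
  "restr n e = (\<lambda>\<sigma> i. if i < n \<sigma> then e \<sigma> i else undefined)"

text \<open>Concatenation of tuples in the index convention of \<open>ctx_add\<close>.\<close>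

definition app :: "'s ctx \<Rightarrow> ('s \<Rightarrow> nat \<Rightarrow> 'u) \<Rightarrow> ('s \<Rightarrow> nat \<Rightarrow> 'u) \<Rightarrow> 's \<Rightarrow> nat \<Rightarrow> 'u" where
  "app n x y = (\<lambda>\<sigma> i. if i < n \<sigma> then x \<sigma> i else y \<sigma> (i - n \<sigma>))"

lemma app_fst [simp]: "i < n \<sigma> \<Longrightarrow> app n x y \<sigma> i = x \<sigma> i"
  and app_snd [simp]: "app n x y \<sigma> (n \<sigma> + i) = y \<sigma> i"
  by (auto simp: app_def)

lemma env_assigns: "env M n e \<Longrightarrow> assigns M n e"
  by (auto simp: env_def assigns_def)

lemma env_restr: "assigns M n e \<Longrightarrow> env M n (restr n e)"
  by (auto simp: env_def assigns_def restr_def)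

lemma restr_same [simp]: "i < n \<sigma> \<Longrightarrow> restr n e \<sigma> i = e \<sigma> i"
  by (simp add: restr_def)

lemma env_in: "env M n e \<Longrightarrow> i < n \<sigma> \<Longrightarrow> e \<sigma> i \<in> crr M \<sigma>"
  by (auto simp: env_def split: if_splits)

lemma env_eqI: "env M n x \<Longrightarrow> env M n y \<Longrightarrow> (\<And>\<sigma> i. i < n \<sigma> \<Longrightarrow> x \<sigma> i = y \<sigma> i) \<Longrightarrow> x = y"
  unfolding env_def fun_eq_iff by metis

lemma tensor_apply [simp]: "(n \<otimes> m) \<sigma> = n \<sigma> + m \<sigma>"
  by (simp add: ctx_add_def)

lemma tensor_assoc: "n \<otimes> m \<otimes> l = n \<otimes> (m \<otimes> l)"
  by (simp add: ctx_add_def add.assoc)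

lemma env_app: "env M n x \<Longrightarrow> env M m y \<Longrightarrow> env M (n \<otimes> m) (app n x y)"
  unfolding env_def app_def
  by (auto split: if_splits simp: less_diff_conv2)

lemma env_split:
  assumes "env M (n \<otimes> m) e" shows "\<exists>x y. env M n x \<and> env M m y \<and> e = app n x y"
proof (intro exI conjI)
  show "env M n (restr n e)" using assms unfolding env_def restr_def by (auto split: if_splits)
  show "env M m (\<lambda>\<sigma> i. e \<sigma> (n \<sigma> + i))" using assms unfolding env_def by auto
  show "e = app n (restr n e) (\<lambda>\<sigma> i. e \<sigma> (n \<sigma> + i))" by (auto simp: fun_eq_iff app_def restr_def)
qed

lemma app_inject:
  assumes "env M n x" "env M n x'" shows "app n x y = app n x' y' \<longleftrightarrow> x = x' \<and> y = y'"
proof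
  assume e: "app n x y = app n x' y'"
  have "x = x'"
  proof (rule env_eqI[OF assms])
    fix \<sigma> i assume "i < n \<sigma>"
    then show "x \<sigma> i = x' \<sigma> i" using fun_cong[OF fun_cong[OF e], of \<sigma> i] by simp
  qed
  moreover have "y = y'"
  proof (intro ext)
    fix \<sigma> i show "y \<sigma> i = y' \<sigma> i" using fun_cong[OF fun_cong[OF e], of \<sigma> "n \<sigma> + i"] by simp
  qed
  ultimately show "x = x' \<and> y = y'" ..
qed simp

lemma app_assoc: "app (n \<otimes> m) (app n x y) z = app n x (app m y z)"
  by (auto simp: app_def fun_eq_iff)

lemma ctxs_tensor: "n \<in> ctxs T \<Longrightarrow> m \<in> ctxs T \<Longrightarrow> n \<otimes> m \<in> ctxs T"
proof -
  assume nm: "n \<in> ctxs T" "m \<in> ctxs T"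
  have "{\<sigma>. (n \<otimes> m) \<sigma> \<noteq> 0} = {\<sigma>. n \<sigma> \<noteq> 0} \<union> {\<sigma>. m \<sigma> \<noteq> 0}" by auto
  with nm show ?thesis by (simp add: ctxs_def)
qed

lemma ctxs_empty: "empty_ctx \<in> ctxs T"
  by (simp add: ctxs_def empty_ctx_def)

lemma sat_subst_cong:
  "fm_in T n \<phi> \<Longrightarrow> (\<And>\<sigma> i. i < n \<sigma> \<Longrightarrow> e \<sigma> (r \<sigma> i) = e' \<sigma> i) \<Longrightarrow>
   sat M (subst r \<phi>) e \<longleftrightarrow> sat M \<phi> e'"
  unfolding sat_subst by (rule sat_cong)

lemma sat_app_fst: "fm_in T n \<phi> \<Longrightarrow> sat M \<phi> (app n x y) \<longleftrightarrow> sat M \<phi> x"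
  by (rule sat_cong) auto

lemma sat_shift [simp]: "sat M (shift n \<phi>) (app n x y) \<longleftrightarrow> sat M \<phi> y"
  by (simp add: shift_def sat_subst)

lemma fm_in_shift: "fm_in T m \<phi> \<Longrightarrow> fm_in T (n \<otimes> m) (shift n \<phi>)"
  unfolding shift_def by (erule fm_in_subst) auto

lemma fm_in_left: "fm_in T n \<phi> \<Longrightarrow> fm_in T (n \<otimes> m) \<phi>"
  by (erule fm_in_mono) auto

text \<open>The head of the list is the outermost quantifier, so its variable ends up above those
  bound by the tail: at index \<open>?c t\<close> of its sort. The two constructions of
  \<open>?z\<close> add and remove that top value.\<close>

lemma sat_vec_ex:
  "sat M (vec_ex ts \<phi>) e \<longleftrightarrow> (\<exists>z. env M (count_list ts) z \<and> sat M \<phi> (app (count_list ts) z e))"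
proof (induction ts arbitrary: e)
  case Nil
  have "app (count_list []) z e = e" for z by (auto simp: app_def fun_eq_iff)
  moreover have "env M (count_list []) (\<lambda>_ _. undefined)" by (simp add: env_def)
  moreover have "vec_ex [] \<phi> = \<phi>" by (simp add: vec_ex_def)
  ultimately show ?case by metis
next
  case (Cons t ts)
  let ?c = "count_list ts" and ?c' = "count_list (t # ts)"
  have "sat M (vec_ex (t # ts) \<phi>) e \<longleftrightarrow>
      (\<exists>x\<in>crr M t. \<exists>z. env M ?c z \<and> sat M \<phi> (app ?c z (push t x e)))"
    using Cons by (simp add: vec_ex_def)
  also have "\<dots> \<longleftrightarrow> (\<exists>z. env M ?c' z \<and> sat M \<phi> (app ?c' z e))"
  proof
    assume "\<exists>x\<in>crr M t. \<exists>z. env M ?c z \<and> sat M \<phi> (app ?c z (push t x e))"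
    then obtain x z where xz: "x \<in> crr M t" "env M ?c z" "sat M \<phi> (app ?c z (push t x e))" by blast
    let ?z = "\<lambda>\<sigma> i. if \<sigma> = t \<and> i = ?c t then x else z \<sigma> i"
    have zz: "env M ?c' ?z" using xz(1,2) unfolding env_def by (auto split: if_splits)
    have eq: "app ?c' ?z e = app ?c z (push t x e)"
    proof (intro ext)
      fix \<sigma> i
      show "app ?c' ?z e \<sigma> i = app ?c z (push t x e) \<sigma> i"
      proof (cases "i < ?c \<sigma>")
        case False
        then obtain j where j: "i = ?c \<sigma> + j" using le_Suc_ex not_less by blast
        show ?thesis by (cases j) (auto simp: j app_def push_def)
      qed (auto simp: app_def)
    qed
    have "env M ?c' ?z \<and> sat M \<phi> (app ?c' ?z e)" unfolding eq using zz xz(3) ..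
    then show "\<exists>z. env M ?c' z \<and> sat M \<phi> (app ?c' z e)" by (rule exI[of _ ?z])
  next
    assume "\<exists>z. env M ?c' z \<and> sat M \<phi> (app ?c' z e)"
    then obtain z where z: "env M ?c' z" "sat M \<phi> (app ?c' z e)" by blast
    let ?z = "restr ?c z" and ?x = "z t (?c t)"
    have xx: "?x \<in> crr M t" using env_in[OF z(1), of "?c t" t] by simp
    have zz: "env M ?c ?z"
      by (intro env_restr) (use env_in[OF z(1)] in \<open>auto simp: assigns_def\<close>)
    have eq: "app ?c' z e = app ?c ?z (push t ?x e)"
    proof (intro ext)
      fix \<sigma> i
      show "app ?c' z e \<sigma> i = app ?c ?z (push t ?x e) \<sigma> i"
      proof (cases "i < ?c \<sigma>")
        case False
        then obtain j where j: "i = ?c \<sigma> + j" using le_Suc_ex not_less by blast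
        show ?thesis by (cases j) (auto simp: j app_def push_def restr_def)
      qed (auto simp: app_def restr_def)
    qed
    have "env M ?c ?z \<and> sat M \<phi> (app ?c ?z (push t ?x e))" unfolding eq[symmetric] using zz z(2) ..
    then show "\<exists>x\<in>crr M t. \<exists>z. env M ?c z \<and> sat M \<phi> (app ?c z (push t x e))"
      by (intro bexI[OF _ xx] exI[of _ ?z])
  qed
  finally show ?case .
qed

lemma sat_vec_eq:
  "sat M (vec_eq ss r r') e \<longleftrightarrow> (\<forall>\<sigma> i. i < count_list ss \<sigma> \<longrightarrow> e \<sigma> (r \<sigma> i) = e \<sigma> (r' \<sigma> i))"
proof -
  have "sat M (foldr (\<lambda>(\<sigma>, i). Conj (Eq \<sigma> (r \<sigma> i) (r' \<sigma> i))) xs Top) e \<longleftrightarrow>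
      (\<forall>(\<sigma>, i)\<in>set xs. e \<sigma> (r \<sigma> i) = e \<sigma> (r' \<sigma> i))" for xs
    by (induction xs) auto
  then show ?thesis by (auto simp: vec_eq_def set_list_vars)
qed

lemma fm_in_vec_ex:
  "set ts \<subseteq> sorts T \<Longrightarrow> fm_in T (count_list ts \<otimes> n) \<phi> \<Longrightarrow> fm_in T n (vec_ex ts \<phi>)"
proof (induction ts arbitrary: n)
  case Nil
  have "count_list [] \<otimes> n = n" by (auto simp: fun_eq_iff)
  with Nil show ?case by (simp add: vec_ex_def)
next
  case (Cons t ts)
  have e: "count_list (t # ts) \<otimes> n = count_list ts \<otimes> n(t := Suc (n t))" by (auto simp: fun_eq_iff)
  have "fm_in T (n(t := Suc (n t))) (vec_ex ts \<phi>)"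
    using Cons.prems unfolding e by (intro Cons.IH) auto
  then show ?case using Cons.prems by (simp add: vec_ex_def)
qed

lemma fm_in_vec_eq:
  assumes "\<And>\<sigma> i. i < count_list ss \<sigma> \<Longrightarrow> r \<sigma> i < n \<sigma> \<and> r' \<sigma> i < n \<sigma>"
  shows "fm_in T n (vec_eq ss r r')"
proof -
  have "\<forall>(\<sigma>, i)\<in>set xs. r \<sigma> i < n \<sigma> \<and> r' \<sigma> i < n \<sigma> \<Longrightarrow>
      fm_in T n (foldr (\<lambda>(\<sigma>, i). Conj (Eq \<sigma> (r \<sigma> i) (r' \<sigma> i))) xs Top)" for xs
    by (induction xs) auto
  then show ?thesis using assms by (auto simp: vec_eq_def set_list_vars)
qed

text \<open>The calculus has families as contexts, while \<open>vec_ex\<close>,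
  \<open>vec_eq\<close> and the objects of \<open>Creg\<close> work with lists. Any ordering of the
  variables serves.\<close>

lemma ctx_list: "n \<in> ctxs T \<Longrightarrow> \<exists>ss. set ss \<subseteq> sorts T \<and> count_list ss = n"
proof -
  assume n: "n \<in> ctxs T"
  then have "finite {\<sigma>. n \<sigma> \<noteq> 0}" by (simp add: ctxs_def)
  then obtain xs where xs: "set xs = {\<sigma>. n \<sigma> \<noteq> 0}" "distinct xs"
    using finite_distinct_list by blast
  have rep: "count_list (replicate k a) b = (if a = b then k else 0)" for k and a b :: 'a
    by (induction k) auto
  have c: "distinct ys \<Longrightarrow> count_list (concat (map (\<lambda>\<sigma>. replicate (n \<sigma>) \<sigma>) ys)) \<tau> =
      (if \<tau> \<in> set ys then n \<tau> else 0)" for ys \<tau>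
    by (induction ys) (auto simp: count_list_append rep)
  have "count_list (concat (map (\<lambda>\<sigma>. replicate (n \<sigma>) \<sigma>) xs)) = n"
    using c[OF xs(2)] xs(1) by (auto simp: fun_eq_iff)
  moreover have "set (concat (map (\<lambda>\<sigma>. replicate (n \<sigma>) \<sigma>) xs)) \<subseteq> sorts T"
    using xs(1) n by (auto simp: ctxs_def)
  ultimately show ?thesis by blast
qed

type_synonym ('s, 'r) mdl = "('s, 'r, ('s, 'r) tm set) str"
type_synonym ('s, 'r) vl = "'s \<Rightarrow> nat \<Rightarrow> ('s, 'r) tm set"

text \<open>Truth of a class at a point. On models and normalised valuations the members of a class
  in \<open>FT_obj\<close> agree, so one member decides.\<close>

definition ev :: "('s, 'r) mdl \<Rightarrow> ('s, 'r) fm set \<Rightarrow> ('s, 'r) vl \<Rightarrow> bool" where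
  "ev M p e \<longleftrightarrow> (\<exists>\<phi>\<in>p. sat M \<phi> e)"

definition denotes ::
  "('s, 'r) thy \<Rightarrow> 's ctx \<Rightarrow> ('s, 'r) fm \<Rightarrow> (('s, 'r) mdl \<Rightarrow> ('s, 'r) vl \<Rightarrow> bool) \<Rightarrow> bool" where
  "denotes T n \<phi> Q \<longleftrightarrow> fm_in T n \<phi> \<and> (\<forall>M e. model T M \<longrightarrow> env M n e \<longrightarrow> (sat M \<phi> e \<longleftrightarrow> Q M e))"

text \<open>A class of formulae specified by its meaning. It is empty when \<open>Q\<close> is not
  definable, so the facts about it start from a formula denoting \<open>Q\<close>; by completeness
  it is then the interprovability class of that formula.\<close>

definition cl ::
  "('s, 'r) thy \<Rightarrow> 's ctx \<Rightarrow> (('s, 'r) mdl \<Rightarrow> ('s, 'r) vl \<Rightarrow> bool) \<Rightarrow> ('s, 'r) fm set" where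
  "cl T n Q = {\<phi>. denotes T n \<phi> Q}"

lemma cl_cong:
  "(\<And>M e. model T M \<Longrightarrow> env M n e \<Longrightarrow> Q M e \<longleftrightarrow> Q' M e) \<Longrightarrow> cl T n Q = cl T n Q'"
  by (auto simp: cl_def denotes_def)

locale regular =
  fixes T :: "('s, 'r) thy"
  assumes reg: "regular_theory T"
begin

text \<open>Normalised valuations suffice, because a formula reads only the variables of its
  context.\<close>

lemma prv_iff:
  "prv T n \<phi> \<psi> \<longleftrightarrow> n \<in> ctxs T \<and> fm_in T n \<phi> \<and> fm_in T n \<psi> \<and>
    (\<forall>(M :: ('s, 'r) mdl) e. model T M \<longrightarrow> env M n e \<longrightarrow> sat M \<phi> e \<longrightarrow> sat M \<psi> e)"
proof -
  have "valid M n \<phi> \<psi> \<longleftrightarrow> (\<forall>e. env M n e \<longrightarrow> sat M \<phi> e \<longrightarrow> sat M \<psi> e)"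
    if "fm_in T n \<phi>" "fm_in T n \<psi>" for M :: "('s, 'r) mdl"
  proof
    assume "valid M n \<phi> \<psi>"
    then show "\<forall>e. env M n e \<longrightarrow> sat M \<phi> e \<longrightarrow> sat M \<psi> e" unfolding valid_def using env_assigns by blast
  next
    assume *: "\<forall>e. env M n e \<longrightarrow> sat M \<phi> e \<longrightarrow> sat M \<psi> e"
    show "valid M n \<phi> \<psi>" unfolding valid_def
    proof (intro allI impI)
      fix e assume e: "assigns M n e" "sat M \<phi> e"
      have "sat M \<chi> (restr n e) = sat M \<chi> e" if "fm_in T n \<chi>" for \<chi>
        by (rule sat_cong[OF that]) simp
      then show "sat M \<psi> e" using * env_restr[OF e(1)] e(2) that by blast
    qed
  qed
  then show ?thesis unfolding prv_iff_valid[OF reg] by blast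
qed

lemma fm_class_cl:
  assumes "n \<in> ctxs T" "denotes T n \<phi> Q" shows "fm_class T n \<phi> = cl T n Q"
  using assms unfolding fm_class_def cl_def prv_iff denotes_def by blast

lemma cl_FT: "n \<in> ctxs T \<Longrightarrow> denotes T n \<phi> Q \<Longrightarrow> cl T n Q \<in> FT_obj T n"
  using fm_class_cl[of n \<phi> Q] unfolding FT_obj_def denotes_def by blast

lemma denotes_sat: "fm_in T n \<phi> \<Longrightarrow> denotes T n \<phi> (\<lambda>M. sat M \<phi>)"
  by (simp add: denotes_def)

lemma ev_cl:
  assumes "denotes T n \<phi> Q" "model T M" "env M n e" shows "ev M (cl T n Q) e \<longleftrightarrow> Q M e"
proof -
  have "sat M \<psi> e \<longleftrightarrow> Q M e" if "\<psi> \<in> cl T n Q" for \<psi>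
    using that assms(2,3) unfolding cl_def denotes_def by simp
  moreover have "\<phi> \<in> cl T n Q" using assms(1) by (simp add: cl_def)
  ultimately show ?thesis unfolding ev_def by blast
qed

lemma ev_class:
  assumes "n \<in> ctxs T" "fm_in T n \<phi>" "model T M" "env M n e"
  shows "ev M (fm_class T n \<phi>) e \<longleftrightarrow> sat M \<phi> e"
  using fm_class_cl[OF assms(1) denotes_sat[OF assms(2)]] ev_cl[OF denotes_sat[OF assms(2)] assms(3,4)]
  by simp

lemma FT_objE:
  assumes "p \<in> FT_obj T n" "n \<in> ctxs T"
  obtains \<phi> where "\<phi> \<in> p" "denotes T n \<phi> (\<lambda>M. ev M p)" "p = fm_class T n \<phi>"
proof -
  obtain \<phi> where \<phi>: "fm_in T n \<phi>" "p = fm_class T n \<phi>"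
    using assms(1) unfolding FT_obj_def by blast
  then have d: "denotes T n \<phi> (\<lambda>M. ev M p)" using ev_class[OF assms(2) \<phi>(1)] by (simp add: denotes_def)
  have pc: "p = cl T n (\<lambda>M. ev M p)" by (rule trans[OF \<phi>(2) fm_class_cl[OF assms(2) d]])
  have "\<phi> \<in> p" by (subst pc) (simp add: cl_def d)
  then show ?thesis using d \<phi>(2) by (rule that)
qed

lemma FT_cl: "p \<in> FT_obj T n \<Longrightarrow> n \<in> ctxs T \<Longrightarrow> p = cl T n (\<lambda>M. ev M p)"
proof -
  assume p: "p \<in> FT_obj T n" and n: "n \<in> ctxs T"
  then obtain \<phi> where \<phi>: "denotes T n \<phi> (\<lambda>M. ev M p)" "p = fm_class T n \<phi>" by (rule FT_objE)
  show ?thesis by (rule trans[OF \<phi>(2) fm_class_cl[OF n \<phi>(1)]])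
qed

lemma FT_in:
  assumes "p \<in> FT_obj T n" "n \<in> ctxs T" "\<phi> \<in> p" shows "denotes T n \<phi> (\<lambda>M. ev M p)"
proof -
  have "\<phi> \<in> cl T n (\<lambda>M. ev M p)" by (subst FT_cl[OF assms(1,2), symmetric]) (rule assms(3))
  then show ?thesis by (simp add: cl_def)
qed

lemma FT_eqI:
  assumes "p \<in> FT_obj T n" "q \<in> FT_obj T n" "n \<in> ctxs T"
    "\<And>M e. model T M \<Longrightarrow> env M n e \<Longrightarrow> ev M p e \<longleftrightarrow> ev M q e"
  shows "p = q"
proof -
  have "cl T n (\<lambda>M. ev M p) = cl T n (\<lambda>M. ev M q)" using assms(4) by (rule cl_cong)
  then show ?thesis
    by (rule trans[OF FT_cl[OF assms(1,3)] trans[OF _ FT_cl[OF assms(2,3), symmetric]]])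
qed

lemma FT_le_iff:
  assumes "p \<in> FT_obj T n" "q \<in> FT_obj T n" "n \<in> ctxs T"
  shows "FT_le T n p q \<longleftrightarrow> (\<forall>M e. model T M \<longrightarrow> env M n e \<longrightarrow> ev M p e \<longrightarrow> ev M q e)"
proof -
  have "FT_le T n p q \<longleftrightarrow> (\<exists>\<phi>\<in>p. \<exists>\<psi>\<in>q. \<forall>M e. model T M \<longrightarrow> env M n e \<longrightarrow> ev M p e \<longrightarrow> ev M q e)"
    unfolding FT_le_def
  proof (intro bex_cong refl)
    fix \<phi> \<psi> assume "\<phi> \<in> p" "\<psi> \<in> q"
    then have "denotes T n \<phi> (\<lambda>M. ev M p)" "denotes T n \<psi> (\<lambda>M. ev M q)" using FT_in assms by auto
    then show "prv T n \<phi> \<psi> \<longleftrightarrow> (\<forall>M e. model T M \<longrightarrow> env M n e \<longrightarrow> ev M p e \<longrightarrow> ev M q e)"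
      using assms(3) unfolding prv_iff denotes_def by blast
  qed
  moreover have "\<exists>\<phi>. \<phi> \<in> p" "\<exists>\<psi>. \<psi> \<in> q" using FT_objE[OF assms(1,3)] FT_objE[OF assms(2,3)] by metis+
  ultimately show ?thesis by blast
qed

lemma poset_FT: "n \<in> ctxs T \<Longrightarrow> poset_on (FT_obj T n) (FT_le T n)"
  unfolding poset_on_def using FT_le_iff FT_eqI by (metis (no_types, lifting))

text \<open>The union in the definition of \<open>boxplus\<close> is a single class, since all
  choices of representatives denote the same predicate.\<close>

lemma boxplus:
  assumes n: "n \<in> ctxs T" and m: "m \<in> ctxs T" and p: "p \<in> FT_obj T n" and q: "q \<in> FT_obj T m"
  shows boxplus_FT: "boxplus T n m p q \<in> FT_obj T (n \<otimes> m)"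
    and ev_boxplus: "model T M \<Longrightarrow> env M n x \<Longrightarrow> env M m y \<Longrightarrow>
      ev M (boxplus T n m p q) (app n x y) \<longleftrightarrow> ev M p x \<and> ev M q y"
proof -
  have nm: "n \<otimes> m \<in> ctxs T" using n m by (rule ctxs_tensor)
  define Q where "Q = (\<lambda>M e. \<exists>x y. env M n x \<and> env M m y \<and> e = app n x y \<and> ev M p x \<and> ev M q y)"
  have d: "denotes T (n \<otimes> m) (Conj \<phi> (shift n \<psi>)) Q" if "\<phi> \<in> p" "\<psi> \<in> q" for \<phi> \<psi>
  proof -
    have dp: "denotes T n \<phi> (\<lambda>M. ev M p)" and dq: "denotes T m \<psi> (\<lambda>M. ev M q)"
      using FT_in[OF p n that(1)] FT_in[OF q m that(2)] .
    then have fm: "fm_in T n \<phi>" "fm_in T m \<psi>" by (auto simp: denotes_def)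
    have "sat M (Conj \<phi> (shift n \<psi>)) e \<longleftrightarrow> Q M e" if M: "model T M" and e: "env M (n \<otimes> m) e" for M e
    proof -
      obtain x y where xy: "env M n x" "env M m y" "e = app n x y" using env_split[OF e] by blast
      have "Q M e \<longleftrightarrow> ev M p x \<and> ev M q y" unfolding Q_def xy(3) using xy(1,2) app_inject by blast
      moreover have "sat M \<phi> x \<longleftrightarrow> ev M p x" "sat M \<psi> y \<longleftrightarrow> ev M q y"
        using dp dq M xy(1,2) unfolding denotes_def by blast+
      ultimately show ?thesis unfolding xy(3) by (simp add: sat_app_fst[OF fm(1)])
    qed
    then show ?thesis using fm fm_in_left fm_in_shift by (auto simp: denotes_def)
  qed
  obtain \<phi>0 \<psi>0 where 0: "\<phi>0 \<in> p" "\<psi>0 \<in> q" using FT_objE[OF p n] FT_objE[OF q m] by metis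
  have "fm_class T (n \<otimes> m) (Conj \<phi> (shift n \<psi>)) = cl T (n \<otimes> m) Q" if "\<phi> \<in> p" "\<psi> \<in> q" for \<phi> \<psi>
    using fm_class_cl[OF nm d[OF that]] .
  then have b: "boxplus T n m p q = cl T (n \<otimes> m) Q" unfolding boxplus_def using 0 by auto
  then show "boxplus T n m p q \<in> FT_obj T (n \<otimes> m)" using cl_FT[OF nm d[OF 0]] by simp
  show "ev M (boxplus T n m p q) (app n x y) \<longleftrightarrow> ev M p x \<and> ev M q y"
    if M: "model T M" and xy: "env M n x" "env M m y"
  proof -
    have "ev M (boxplus T n m p q) (app n x y) \<longleftrightarrow> Q M (app n x y)"
      unfolding b by (rule ev_cl[OF d[OF 0] M env_app[OF xy]])
    then show ?thesis unfolding Q_def using xy app_inject by blast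
  qed
qed

end

section \<open>The regular calculus\<close>

text \<open>A leg into the empty apex has empty domain. Hence outside the support of a morphism of
  \<open>CT\<close> both contexts vanish.\<close>

lemma W_id0_hom: "W_id 0 \<in> hom Wcat n m \<Longrightarrow> n = 0 \<and> m = 0"
proof -
  assume h: "W_id 0 \<in> hom Wcat n m"
  have "(0, \<lambda>i\<in>{..<0}. i, \<lambda>i\<in>{..<0}. i) \<in> W_id 0"
    unfolding W_id_def by (rule cospan_class_refl) (simp add: cospans_def fun_eq_iff)
  from in_W_hom(1)[OF h this] show ?thesis
    by (auto simp: cospans_def PiE_iff)
qed

text \<open>Equivalence with a cospan of empty apex requires a function from \<open>{..<k}\<close>
  into the empty set.\<close>

lemma in_W_id0: "(k, f, g) \<in> W_id 0 \<Longrightarrow> k = 0"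
  by (cases k) (auto simp: W_id_def cospan_class_def)

lemma W_comp_id0: "W_comp 0 0 0 (W_id 0) (W_id 0) = W_id 0"
  by (rule W_eqI[OF W_comp_hom[OF W_id_hom W_id_hom] W_id_hom])
    (simp add: wrel_W_comp[OF W_id_hom W_id_hom] wrel_W_id)

lemma W_tensor_id: "W_tensor n n m m (W_id n) (W_id m) = W_id (n + m)"
  by (rule W_eqI[OF W_tensor_hom[OF W_id_hom W_id_hom] W_id_hom])
    (simp add: wrel_W_tensor[OF W_id_hom W_id_hom] wrel_W_id all_less_add)

lemma fn_cospan_cong: "(\<And>i. i < m \<Longrightarrow> f i = f' i) \<Longrightarrow> fn_cospan m k f = fn_cospan m k f'"
proof -
  assume "\<And>i. i < m \<Longrightarrow> f i = f' i"
  then have "(\<lambda>i\<in>{..<m}. f i) = (\<lambda>i\<in>{..<m}. f' i)" by (auto simp: fun_eq_iff restrict_def)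
  then show ?thesis by (simp add: fn_cospan_def)
qed

lemma cofn_cospan_cong: "(\<And>i. i < m \<Longrightarrow> f i = f' i) \<Longrightarrow> cofn_cospan k m f = cofn_cospan k m f'"
proof -
  assume "\<And>i. i < m \<Longrightarrow> f i = f' i"
  then have "(\<lambda>i\<in>{..<m}. f i) = (\<lambda>i\<in>{..<m}. f' i)" by (auto simp: fun_eq_iff restrict_def)
  then show ?thesis by (simp add: cofn_cospan_def)
qed

lemma fn_cospan_id0: "fn_cospan 0 0 f = W_id 0"
  unfolding W_id_fn by (rule fn_cospan_cong) simp

lemma cofn_cospan_id0: "cofn_cospan 0 0 f = W_id 0"
proof -
  have "cofn_cospan 0 0 f = cofn_cospan 0 0 (\<lambda>i. i)" by (rule cofn_cospan_cong) simp
  then show ?thesis by (simp add: W_id_def cofn_cospan_def)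
qed

text \<open>The generator acts on the variable of least index, so the other variables move along
  \<open>Suc\<close>. The same map read backwards is \<open>tensor_eps1\<close>.\<close>

lemma tensor_eta1: "W_tensor 0 1 n n eta1 (W_id n) = fn_cospan n (1 + n) Suc"
proof (rule W_eqI)
  show "W_tensor 0 1 n n eta1 (W_id n) \<in> hom Wcat n (1 + n)"
    using W_tensor_hom[OF eta1(1) W_id_hom] by simp
  show "fn_cospan n (1 + n) Suc \<in> hom Wcat n (1 + n)" by (rule fn_cospan_hom) simp
  show "wrel n (1 + n) (W_tensor 0 1 n n eta1 (W_id n)) D x y \<longleftrightarrow> wrel n (1 + n) (fn_cospan n (1 + n) Suc) D x y"
    for D and x y :: "nat \<Rightarrow> nat"
    using wrel_W_tensor[OF eta1(1) W_id_hom, of n D x y]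
    by (subst wrel_fn_cospan) (auto simp: eta1(2)[unfolded One_nat_def] wrel_W_id all_less_add[of 1, simplified])
qed

text \<open>Truncated subtraction sends both 0 and 1 to 0 and moves the remaining variables down by
  one. The same map read backwards is \<open>tensor_del1\<close>.\<close>

lemma tensor_mu1: "W_tensor 2 1 n n mu1 (W_id n) = fn_cospan (2 + n) (1 + n) (\<lambda>i. i - 1)"
proof (rule W_eqI)
  show "W_tensor 2 1 n n mu1 (W_id n) \<in> hom Wcat (2 + n) (1 + n)" by (rule W_tensor_hom[OF mu1(1) W_id_hom])
  show "fn_cospan (2 + n) (1 + n) (\<lambda>i. i - 1) \<in> hom Wcat (2 + n) (1 + n)" by (rule fn_cospan_hom) auto
  show "wrel (2 + n) (1 + n) (W_tensor 2 1 n n mu1 (W_id n)) D x y \<longleftrightarrow>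
      wrel (2 + n) (1 + n) (fn_cospan (2 + n) (1 + n) (\<lambda>i. i - 1)) D x y"
    for D and x y :: "nat \<Rightarrow> nat"
    unfolding wrel_W_tensor[OF mu1(1) W_id_hom]
    by (subst wrel_fn_cospan) (auto simp: mu1(2)[unfolded One_nat_def] wrel_W_id All_less_Suc2)
qed

lemma tensor_eps1: "W_tensor 1 0 n n eps1 (W_id n) = cofn_cospan (1 + n) n Suc"
proof (rule W_eqI)
  show "W_tensor 1 0 n n eps1 (W_id n) \<in> hom Wcat (1 + n) n"
    using W_tensor_hom[OF eps1(1) W_id_hom] by simp
  show "cofn_cospan (1 + n) n Suc \<in> hom Wcat (1 + n) n" by (rule cofn_cospan_hom) simp
  show "wrel (1 + n) n (W_tensor 1 0 n n eps1 (W_id n)) D x y \<longleftrightarrow> wrel (1 + n) n (cofn_cospan (1 + n) n Suc) D x y"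
    for D and x y :: "nat \<Rightarrow> nat"
    using wrel_W_tensor[OF eps1(1) W_id_hom, of n D x y]
    by (subst wrel_cofn_cospan) (auto simp: eps1(2)[unfolded One_nat_def] wrel_W_id all_less_add[of 1, simplified])
qed

lemma tensor_del1: "W_tensor 1 2 n n del1 (W_id n) = cofn_cospan (1 + n) (2 + n) (\<lambda>i. i - 1)"
proof (rule W_eqI)
  show "W_tensor 1 2 n n del1 (W_id n) \<in> hom Wcat (1 + n) (2 + n)" by (rule W_tensor_hom[OF del1(1) W_id_hom])
  show "cofn_cospan (1 + n) (2 + n) (\<lambda>i. i - 1) \<in> hom Wcat (1 + n) (2 + n)" by (rule cofn_cospan_hom) auto
  show "wrel (1 + n) (2 + n) (W_tensor 1 2 n n del1 (W_id n)) D x y \<longleftrightarrow>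
      wrel (1 + n) (2 + n) (cofn_cospan (1 + n) (2 + n) (\<lambda>i. i - 1)) D x y"
    for D and x y :: "nat \<Rightarrow> nat"
    unfolding wrel_W_tensor[OF del1(1) W_id_hom]
    by (subst wrel_cofn_cospan) (auto simp: del1(2)[unfolded One_nat_def] wrel_W_id All_less_Suc2)
qed

text \<open>A bijection gives the same relation as a map and as a reversed inverse. The forward
  reading makes symmetries available when maps are built from generators.\<close>

lemma tensor_swap:
  "W_tensor (n + m) (m + n) l l (W_swap n m) (W_id l) =
   fn_cospan (n + m + l) (m + n + l) (\<lambda>i. if i < n then m + i else if i < n + m then i - n else i)"
  (is "_ = fn_cospan _ _ ?f")
proof (rule W_eqI)
  show "W_tensor (n + m) (m + n) l l (W_swap n m) (W_id l) \<in> hom Wcat (n + m + l) (m + n + l)"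
    by (rule W_tensor_hom[OF W_swap_hom W_id_hom])
  show "fn_cospan (n + m + l) (m + n + l) ?f \<in> hom Wcat (n + m + l) (m + n + l)"
    by (rule fn_cospan_hom) auto
  show "wrel (n + m + l) (m + n + l) (W_tensor (n + m) (m + n) l l (W_swap n m) (W_id l)) D x y \<longleftrightarrow>
      wrel (n + m + l) (m + n + l) (fn_cospan (n + m + l) (m + n + l) ?f) D x y"
    for D and x y :: "nat \<Rightarrow> nat"
  proof -
    have c: "m + n + i = n + m + i" for i by simp
    have 1: "(\<forall>i<n + m + l. x i = y (?f i)) \<longleftrightarrow>
        (\<forall>i<n. x i = y (m + i)) \<and> (\<forall>i<m. x (n + i) = y i) \<and> (\<forall>i<l. x (n + m + i) = y (n + m + i))"
      unfolding all_less_add by simp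
    have 2: "(\<forall>i<m + n + l. y i \<in> D) \<longleftrightarrow>
        ((\<forall>i<m. y i \<in> D) \<and> (\<forall>i<n. y (m + i) \<in> D)) \<and> (\<forall>i<l. y (n + m + i) \<in> D)"
      using all_less_add[of "m + n" l "\<lambda>i. y i \<in> D"] all_less_add[of m n "\<lambda>i. y i \<in> D"] by (simp add: c)
    have 3: "(\<forall>i<n + m. x i \<in> D) \<longleftrightarrow> (\<forall>i<n. x i \<in> D) \<and> (\<forall>i<m. x (n + i) \<in> D)"
      by (rule all_less_add)
    have 4: "\<forall>i<n + m + l. ?f i < m + n + l" by auto
    have L: "wrel (n + m + l) (m + n + l) (W_tensor (n + m) (m + n) l l (W_swap n m) (W_id l)) D x y \<longleftrightarrow>
        (((\<forall>i<n. x i \<in> D) \<and> (\<forall>i<m. x (n + i) \<in> D)) \<and> (\<forall>i<n. y (m + i) = x i) \<and> (\<forall>j<m. y j = x (n + j))) \<and>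
        (\<forall>i<l. y (n + m + i) \<in> D \<and> x (n + m + i) = y (n + m + i))"
      unfolding wrel_W_tensor[OF W_swap_hom W_id_hom] wrel_W_swap wrel_W_id 3 by (simp add: c)
    show ?thesis unfolding L wrel_fn_cospan[OF 4] 1 2
      by (rule iffI; elim conjE; intro conjI allI impI; simp)
  qed
qed

section \<open>Morphisms of the calculus as sortwise relations between tuples\<close>

definition ctrel ::
  "'s ctx \<Rightarrow> 's ctx \<Rightarrow> 's ct_mor \<Rightarrow> ('s, 'r, 'u) str \<Rightarrow> ('s \<Rightarrow> nat \<Rightarrow> 'u) \<Rightarrow> ('s \<Rightarrow> nat \<Rightarrow> 'u) \<Rightarrow> bool" where
  "ctrel n m w M x y \<longleftrightarrow> (\<forall>\<sigma>. wrel (n \<sigma>) (m \<sigma>) (w \<sigma>) (crr M \<sigma>) (x \<sigma>) (y \<sigma>))"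

lemma CT_hom: "w \<in> hom (CT T) n m \<longleftrightarrow> (\<forall>\<sigma>. w \<sigma> \<in> hom Wcat (n \<sigma>) (m \<sigma>)) \<and>
    finite {\<sigma>. w \<sigma> \<noteq> W_id 0} \<and> {\<sigma>. w \<sigma> \<noteq> W_id 0} \<subseteq> sorts T"
  by (simp add: CT_def)

lemma CT_homD: "w \<in> hom (CT T) n m \<Longrightarrow> w \<sigma> \<in> hom Wcat (n \<sigma>) (m \<sigma>)"
  by (simp add: CT_hom)

lemma CT_homI:
  assumes "\<And>\<sigma>. w \<sigma> \<in> hom Wcat (n \<sigma>) (m \<sigma>)" "finite S" "S \<subseteq> sorts T" "\<And>\<sigma>. \<sigma> \<notin> S \<Longrightarrow> w \<sigma> = W_id 0"
  shows "w \<in> hom (CT T) n m"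
proof -
  have "{\<sigma>. w \<sigma> \<noteq> W_id 0} \<subseteq> S" using assms(4) by blast
  then have "finite {\<sigma>. w \<sigma> \<noteq> W_id 0}" "{\<sigma>. w \<sigma> \<noteq> W_id 0} \<subseteq> sorts T"
    using assms(2,3) by (auto intro: finite_subset)
  then show ?thesis using assms(1) unfolding CT_hom by blast
qed

lemma CT_simps [simp]:
  "obj (CT T) = ctxs T" "ident (CT T) n = (\<lambda>\<sigma>. W_id (n \<sigma>))"
  "comp (CT T) n m l u v = (\<lambda>\<sigma>. W_comp (n \<sigma>) (m \<sigma>) (l \<sigma>) (u \<sigma>) (v \<sigma>))"
  "le (CT T) n m u v \<longleftrightarrow> (\<forall>\<sigma>. le Wcat (n \<sigma>) (m \<sigma>) (u \<sigma>) (v \<sigma>))"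
  by (simp_all add: CT_def)

lemma CT_ident_hom: "n \<in> ctxs T \<Longrightarrow> (\<lambda>\<sigma>. W_id (n \<sigma>)) \<in> hom (CT T) n n"
  by (rule CT_homI[of _ _ _ "{\<sigma>. n \<sigma> \<noteq> 0}"]) (auto simp: W_id_hom ctxs_def)

lemma CT_comp_hom:
  assumes "u \<in> hom (CT T) n m" "v \<in> hom (CT T) m l"
  shows "(\<lambda>\<sigma>. W_comp (n \<sigma>) (m \<sigma>) (l \<sigma>) (u \<sigma>) (v \<sigma>)) \<in> hom (CT T) n l"
proof (rule CT_homI[of _ _ _ "{\<sigma>. u \<sigma> \<noteq> W_id 0} \<union> {\<sigma>. v \<sigma> \<noteq> W_id 0}"])
  fix \<sigma>
  show "W_comp (n \<sigma>) (m \<sigma>) (l \<sigma>) (u \<sigma>) (v \<sigma>) \<in> hom Wcat (n \<sigma>) (l \<sigma>)"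
    by (rule W_comp_hom[OF CT_homD[OF assms(1)] CT_homD[OF assms(2)]])
  assume "\<sigma> \<notin> {\<sigma>. u \<sigma> \<noteq> W_id 0} \<union> {\<sigma>. v \<sigma> \<noteq> W_id 0}"
  then have uv: "u \<sigma> = W_id 0" "v \<sigma> = W_id 0" by auto
  then have "n \<sigma> = 0" "m \<sigma> = 0" "l \<sigma> = 0"
    using W_id0_hom CT_homD[OF assms(1), of \<sigma>] CT_homD[OF assms(2), of \<sigma>] by metis+
  with uv show "W_comp (n \<sigma>) (m \<sigma>) (l \<sigma>) (u \<sigma>) (v \<sigma>) = W_id 0" by (simp add: W_comp_id0)
qed (use assms in \<open>auto simp: CT_hom\<close>)

lemma CT_tensor_hom:
  assumes "u \<in> hom (CT T) n m" "v \<in> hom (CT T) n' m'"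
  shows "CT_tensor n m n' m' u v \<in> hom (CT T) (n \<otimes> n') (m \<otimes> m')"
proof (rule CT_homI[of _ _ _ "{\<sigma>. u \<sigma> \<noteq> W_id 0} \<union> {\<sigma>. v \<sigma> \<noteq> W_id 0}"])
  fix \<sigma>
  show "CT_tensor n m n' m' u v \<sigma> \<in> hom Wcat ((n \<otimes> n') \<sigma>) ((m \<otimes> m') \<sigma>)"
    unfolding CT_tensor_def tensor_apply
    by (rule W_tensor_hom[OF CT_homD[OF assms(1)] CT_homD[OF assms(2)]])
  assume "\<sigma> \<notin> {\<sigma>. u \<sigma> \<noteq> W_id 0} \<union> {\<sigma>. v \<sigma> \<noteq> W_id 0}"
  then have uv: "u \<sigma> = W_id 0" "v \<sigma> = W_id 0" by auto
  then have "n \<sigma> = 0" "m \<sigma> = 0" "n' \<sigma> = 0" "m' \<sigma> = 0"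
    using W_id0_hom CT_homD[OF assms(1), of \<sigma>] CT_homD[OF assms(2), of \<sigma>] by metis+
  with uv show "CT_tensor n m n' m' u v \<sigma> = W_id 0"
    using W_tensor_id[of 0 0] by (simp add: CT_tensor_def)
qed (use assms in \<open>auto simp: CT_hom\<close>)

lemma ctrel_ident:
  "ctrel n n (\<lambda>\<sigma>. W_id (n \<sigma>)) M x y \<longleftrightarrow> (\<forall>\<sigma> i. i < n \<sigma> \<longrightarrow> y \<sigma> i \<in> crr M \<sigma> \<and> x \<sigma> i = y \<sigma> i)"
  by (auto simp: ctrel_def wrel_W_id)

lemma ctrel_cong:
  "(\<And>\<sigma> i. i < n \<sigma> \<Longrightarrow> x \<sigma> i = x' \<sigma> i) \<Longrightarrow> (\<And>\<sigma> i. i < m \<sigma> \<Longrightarrow> y \<sigma> i = y' \<sigma> i) \<Longrightarrow>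
   ctrel n m w M x y \<longleftrightarrow> ctrel n m w M x' y'"
  unfolding ctrel_def by (intro all_cong1 wrel_cong) auto

text \<open>Composition is computed in each sort separately; a choice over the sorts assembles the
  middle tuples into one valuation, which is then normalised.\<close>

lemma ctrel_comp:
  assumes u: "u \<in> hom (CT T) n m" and v: "v \<in> hom (CT T) m l"
  shows "ctrel n l (\<lambda>\<sigma>. W_comp (n \<sigma>) (m \<sigma>) (l \<sigma>) (u \<sigma>) (v \<sigma>)) M x z \<longleftrightarrow>
    (\<exists>y. env M m y \<and> ctrel n m u M x y \<and> ctrel m l v M y z)"
proof -
  have "ctrel n l (\<lambda>\<sigma>. W_comp (n \<sigma>) (m \<sigma>) (l \<sigma>) (u \<sigma>) (v \<sigma>)) M x z \<longleftrightarrow>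
      (\<forall>\<sigma>. \<exists>y. wrel (n \<sigma>) (m \<sigma>) (u \<sigma>) (crr M \<sigma>) (x \<sigma>) y \<and> wrel (m \<sigma>) (l \<sigma>) (v \<sigma>) (crr M \<sigma>) y (z \<sigma>))"
    unfolding ctrel_def by (simp add: wrel_W_comp[OF CT_homD[OF u] CT_homD[OF v]])
  also have "\<dots> \<longleftrightarrow> (\<exists>y. ctrel n m u M x y \<and> ctrel m l v M y z)"
    unfolding ctrel_def choice_iff by blast
  also have "\<dots> \<longleftrightarrow> (\<exists>y. env M m y \<and> ctrel n m u M x y \<and> ctrel m l v M y z)"
  proof
    assume "\<exists>y. ctrel n m u M x y \<and> ctrel m l v M y z"
    then obtain y where y: "ctrel n m u M x y" "ctrel m l v M y z" by blast
    have "assigns M m y"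
      using y(1) wrel_dom(2)[OF CT_homD[OF u]] unfolding assigns_def ctrel_def by blast
    then have "env M m (restr m y)" by (rule env_restr)
    moreover have "ctrel n m u M x (restr m y)" "ctrel m l v M (restr m y) z"
      using y ctrel_cong[of n x x m "restr m y" y u M] ctrel_cong[of m "restr m y" y l z z v M] by auto
    ultimately show "\<exists>y. env M m y \<and> ctrel n m u M x y \<and> ctrel m l v M y z" by blast
  qed blast
  finally show ?thesis .
qed

lemma ctrel_tensor:
  assumes u: "u \<in> hom (CT T) n m" and v: "v \<in> hom (CT T) n' m'"
  shows "ctrel (n \<otimes> n') (m \<otimes> m') (CT_tensor n m n' m' u v) M (app n x x') (app m y y') \<longleftrightarrow>
    ctrel n m u M x y \<and> ctrel n' m' v M x' y'"
proof -
  have "wrel (n \<sigma>) (m \<sigma>) (u \<sigma>) (crr M \<sigma>) (app n x x' \<sigma>) (app m y y' \<sigma>) \<longleftrightarrow>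
      wrel (n \<sigma>) (m \<sigma>) (u \<sigma>) (crr M \<sigma>) (x \<sigma>) (y \<sigma>)" for \<sigma>
    by (rule wrel_cong) auto
  then show ?thesis
    unfolding ctrel_def CT_tensor_def tensor_apply
    by (auto simp: wrel_W_tensor[OF CT_homD[OF u] CT_homD[OF v]])
qed

definition ct_fn :: "'s ctx \<Rightarrow> 's ctx \<Rightarrow> ('s \<Rightarrow> nat \<Rightarrow> nat) \<Rightarrow> 's ct_mor" where
  "ct_fn n m r = (\<lambda>\<sigma>. fn_cospan (n \<sigma>) (m \<sigma>) (r \<sigma>))"

definition ct_cofn :: "'s ctx \<Rightarrow> 's ctx \<Rightarrow> ('s \<Rightarrow> nat \<Rightarrow> nat) \<Rightarrow> 's ct_mor" where
  "ct_cofn n m r = (\<lambda>\<sigma>. cofn_cospan (n \<sigma>) (m \<sigma>) (r \<sigma>))"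

lemma ct_fn_cong: "(\<And>\<sigma> i. i < n \<sigma> \<Longrightarrow> r \<sigma> i = s \<sigma> i) \<Longrightarrow> ct_fn n m r = ct_fn n m s"
  unfolding ct_fn_def by (intro ext fn_cospan_cong) auto

definition ctx_map :: "'s ctx \<Rightarrow> 's ctx \<Rightarrow> ('s \<Rightarrow> nat \<Rightarrow> nat) \<Rightarrow> bool" where
  "ctx_map n m r \<longleftrightarrow> (\<forall>\<sigma> i. i < n \<sigma> \<longrightarrow> r \<sigma> i < m \<sigma>)"

lemma ctx_map_all: "ctx_map n m r \<Longrightarrow> \<forall>i<n \<sigma>. r \<sigma> i < m \<sigma>"
  by (simp add: ctx_map_def)

lemma ctx_mapD: "ctx_map n m r \<Longrightarrow> i < n \<sigma> \<Longrightarrow> r \<sigma> i < m \<sigma>"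
  by (simp add: ctx_map_def)

lemma
  assumes "ctx_map n m r" "n \<in> ctxs T" "m \<in> ctxs T"
  shows ct_fn_hom: "ct_fn n m r \<in> hom (CT T) n m" and ct_cofn_hom: "ct_cofn m n r \<in> hom (CT T) m n"
proof -
  have fin: "finite ({\<sigma>. n \<sigma> \<noteq> 0} \<union> {\<sigma>. m \<sigma> \<noteq> 0})" "{\<sigma>. n \<sigma> \<noteq> 0} \<union> {\<sigma>. m \<sigma> \<noteq> 0} \<subseteq> sorts T"
    using assms(2,3) by (auto simp: ctxs_def)
  show "ct_fn n m r \<in> hom (CT T) n m" unfolding ct_fn_def
    by (rule CT_homI[OF _ fin])
      (auto intro: fn_cospan_hom[OF ctx_map_all[OF assms(1)]] simp: fn_cospan_id0)
  show "ct_cofn m n r \<in> hom (CT T) m n" unfolding ct_cofn_def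
    by (rule CT_homI[OF _ fin])
      (auto intro: cofn_cospan_hom[OF ctx_map_all[OF assms(1)]] simp: cofn_cospan_id0)
qed

lemma
  assumes "ctx_map n m r"
  shows ctrel_fn: "ctrel n m (ct_fn n m r) M x y \<longleftrightarrow> assigns M m y \<and> (\<forall>\<sigma> i. i < n \<sigma> \<longrightarrow> x \<sigma> i = y \<sigma> (r \<sigma> i))"
    and ctrel_cofn: "ctrel m n (ct_cofn m n r) M y x \<longleftrightarrow> assigns M m y \<and> (\<forall>\<sigma> i. i < n \<sigma> \<longrightarrow> x \<sigma> i = y \<sigma> (r \<sigma> i))"
  unfolding ctrel_def ct_fn_def ct_cofn_def assigns_def
  by (auto simp: wrel_fn_cospan[OF ctx_map_all[OF assms]] wrel_cofn_cospan[OF ctx_map_all[OF assms]])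

lemma CT_comp_fn:
  assumes "ctx_map n m r" "ctx_map m l s"
  shows "(\<lambda>\<sigma>. W_comp (n \<sigma>) (m \<sigma>) (l \<sigma>) (ct_fn n m r \<sigma>) (ct_fn m l s \<sigma>)) = ct_fn n l (\<lambda>\<sigma> i. s \<sigma> (r \<sigma> i))"
proof
  fix \<sigma>
  have r: "\<forall>i<n \<sigma>. r \<sigma> i < m \<sigma>" and s: "\<forall>i<m \<sigma>. s \<sigma> i < l \<sigma>" and sr: "\<forall>i<n \<sigma>. s \<sigma> (r \<sigma> i) < l \<sigma>"
    using ctx_mapD[OF assms(1)] ctx_mapD[OF assms(2)] by auto
  show "W_comp (n \<sigma>) (m \<sigma>) (l \<sigma>) (ct_fn n m r \<sigma>) (ct_fn m l s \<sigma>) = ct_fn n l (\<lambda>\<sigma> i. s \<sigma> (r \<sigma> i)) \<sigma>"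
    unfolding ct_fn_def
  proof (rule W_eqI[OF W_comp_hom[OF fn_cospan_hom[OF r] fn_cospan_hom[OF s]] fn_cospan_hom[OF sr]])
    fix D :: "nat set" and x z
    have "(\<exists>y. ((\<forall>j<m \<sigma>. y j \<in> D) \<and> (\<forall>i<n \<sigma>. x i = y (r \<sigma> i))) \<and> (\<forall>j<l \<sigma>. z j \<in> D) \<and> (\<forall>i<m \<sigma>. y i = z (s \<sigma> i))) \<longleftrightarrow>
        (\<forall>j<l \<sigma>. z j \<in> D) \<and> (\<forall>i<n \<sigma>. x i = z (s \<sigma> (r \<sigma> i)))" (is "?L \<longleftrightarrow> ?R")
    proof
      assume ?L then show ?R using r by auto
    next
      assume ?R then show ?L using s by (intro exI[of _ "\<lambda>i. z (s \<sigma> i)"]) auto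
    qed
    then show "wrel (n \<sigma>) (l \<sigma>) (W_comp (n \<sigma>) (m \<sigma>) (l \<sigma>) (fn_cospan (n \<sigma>) (m \<sigma>) (r \<sigma>)) (fn_cospan (m \<sigma>) (l \<sigma>) (s \<sigma>))) D x z =
       wrel (n \<sigma>) (l \<sigma>) (fn_cospan (n \<sigma>) (l \<sigma>) (\<lambda>i. s \<sigma> (r \<sigma> i))) D x z"
      unfolding wrel_W_comp[OF fn_cospan_hom[OF r] fn_cospan_hom[OF s]] wrel_fn_cospan[OF r] wrel_fn_cospan[OF s]
        wrel_fn_cospan[OF sr] .
  qed
qed

text \<open>A representative \<open>(k, f, g)\<close> is chosen in every sort. The apexes form a
  context because a component equal to \<open>W_id 0\<close> contains only cospans with empty
  apex.\<close>

lemma CT_decompose: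
  fixes T :: "('s, 'r) thy"
  assumes w: "w \<in> hom (CT T) n m" and n: "n \<in> ctxs T" and m: "m \<in> ctxs T"
  obtains k f g where "k \<in> ctxs T" "ctx_map n k f" "ctx_map m k g"
    "w = (\<lambda>\<sigma>. W_comp (n \<sigma>) (k \<sigma>) (m \<sigma>) (ct_fn n k f \<sigma>) (ct_cofn k m g \<sigma>))"
    "\<And>(M :: ('s, 'r) mdl) x y. ctrel n m w M x y \<longleftrightarrow> (\<exists>z. assigns M k z \<and>
       (\<forall>\<sigma> i. i < n \<sigma> \<longrightarrow> x \<sigma> i = z \<sigma> (f \<sigma> i)) \<and> (\<forall>\<sigma> i. i < m \<sigma> \<longrightarrow> y \<sigma> i = z \<sigma> (g \<sigma> i)))"
proof -
  have "\<forall>\<sigma>. \<exists>k f g. (k, f, g) \<in> w \<sigma>" using W_hom_nonempty[OF CT_homD[OF w]] by auto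
  then obtain k f g where c: "\<And>\<sigma>. (k \<sigma>, f \<sigma>, g \<sigma>) \<in> w \<sigma>" by metis
  note ch = in_W_hom[OF CT_homD[OF w] c]
  have "{\<sigma>. k \<sigma> \<noteq> 0} \<subseteq> {\<sigma>. w \<sigma> \<noteq> W_id 0}"
  proof
    fix \<sigma> assume "\<sigma> \<in> {\<sigma>. k \<sigma> \<noteq> 0}"
    then show "\<sigma> \<in> {\<sigma>. w \<sigma> \<noteq> W_id 0}" using c[of \<sigma>] in_W_id0[of "k \<sigma>" "f \<sigma>" "g \<sigma>"] by auto
  qed
  then have k: "k \<in> ctxs T" using w unfolding ctxs_def CT_hom by (auto intro: finite_subset)
  have f: "ctx_map n k f" and g: "ctx_map m k g"
    using ch(1) unfolding cospans_def ctx_map_def by (auto simp: PiE_iff)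
  note f' = ctx_map_all[OF f] and g' = ctx_map_all[OF g]
  have weq: "w \<sigma> = W_comp (n \<sigma>) (k \<sigma>) (m \<sigma>) (ct_fn n k f \<sigma>) (ct_cofn k m g \<sigma>)" for \<sigma>
    unfolding ct_fn_def ct_cofn_def
  proof (rule W_eqI[OF CT_homD[OF w] W_comp_hom[OF fn_cospan_hom[OF f'] cofn_cospan_hom[OF g']]])
    fix D :: "nat set" and x y
    show "wrel (n \<sigma>) (m \<sigma>) (w \<sigma>) D x y =
       wrel (n \<sigma>) (m \<sigma>) (W_comp (n \<sigma>) (k \<sigma>) (m \<sigma>) (fn_cospan (n \<sigma>) (k \<sigma>) (f \<sigma>)) (cofn_cospan (k \<sigma>) (m \<sigma>) (g \<sigma>))) D x y"
      unfolding wrel_W_comp[OF fn_cospan_hom[OF f'] cofn_cospan_hom[OF g']] ch(3)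
        wrel_fn_cospan[OF f'] wrel_cofn_cospan[OF g'] by auto
  qed
  have rel: "ctrel n m w M x y \<longleftrightarrow> (\<exists>z. assigns M k z \<and>
       (\<forall>\<sigma> i. i < n \<sigma> \<longrightarrow> x \<sigma> i = z \<sigma> (f \<sigma> i)) \<and> (\<forall>\<sigma> i. i < m \<sigma> \<longrightarrow> y \<sigma> i = z \<sigma> (g \<sigma> i)))"
    for M :: "('s, 'r) mdl" and x y
    unfolding ctrel_def ch(3) crel.simps choice_iff assigns_def by (rule ex_cong1) auto
  show ?thesis by (rule that[OF k f g _ rel]) (rule ext, rule weq)
qed

subsection \<open>The action on formulae\<close>

context regular
begin

text \<open>Direct images of definable sets are definable: for a cospan with legs \<open>f\<close>
  and \<open>g\<close> the image of \<open>\<phi>\<close> is the formula \<open>\<psi>\<close>,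
  saying that some valuation \<open>z\<close> of the apex satisfies \<open>\<phi>\<close> at
  \<open>z o f\<close> and has \<open>z o g = y\<close>.\<close>

lemma denotes_ctrel:
  assumes n: "n \<in> ctxs T" and m: "m \<in> ctxs T" and w: "w \<in> hom (CT T) n m" and \<phi>: "denotes T n \<phi> Q"
  shows "\<exists>\<psi>. denotes T m \<psi> (\<lambda>M y. \<exists>x. env M n x \<and> Q M x \<and> ctrel n m w M x y)"
proof -
  obtain k f g where k: "k \<in> ctxs T" and f: "ctx_map n k f" and g: "ctx_map m k g"
    and rel: "\<And>(M :: ('s, 'r) mdl) x y. ctrel n m w M x y \<longleftrightarrow> (\<exists>z. assigns M k z \<and>
       (\<forall>\<sigma> i. i < n \<sigma> \<longrightarrow> x \<sigma> i = z \<sigma> (f \<sigma> i)) \<and> (\<forall>\<sigma> i. i < m \<sigma> \<longrightarrow> y \<sigma> i = z \<sigma> (g \<sigma> i)))"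
    by (rule CT_decompose[OF w n m]) (rule that)
  obtain ks ms where ks: "set ks \<subseteq> sorts T" "count_list ks = k" and ms: "count_list ms = m"
    using ctx_list[OF k] ctx_list[OF m] by blast
  have fm: "fm_in T n \<phi>" using \<phi> by (simp add: denotes_def)
  define \<psi> where "\<psi> = vec_ex ks (Conj (subst f \<phi>) (vec_eq ms g (\<lambda>\<sigma> j. k \<sigma> + j)))"
  have "fm_in T m \<psi>" unfolding \<psi>_def
  proof (rule fm_in_vec_ex[OF ks(1)], simp only: fm_in.simps, intro conjI)
    show "fm_in T (count_list ks \<otimes> m) (subst f \<phi>)"
      using ctx_mapD[OF f] by (intro fm_in_subst[OF fm]) (auto simp: ks trans_less_add1)
    show "fm_in T (count_list ks \<otimes> m) (vec_eq ms g (\<lambda>\<sigma> j. k \<sigma> + j))"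
      using ctx_mapD[OF g] by (intro fm_in_vec_eq) (auto simp: ks ms trans_less_add1)
  qed
  moreover have "sat M \<psi> y \<longleftrightarrow> (\<exists>x. env M n x \<and> Q M x \<and> ctrel n m w M x y)"
    if M: "model T M" and y: "env M m y" for M y
  proof -
    have "sat M \<psi> y \<longleftrightarrow> (\<exists>z. env M k z \<and> sat M (subst f \<phi>) (app k z y) \<and>
        (\<forall>\<sigma> i. i < m \<sigma> \<longrightarrow> app k z y \<sigma> (g \<sigma> i) = y \<sigma> i))"
      unfolding \<psi>_def sat_vec_ex ks sat.simps sat_vec_eq ms by simp
    also have "\<dots> \<longleftrightarrow> (\<exists>z. env M k z \<and> Q M (restr n (\<lambda>\<sigma> i. z \<sigma> (f \<sigma> i))) \<and>
        (\<forall>\<sigma> i. i < m \<sigma> \<longrightarrow> y \<sigma> i = z \<sigma> (g \<sigma> i)))"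
    proof (intro ex_cong1 conj_cong refl)
      fix z assume z: "env M k z"
      have e: "env M n (restr n (\<lambda>\<sigma> i. z \<sigma> (f \<sigma> i)))"
        using env_in[OF z] ctx_mapD[OF f] by (intro env_restr) (auto simp: assigns_def)
      have "sat M (subst f \<phi>) (app k z y) \<longleftrightarrow> sat M \<phi> (restr n (\<lambda>\<sigma> i. z \<sigma> (f \<sigma> i)))"
        by (rule sat_subst_cong[OF fm]) (simp add: ctx_mapD[OF f])
      then show "sat M (subst f \<phi>) (app k z y) \<longleftrightarrow> Q M (restr n (\<lambda>\<sigma> i. z \<sigma> (f \<sigma> i)))"
        using \<phi> M e by (simp add: denotes_def)
      show "(\<forall>\<sigma> i. i < m \<sigma> \<longrightarrow> app k z y \<sigma> (g \<sigma> i) = y \<sigma> i) \<longleftrightarrow> (\<forall>\<sigma> i. i < m \<sigma> \<longrightarrow> y \<sigma> i = z \<sigma> (g \<sigma> i))"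
        using ctx_mapD[OF g] by auto
    qed
    also have "\<dots> \<longleftrightarrow> (\<exists>x. env M n x \<and> Q M x \<and> ctrel n m w M x y)"
    proof
      assume "\<exists>z. env M k z \<and> Q M (restr n (\<lambda>\<sigma> i. z \<sigma> (f \<sigma> i))) \<and> (\<forall>\<sigma> i. i < m \<sigma> \<longrightarrow> y \<sigma> i = z \<sigma> (g \<sigma> i))"
      then obtain z where z: "env M k z" "Q M (restr n (\<lambda>\<sigma> i. z \<sigma> (f \<sigma> i)))"
        "\<forall>\<sigma> i. i < m \<sigma> \<longrightarrow> y \<sigma> i = z \<sigma> (g \<sigma> i)" by blast
      have "env M n (restr n (\<lambda>\<sigma> i. z \<sigma> (f \<sigma> i)))"
        using env_in[OF z(1)] ctx_mapD[OF f] by (intro env_restr) (auto simp: assigns_def)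
      moreover have "ctrel n m w M (restr n (\<lambda>\<sigma> i. z \<sigma> (f \<sigma> i))) y"
        unfolding rel by (rule exI[of _ z]) (simp add: env_assigns[OF z(1)] z(3))
      ultimately show "\<exists>x. env M n x \<and> Q M x \<and> ctrel n m w M x y" using z(2) by blast
    next
      assume "\<exists>x. env M n x \<and> Q M x \<and> ctrel n m w M x y"
      then obtain x z where x: "env M n x" "Q M x" and z: "assigns M k z"
        "\<forall>\<sigma> i. i < n \<sigma> \<longrightarrow> x \<sigma> i = z \<sigma> (f \<sigma> i)" "\<forall>\<sigma> i. i < m \<sigma> \<longrightarrow> y \<sigma> i = z \<sigma> (g \<sigma> i)"
        unfolding rel by blast
      have "env M n (restr n (\<lambda>\<sigma> i. restr k z \<sigma> (f \<sigma> i)))"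
        using z(1) ctx_mapD[OF f] by (intro env_restr) (auto simp: assigns_def)
      then have "restr n (\<lambda>\<sigma> i. restr k z \<sigma> (f \<sigma> i)) = x"
        by (rule env_eqI[OF _ x(1)]) (simp add: z(2) ctx_mapD[OF f])
      then show "\<exists>z. env M k z \<and> Q M (restr n (\<lambda>\<sigma> i. z \<sigma> (f \<sigma> i))) \<and> (\<forall>\<sigma> i. i < m \<sigma> \<longrightarrow> y \<sigma> i = z \<sigma> (g \<sigma> i))"
        using x(2) env_restr[OF z(1)] z(3) ctx_mapD[OF g] by (intro exI[of _ "restr k z"]) simp
    qed
    finally show ?thesis .
  qed
  ultimately show ?thesis unfolding denotes_def by blast
qed

definition act :: "('s, 'r) calculus" where
  "act = (\<lambda>n m w. if n \<in> ctxs T \<and> m \<in> ctxs T \<and> w \<in> hom (CT T) n m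
     then (\<lambda>p\<in>FT_obj T n. cl T m (\<lambda>M y. \<exists>x. env M n x \<and> ev M p x \<and> ctrel n m w M x y))
     else undefined)"

lemma act:
  assumes n: "n \<in> ctxs T" and m: "m \<in> ctxs T" and w: "w \<in> hom (CT T) n m" and p: "p \<in> FT_obj T n"
  shows act_FT: "act n m w p \<in> FT_obj T m"
    and ev_act: "model T M \<Longrightarrow> env M m y \<Longrightarrow>
      ev M (act n m w p) y \<longleftrightarrow> (\<exists>x. env M n x \<and> ev M p x \<and> ctrel n m w M x y)"
proof -
  obtain \<phi> where "denotes T n \<phi> (\<lambda>M. ev M p)" using FT_objE[OF p n] by metis
  from denotes_ctrel[OF n m w this] obtain \<psi>
    where \<psi>: "denotes T m \<psi> (\<lambda>M y. \<exists>x. env M n x \<and> ev M p x \<and> ctrel n m w M x y)" by blast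
  have a: "act n m w p = cl T m (\<lambda>M y. \<exists>x. env M n x \<and> ev M p x \<and> ctrel n m w M x y)"
    using n m w p by (simp add: act_def)
  show "act n m w p \<in> FT_obj T m" unfolding a by (rule cl_FT[OF m \<psi>])
  show "model T M \<Longrightarrow> env M m y \<Longrightarrow>
      ev M (act n m w p) y \<longleftrightarrow> (\<exists>x. env M n x \<and> ev M p x \<and> ctrel n m w M x y)"
    unfolding a by (rule ev_cl[OF \<psi>])
qed

lemma act_functor: "po_functor_to_posets T act"
  unfolding po_functor_to_posets_def CT_simps(1)
proof (intro conjI ballI allI impI)
  fix n m w assume "\<not> (n \<in> ctxs T \<and> m \<in> ctxs T \<and> w \<in> hom (CT T) n m)"
  then show "act n m w = undefined" by (auto simp: act_def)
next
  fix n m w assume h: "n \<in> ctxs T" "m \<in> ctxs T" "w \<in> hom (CT T) n m"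
  show "act n m w \<in> FT_obj T n \<rightarrow>\<^sub>E FT_obj T m"
  proof (rule PiE_I)
    fix p assume "p \<notin> FT_obj T n" then show "act n m w p = undefined" using h by (simp add: act_def)
  qed (rule act_FT[OF h])
  fix p q assume pq: "p \<in> FT_obj T n" "q \<in> FT_obj T n" "FT_le T n p q"
  then show "FT_le T m (act n m w p) (act n m w q)"
    unfolding FT_le_iff[OF act_FT[OF h pq(1)] act_FT[OF h pq(2)] h(2)] FT_le_iff[OF pq(1,2) h(1)]
    using ev_act[OF h pq(1)] ev_act[OF h pq(2)] by blast
next
  fix n p assume n: "n \<in> ctxs T" and p: "p \<in> FT_obj T n"
  have h: "ident (CT T) n \<in> hom (CT T) n n" using CT_ident_hom[OF n] by simp
  show "act n n (ident (CT T) n) p = p"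
  proof (rule FT_eqI[OF act_FT[OF n n h p] p n])
    fix M :: "('s, 'r) mdl" and y assume M: "model T M" and y: "env M n y"
    have "ctrel n n (ident (CT T) n) M x y \<longleftrightarrow> x = y" if "env M n x" for x
      unfolding CT_simps ctrel_ident using env_in[OF y] env_eqI[OF that y] by blast
    then show "ev M (act n n (ident (CT T) n) p) y \<longleftrightarrow> ev M p y"
      unfolding ev_act[OF n n h p M y] using y by blast
  qed
next
  fix n m l u v p
  assume nml: "n \<in> ctxs T" "m \<in> ctxs T" "l \<in> ctxs T" and u: "u \<in> hom (CT T) n m" and v: "v \<in> hom (CT T) m l"
    and p: "p \<in> FT_obj T n"
  have h: "comp (CT T) n m l u v \<in> hom (CT T) n l" using CT_comp_hom[OF u v] by simp
  note q = act_FT[OF nml(1,2) u p]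
  show "act n l (comp (CT T) n m l u v) p = act m l v (act n m u p)"
  proof (rule FT_eqI[OF act_FT[OF nml(1,3) h p] act_FT[OF nml(2,3) v q] nml(3)])
    fix M :: "('s, 'r) mdl" and z assume M: "model T M" and z: "env M l z"
    show "ev M (act n l (comp (CT T) n m l u v) p) z \<longleftrightarrow> ev M (act m l v (act n m u p)) z"
      unfolding CT_simps(3) ev_act[OF nml(1,3) CT_comp_hom[OF u v] p M z] ev_act[OF nml(2,3) v q M z]
        ctrel_comp[OF u v]
      using ev_act[OF nml(1,2) u p M] by blast
  qed
next
  fix n m u v p
  assume nm: "n \<in> ctxs T" "m \<in> ctxs T" and u: "u \<in> hom (CT T) n m" and v: "v \<in> hom (CT T) n m"
    and le: "le (CT T) n m u v" and p: "p \<in> FT_obj T n"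
  have "ctrel n m v M x y" if "ctrel n m u M x y" for M :: "('s, 'r) mdl" and x y
    using that wrel_mono[OF CT_homD[OF u] CT_homD[OF v]] le unfolding ctrel_def CT_simps by blast
  then show "FT_le T m (act n m u p) (act n m v p)"
    unfolding FT_le_iff[OF act_FT[OF nm u p] act_FT[OF nm v p] nm(2)]
    using ev_act[OF nm u p] ev_act[OF nm v p] by blast
qed (rule poset_FT)

end

section \<open>The generators of the calculus as maps and reversed maps of contexts\<close>

lemma W_id_cofn: "W_id n = cofn_cospan n n (\<lambda>i. i)"
  by (simp add: W_id_def cofn_cospan_def)

lemmas gen_unfold = gen_tensor_def CT_tensor_def sort_ctx_def at_sort_def CT_id_def CT_swap_def

lemma W_tensor_id0: "W_tensor 0 0 n n (W_id 0) (W_id n) = W_id n"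
  using W_tensor_id[of 0 n] by simp

lemma gen_eta1: "gen_tensor \<sigma> 0 1 eta1 n =
    ct_fn n (sort_ctx \<sigma> 1 \<otimes> n) (\<lambda>\<tau> i. if \<tau> = \<sigma> then Suc i else i)"
proof
  fix \<tau>
  show "gen_tensor \<sigma> 0 1 eta1 n \<tau> = ct_fn n (sort_ctx \<sigma> 1 \<otimes> n) (\<lambda>\<tau> i. if \<tau> = \<sigma> then Suc i else i) \<tau>"
    by (cases "\<tau> = \<sigma>") (simp_all del: One_nat_def add: gen_unfold ct_fn_def tensor_eta1 W_tensor_id0 W_id_fn[symmetric])
qed

lemma gen_mu1: "gen_tensor \<sigma> 2 1 mu1 n =
    ct_fn (sort_ctx \<sigma> 2 \<otimes> n) (sort_ctx \<sigma> 1 \<otimes> n) (\<lambda>\<tau> i. if \<tau> = \<sigma> then i - 1 else i)"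
proof
  fix \<tau>
  show "gen_tensor \<sigma> 2 1 mu1 n \<tau> = ct_fn (sort_ctx \<sigma> 2 \<otimes> n) (sort_ctx \<sigma> 1 \<otimes> n) (\<lambda>\<tau> i. if \<tau> = \<sigma> then i - 1 else i) \<tau>"
    by (cases "\<tau> = \<sigma>") (simp_all del: One_nat_def add: gen_unfold ct_fn_def tensor_mu1 W_tensor_id0 W_id_fn[symmetric])
qed

lemma gen_eps1: "gen_tensor \<sigma> 1 0 eps1 n =
    ct_cofn (sort_ctx \<sigma> 1 \<otimes> n) n (\<lambda>\<tau> i. if \<tau> = \<sigma> then Suc i else i)"
proof
  fix \<tau>
  show "gen_tensor \<sigma> 1 0 eps1 n \<tau> = ct_cofn (sort_ctx \<sigma> 1 \<otimes> n) n (\<lambda>\<tau> i. if \<tau> = \<sigma> then Suc i else i) \<tau>"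
    by (cases "\<tau> = \<sigma>") (simp_all del: One_nat_def add: gen_unfold ct_cofn_def tensor_eps1 W_tensor_id0 W_id_cofn[symmetric])
qed

lemma gen_del1: "gen_tensor \<sigma> 1 2 del1 n =
    ct_cofn (sort_ctx \<sigma> 1 \<otimes> n) (sort_ctx \<sigma> 2 \<otimes> n) (\<lambda>\<tau> i. if \<tau> = \<sigma> then i - 1 else i)"
proof
  fix \<tau>
  show "gen_tensor \<sigma> 1 2 del1 n \<tau> = ct_cofn (sort_ctx \<sigma> 1 \<otimes> n) (sort_ctx \<sigma> 2 \<otimes> n) (\<lambda>\<tau> i. if \<tau> = \<sigma> then i - 1 else i) \<tau>"
    by (cases "\<tau> = \<sigma>") (simp_all del: One_nat_def add: gen_unfold ct_cofn_def tensor_del1 W_tensor_id0 W_id_cofn[symmetric])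
qed

lemma gen_swap: "CT_tensor (n \<otimes> m) (m \<otimes> n) l l (CT_swap n m) (CT_id l) =
    ct_fn (n \<otimes> m \<otimes> l) (m \<otimes> n \<otimes> l) (swap_vars n m)"
  by (rule ext) (simp add: gen_unfold ct_fn_def tensor_swap swap_vars_def[abs_def])

lemma sort_ctx_apply: "sort_ctx \<sigma> k \<tau> = (if \<tau> = \<sigma> then k else 0)"
  by (simp add: sort_ctx_def)

lemma empty_tensor [simp]: "empty_ctx \<otimes> n = n" "n \<otimes> empty_ctx = n"
  by (simp_all add: fun_eq_iff empty_ctx_def)

lemma ctx_map_gens:
  "ctx_map n (sort_ctx \<sigma> 1 \<otimes> n) (\<lambda>\<tau> i. if \<tau> = \<sigma> then Suc i else i)"
  "ctx_map (sort_ctx \<sigma> 2 \<otimes> n) (sort_ctx \<sigma> 1 \<otimes> n) (\<lambda>\<tau> i. if \<tau> = \<sigma> then i - 1 else i)"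
  "ctx_map (n \<otimes> m \<otimes> l) (m \<otimes> n \<otimes> l) (swap_vars n m)"
  by (auto simp: ctx_map_def sort_ctx_apply swap_vars_def split: if_splits)

context regular
begin

text \<open>Along a map the target tuple determines the source tuple, so the image is a
  substitution. Along a reversed map it is a quantification over the fibres, which specialises to
  \<open>\<exists>\<close> for \<open>eps1\<close> and to a conjunction with an equality for
  \<open>del1\<close>.\<close>

lemma
  assumes n: "n \<in> ctxs T" and m: "m \<in> ctxs T" and r: "ctx_map n m r"
  shows act_fn: "fm_in T n \<phi> \<Longrightarrow> act n m (ct_fn n m r) (fm_class T n \<phi>) = fm_class T m (subst r \<phi>)"
    and ev_act_cofn: "fm_in T m \<psi> \<Longrightarrow> model T M \<Longrightarrow> env M n x \<Longrightarrow>
      ev M (act m n (ct_cofn m n r) (fm_class T m \<psi>)) x \<longleftrightarrow>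
      (\<exists>y. env M m y \<and> sat M \<psi> y \<and> (\<forall>\<sigma> i. i < n \<sigma> \<longrightarrow> x \<sigma> i = y \<sigma> (r \<sigma> i)))"
proof -
  have cls: "fm_class T n \<phi> \<in> FT_obj T n" if "fm_in T n \<phi>" for n \<phi>
    using that by (auto simp: FT_obj_def)
  {
    assume \<phi>: "fm_in T n \<phi>"
    have r\<phi>: "fm_in T m (subst r \<phi>)" using ctx_mapD[OF r] by (rule fm_in_subst[OF \<phi>])
    note a = n m ct_fn_hom[OF r n m] cls[OF \<phi>]
    show "act n m (ct_fn n m r) (fm_class T n \<phi>) = fm_class T m (subst r \<phi>)"
    proof (rule FT_eqI[OF act_FT[OF a] cls[OF r\<phi>] m])
      fix M :: "('s, 'r) mdl" and y assume M: "model T M" and y: "env M m y"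
      have e: "env M n (restr n (\<lambda>\<sigma> i. y \<sigma> (r \<sigma> i)))"
        using env_in[OF y] ctx_mapD[OF r] by (intro env_restr) (auto simp: assigns_def)
      have "(\<exists>x. env M n x \<and> ev M (fm_class T n \<phi>) x \<and> ctrel n m (ct_fn n m r) M x y) \<longleftrightarrow>
          sat M (subst r \<phi>) y" (is "?L \<longleftrightarrow> ?R")
      proof
        assume ?L
        then obtain x where x: "env M n x" "sat M \<phi> x" "\<forall>\<sigma> i. i < n \<sigma> \<longrightarrow> x \<sigma> i = y \<sigma> (r \<sigma> i)"
          unfolding ctrel_fn[OF r] using ev_class[OF n \<phi> M] by blast
        then show ?R using sat_subst_cong[OF \<phi>, of y r x M] by simp
      next
        assume ?R
        then have "sat M \<phi> (restr n (\<lambda>\<sigma> i. y \<sigma> (r \<sigma> i)))"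
          using sat_subst_cong[OF \<phi>, of y r "restr n (\<lambda>\<sigma> i. y \<sigma> (r \<sigma> i))" M] by simp
        then show ?L unfolding ctrel_fn[OF r] using e ev_class[OF n \<phi> M e] env_assigns[OF y]
          by (intro exI[of _ "restr n (\<lambda>\<sigma> i. y \<sigma> (r \<sigma> i))"]) simp
      qed
      then show "ev M (act n m (ct_fn n m r) (fm_class T n \<phi>)) y \<longleftrightarrow> ev M (fm_class T m (subst r \<phi>)) y"
        unfolding ev_act[OF a M y] ev_class[OF m r\<phi> M y] .
    qed
  }
  assume \<psi>: "fm_in T m \<psi>" and M: "model T M" and x: "env M n x"
  show "ev M (act m n (ct_cofn m n r) (fm_class T m \<psi>)) x \<longleftrightarrow>
      (\<exists>y. env M m y \<and> sat M \<psi> y \<and> (\<forall>\<sigma> i. i < n \<sigma> \<longrightarrow> x \<sigma> i = y \<sigma> (r \<sigma> i)))"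
    unfolding ev_act[OF m n ct_cofn_hom[OF r n m] cls[OF \<psi>] M x] ctrel_cofn[OF r]
    using ev_class[OF m \<psi> M] env_assigns by blast
qed

lemma is_FT_act: "is_FT T act"
  unfolding is_FT_def
proof (intro conjI ballI allI impI act_functor)
  fix n \<sigma> assume n: "n \<in> ctxs T" and \<sigma>: "\<sigma> \<in> sorts T"
  have n1: "sort_ctx \<sigma> 1 \<otimes> n \<in> ctxs T" and n2: "sort_ctx \<sigma> 2 \<otimes> n \<in> ctxs T"
    using n \<sigma> by (auto intro: ctxs_tensor ctxs_sort)
  have cls: "fm_class T n \<phi> \<in> FT_obj T n" if "fm_in T n \<phi>" for n \<phi>
    using that by (auto simp: FT_obj_def)
  fix \<phi>
  show "act n (sort_ctx \<sigma> 1 \<otimes> n) (gen_tensor \<sigma> 0 1 eta1 n) (fm_class T n \<phi>) =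
      fm_class T (sort_ctx \<sigma> 1 \<otimes> n) (weaken \<sigma> \<phi>)" if "fm_in T n \<phi>"
    unfolding gen_eta1 weaken_def by (rule act_fn[OF n n1 ctx_map_gens(1) that])
  show "act (sort_ctx \<sigma> 2 \<otimes> n) (sort_ctx \<sigma> 1 \<otimes> n) (gen_tensor \<sigma> 2 1 mu1 n)
      (fm_class T (sort_ctx \<sigma> 2 \<otimes> n) \<phi>) =
      fm_class T (sort_ctx \<sigma> 1 \<otimes> n) (subst (\<lambda>\<tau> i. if \<tau> = \<sigma> then i - 1 else i) \<phi>)"
    if "fm_in T (sort_ctx \<sigma> 2 \<otimes> n) \<phi>"
    unfolding gen_mu1 by (rule act_fn[OF n2 n1 ctx_map_gens(2) that])
  show "act (sort_ctx \<sigma> 1 \<otimes> n) n (gen_tensor \<sigma> 1 0 eps1 n) (fm_class T (sort_ctx \<sigma> 1 \<otimes> n) \<phi>) =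
      fm_class T n (Ex \<sigma> \<phi>)" if \<phi>: "fm_in T (sort_ctx \<sigma> 1 \<otimes> n) \<phi>"
  proof -
    have "sort_ctx \<sigma> 1 \<otimes> n = n(\<sigma> := Suc (n \<sigma>))" by (simp add: fun_eq_iff sort_ctx_apply)
    then have E: "fm_in T n (Ex \<sigma> \<phi>)" using \<phi> \<sigma> by simp
    have h: "ct_cofn (sort_ctx \<sigma> 1 \<otimes> n) n (\<lambda>\<tau> i. if \<tau> = \<sigma> then Suc i else i) \<in> hom (CT T) (sort_ctx \<sigma> 1 \<otimes> n) n"
      by (rule ct_cofn_hom[OF ctx_map_gens(1) n n1])
    show ?thesis unfolding gen_eps1
    proof (rule FT_eqI[OF act_FT[OF n1 n h cls[OF \<phi>]] cls[OF E] n])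
      fix M :: "('s, 'r) mdl" and x assume M: "model T M" and x: "env M n x"
      show "ev M (act (sort_ctx \<sigma> 1 \<otimes> n) n (ct_cofn (sort_ctx \<sigma> 1 \<otimes> n) n (\<lambda>\<tau> i. if \<tau> = \<sigma> then Suc i else i))
          (fm_class T (sort_ctx \<sigma> 1 \<otimes> n) \<phi>)) x \<longleftrightarrow> ev M (fm_class T n (Ex \<sigma> \<phi>)) x"
        unfolding ev_act_cofn[OF n n1 ctx_map_gens(1) \<phi> M x] ev_class[OF n E M x] sat.simps
      proof
        assume "\<exists>y. env M (sort_ctx \<sigma> 1 \<otimes> n) y \<and> sat M \<phi> y \<and>
          (\<forall>\<tau> i. i < n \<tau> \<longrightarrow> x \<tau> i = y \<tau> (if \<tau> = \<sigma> then Suc i else i))"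
        then obtain y where y: "env M (sort_ctx \<sigma> 1 \<otimes> n) y" "sat M \<phi> y"
          "\<forall>\<tau> i. i < n \<tau> \<longrightarrow> x \<tau> i = y \<tau> (if \<tau> = \<sigma> then Suc i else i)" by blast
        have "y \<sigma> 0 \<in> crr M \<sigma>" using env_in[OF y(1), of 0 \<sigma>] by (simp add: sort_ctx_apply)
        moreover have "sat M \<phi> (push \<sigma> (y \<sigma> 0) x) \<longleftrightarrow> sat M \<phi> y"
          using y(3) by (intro sat_cong[OF \<phi>]) (auto simp: push_def sort_ctx_apply split: nat.splits if_splits)
        ultimately show "\<exists>a\<in>crr M \<sigma>. sat M \<phi> (push \<sigma> a x)" using y(2) by blast
      next
        assume "\<exists>a\<in>crr M \<sigma>. sat M \<phi> (push \<sigma> a x)"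
        then obtain a where a: "a \<in> crr M \<sigma>" "sat M \<phi> (push \<sigma> a x)" by blast
        have "env M (sort_ctx \<sigma> 1 \<otimes> n) (push \<sigma> a x)"
          using a(1) x unfolding env_def by (auto simp: push_def sort_ctx_apply split: nat.splits)
        then show "\<exists>y. env M (sort_ctx \<sigma> 1 \<otimes> n) y \<and> sat M \<phi> y \<and>
          (\<forall>\<tau> i. i < n \<tau> \<longrightarrow> x \<tau> i = y \<tau> (if \<tau> = \<sigma> then Suc i else i))"
          using a(2) by (intro exI[of _ "push \<sigma> a x"]) (simp add: push_def)
      qed
    qed
  qed
  show "act (sort_ctx \<sigma> 1 \<otimes> n) (sort_ctx \<sigma> 2 \<otimes> n) (gen_tensor \<sigma> 1 2 del1 n)
      (fm_class T (sort_ctx \<sigma> 1 \<otimes> n) \<phi>) = fm_class T (sort_ctx \<sigma> 2 \<otimes> n)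
        (Conj (subst (\<lambda>\<tau> i. if \<tau> = \<sigma> \<and> 0 < i then Suc i else i) \<phi>) (Eq \<sigma> 0 1))"
    if \<phi>: "fm_in T (sort_ctx \<sigma> 1 \<otimes> n) \<phi>"
  proof -
    \<comment> \<open>The map \<open>?r\<close> merges variables 0 and 1, and \<open>?s\<close> is a
      section of it; the equation \<open>x \<sigma> 0 = x \<sigma> 1\<close> says that
      \<open>x\<close> factors through \<open>?r\<close>.\<close>
    let ?s = "\<lambda>\<tau> i. if \<tau> = \<sigma> \<and> 0 < i then Suc i else i" and ?r = "\<lambda>\<tau> i. if \<tau> = \<sigma> then i - 1 else i"
    have s: "ctx_map (sort_ctx \<sigma> 1 \<otimes> n) (sort_ctx \<sigma> 2 \<otimes> n) ?s"
      by (auto simp: ctx_map_def sort_ctx_apply split: if_splits)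
    have C: "fm_in T (sort_ctx \<sigma> 2 \<otimes> n) (Conj (subst ?s \<phi>) (Eq \<sigma> 0 1))"
    proof -
      have "fm_in T (sort_ctx \<sigma> 2 \<otimes> n) (subst ?s \<phi>)" by (rule fm_in_subst[OF \<phi>]) (rule ctx_mapD[OF s])
      then show ?thesis by (simp add: sort_ctx_apply)
    qed
    have h: "ct_cofn (sort_ctx \<sigma> 1 \<otimes> n) (sort_ctx \<sigma> 2 \<otimes> n) ?r \<in> hom (CT T) (sort_ctx \<sigma> 1 \<otimes> n) (sort_ctx \<sigma> 2 \<otimes> n)"
      by (rule ct_cofn_hom[OF ctx_map_gens(2) n2 n1])
    show ?thesis unfolding gen_del1
    proof (rule FT_eqI[OF act_FT[OF n1 n2 h cls[OF \<phi>]] cls[OF C] n2])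
      fix M :: "('s, 'r) mdl" and x assume M: "model T M" and x: "env M (sort_ctx \<sigma> 2 \<otimes> n) x"
      show "ev M (act (sort_ctx \<sigma> 1 \<otimes> n) (sort_ctx \<sigma> 2 \<otimes> n) (ct_cofn (sort_ctx \<sigma> 1 \<otimes> n) (sort_ctx \<sigma> 2 \<otimes> n) ?r)
          (fm_class T (sort_ctx \<sigma> 1 \<otimes> n) \<phi>)) x \<longleftrightarrow>
          ev M (fm_class T (sort_ctx \<sigma> 2 \<otimes> n) (Conj (subst ?s \<phi>) (Eq \<sigma> 0 1))) x"
        unfolding ev_act_cofn[OF n2 n1 ctx_map_gens(2) \<phi> M x] ev_class[OF n2 C M x] sat.simps
      proof
        assume "\<exists>y. env M (sort_ctx \<sigma> 1 \<otimes> n) y \<and> sat M \<phi> y \<and>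
          (\<forall>\<tau> i. i < (sort_ctx \<sigma> 2 \<otimes> n) \<tau> \<longrightarrow> x \<tau> i = y \<tau> (?r \<tau> i))"
        then obtain y where y: "sat M \<phi> y"
          "\<And>\<tau> i. i < (sort_ctx \<sigma> 2 \<otimes> n) \<tau> \<Longrightarrow> x \<tau> i = y \<tau> (?r \<tau> i)" by blast
        have "sat M (subst ?s \<phi>) x \<longleftrightarrow> sat M \<phi> y"
        proof (rule sat_subst_cong[OF \<phi>])
          fix \<tau> i assume "i < (sort_ctx \<sigma> 1 \<otimes> n) \<tau>"
          then show "x \<tau> (?s \<tau> i) = y \<tau> i" by (subst y(2)) (auto simp: sort_ctx_apply)
        qed
        moreover have "x \<sigma> 0 = x \<sigma> 1" using y(2)[of 0 \<sigma>] y(2)[of 1 \<sigma>] by (simp add: sort_ctx_apply)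
        ultimately show "sat M (subst ?s \<phi>) x \<and> x \<sigma> 0 = x \<sigma> 1" using y(1) by blast
      next
        assume a: "sat M (subst ?s \<phi>) x \<and> x \<sigma> 0 = x \<sigma> 1"
        let ?y = "restr (sort_ctx \<sigma> 1 \<otimes> n) (\<lambda>\<tau> i. x \<tau> (?s \<tau> i))"
        have y1: "env M (sort_ctx \<sigma> 1 \<otimes> n) ?y"
          using env_in[OF x] ctx_mapD[OF s] by (intro env_restr) (auto simp: assigns_def)
        have y2: "sat M (subst ?s \<phi>) x \<longleftrightarrow> sat M \<phi> ?y"
          by (rule sat_subst_cong[OF \<phi>]) (simp del: tensor_apply)
        have y3: "x \<tau> i = ?y \<tau> (?r \<tau> i)" if i: "i < (sort_ctx \<sigma> 2 \<otimes> n) \<tau>" for \<tau> i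
        proof -
          have "?r \<tau> i < (sort_ctx \<sigma> 1 \<otimes> n) \<tau>" by (rule ctx_mapD[OF ctx_map_gens(2) i])
          then have "?y \<tau> (?r \<tau> i) = x \<tau> (?s \<tau> (?r \<tau> i))" by (rule restr_same)
          also have "\<dots> = x \<tau> i"
          proof (cases "\<tau> = \<sigma>")
            case True
            consider "i = 0" | "i = 1" | "1 < i" by linarith
            then show ?thesis using a True by cases simp_all
          qed simp
          finally show ?thesis by simp
        qed
        show "\<exists>y. env M (sort_ctx \<sigma> 1 \<otimes> n) y \<and> sat M \<phi> y \<and>
          (\<forall>\<tau> i. i < (sort_ctx \<sigma> 2 \<otimes> n) \<tau> \<longrightarrow> x \<tau> i = y \<tau> (?r \<tau> i))"
          by (rule exI[of _ ?y], intro conjI allI impI y1 y3) (use a y2 in blast)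
      qed
    qed
  qed
next
  fix n m l \<phi>
  assume nml: "n \<in> ctxs T" "m \<in> ctxs T" "l \<in> ctxs T" and \<phi>: "fm_in T (n \<otimes> m \<otimes> l) \<phi>"
  show "act (n \<otimes> m \<otimes> l) (m \<otimes> n \<otimes> l) (CT_tensor (n \<otimes> m) (m \<otimes> n) l l (CT_swap n m) (CT_id l))
      (fm_class T (n \<otimes> m \<otimes> l) \<phi>) = fm_class T (m \<otimes> n \<otimes> l) (subst (swap_vars n m) \<phi>)"
    unfolding gen_swap using nml by (intro act_fn[OF _ _ ctx_map_gens(3) \<phi>]) (auto intro: ctxs_tensor)
qed

subsection \<open>Uniqueness\<close>

lemma ctx_induct [consumes 1, case_names empty add]:
  assumes "n \<in> ctxs T" "Q empty_ctx"
    "\<And>\<sigma> n. \<sigma> \<in> sorts T \<Longrightarrow> n \<in> ctxs T \<Longrightarrow> Q n \<Longrightarrow> Q (sort_ctx \<sigma> 1 \<otimes> n)"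
  shows "Q n"
proof -
  obtain ss where "set ss \<subseteq> sorts T" "count_list ss = n" using ctx_list[OF assms(1)] by blast
  then show ?thesis
  proof (induction ss arbitrary: n)
    case Nil
    then have "n = empty_ctx" by (auto simp: empty_ctx_def fun_eq_iff)
    then show ?case using assms(2) by simp
  next
    case (Cons s ss)
    have "count_list (s # ss) = sort_ctx s 1 \<otimes> count_list ss" by (simp add: sort_ctx_apply fun_eq_iff)
    then have "n = sort_ctx s 1 \<otimes> count_list ss" using Cons.prems(2) by (simp only:)
    moreover have "count_list ss \<in> ctxs T" using Cons.prems(1) by (intro count_list_ctxs) simp
    moreover have "Q (count_list ss)" "s \<in> sorts T" using Cons.IH[OF _ refl] Cons.prems(1) by auto
    ultimately show ?case using assms(3) by blast
  qed
qed

context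
  fixes P P' :: "('s, 'r) calculus"
  assumes P: "is_FT T P" and P': "is_FT T P'"
begin

definition agree :: "'s ctx \<Rightarrow> 's ctx \<Rightarrow> 's ct_mor \<Rightarrow> bool" where
  "agree n m w \<longleftrightarrow> w \<in> hom (CT T) n m \<and> (\<forall>p\<in>FT_obj T n. P n m w p = P' n m w p)"

lemma pf:
  assumes "is_FT T Q" "n \<in> ctxs T" "m \<in> ctxs T" "w \<in> hom (CT T) n m"
  shows "Q n m w \<in> FT_obj T n \<rightarrow>\<^sub>E FT_obj T m"
    "p \<in> FT_obj T n \<Longrightarrow> q \<in> FT_obj T n \<Longrightarrow> FT_le T n p q \<Longrightarrow> FT_le T m (Q n m w p) (Q n m w q)"
    "v \<in> hom (CT T) n m \<Longrightarrow> le (CT T) n m w v \<Longrightarrow> p \<in> FT_obj T n \<Longrightarrow> FT_le T m (Q n m w p) (Q n m v p)"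
    "l \<in> ctxs T \<Longrightarrow> v \<in> hom (CT T) m l \<Longrightarrow> p \<in> FT_obj T n \<Longrightarrow>
      Q n l (comp (CT T) n m l w v) p = Q m l v (Q n m w p)"
proof -
  have f: "po_functor_to_posets T Q" using assms(1) unfolding is_FT_def by (rule conjunct1)
  note f = f[unfolded po_functor_to_posets_def CT_simps(1), THEN conjunct2, THEN conjunct2]
  note f1 = f[THEN conjunct1] and f2 = f[THEN conjunct2, THEN conjunct2, THEN conjunct1]
    and f3 = f[THEN conjunct2, THEN conjunct2, THEN conjunct2]
  show "Q n m w \<in> FT_obj T n \<rightarrow>\<^sub>E FT_obj T m" using f1 assms(2-4) by blast
  show "p \<in> FT_obj T n \<Longrightarrow> q \<in> FT_obj T n \<Longrightarrow> FT_le T n p q \<Longrightarrow> FT_le T m (Q n m w p) (Q n m w q)"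
    using f1 assms(2-4) by blast
  show "v \<in> hom (CT T) n m \<Longrightarrow> le (CT T) n m w v \<Longrightarrow> p \<in> FT_obj T n \<Longrightarrow> FT_le T m (Q n m w p) (Q n m v p)"
    using f3 assms(2-4) by blast
  show "l \<in> ctxs T \<Longrightarrow> v \<in> hom (CT T) m l \<Longrightarrow> p \<in> FT_obj T n \<Longrightarrow>
      Q n l (comp (CT T) n m l w v) p = Q m l v (Q n m w p)"
    using f2 assms(2-4) by blast
qed

lemma pf_ident: "is_FT T Q \<Longrightarrow> n \<in> ctxs T \<Longrightarrow> p \<in> FT_obj T n \<Longrightarrow> Q n n (\<lambda>\<sigma>. W_id (n \<sigma>)) p = p"
proof -
  assume Q: "is_FT T Q" and n: "n \<in> ctxs T" and p: "p \<in> FT_obj T n"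
  have f: "po_functor_to_posets T Q" using Q unfolding is_FT_def by (rule conjunct1)
  note f = f[unfolded po_functor_to_posets_def CT_simps(1,2), THEN conjunct2, THEN conjunct2,
    THEN conjunct2, THEN conjunct1]
  then show ?thesis using n p by blast
qed

lemma pf_undefined:
  assumes "is_FT T Q" "\<not> (n \<in> ctxs T \<and> m \<in> ctxs T \<and> w \<in> hom (CT T) n m)"
  shows "Q n m w = undefined"
proof -
  have f: "po_functor_to_posets T Q" using assms(1) unfolding is_FT_def by (rule conjunct1)
  note f = f[unfolded po_functor_to_posets_def CT_simps(1), THEN conjunct2, THEN conjunct1]
  then show ?thesis using assms(2) by blast
qed

lemma pf_in:
  assumes "is_FT T Q" "n \<in> ctxs T" "m \<in> ctxs T" "w \<in> hom (CT T) n m" "p \<in> FT_obj T n"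
  shows "Q n m w p \<in> FT_obj T m"
  using pf(1)[OF assms(1-4)] assms(5) by (rule PiE_mem)

lemma agree_comp:
  assumes "n \<in> ctxs T" "m \<in> ctxs T" "l \<in> ctxs T" "agree n m u" "agree m l v"
  shows "agree n l (\<lambda>\<sigma>. W_comp (n \<sigma>) (m \<sigma>) (l \<sigma>) (u \<sigma>) (v \<sigma>))"
proof -
  have u: "u \<in> hom (CT T) n m" and v: "v \<in> hom (CT T) m l" using assms(4,5) by (auto simp: agree_def)
  have "P n l (comp (CT T) n m l u v) p = P' n l (comp (CT T) n m l u v) p" if p: "p \<in> FT_obj T n" for p
    using pf(4)[OF P assms(1,2) u assms(3) v p] pf(4)[OF P' assms(1,2) u assms(3) v p]
      pf_in[OF P assms(1,2) u p] assms(4,5) p by (simp add: agree_def)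
  then show ?thesis unfolding agree_def using CT_comp_hom[OF u v] by simp
qed

lemma agree_ident: "n \<in> ctxs T \<Longrightarrow> agree n n (\<lambda>\<sigma>. W_id (n \<sigma>))"
  unfolding agree_def using CT_ident_hom pf_ident[OF P] pf_ident[OF P'] by simp

abbreviation agree_fn :: "'s ctx \<Rightarrow> 's ctx \<Rightarrow> ('s \<Rightarrow> nat \<Rightarrow> nat) \<Rightarrow> bool" where
  "agree_fn n m r \<equiv> ctx_map n m r \<and> agree n m (ct_fn n m r)"

text \<open>The equation is asked for only inside the context, which lets a composite be stated by
  any convenient renaming.\<close>

lemma agree_fn_comp:
  assumes "n \<in> ctxs T" "m \<in> ctxs T" "l \<in> ctxs T" "agree_fn n m r" "agree_fn m l s"
    and eq: "\<And>\<sigma> i. i < n \<sigma> \<Longrightarrow> s \<sigma> (r \<sigma> i) = t \<sigma> i"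
  shows "agree_fn n l t"
proof
  have rs: "ctx_map n m r" "ctx_map m l s" using assms by auto
  show "ctx_map n l t" unfolding ctx_map_def using ctx_mapD[OF rs(2) ctx_mapD[OF rs(1)]] eq by fastforce
  have e: "ct_fn n l t = ct_fn n l (\<lambda>\<sigma> i. s \<sigma> (r \<sigma> i))" by (rule ct_fn_cong) (simp add: eq)
  show "agree n l (ct_fn n l t)" unfolding e CT_comp_fn[OF rs, symmetric]
    by (rule agree_comp[OF assms(1-3) assms(4)[THEN conjunct2] assms(5)[THEN conjunct2]])
qed

lemma agree_fn_id: "n \<in> ctxs T \<Longrightarrow> (\<And>\<sigma> i. i < n \<sigma> \<Longrightarrow> r \<sigma> i = i) \<Longrightarrow> agree_fn n n r"
proof -
  assume n: "n \<in> ctxs T" and r: "\<And>\<sigma> i. i < n \<sigma> \<Longrightarrow> r \<sigma> i = i"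
  have "ct_fn n n r = (\<lambda>\<sigma>. W_id (n \<sigma>))"
    unfolding W_id_fn ct_fn_def using r by (intro ext fn_cospan_cong) auto
  then show ?thesis using agree_ident[OF n] r by (simp add: ctx_map_def)
qed

lemma FT_obj_cases: "p \<in> FT_obj T n \<Longrightarrow> (\<And>\<phi>. fm_in T n \<phi> \<Longrightarrow> p = fm_class T n \<phi> \<Longrightarrow> thesis) \<Longrightarrow> thesis"
  unfolding FT_obj_def by blast

lemma agree_eta:
  assumes "n \<in> ctxs T" "\<sigma> \<in> sorts T"
  shows "agree_fn n (sort_ctx \<sigma> 1 \<otimes> n) (\<lambda>\<tau> i. if \<tau> = \<sigma> then Suc i else i)"
proof -
  have "P n (sort_ctx \<sigma> 1 \<otimes> n) (gen_tensor \<sigma> 0 1 eta1 n) p = P' n (sort_ctx \<sigma> 1 \<otimes> n) (gen_tensor \<sigma> 0 1 eta1 n) p"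
    if "p \<in> FT_obj T n" for p
    using that by (rule FT_obj_cases) (use P P' assms in \<open>simp add: is_FT_def\<close>)
  then show ?thesis unfolding agree_def gen_eta1
    by (intro conjI ballI ctx_map_gens(1) ct_fn_hom ctxs_tensor ctxs_sort assms)
qed

lemma agree_mu:
  assumes "n \<in> ctxs T" "\<sigma> \<in> sorts T"
  shows "agree_fn (sort_ctx \<sigma> 2 \<otimes> n) (sort_ctx \<sigma> 1 \<otimes> n) (\<lambda>\<tau> i. if \<tau> = \<sigma> then i - 1 else i)"
proof -
  have "P (sort_ctx \<sigma> 2 \<otimes> n) (sort_ctx \<sigma> 1 \<otimes> n) (gen_tensor \<sigma> 2 1 mu1 n) p =
      P' (sort_ctx \<sigma> 2 \<otimes> n) (sort_ctx \<sigma> 1 \<otimes> n) (gen_tensor \<sigma> 2 1 mu1 n) p"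
    if "p \<in> FT_obj T (sort_ctx \<sigma> 2 \<otimes> n)" for p
    using that by (rule FT_obj_cases) (use P P' assms in \<open>simp add: is_FT_def\<close>)
  then show ?thesis unfolding agree_def gen_mu1
    by (intro conjI ballI ctx_map_gens(2) ct_fn_hom ctxs_tensor ctxs_sort assms)
qed

lemma agree_swap:
  assumes "n \<in> ctxs T" "m \<in> ctxs T" "l \<in> ctxs T"
  shows "agree_fn (n \<otimes> m \<otimes> l) (m \<otimes> n \<otimes> l) (swap_vars n m)"
proof -
  let ?w = "CT_tensor (n \<otimes> m) (m \<otimes> n) l l (CT_swap n m) (CT_id l)"
  have "P (n \<otimes> m \<otimes> l) (m \<otimes> n \<otimes> l) ?w p = P' (n \<otimes> m \<otimes> l) (m \<otimes> n \<otimes> l) ?w p"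
    if "p \<in> FT_obj T (n \<otimes> m \<otimes> l)" for p
    using that by (rule FT_obj_cases) (use P P' assms in \<open>simp add: is_FT_def\<close>)
  then show ?thesis unfolding agree_def gen_swap
    by (intro conjI ballI ctx_map_gens(3) ct_fn_hom ctxs_tensor assms)
qed

text \<open>Weakening by a whole context is iterated \<open>eta1\<close>, one variable at a
  time.\<close>

lemma agree_inr:
  assumes "m \<in> ctxs T" "n \<in> ctxs T" shows "agree_fn n (m \<otimes> n) (\<lambda>\<sigma> i. m \<sigma> + i)"
  using assms(1)
proof (induction rule: ctx_induct)
  case empty
  show ?case using agree_fn_id[OF assms(2), of "\<lambda>\<sigma> i. empty_ctx \<sigma> + i"] by (simp add: empty_ctx_def)
next
  case (add \<sigma> m)
  have c: "sort_ctx \<sigma> 1 \<otimes> m \<otimes> n = sort_ctx \<sigma> 1 \<otimes> (m \<otimes> n)" by (rule tensor_assoc)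
  have mn: "m \<otimes> n \<in> ctxs T" using add assms(2) by (auto intro: ctxs_tensor)
  have "sort_ctx \<sigma> 1 \<otimes> (m \<otimes> n) \<in> ctxs T" using mn add by (auto intro: ctxs_tensor ctxs_sort)
  note * = agree_fn_comp[OF assms(2) mn this add(3) agree_eta[OF mn add(1)]]
  show ?case unfolding c by (rule *) (simp add: sort_ctx_apply)
qed

text \<open>The generators add variables in front only, so the inclusion on the other side needs a
  symmetry.\<close>

lemma agree_inl:
  assumes "n \<in> ctxs T" "m \<in> ctxs T" shows "agree_fn n (n \<otimes> m) (\<lambda>\<sigma> i. i)"
proof -
  have s: "agree_fn (m \<otimes> n) (n \<otimes> m) (swap_vars m n)"
    using agree_swap[OF assms(2,1) ctxs_empty] by simp
  show ?thesis
    by (rule agree_fn_comp[OF assms(1) _ _ agree_inr[OF assms(2,1)] s])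
      (use assms in \<open>auto intro: ctxs_tensor simp: swap_vars_def\<close>)
qed

text \<open>Merges a new variable, of index 0, into variable \<open>p\<close>. As \<open>mu1\<close>
  merges only the two foremost variables, the new one is moved past the first \<open>p\<close>
  variables, the resulting pair is moved to the front and merged there, and the result is moved back
  to position \<open>p\<close>. The context \<open>d\<close> holds the variables of this sort above
  \<open>p\<close> together with all other sorts.\<close>

lemma agree_merge:
  assumes c: "c \<in> ctxs T" and \<sigma>: "\<sigma> \<in> sorts T" and p: "p < c \<sigma>"
  shows "agree_fn (sort_ctx \<sigma> 1 \<otimes> c) c
    (\<lambda>\<tau> i. if \<tau> = \<sigma> then (case i of 0 \<Rightarrow> p | Suc j \<Rightarrow> j) else i)"
proof -
  define d where "d = c(\<sigma> := c \<sigma> - Suc p)"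
  have "{\<tau>. d \<tau> \<noteq> 0} \<subseteq> {\<tau>. c \<tau> \<noteq> 0}" by (auto simp: d_def)
  then have d: "d \<in> ctxs T" using c unfolding ctxs_def by (auto intro: finite_subset)
  let ?p = "sort_ctx \<sigma> p" and ?a = "sort_ctx \<sigma> 1" and ?b = "sort_ctx \<sigma> 2"
  have k: "sort_ctx \<sigma> j \<in> ctxs T" for j using \<sigma> by (rule ctxs_sort)
  have ceq: "?p \<otimes> ?a \<otimes> d = c" using p by (auto simp: fun_eq_iff sort_ctx_apply d_def)
  have 1: "agree_fn (?a \<otimes> c) (?p \<otimes> ?b \<otimes> d) (swap_vars ?a ?p)"
  proof -
    have "?a \<otimes> ?p \<otimes> (?a \<otimes> d) = ?a \<otimes> c" "?p \<otimes> ?a \<otimes> (?a \<otimes> d) = ?p \<otimes> ?b \<otimes> d"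
      by (simp_all add: ceq[symmetric] fun_eq_iff sort_ctx_apply)
    then show ?thesis using agree_swap[OF k k ctxs_tensor[OF k d], of 1 p 1] by simp
  qed
  have 2: "agree_fn (?p \<otimes> ?b \<otimes> d) (?b \<otimes> ?p \<otimes> d) (swap_vars ?p ?b)" by (rule agree_swap[OF k k d])
  have 3: "agree_fn (?b \<otimes> ?p \<otimes> d) (?a \<otimes> ?p \<otimes> d) (\<lambda>\<tau> i. if \<tau> = \<sigma> then i - 1 else i)"
    using agree_mu[OF ctxs_tensor[OF k d] \<sigma>] by (simp only: tensor_assoc)
  have 4: "agree_fn (?a \<otimes> ?p \<otimes> d) c (swap_vars ?a ?p)" using agree_swap[OF k k d, of 1 p] ceq by simp
  note [intro] = ctxs_tensor k d c
  have 12: "agree_fn (?a \<otimes> c) (?b \<otimes> ?p \<otimes> d) (\<lambda>\<tau> i. swap_vars ?p ?b \<tau> (swap_vars ?a ?p \<tau> i))"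
    by (rule agree_fn_comp[OF _ _ _ 1 2]) auto
  have 34: "agree_fn (?b \<otimes> ?p \<otimes> d) c (\<lambda>\<tau> i. swap_vars ?a ?p \<tau> (if \<tau> = \<sigma> then i - 1 else i))"
    by (rule agree_fn_comp[OF _ _ _ 3 4]) auto
  show ?thesis
  proof (rule agree_fn_comp[OF _ _ _ 12 34])
    fix \<tau> i assume "i < (?a \<otimes> c) \<tau>"
    show "swap_vars ?a ?p \<tau> (if \<tau> = \<sigma> then swap_vars ?p ?b \<tau> (swap_vars ?a ?p \<tau> i) - 1
        else swap_vars ?p ?b \<tau> (swap_vars ?a ?p \<tau> i)) =
      (if \<tau> = \<sigma> then (case i of 0 \<Rightarrow> p | Suc j \<Rightarrow> j) else i)"
      by (cases i) (auto simp: swap_vars_def sort_ctx_apply)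
  qed auto
qed

text \<open>The copairing of \<open>r\<close> with the identity of \<open>m\<close>, obtained by
  merging the variables of \<open>n\<close> one by one into their images. Every map \<open>r\<close>
  is the inclusion \<open>agree_inl\<close> followed by this.\<close>

lemma agree_fold:
  assumes n: "n \<in> ctxs T" and m: "m \<in> ctxs T"
  shows "ctx_map n m r \<Longrightarrow> agree_fn (n \<otimes> m) m (\<lambda>\<sigma> i. if i < n \<sigma> then r \<sigma> i else i - n \<sigma>)"
  using n
proof (induction arbitrary: r rule: ctx_induct)
  case empty
  show ?case using agree_fn_id[OF m] by (simp add: empty_ctx_def)
next
  case (add \<sigma> n)
  let ?r = "\<lambda>\<tau> i. if \<tau> = \<sigma> then r \<sigma> (Suc i) else r \<tau> i"
  have r0: "r \<sigma> 0 < m \<sigma>" using ctx_mapD[OF add.prems, of 0 \<sigma>] by (simp add: sort_ctx_apply)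
  have r: "ctx_map n m ?r"
    using add.prems by (auto simp: ctx_map_def sort_ctx_apply split: if_splits)
  have nm: "n \<otimes> m \<in> ctxs T" using add(2) m by (rule ctxs_tensor)
  \<comment> \<open>The image \<open>r \<sigma> 0\<close> is a variable of \<open>m\<close>, hence
    has index \<open>n \<sigma> + r \<sigma> 0\<close> in \<open>n \<otimes> m\<close>.\<close>
  have merge: "agree_fn (sort_ctx \<sigma> 1 \<otimes> (n \<otimes> m)) (n \<otimes> m)
    (\<lambda>\<tau> i. if \<tau> = \<sigma> then (case i of 0 \<Rightarrow> n \<sigma> + r \<sigma> 0 | Suc j \<Rightarrow> j) else i)"
    by (rule agree_merge[OF nm add(1)]) (simp add: r0)
  show ?case unfolding tensor_assoc[of "sort_ctx \<sigma> 1"]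
    by (rule agree_fn_comp[OF _ nm m merge add(3)[OF r]])
      (use nm add(1) in \<open>auto intro: ctxs_tensor ctxs_sort simp: sort_ctx_apply split: nat.splits\<close>)
qed

lemma agree_fn:
  assumes n: "n \<in> ctxs T" and m: "m \<in> ctxs T" and r: "ctx_map n m r"
  shows "agree n m (ct_fn n m r)"
proof -
  have "agree_fn n m r"
    by (rule agree_fn_comp[OF n ctxs_tensor[OF n m] m agree_inl[OF n m] agree_fold[OF n m r]]) simp
  then show ?thesis ..
qed

text \<open>The cospan of a map, read backwards, is adjoint to the cospan read forwards. Adjoints of
  monotone maps between posets are unique, so the values on maps determine all others.\<close>

lemma cofn_le:
  assumes Q: "is_FT T Q" and Q': "is_FT T Q'"
    and n: "n \<in> ctxs T" and m: "m \<in> ctxs T" and r: "ctx_map n m r" and p: "p \<in> FT_obj T m"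
    and eq: "\<And>p. p \<in> FT_obj T n \<Longrightarrow> Q n m (ct_fn n m r) p = Q' n m (ct_fn n m r) p"
  shows "FT_le T n (Q m n (ct_cofn m n r) p) (Q' m n (ct_cofn m n r) p)"
proof -
  let ?f = "ct_fn n m r" and ?g = "ct_cofn m n r"
  note f = ct_fn_hom[OF r n m] and g = ct_cofn_hom[OF r n m] and ra = ctx_map_all[OF r]
  note fW = fn_cospan_hom[OF ra] and gW = cofn_cospan_hom[OF ra]
  have fg: "comp (CT T) n m n ?f ?g \<in> hom (CT T) n n" and gf: "comp (CT T) m n m ?g ?f \<in> hom (CT T) m m"
    using CT_comp_hom[OF f g] CT_comp_hom[OF g f] by simp_all
  have le1: "le (CT T) n n (comp (CT T) n m n ?f ?g) (\<lambda>\<sigma>. W_id (n \<sigma>))"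
    unfolding CT_simps ct_fn_def ct_cofn_def
    by (auto simp: W_le_iff[OF W_comp_hom[OF fW gW] W_id_hom] wrel_W_comp[OF fW gW] wrel_fn_cospan[OF ra]
      wrel_cofn_cospan[OF ra] wrel_W_id ra)
  have le2: "le (CT T) m m (\<lambda>\<sigma>. W_id (m \<sigma>)) (comp (CT T) m n m ?g ?f)"
    unfolding CT_simps ct_fn_def ct_cofn_def
  proof
    fix \<sigma>
    have "\<exists>y. (\<forall>j<m \<sigma>. x j \<in> D) \<and> (\<forall>i<n \<sigma>. y i = x (r \<sigma> i)) \<and> (\<forall>j<m \<sigma>. z j \<in> D) \<and> (\<forall>i<n \<sigma>. y i = z (r \<sigma> i))"
      if "\<forall>i<m \<sigma>. z i \<in> D \<and> x i = z i" for D :: "nat set" and x z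
      using that ra by (intro exI[of _ "\<lambda>i. z (r \<sigma> i)"]) auto
    then show "le Wcat (m \<sigma>) (m \<sigma>) (W_id (m \<sigma>)) (W_comp (m \<sigma>) (n \<sigma>) (m \<sigma>)
        (cofn_cospan (m \<sigma>) (n \<sigma>) (r \<sigma>)) (fn_cospan (n \<sigma>) (m \<sigma>) (r \<sigma>)))"
      unfolding W_le_iff[OF W_id_hom W_comp_hom[OF gW fW]] wrel_W_comp[OF gW fW] wrel_fn_cospan[OF ra]
        wrel_cofn_cospan[OF ra] wrel_W_id by blast
  qed
  let ?q = "Q' m n ?g p"
  have q: "?q \<in> FT_obj T n" by (rule pf_in[OF Q' m n g p])
  have fq: "Q n m ?f ?q \<in> FT_obj T m" by (rule pf_in[OF Q n m f q])
  \<comment> \<open>The unit of the adjunction under \<open>Q'\<close>. Its map part may be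
    exchanged for that of \<open>Q\<close>; applying the reversed map under \<open>Q\<close> and
    then the counit under \<open>Q\<close> closes the chain.\<close>
  have "FT_le T m p (Q' n m ?f ?q)"
    using pf(3)[OF Q' m m CT_ident_hom[OF m] gf le2 p] pf_ident[OF Q' m p] pf(4)[OF Q' m n g m f p] by simp
  then have "FT_le T m p (Q n m ?f ?q)" using eq[OF q] by simp
  then have a: "FT_le T n (Q m n ?g p) (Q m n ?g (Q n m ?f ?q))" by (rule pf(2)[OF Q m n g p fq])
  have b: "FT_le T n (Q m n ?g (Q n m ?f ?q)) ?q"
    using pf(3)[OF Q n n fg CT_ident_hom[OF n] le1 q] pf_ident[OF Q n q] pf(4)[OF Q n m f n g q] by simp
  show ?thesis
    using poset_FT[OF n] a b pf_in[OF Q m n g p] pf_in[OF Q m n g fq] q unfolding poset_on_def by blast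
qed

lemma is_FT_unique: "P = P'"
proof (intro ext)
  fix n m w p
  show "P n m w p = P' n m w p"
  proof (cases "n \<in> ctxs T \<and> m \<in> ctxs T \<and> w \<in> hom (CT T) n m")
    case True
    then have n: "n \<in> ctxs T" and m: "m \<in> ctxs T" and w: "w \<in> hom (CT T) n m" by auto
    have "agree n m w"
    proof (rule CT_decompose[OF w n m])
      fix k f g assume k: "k \<in> ctxs T" and f: "ctx_map n k f" and g: "ctx_map m k g"
        and weq: "w = (\<lambda>\<sigma>. W_comp (n \<sigma>) (k \<sigma>) (m \<sigma>) (ct_fn n k f \<sigma>) (ct_cofn k m g \<sigma>))"
      have eq: "P m k (ct_fn m k g) p = P' m k (ct_fn m k g) p" if "p \<in> FT_obj T m" for p
        using agree_fn[OF m k g] that by (simp add: agree_def)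
      note gh = ct_cofn_hom[OF g m k]
      have "P k m (ct_cofn k m g) p = P' k m (ct_cofn k m g) p" if p: "p \<in> FT_obj T k" for p
        using poset_FT[OF m] cofn_le[OF P P' m k g p eq] cofn_le[OF P' P m k g p eq[symmetric]]
          pf_in[OF P k m gh p] pf_in[OF P' k m gh p] unfolding poset_on_def by blast
      then have "agree k m (ct_cofn k m g)" using gh by (simp add: agree_def)
      then show "agree n m w" unfolding weq by (rule agree_comp[OF n k m agree_fn[OF n k f]])
    qed
    then have a: "p \<in> FT_obj T n \<Longrightarrow> ?thesis" unfolding agree_def by blast
    have "p \<notin> FT_obj T n \<Longrightarrow> P n m w p = undefined" "p \<notin> FT_obj T n \<Longrightarrow> P' n m w p = undefined"
      by (rule PiE_arb[OF pf(1)[OF P n m w]], assumption) (rule PiE_arb[OF pf(1)[OF P' n m w]])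
    with a show ?thesis by (cases "p \<in> FT_obj T n") simp_all
  next
    case False
    then show ?thesis using pf_undefined[OF P] pf_undefined[OF P'] by simp
  qed
qed

end

lemma FT_unique: "\<exists>!P. is_FT T P"
  using is_FT_act is_FT_unique by blast

lemma FT_act: "FT T = act"
  unfolding FT_def using is_FT_act is_FT_unique by blast

end

section \<open>Transport along functors that are surjective on objects\<close>

text \<open>Nothing is assumed of the target: a structure reached in this way from a category is
  itself a category, so the laws of \<open>Syn\<close> and \<open>Rel\<close> come from those of
  relations. Injectivity on objects is not asked for, as representatives are identified in
  \<open>Syn\<close>.\<close>

definition cat_onto ::
  "('o, 'a, 'y) cat_scheme \<Rightarrow> ('p, 'b, 'z) cat_scheme \<Rightarrow>
   ('o \<Rightarrow> 'p) \<Rightarrow> ('o \<Rightarrow> 'o \<Rightarrow> 'a \<Rightarrow> 'b) \<Rightarrow> bool" where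
  "cat_onto K C Go Ga \<longleftrightarrow> Go ` obj K = obj C \<and>
     (\<forall>a\<in>obj K. \<forall>b\<in>obj K. bij_betw (Ga a b) (hom K a b) (hom C (Go a) (Go b))) \<and>
     (\<forall>a\<in>obj K. Ga a a (ident K a) = ident C (Go a)) \<and>
     (\<forall>a\<in>obj K. \<forall>b\<in>obj K. \<forall>c\<in>obj K. \<forall>f\<in>hom K a b. \<forall>g\<in>hom K b c.
        Ga a c (comp K a b c f g) = comp C (Go a) (Go b) (Go c) (Ga a b f) (Ga b c g))"

definition po_onto ::
  "('o, 'a, 'y) pocat_scheme \<Rightarrow> ('p, 'b, 'z) pocat_scheme \<Rightarrow>
   ('o \<Rightarrow> 'p) \<Rightarrow> ('o \<Rightarrow> 'o \<Rightarrow> 'a \<Rightarrow> 'b) \<Rightarrow> bool" where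
  "po_onto K C Go Ga \<longleftrightarrow> cat_onto K C Go Ga \<and>
     (\<forall>a\<in>obj K. \<forall>b\<in>obj K. \<forall>f\<in>hom K a b. \<forall>g\<in>hom K a b.
        le C (Go a) (Go b) (Ga a b f) (Ga a b g) \<longleftrightarrow> le K a b f g)"

lemma categoryD:
  assumes "category C"
  shows "a \<in> obj C \<Longrightarrow> ident C a \<in> hom C a a"
    "a \<in> obj C \<Longrightarrow> b \<in> obj C \<Longrightarrow> c \<in> obj C \<Longrightarrow> f \<in> hom C a b \<Longrightarrow> g \<in> hom C b c \<Longrightarrow>
      comp C a b c f g \<in> hom C a c"
    "a \<in> obj C \<Longrightarrow> b \<in> obj C \<Longrightarrow> f \<in> hom C a b \<Longrightarrow> comp C a a b (ident C a) f = f"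
    "a \<in> obj C \<Longrightarrow> b \<in> obj C \<Longrightarrow> f \<in> hom C a b \<Longrightarrow> comp C a b b f (ident C b) = f"
    "a \<in> obj C \<Longrightarrow> b \<in> obj C \<Longrightarrow> c \<in> obj C \<Longrightarrow> d \<in> obj C \<Longrightarrow>
      f \<in> hom C a b \<Longrightarrow> g \<in> hom C b c \<Longrightarrow> h \<in> hom C c d \<Longrightarrow>
      comp C a c d (comp C a b c f g) h = comp C a b d f (comp C b c d g h)"
proof -
  note c = assms[unfolded category_def]
  show "a \<in> obj C \<Longrightarrow> ident C a \<in> hom C a a" using c[THEN conjunct1] by blast
  show "a \<in> obj C \<Longrightarrow> b \<in> obj C \<Longrightarrow> c \<in> obj C \<Longrightarrow> f \<in> hom C a b \<Longrightarrow> g \<in> hom C b c \<Longrightarrow>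
      comp C a b c f g \<in> hom C a c" using c[THEN conjunct2, THEN conjunct1] by blast
  show "a \<in> obj C \<Longrightarrow> b \<in> obj C \<Longrightarrow> f \<in> hom C a b \<Longrightarrow> comp C a a b (ident C a) f = f"
    "a \<in> obj C \<Longrightarrow> b \<in> obj C \<Longrightarrow> f \<in> hom C a b \<Longrightarrow> comp C a b b f (ident C b) = f"
    using c[THEN conjunct2, THEN conjunct2, THEN conjunct1] by blast+
  show "a \<in> obj C \<Longrightarrow> b \<in> obj C \<Longrightarrow> c \<in> obj C \<Longrightarrow> d \<in> obj C \<Longrightarrow>
      f \<in> hom C a b \<Longrightarrow> g \<in> hom C b c \<Longrightarrow> h \<in> hom C c d \<Longrightarrow>
      comp C a c d (comp C a b c f g) h = comp C a b d f (comp C b c d g h)"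
    using c[THEN conjunct2, THEN conjunct2, THEN conjunct2] by blast
qed

lemma cat_ontoD:
  assumes "cat_onto K C Go Ga"
  shows "c \<in> obj C \<Longrightarrow> \<exists>a\<in>obj K. c = Go a" "a \<in> obj K \<Longrightarrow> Go a \<in> obj C"
    "a \<in> obj K \<Longrightarrow> b \<in> obj K \<Longrightarrow> f' \<in> hom C (Go a) (Go b) \<Longrightarrow> \<exists>f\<in>hom K a b. f' = Ga a b f"
    "a \<in> obj K \<Longrightarrow> b \<in> obj K \<Longrightarrow> f \<in> hom K a b \<Longrightarrow> Ga a b f \<in> hom C (Go a) (Go b)"
    "a \<in> obj K \<Longrightarrow> b \<in> obj K \<Longrightarrow> f \<in> hom K a b \<Longrightarrow> g \<in> hom K a b \<Longrightarrow> Ga a b f = Ga a b g \<Longrightarrow> f = g"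
    "a \<in> obj K \<Longrightarrow> Ga a a (ident K a) = ident C (Go a)"
    "a \<in> obj K \<Longrightarrow> b \<in> obj K \<Longrightarrow> c' \<in> obj K \<Longrightarrow> f \<in> hom K a b \<Longrightarrow> g \<in> hom K b c' \<Longrightarrow>
      Ga a c' (comp K a b c' f g) = comp C (Go a) (Go b) (Go c') (Ga a b f) (Ga b c' g)"
    "a \<in> obj K \<Longrightarrow> b \<in> obj K \<Longrightarrow> bij_betw (Ga a b) (hom K a b) (hom C (Go a) (Go b))"
proof -
  note c = assms[unfolded cat_onto_def]
  show 1: "a \<in> obj K \<Longrightarrow> b \<in> obj K \<Longrightarrow> bij_betw (Ga a b) (hom K a b) (hom C (Go a) (Go b))"
    for a b using c by blast
  show "c \<in> obj C \<Longrightarrow> \<exists>a\<in>obj K. c = Go a" "a \<in> obj K \<Longrightarrow> Go a \<in> obj C" using c by blast+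
  show "a \<in> obj K \<Longrightarrow> b \<in> obj K \<Longrightarrow> f' \<in> hom C (Go a) (Go b) \<Longrightarrow> \<exists>f\<in>hom K a b. f' = Ga a b f"
    using 1[of a b] unfolding bij_betw_def by blast
  show "a \<in> obj K \<Longrightarrow> b \<in> obj K \<Longrightarrow> f \<in> hom K a b \<Longrightarrow> Ga a b f \<in> hom C (Go a) (Go b)"
    using 1[of a b] unfolding bij_betw_def by blast
  show "a \<in> obj K \<Longrightarrow> b \<in> obj K \<Longrightarrow> f \<in> hom K a b \<Longrightarrow> g \<in> hom K a b \<Longrightarrow> Ga a b f = Ga a b g \<Longrightarrow> f = g"
    using 1[of a b] unfolding bij_betw_def inj_on_def by blast
  show "a \<in> obj K \<Longrightarrow> Ga a a (ident K a) = ident C (Go a)" using c by blast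
  show "a \<in> obj K \<Longrightarrow> b \<in> obj K \<Longrightarrow> c' \<in> obj K \<Longrightarrow> f \<in> hom K a b \<Longrightarrow> g \<in> hom K b c' \<Longrightarrow>
      Ga a c' (comp K a b c' f g) = comp C (Go a) (Go b) (Go c') (Ga a b f) (Ga b c' g)"
    using c by blast
qed

lemma cat_onto_category:
  assumes K: "category K" and G: "cat_onto K C Go Ga"
  shows "category C"
proof -
  note k = categoryD[OF K] and g = cat_ontoD[OF G]
  show ?thesis unfolding category_def
  proof (intro conjI ballI)
    fix a assume "a \<in> obj C"
    then obtain a' where a: "a' \<in> obj K" "a = Go a'" using g(1) by blast
    show "ident C a \<in> hom C a a" using g(4)[OF a(1,1) k(1)[OF a(1)]] g(6)[OF a(1)] a(2) by simp
  next
    fix a b c f h assume "a \<in> obj C" "b \<in> obj C" "c \<in> obj C" and fh: "f \<in> hom C a b" "h \<in> hom C b c"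
    then obtain a' b' c' where o: "a' \<in> obj K" "a = Go a'" "b' \<in> obj K" "b = Go b'" "c' \<in> obj K" "c = Go c'"
      using g(1) by metis
    obtain f' h' where m: "f' \<in> hom K a' b'" "f = Ga a' b' f'" "h' \<in> hom K b' c'" "h = Ga b' c' h'"
      using g(3)[OF o(1,3)] g(3)[OF o(3,5)] fh unfolding o(2,4,6) by metis
    show "comp C a b c f h \<in> hom C a c"
      using g(7)[OF o(1,3,5) m(1,3)] g(4)[OF o(1,5) k(2)[OF o(1,3,5) m(1,3)]] o m by simp
  next
    fix a b f assume "a \<in> obj C" "b \<in> obj C" and f: "f \<in> hom C a b"
    then obtain a' b' where o: "a' \<in> obj K" "a = Go a'" "b' \<in> obj K" "b = Go b'" using g(1) by metis
    obtain f' where m: "f' \<in> hom K a' b'" "f = Ga a' b' f'" using g(3)[OF o(1,3)] f unfolding o(2,4) by metis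
    show "comp C a a b (ident C a) f = f"
      using g(7)[OF o(1,1,3) k(1)[OF o(1)] m(1)] k(3)[OF o(1,3) m(1)] g(6)[OF o(1)] o m by simp
    show "comp C a b b f (ident C b) = f"
      using g(7)[OF o(1,3,3) m(1) k(1)[OF o(3)]] k(4)[OF o(1,3) m(1)] g(6)[OF o(3)] o m by simp
  next
    fix a b c d f h j assume "a \<in> obj C" "b \<in> obj C" "c \<in> obj C" "d \<in> obj C"
      and fh: "f \<in> hom C a b" "h \<in> hom C b c" "j \<in> hom C c d"
    then obtain a' b' c' d' where o: "a' \<in> obj K" "a = Go a'" "b' \<in> obj K" "b = Go b'" "c' \<in> obj K" "c = Go c'"
      "d' \<in> obj K" "d = Go d'"
      using g(1) by metis
    obtain f' h' j' where m: "f' \<in> hom K a' b'" "f = Ga a' b' f'" "h' \<in> hom K b' c'" "h = Ga b' c' h'"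
      "j' \<in> hom K c' d'" "j = Ga c' d' j'"
      using g(3)[OF o(1,3)] g(3)[OF o(3,5)] g(3)[OF o(5,7)] fh unfolding o(2,4,6,8) by metis
    show "comp C a c d (comp C a b c f h) j = comp C a b d f (comp C b c d h j)"
      using g(7)[OF o(1,3,5) m(1,3)] g(7)[OF o(3,5,7) m(3,5)]
        g(7)[OF o(1,5,7) k(2)[OF o(1,3,5) m(1,3)] m(5)] g(7)[OF o(1,3,7) m(1) k(2)[OF o(3,5,7) m(3,5)]]
        k(5)[OF o(1,3,5,7) m(1,3,5)] o m by simp
  qed
qed

lemma po_onto_po_category:
  assumes K: "po_category K" and G: "po_onto K C Go Ga"
  shows "po_category C"
proof -
  have GC: "cat_onto K C Go Ga" and KC: "category K"
    using G K by (auto simp: po_onto_def po_category_def)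
  note g = cat_ontoD[OF GC]
  have le: "le C (Go a) (Go b) (Ga a b f) (Ga a b h) \<longleftrightarrow> le K a b f h"
    if "a \<in> obj K" "b \<in> obj K" "f \<in> hom K a b" "h \<in> hom K a b" for a b f h
    using G that unfolding po_onto_def by blast
  show ?thesis unfolding po_category_def
  proof (intro conjI ballI impI)
    show "category C" by (rule cat_onto_category[OF KC GC])
  next
    fix a b assume "a \<in> obj C" "b \<in> obj C"
    then obtain a' b' where o: "a' \<in> obj K" "a = Go a'" "b' \<in> obj K" "b = Go b'" using g(1) by metis
    have p: "poset_on (hom K a' b') (le K a' b')" using K o(1,3) unfolding po_category_def by blast
    have h: "hom C a b = Ga a' b' ` hom K a' b'" using g(8)[OF o(1,3)] unfolding o(2,4) bij_betw_def by blast
    show "poset_on (hom C a b) (le C a b)"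
      unfolding poset_on_def
    proof (intro conjI ballI impI)
      fix x assume "x \<in> hom C a b"
      then obtain x' where x': "x' \<in> hom K a' b'" "x = Ga a' b' x'" unfolding h by blast
      then have "le K a' b' x' x'" using p unfolding poset_on_def by blast
      then show "le C a b x x" using le[OF o(1,3)] x' unfolding o(2,4) by blast
    next
      fix x y z assume x: "x \<in> hom C a b" "y \<in> hom C a b" "z \<in> hom C a b" "le C a b x y" "le C a b y z"
      obtain x' y' z' where x': "x' \<in> hom K a' b'" "x = Ga a' b' x'" "y' \<in> hom K a' b'" "y = Ga a' b' y'"
        "z' \<in> hom K a' b'" "z = Ga a' b' z'" using x(1-3) unfolding h by blast
      then have "le K a' b' x' y'" "le K a' b' y' z'" using x(4,5) le[OF o(1,3)] unfolding o(2,4) by blast+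
      then have "le K a' b' x' z'" using p x' unfolding poset_on_def by blast
      then show "le C a b x z" using le[OF o(1,3)] x' unfolding o(2,4) by blast
    next
      fix x y assume x: "x \<in> hom C a b" "y \<in> hom C a b" "le C a b x y" "le C a b y x"
      obtain x' y' where x': "x' \<in> hom K a' b'" "x = Ga a' b' x'" "y' \<in> hom K a' b'" "y = Ga a' b' y'"
        using x(1,2) unfolding h by blast
      then have "le K a' b' x' y'" "le K a' b' y' x'" using x(3,4) le[OF o(1,3)] unfolding o(2,4) by blast+
      then have "x' = y'" using p x' unfolding poset_on_def by blast
      then show "x = y" using x' by simp
    qed
  next
    fix a b c f f1 h h1 assume "a \<in> obj C" "b \<in> obj C" "c \<in> obj C"
      and fh: "f \<in> hom C a b" "f1 \<in> hom C a b" "h \<in> hom C b c" "h1 \<in> hom C b c"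
      and l: "le C a b f f1" "le C b c h h1"
    then obtain a' b' c' where o: "a' \<in> obj K" "a = Go a'" "b' \<in> obj K" "b = Go b'" "c' \<in> obj K" "c = Go c'"
      using g(1) by metis
    obtain f' f1' where m: "f' \<in> hom K a' b'" "f = Ga a' b' f'" "f1' \<in> hom K a' b'" "f1 = Ga a' b' f1'"
      using g(3)[OF o(1,3)] fh unfolding o(2,4,6) by metis
    obtain h' h1' where m': "h' \<in> hom K b' c'" "h = Ga b' c' h'" "h1' \<in> hom K b' c'" "h1 = Ga b' c' h1'"
      using g(3)[OF o(3,5)] fh unfolding o(2,4,6) by metis
    have "le K a' b' f' f1'" "le K b' c' h' h1'"
      using l le[OF o(1,3) m(1,3)] le[OF o(3,5) m'(1,3)] o m m' by simp_all
    then have "le K a' c' (comp K a' b' c' f' h') (comp K a' b' c' f1' h1')"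
      using K o(1,3,5) m(1,3) m'(1,3) unfolding po_category_def by blast
    then show "le C a c (comp C a b c f h) (comp C a b c f1 h1)"
      using le[OF o(1,5) categoryD(2)[OF KC o(1,3,5) m(1) m'(1)] categoryD(2)[OF KC o(1,3,5) m(3) m'(3)]]
        g(7)[OF o(1,3,5) m(1) m'(1)] g(7)[OF o(1,3,5) m(3) m'(3)] o m m' by simp
  qed
qed

lemma cat_onto_equivalent:
  assumes K: "category K" and G: "cat_onto K C Go Ga"
  shows "cat_equivalent K C"
proof -
  have C: "category C" by (rule cat_onto_category[OF K G])
  note c = categoryD[OF C] and g = cat_ontoD[OF G]
  have "isomorphic C d d" if "d \<in> obj C" for d
    unfolding isomorphic_def using c(1)[OF that] c(3)[OF that that c(1)[OF that]] by blast
  then have "\<forall>d\<in>obj C. \<exists>a\<in>obj K. isomorphic C (Go a) d" using g(1) by metis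
  moreover have "is_functor K C Go Ga" unfolding is_functor_def using g(2,4,6,7) by blast
  ultimately show ?thesis unfolding cat_equivalent_def using K C g(8) by blast
qed

text \<open>A section \<open>s\<close> of the object map of the first comparison is chosen, arrows
  are lifted along the bijections on homs, and the second comparison is applied. Lifts are unique,
  so this is functorial.\<close>

lemma po_onto_equivalent:
  assumes K: "po_category K" and G: "po_onto K C Go Ga" and H: "po_onto K D Ho Ha"
  shows "po_equivalent C D"
proof -
  have GC: "cat_onto K C Go Ga" and HC: "cat_onto K D Ho Ha" and KC: "category K"
    using G H K by (auto simp: po_onto_def po_category_def)
  note g = cat_ontoD[OF GC] and h = cat_ontoD[OF HC] and k = categoryD[OF KC]
  have gle: "le C (Go a) (Go b) (Ga a b f) (Ga a b f') \<longleftrightarrow> le K a b f f'"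
    and hle: "le D (Ho a) (Ho b) (Ha a b f) (Ha a b f') \<longleftrightarrow> le K a b f f'"
    if "a \<in> obj K" "b \<in> obj K" "f \<in> hom K a b" "f' \<in> hom K a b" for a b f f'
    using G H that unfolding po_onto_def by blast+
  define s where "s = (\<lambda>c. SOME a. a \<in> obj K \<and> c = Go a)"
  have s: "s c \<in> obj K" "Go (s c) = c" if "c \<in> obj C" for c
  proof -
    have "\<exists>a. a \<in> obj K \<and> c = Go a" using g(1)[OF that] by blast
    then have "s c \<in> obj K \<and> c = Go (s c)" unfolding s_def by (rule someI_ex)
    then show "s c \<in> obj K" "Go (s c) = c" by simp_all
  qed
  define I where "I = (\<lambda>a b. inv_into (hom K (s a) (s b)) (Ga (s a) (s b)))"
  have I: "I a b f \<in> hom K (s a) (s b)" "Ga (s a) (s b) (I a b f) = f"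
    if "a \<in> obj C" "b \<in> obj C" "f \<in> hom C a b" for a b f
  proof -
    have "f \<in> Ga (s a) (s b) ` hom K (s a) (s b)"
      using g(8)[OF s(1)[OF that(1)] s(1)[OF that(2)]] that s unfolding bij_betw_def by simp
    then show "I a b f \<in> hom K (s a) (s b)" "Ga (s a) (s b) (I a b f) = f"
      unfolding I_def by (rule inv_into_into, rule f_inv_into_f)
  qed
  let ?Fo = "\<lambda>c. Ho (s c)" and ?Fa = "\<lambda>a b f. Ha (s a) (s b) (I a b f)"
  have C: "po_category C" and D: "po_category D"
    using po_onto_po_category[OF K G] po_onto_po_category[OF K H] .
  have CC: "category C" using C by (simp add: po_category_def)
  note c = categoryD[OF CC]
  have fctr: "is_functor C D ?Fo ?Fa" unfolding is_functor_def
  proof (intro conjI ballI)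
    fix a assume "a \<in> obj C" then show "?Fo a \<in> obj D" using s h(2) by blast
  next
    fix a b f assume "a \<in> obj C" "b \<in> obj C" "f \<in> hom C a b"
    then show "?Fa a b f \<in> hom D (?Fo a) (?Fo b)" by (intro h(4) s(1) I(1))
  next
    fix a assume a: "a \<in> obj C"
    have "I a a (ident C a) = ident K (s a)"
      using g(5)[OF s(1)[OF a] s(1)[OF a] I(1)[OF a a c(1)[OF a]] k(1)[OF s(1)[OF a]]]
        I(2)[OF a a c(1)[OF a]] g(6)[OF s(1)[OF a]] s(2)[OF a] by simp
    then show "?Fa a a (ident C a) = ident D (?Fo a)" using h(6)[OF s(1)[OF a]] by simp
  next
    fix a b d f f' assume o: "a \<in> obj C" "b \<in> obj C" "d \<in> obj C" and m: "f \<in> hom C a b" "f' \<in> hom C b d"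
    note so = s(1)[OF o(1)] s(1)[OF o(2)] s(1)[OF o(3)]
    note i = I(1)[OF o(1,2) m(1)] I(1)[OF o(2,3) m(2)]
    have "I a d (comp C a b d f f') = comp K (s a) (s b) (s d) (I a b f) (I b d f')"
      using g(5)[OF so(1,3) I(1)[OF o(1,3) c(2)[OF o m]] k(2)[OF so i]]
        I(2)[OF o(1,3) c(2)[OF o m]] g(7)[OF so i] I(2)[OF o(1,2) m(1)] I(2)[OF o(2,3) m(2)] s(2) o by simp
    then show "?Fa a d (comp C a b d f f') = comp D (?Fo a) (?Fo b) (?Fo d) (?Fa a b f) (?Fa b d f')"
      using h(7)[OF so i] by simp
  qed
  have le: "le D (?Fo a) (?Fo b) (?Fa a b f) (?Fa a b f') \<longleftrightarrow> le C a b f f'"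
    if o: "a \<in> obj C" "b \<in> obj C" and m: "f \<in> hom C a b" "f' \<in> hom C a b" for a b f f'
    using gle[OF s(1)[OF o(1)] s(1)[OF o(2)] I(1)[OF o m(1)] I(1)[OF o m(2)]]
      hle[OF s(1)[OF o(1)] s(1)[OF o(2)] I(1)[OF o m(1)] I(1)[OF o m(2)]]
      I(2)[OF o m(1)] I(2)[OF o m(2)] s(2) o by simp
  have bij: "bij_betw (?Fa a b) (hom C a b) (hom D (?Fo a) (?Fo b))" if o: "a \<in> obj C" "b \<in> obj C" for a b
  proof -
    note so = s(1)[OF o(1)] s(1)[OF o(2)]
    have "bij_betw (I a b) (hom C a b) (hom K (s a) (s b))"
      unfolding I_def using bij_betw_inv_into[OF g(8)[OF so]] s(2) o by simp
    from bij_betw_trans[OF this h(8)[OF so]] show ?thesis by (simp add: o_def)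
  qed
  have "\<exists>a\<in>obj C. isomorphic D (?Fo a) d" if d: "d \<in> obj D" for d
  proof -
    obtain x where x: "x \<in> obj K" "d = Ho x" using h(1)[OF d] by blast
    let ?c = "Go x"
    have cC: "?c \<in> obj C" by (rule g(2)[OF x(1)])
    note sc = s(1)[OF cC]
    have gs: "Go (s ?c) = ?c" by (rule s(2)[OF cC])
    \<comment> \<open>The objects \<open>x\<close> and \<open>s ?c\<close> lie over the same object
      of \<open>C\<close>; the two lifts of its identity are mutually inverse.\<close>
    obtain u where u: "u \<in> hom K (s ?c) x" "Ga (s ?c) x u = ident C ?c"
      using g(3)[OF sc x(1)] c(1)[OF cC] gs by metis
    obtain v where v: "v \<in> hom K x (s ?c)" "Ga x (s ?c) v = ident C ?c"
      using g(3)[OF x(1) sc] c(1)[OF cC] gs by metis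
    have uv: "comp K (s ?c) x (s ?c) u v = ident K (s ?c)"
      using g(5)[OF sc sc k(2)[OF sc x(1) sc u(1) v(1)] k(1)[OF sc]] g(7)[OF sc x(1) sc u(1) v(1)]
        c(3)[OF cC cC c(1)[OF cC]] u(2) v(2) gs g(6)[OF sc] by simp
    have vu: "comp K x (s ?c) x v u = ident K x"
      using g(5)[OF x(1) x(1) k(2)[OF x(1) sc x(1) v(1) u(1)] k(1)[OF x(1)]] g(7)[OF x(1) sc x(1) v(1) u(1)]
        c(3)[OF cC cC c(1)[OF cC]] u(2) v(2) gs g(6)[OF x(1)] by simp
    have "isomorphic D (?Fo ?c) d" unfolding isomorphic_def x(2)
      using h(4)[OF sc x(1) u(1)] h(4)[OF x(1) sc v(1)] h(7)[OF sc x(1) sc u(1) v(1)] h(7)[OF x(1) sc x(1) v(1) u(1)]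
        uv vu h(6)[OF sc] h(6)[OF x(1)] by (metis (no_types))
    then show ?thesis using cC by blast
  qed
  then show ?thesis
    unfolding po_equivalent_def po_functor_def using C D fctr bij le by blast
qed

lemma po_onto_left_adjoint:
  assumes K: "category K" and G: "po_onto K C Go Ga" and o: "a \<in> obj K" "b \<in> obj K" and f: "f \<in> hom K a b"
  shows "left_adjoint C (Go a) (Go b) (Ga a b f) \<longleftrightarrow> left_adjoint K a b f"
proof -
  have GC: "cat_onto K C Go Ga" using G by (simp add: po_onto_def)
  note g = cat_ontoD[OF GC] and k = categoryD[OF K]
  have gle: "le C (Go a) (Go b) (Ga a b f) (Ga a b f') \<longleftrightarrow> le K a b f f'"
    if "a \<in> obj K" "b \<in> obj K" "f \<in> hom K a b" "f' \<in> hom K a b" for a b f f'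
    using G that unfolding po_onto_def by blast
  have "le C (Go a) (Go a) (ident C (Go a)) (comp C (Go a) (Go b) (Go a) (Ga a b f) (Ga b a f')) \<longleftrightarrow>
      le K a a (ident K a) (comp K a b a f f')"
    "le C (Go b) (Go b) (comp C (Go b) (Go a) (Go b) (Ga b a f') (Ga a b f)) (ident C (Go b)) \<longleftrightarrow>
      le K b b (comp K b a b f' f) (ident K b)" if f': "f' \<in> hom K b a" for f'
    using gle[OF o(1,1) k(1)[OF o(1)] k(2)[OF o(1,2,1) f f']] gle[OF o(2,2) k(2)[OF o(2,1,2) f' f] k(1)[OF o(2)]]
      g(6)[OF o(1)] g(6)[OF o(2)] g(7)[OF o(1,2,1) f f'] g(7)[OF o(2,1,2) f' f] by simp_all
  moreover have "hom C (Go b) (Go a) = Ga b a ` hom K b a" using g(8)[OF o(2,1)] by (simp add: bij_betw_def)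
  ultimately show ?thesis unfolding left_adjoint_def using f g(4)[OF o f] by (simp only: bex_simps) blast
qed

lemma po_onto_LAdj:
  assumes K: "category K" and G: "po_onto K C Go Ga"
  shows "cat_onto (LAdj K) (LAdj C) Go Ga"
proof -
  have GC: "cat_onto K C Go Ga" using G by (simp add: po_onto_def)
  note g = cat_ontoD[OF GC]
  have l: "f \<in> hom K a b" if "left_adjoint K a b f" for a b f using that by (simp add: left_adjoint_def)
  have bij: "bij_betw (Ga a b) {f. left_adjoint K a b f} {f. left_adjoint C (Go a) (Go b) f}"
    if o: "a \<in> obj K" "b \<in> obj K" for a b
  proof (rule bij_betw_imageI)
    show "inj_on (Ga a b) {f. left_adjoint K a b f}" using g(5)[OF o] l by (auto simp: inj_on_def)
    show "Ga a b ` {f. left_adjoint K a b f} = {f. left_adjoint C (Go a) (Go b) f}"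
    proof (intro set_eqI iffI)
      fix f assume "f \<in> {f. left_adjoint C (Go a) (Go b) f}"
      then have f: "left_adjoint C (Go a) (Go b) f" by simp
      then have "f \<in> hom C (Go a) (Go b)" by (simp add: left_adjoint_def)
      then obtain f' where f': "f' \<in> hom K a b" "f = Ga a b f'" using g(3)[OF o] by blast
      then show "f \<in> Ga a b ` {f. left_adjoint K a b f}" using f po_onto_left_adjoint[OF K G o f'(1)] by blast
    next
      fix f assume "f \<in> Ga a b ` {f. left_adjoint K a b f}"
      then show "f \<in> {f. left_adjoint C (Go a) (Go b) f}" using po_onto_left_adjoint[OF K G o l] by blast
    qed
  qed
  have "Go ` obj K = obj C" using GC by (simp add: cat_onto_def)
  then show ?thesis unfolding cat_onto_def LAdj_def using bij g(6,7) l by simp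
qed

lemma cat_onto_trans:
  assumes "cat_onto K C Go Ga" "cat_onto C D Ho Ha"
  shows "cat_onto K D (\<lambda>a. Ho (Go a)) (\<lambda>a b f. Ha (Go a) (Go b) (Ga a b f))"
proof -
  note g = cat_ontoD[OF assms(1)] and h = cat_ontoD[OF assms(2)]
  show ?thesis unfolding cat_onto_def
  proof (intro conjI ballI)
    show "(\<lambda>a. Ho (Go a)) ` obj K = obj D" 
    proof -
      have "Go ` obj K = obj C" "Ho ` obj C = obj D" using assms by (simp_all add: cat_onto_def)
      then show ?thesis by (simp only: image_image[symmetric])
    qed
    fix a b assume o: "a \<in> obj K" "b \<in> obj K"
    show "bij_betw (\<lambda>f. Ha (Go a) (Go b) (Ga a b f)) (hom K a b) (hom D (Ho (Go a)) (Ho (Go b)))"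
      using bij_betw_trans[OF g(8)[OF o] h(8)[OF g(2)[OF o(1)] g(2)[OF o(2)]]] by (simp add: o_def)
  next
    fix a assume "a \<in> obj K"
    then show "Ha (Go a) (Go a) (Ga a a (ident K a)) = ident D (Ho (Go a))" using g(2,6) h(6) by simp
  next
    fix a b c f f' assume o: "a \<in> obj K" "b \<in> obj K" "c \<in> obj K" and m: "f \<in> hom K a b" "f' \<in> hom K b c"
    show "Ha (Go a) (Go c) (Ga a c (comp K a b c f f')) =
      comp D (Ho (Go a)) (Ho (Go b)) (Ho (Go c)) (Ha (Go a) (Go b) (Ga a b f)) (Ha (Go b) (Go c) (Ga b c f'))"
      using g(7)[OF o m] h(7)[OF g(2)[OF o(1)] g(2)[OF o(2)] g(2)[OF o(3)] g(4)[OF o(1,2) m(1)] g(4)[OF o(2,3) m(2)]]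
      by simp
  qed
qed

section \<open>Categories of definable maps\<close>

text \<open>\<open>'m\<close> is the type of models and \<open>pts a M\<close> the interpretation of the object \<open>a\<close> in \<open>M\<close>. The family
  \<open>drel\<close> consists of the definable relations, the maps are those whose graph is definable, and
  every definable relation is tabulated by a span.\<close>

locale definable_category =
  fixes C :: "('o, 'a) cat"
    and pts :: "'o \<Rightarrow> 'm \<Rightarrow> 'e set"
    and ap :: "'o \<Rightarrow> 'o \<Rightarrow> 'a \<Rightarrow> 'm \<Rightarrow> 'e \<Rightarrow> 'e"
    and drel :: "'o \<Rightarrow> 'o \<Rightarrow> ('m \<Rightarrow> ('e \<times> 'e) set) \<Rightarrow> bool"
  assumes ident_hom: "a \<in> obj C \<Longrightarrow> ident C a \<in> hom C a a"
    and comp_hom: "a \<in> obj C \<Longrightarrow> b \<in> obj C \<Longrightarrow> c \<in> obj C \<Longrightarrow> f \<in> hom C a b \<Longrightarrow> g \<in> hom C b c \<Longrightarrow>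
      comp C a b c f g \<in> hom C a c"
    and ap_in: "a \<in> obj C \<Longrightarrow> b \<in> obj C \<Longrightarrow> f \<in> hom C a b \<Longrightarrow> x \<in> pts a M \<Longrightarrow> ap a b f M x \<in> pts b M"
    and ap_ident: "a \<in> obj C \<Longrightarrow> x \<in> pts a M \<Longrightarrow> ap a a (ident C a) M x = x"
    and ap_comp: "a \<in> obj C \<Longrightarrow> b \<in> obj C \<Longrightarrow> c \<in> obj C \<Longrightarrow> f \<in> hom C a b \<Longrightarrow> g \<in> hom C b c \<Longrightarrow>
      x \<in> pts a M \<Longrightarrow> ap a c (comp C a b c f g) M x = ap b c g M (ap a b f M x)"
    and ap_ext: "a \<in> obj C \<Longrightarrow> b \<in> obj C \<Longrightarrow> f \<in> hom C a b \<Longrightarrow> g \<in> hom C a b \<Longrightarrow>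
      (\<And>M x. x \<in> pts a M \<Longrightarrow> ap a b f M x = ap a b g M x) \<Longrightarrow> f = g"
    and drel_sub: "a \<in> obj C \<Longrightarrow> b \<in> obj C \<Longrightarrow> drel a b R \<Longrightarrow> R M \<subseteq> pts a M \<times> pts b M"
    and drel_graph: "a \<in> obj C \<Longrightarrow> b \<in> obj C \<Longrightarrow> f \<in> hom C a b \<Longrightarrow>
      drel a b (\<lambda>M. (\<lambda>x. (x, ap a b f M x)) ` pts a M)"
    and drel_fun: "a \<in> obj C \<Longrightarrow> b \<in> obj C \<Longrightarrow> drel a b R \<Longrightarrow>
      (\<And>M x. x \<in> pts a M \<Longrightarrow> \<exists>!y. (x, y) \<in> R M) \<Longrightarrow>
      \<exists>f\<in>hom C a b. \<forall>M. \<forall>x\<in>pts a M. (x, ap a b f M x) \<in> R M"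
    and drel_comp: "a \<in> obj C \<Longrightarrow> b \<in> obj C \<Longrightarrow> c \<in> obj C \<Longrightarrow> drel a b R \<Longrightarrow> drel b c S \<Longrightarrow>
      drel a c (\<lambda>M. R M O S M)"
    and drel_conv: "a \<in> obj C \<Longrightarrow> b \<in> obj C \<Longrightarrow> drel a b R \<Longrightarrow> drel b a (\<lambda>M. (R M)\<inverse>)"
    and drel_int: "a \<in> obj C \<Longrightarrow> b \<in> obj C \<Longrightarrow> drel a b R \<Longrightarrow> drel a b S \<Longrightarrow> drel a b (\<lambda>M. R M \<inter> S M)"
    and drel_top: "a \<in> obj C \<Longrightarrow> b \<in> obj C \<Longrightarrow> drel a b (\<lambda>M. pts a M \<times> pts b M)"
    and tabulation: "a \<in> obj C \<Longrightarrow> b \<in> obj C \<Longrightarrow> drel a b R \<Longrightarrow>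
      \<exists>t\<in>obj C. \<exists>f\<in>hom C t a. \<exists>g\<in>hom C t b.
        \<forall>M. bij_betw (\<lambda>w. (ap t a f M w, ap t b g M w)) (pts t M) (R M)"
    and terminal: "\<exists>t\<in>obj C. \<forall>a\<in>obj C. \<forall>M. pts a M \<noteq> {} \<longrightarrow> (\<exists>u. pts t M = {u})"
begin

lemma category: "category C"
  unfolding category_def
proof (intro conjI ballI)
  fix a b f assume o: "a \<in> obj C" "b \<in> obj C" and f: "f \<in> hom C a b"
  show "comp C a a b (ident C a) f = f"
    by (rule ap_ext[OF o comp_hom[OF o(1,1,2) ident_hom[OF o(1)] f] f])
      (simp add: ap_comp[OF o(1,1,2) ident_hom[OF o(1)] f] ap_ident[OF o(1)])
  show "comp C a b b f (ident C b) = f"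
    by (rule ap_ext[OF o comp_hom[OF o(1,2,2) f ident_hom[OF o(2)]] f])
      (simp add: ap_comp[OF o(1,2,2) f ident_hom[OF o(2)]] ap_ident[OF o(2)] ap_in[OF o f])
next
  fix a b c d f g h
  assume o: "a \<in> obj C" "b \<in> obj C" "c \<in> obj C" "d \<in> obj C"
    and m: "f \<in> hom C a b" "g \<in> hom C b c" "h \<in> hom C c d"
  note fg = comp_hom[OF o(1,2,3) m(1,2)] and gh = comp_hom[OF o(2,3,4) m(2,3)]
  show "comp C a c d (comp C a b c f g) h = comp C a b d f (comp C b c d g h)"
    by (rule ap_ext[OF o(1,4) comp_hom[OF o(1,3,4) fg m(3)] comp_hom[OF o(1,2,4) m(1) gh]])
      (simp add: ap_comp[OF o(1,3,4) fg m(3)] ap_comp[OF o(1,2,4) m(1) gh] ap_comp[OF o(1,2,3) m(1,2)]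
        ap_comp[OF o(2,3,4) m(2,3)] ap_in[OF o(1,2) m(1)])
qed (auto intro: ident_hom comp_hom)

definition gr :: "'o \<Rightarrow> 'o \<Rightarrow> 'a \<Rightarrow> 'm \<Rightarrow> ('e \<times> 'e) set" where
  "gr a b f = (\<lambda>M. (\<lambda>x. (x, ap a b f M x)) ` pts a M)"

lemma in_gr [simp]: "(x, y) \<in> gr a b f M \<longleftrightarrow> x \<in> pts a M \<and> y = ap a b f M x"
  by (auto simp: gr_def)

lemma drel_gr: "a \<in> obj C \<Longrightarrow> b \<in> obj C \<Longrightarrow> f \<in> hom C a b \<Longrightarrow> drel a b (gr a b f)"
  unfolding gr_def by (rule drel_graph)

section \<open>Tabulating spans and their universal property\<close>

definition span ::
  "'o \<Rightarrow> 'o \<Rightarrow> 'o \<Rightarrow> 'a \<Rightarrow> 'a \<Rightarrow> ('m \<Rightarrow> ('e \<times> 'e) set) \<Rightarrow> bool" where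
  "span a b t u v R \<longleftrightarrow> t \<in> obj C \<and> u \<in> hom C t a \<and> v \<in> hom C t b \<and>
     (\<forall>M. bij_betw (\<lambda>w. (ap t a u M w, ap t b v M w)) (pts t M) (R M))"

text \<open>The common form of the universal properties in use: pullbacks are the case where
  \<open>R\<close> is \<open>fib\<close>, binary products the case where \<open>R\<close> is the
  full relation.\<close>

definition univ ::
  "'o \<Rightarrow> 'o \<Rightarrow> 'o \<Rightarrow> 'a \<Rightarrow> 'a \<Rightarrow> ('m \<Rightarrow> ('e \<times> 'e) set) \<Rightarrow> bool" where
  "univ a b t u v R \<longleftrightarrow> t \<in> obj C \<and> u \<in> hom C t a \<and> v \<in> hom C t b \<and>
     (\<forall>M. \<forall>w\<in>pts t M. (ap t a u M w, ap t b v M w) \<in> R M) \<and>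
     (\<forall>x\<in>obj C. \<forall>s\<in>hom C x a. \<forall>s'\<in>hom C x b.
        (\<forall>M. \<forall>w\<in>pts x M. (ap x a s M w, ap x b s' M w) \<in> R M) \<longrightarrow>
        (\<exists>!h. h \<in> hom C x t \<and> comp C x t a h u = s \<and> comp C x t b h v = s'))"

lemma spanD:
  assumes "span a b t u v R"
  shows "t \<in> obj C" "u \<in> hom C t a" "v \<in> hom C t b"
    "w \<in> pts t M \<Longrightarrow> (ap t a u M w, ap t b v M w) \<in> R M"
    "(x, y) \<in> R M \<Longrightarrow> \<exists>w\<in>pts t M. ap t a u M w = x \<and> ap t b v M w = y"
    "w \<in> pts t M \<Longrightarrow> w' \<in> pts t M \<Longrightarrow> ap t a u M w = ap t a u M w' \<Longrightarrow> ap t b v M w = ap t b v M w' \<Longrightarrow> w = w'"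
proof -
  have b: "bij_betw (\<lambda>w. (ap t a u M w, ap t b v M w)) (pts t M) (R M)"
    and "t \<in> obj C" "u \<in> hom C t a" "v \<in> hom C t b"
    using assms unfolding span_def by blast+
  then show "t \<in> obj C" "u \<in> hom C t a" "v \<in> hom C t b" by auto
  have im: "(\<lambda>w. (ap t a u M w, ap t b v M w)) ` pts t M = R M"
    and inj: "inj_on (\<lambda>w. (ap t a u M w, ap t b v M w)) (pts t M)"
    using b unfolding bij_betw_def by auto
  show "w \<in> pts t M \<Longrightarrow> (ap t a u M w, ap t b v M w) \<in> R M" using im by blast
  show "(x, y) \<in> R M \<Longrightarrow> \<exists>w\<in>pts t M. ap t a u M w = x \<and> ap t b v M w = y" using im by force
  show "w \<in> pts t M \<Longrightarrow> w' \<in> pts t M \<Longrightarrow> ap t a u M w = ap t a u M w' \<Longrightarrow> ap t b v M w = ap t b v M w' \<Longrightarrow> w = w'"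
    using inj unfolding inj_on_def by blast
qed

lemma spanI:
  assumes "t \<in> obj C" "u \<in> hom C t a" "v \<in> hom C t b"
    "\<And>M w. w \<in> pts t M \<Longrightarrow> (ap t a u M w, ap t b v M w) \<in> R M"
    "\<And>M x y. (x, y) \<in> R M \<Longrightarrow> \<exists>w\<in>pts t M. ap t a u M w = x \<and> ap t b v M w = y"
    "\<And>M w w'. w \<in> pts t M \<Longrightarrow> w' \<in> pts t M \<Longrightarrow> ap t a u M w = ap t a u M w' \<Longrightarrow>
      ap t b v M w = ap t b v M w' \<Longrightarrow> w = w'"
  shows "span a b t u v R"
  unfolding span_def bij_betw_def inj_on_def
proof (intro conjI allI ballI impI assms(1-3))
  fix M
  show "(\<lambda>w. (ap t a u M w, ap t b v M w)) ` pts t M = R M"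
  proof (intro set_eqI iffI)
    fix z assume "z \<in> R M"
    then obtain w where "w \<in> pts t M" "ap t a u M w = fst z" "ap t b v M w = snd z"
      using assms(5)[of "fst z" "snd z" M] by auto
    then show "z \<in> (\<lambda>w. (ap t a u M w, ap t b v M w)) ` pts t M" by (intro image_eqI[of _ _ w]) auto
  qed (use assms(4) in blast)
  fix w w' assume "w \<in> pts t M" "w' \<in> pts t M" "(ap t a u M w, ap t b v M w) = (ap t a u M w', ap t b v M w')"
  then show "w = w'" using assms(6) by blast
qed

lemma span_exists:
  assumes "a \<in> obj C" "b \<in> obj C" "drel a b R" obtains t u v where "span a b t u v R"
  using tabulation[OF assms] unfolding span_def by blast

text \<open>The mediating arrow exists because its graph, relating \<open>w\<close> to the point of
  \<open>t\<close> that lies over the images of \<open>w\<close>, is definable and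
  functional.\<close>

lemma span_lift:
  assumes o: "a \<in> obj C" "b \<in> obj C" "x \<in> obj C" and sp: "span a b t u v R"
    and s: "s \<in> hom C x a" "s' \<in> hom C x b"
    and R: "\<And>M w. w \<in> pts x M \<Longrightarrow> (ap x a s M w, ap x b s' M w) \<in> R M"
  shows "\<exists>!h. h \<in> hom C x t \<and> comp C x t a h u = s \<and> comp C x t b h v = s'"
proof -
  note t = spanD[OF sp]
  let ?S = "\<lambda>M. (gr x a s M O (gr t a u M)\<inverse>) \<inter> (gr x b s' M O (gr t b v M)\<inverse>)"
  have S: "drel x t ?S"
    by (intro drel_int drel_comp[of _ a] drel_comp[of _ b] drel_conv drel_gr o s t(1-3))
  have inS: "(w, z) \<in> ?S M \<longleftrightarrow> w \<in> pts x M \<and> z \<in> pts t M \<and> ap t a u M z = ap x a s M w \<and> ap t b v M z = ap x b s' M w"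
    for w z M by auto
  have "\<exists>h\<in>hom C x t. \<forall>M. \<forall>w\<in>pts x M. (w, ap x t h M w) \<in> ?S M"
  proof (rule drel_fun[OF o(3) t(1) S])
    fix M w assume w: "w \<in> pts x M"
    show "\<exists>!z. (w, z) \<in> ?S M" unfolding inS using t(5)[OF R[OF w]] t(6) w by metis
  qed
  then obtain h where h: "h \<in> hom C x t"
    "\<And>M w. w \<in> pts x M \<Longrightarrow> ap t a u M (ap x t h M w) = ap x a s M w \<and> ap t b v M (ap x t h M w) = ap x b s' M w"
    unfolding inS by blast
  show ?thesis
  proof (rule ex1I[of _ h], intro conjI h(1))
    show "comp C x t a h u = s"
      by (rule ap_ext[OF o(3,1) comp_hom[OF o(3) t(1) o(1) h(1) t(2)] s(1)])
        (simp add: ap_comp[OF o(3) t(1) o(1) h(1) t(2)] h(2))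
    show "comp C x t b h v = s'"
      by (rule ap_ext[OF o(3,2) comp_hom[OF o(3) t(1) o(2) h(1) t(3)] s(2)])
        (simp add: ap_comp[OF o(3) t(1) o(2) h(1) t(3)] h(2))
    fix k assume k: "k \<in> hom C x t \<and> comp C x t a k u = s \<and> comp C x t b k v = s'"
    then have kh: "k \<in> hom C x t" by blast
    show "k = h"
    proof (rule ap_ext[OF o(3) t(1) kh h(1)])
      fix M w assume w: "w \<in> pts x M"
      have "ap t a u M (ap x t k M w) = ap x a s M w" "ap t b v M (ap x t k M w) = ap x b s' M w"
        using ap_comp[OF o(3) t(1) o(1) kh t(2) w] ap_comp[OF o(3) t(1) o(2) kh t(3) w] k by auto
      then show "ap x t k M w = ap x t h M w"
        using t(6) ap_in[OF o(3) t(1) kh w] ap_in[OF o(3) t(1) h(1) w] h(2)[OF w] by metis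
    qed
  qed
qed

text \<open>A universal span is compared with a tabulation of the same relation. The mediating
  arrows \<open>h\<close> and \<open>k\<close> in the two directions transport the bijection on
  points from the tabulation.\<close>

lemma univ_iff_span:
  assumes o: "a \<in> obj C" "b \<in> obj C" and R: "drel a b R"
  shows "univ a b p u v R \<longleftrightarrow> span a b p u v R"
proof
  assume sp: "span a b p u v R"
  show "univ a b p u v R" unfolding univ_def
    using spanD(1-4)[OF sp] span_lift[OF o _ sp] by blast
next
  assume un: "univ a b p u v R"
  have p: "p \<in> obj C" "u \<in> hom C p a" "v \<in> hom C p b"
    and uv: "\<And>M w. w \<in> pts p M \<Longrightarrow> (ap p a u M w, ap p b v M w) \<in> R M"
    and lift: "\<And>x s s'. x \<in> obj C \<Longrightarrow> s \<in> hom C x a \<Longrightarrow> s' \<in> hom C x b \<Longrightarrow>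
        (\<And>M w. w \<in> pts x M \<Longrightarrow> (ap x a s M w, ap x b s' M w) \<in> R M) \<Longrightarrow>
        \<exists>!h. h \<in> hom C x p \<and> comp C x p a h u = s \<and> comp C x p b h v = s'"
    using un unfolding univ_def by blast+
  obtain t u' v' where sp: "span a b t u' v' R" using span_exists[OF o R] by blast
  note t = spanD[OF sp]
  obtain h where h: "h \<in> hom C p t" "comp C p t a h u' = u" "comp C p t b h v' = v"
    using span_lift[OF o p(1) sp p(2,3) uv] by blast
  obtain k where k: "k \<in> hom C t p" "comp C t p a k u = u'" "comp C t p b k v = v'"
    using lift[OF t(1-3) t(4)] by blast
  have hk: "comp C p t p h k \<in> hom C p p" by (rule comp_hom[OF p(1) t(1) p(1) h(1) k(1)])
  note assoc = categoryD(5)[OF category]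
  have "comp C p t p h k = ident C p"
    using lift[OF p uv] hk ident_hom[OF p(1)] categoryD(3)[OF category p(1) o(1) p(2)]
      categoryD(3)[OF category p(1) o(2) p(3)]
      assoc[OF p(1) t(1) p(1) o(1) h(1) k(1) p(2)] assoc[OF p(1) t(1) p(1) o(2) h(1) k(1) p(3)] h k by metis
  then have kh: "ap t p k M (ap p t h M w) = w" if "w \<in> pts p M" for M w
    using ap_comp[OF p(1) t(1) p(1) h(1) k(1) that] ap_ident[OF p(1) that] by simp
  have hu: "ap p a u M w = ap t a u' M (ap p t h M w)" "ap p b v M w = ap t b v' M (ap p t h M w)"
    if "w \<in> pts p M" for M w
    using ap_comp[OF p(1) t(1) o(1) h(1) t(2) that] ap_comp[OF p(1) t(1) o(2) h(1) t(3) that] h by simp_all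
  have ku: "ap t a u' M z = ap p a u M (ap t p k M z)" "ap t b v' M z = ap p b v M (ap t p k M z)"
    if "z \<in> pts t M" for M z
    using ap_comp[OF t(1) p(1) o(1) k(1) p(2) that] ap_comp[OF t(1) p(1) o(2) k(1) p(3) that] k by simp_all
  show "span a b p u v R"
  proof (rule spanI[OF p uv])
    fix M x y assume "(x, y) \<in> R M"
    then obtain z where z: "z \<in> pts t M" "ap t a u' M z = x" "ap t b v' M z = y" using t(5) by blast
    then show "\<exists>w\<in>pts p M. ap p a u M w = x \<and> ap p b v M w = y"
      using ku[OF z(1)] ap_in[OF t(1) p(1) k(1) z(1)] by auto
  next
    fix M w w' assume w: "w \<in> pts p M" "w' \<in> pts p M" "ap p a u M w = ap p a u M w'" "ap p b v M w = ap p b v M w'"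
    have "ap p t h M w = ap p t h M w'"
      using t(6) ap_in[OF p(1) t(1) h(1)] w hu by metis
    then show "w = w'" using kh w(1,2) by metis
  qed
qed

section \<open>Pullbacks, monomorphisms, images and regular epimorphisms on points\<close>

definition fib :: "'o \<Rightarrow> 'o \<Rightarrow> 'o \<Rightarrow> 'a \<Rightarrow> 'a \<Rightarrow> 'm \<Rightarrow> ('e \<times> 'e) set" where
  "fib a b c f g = (\<lambda>M. {(x, y). x \<in> pts a M \<and> y \<in> pts b M \<and> ap a c f M x = ap b c g M y})"

lemma drel_fib:
  assumes "a \<in> obj C" "b \<in> obj C" "c \<in> obj C" "f \<in> hom C a c" "g \<in> hom C b c"
  shows "drel a b (fib a b c f g)"
proof -
  have "fib a b c f g = (\<lambda>M. gr a c f M O (gr b c g M)\<inverse>)" by (auto simp: fib_def fun_eq_iff)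
  moreover have "drel a b (\<lambda>M. gr a c f M O (gr b c g M)\<inverse>)"
    by (intro drel_comp[of _ c] drel_conv drel_gr assms)
  ultimately show ?thesis by simp
qed

lemma comp_eq_iff_fib:
  assumes "a \<in> obj C" "b \<in> obj C" "c \<in> obj C" "f \<in> hom C a c" "g \<in> hom C b c"
    "x \<in> obj C" "s \<in> hom C x a" "t \<in> hom C x b"
  shows "comp C x a c s f = comp C x b c t g \<longleftrightarrow>
    (\<forall>M. \<forall>w\<in>pts x M. (ap x a s M w, ap x b t M w) \<in> fib a b c f g M)" (is "?L \<longleftrightarrow> ?R")
proof
  assume L: ?L
  show ?R
  proof (intro allI ballI)
    fix M w assume w: "w \<in> pts x M"
    have "ap a c f M (ap x a s M w) = ap b c g M (ap x b t M w)"
      using ap_comp[OF assms(6,1,3,7,4) w] ap_comp[OF assms(6,2,3,8,5) w] L by simp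
    then show "(ap x a s M w, ap x b t M w) \<in> fib a b c f g M"
      using ap_in[OF assms(6,1,7) w] ap_in[OF assms(6,2,8) w] by (simp add: fib_def)
  qed
next
  assume R: ?R
  show ?L
    by (rule ap_ext[OF assms(6,3) comp_hom[OF assms(6,1,3,7,4)] comp_hom[OF assms(6,2,3,8,5)]])
      (use R in \<open>simp add: ap_comp[OF assms(6,1,3,7,4)] ap_comp[OF assms(6,2,3,8,5)] fib_def\<close>)
qed

lemma is_pullback_iff:
  assumes "a \<in> obj C" "b \<in> obj C" "c \<in> obj C" "f \<in> hom C a c" "g \<in> hom C b c"
  shows "is_pullback C a b c f g p u v \<longleftrightarrow> span a b p u v (fib a b c f g)"
proof -
  have "is_pullback C a b c f g p u v \<longleftrightarrow> univ a b p u v (fib a b c f g)"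
    unfolding is_pullback_def univ_def using comp_eq_iff_fib[OF assms] by (auto 0 0)
  then show ?thesis using univ_iff_span[OF assms(1,2) drel_fib[OF assms]] by simp
qed

lemma is_product_iff:
  assumes o: "a \<in> obj C" "b \<in> obj C"
  shows "is_product C a b p u v \<longleftrightarrow> span a b p u v (\<lambda>M. pts a M \<times> pts b M)"
proof -
  have "is_product C a b p u v \<longleftrightarrow> univ a b p u v (\<lambda>M. pts a M \<times> pts b M)"
    unfolding is_product_def univ_def using ap_in o by blast
  then show ?thesis using univ_iff_span[OF o drel_top[OF o]] by simp
qed

text \<open>The kernel pair of a monomorphism is tabulated by a span whose two legs must be equal;
  this is injectivity on points.\<close>

lemma is_mono_iff:
  assumes o: "a \<in> obj C" "b \<in> obj C"
  shows "is_mono C a b f \<longleftrightarrow> f \<in> hom C a b \<and> (\<forall>M. inj_on (ap a b f M) (pts a M))"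
proof
  assume m: "is_mono C a b f"
  then have f: "f \<in> hom C a b" by (simp add: is_mono_def)
  obtain t u v where sp: "span a a t u v (fib a a b f f)"
    using span_exists[OF o(1,1) drel_fib[OF o(1,1,2) f f]] by blast
  note t = spanD[OF sp]
  have "comp C t a b u f = comp C t a b v f"
    using comp_eq_iff_fib[OF o(1,1,2) f f t(1-3)] t(4) by blast
  then have uv: "u = v" using m t(1-3) unfolding is_mono_def by blast
  have "x = y" if "x \<in> pts a M" "y \<in> pts a M" "ap a b f M x = ap a b f M y" for M x y
    using t(5)[of x y M] that uv by (auto simp: fib_def)
  then show "f \<in> hom C a b \<and> (\<forall>M. inj_on (ap a b f M) (pts a M))" using f by (auto simp: inj_on_def)
next
  assume f: "f \<in> hom C a b \<and> (\<forall>M. inj_on (ap a b f M) (pts a M))"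
  then have fh: "f \<in> hom C a b" by blast
  show "is_mono C a b f" unfolding is_mono_def
  proof (intro conjI ballI impI fh)
    fix x g h assume x: "x \<in> obj C" "g \<in> hom C x a" "h \<in> hom C x a" and eq: "comp C x a b g f = comp C x a b h f"
    show "g = h"
    proof (rule ap_ext[OF x(1) o(1) x(2,3)])
      fix M w assume w: "w \<in> pts x M"
      have "ap a b f M (ap x a g M w) = ap a b f M (ap x a h M w)"
        using ap_comp[OF x(1) o x(2) fh w] ap_comp[OF x(1) o x(3) fh w] eq by simp
      then show "ap x a g M w = ap x a h M w"
        using f ap_in[OF x(1) o(1) x(2) w] ap_in[OF x(1) o(1) x(3) w] unfolding inj_on_def by blast
    qed
  qed
qed

text \<open>The diagonal of the image is the definable relation \<open>?R\<close>. The two legs of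
  its tabulation agree on points, and either of them is the required monomorphism.\<close>

lemma image_object:
  assumes o: "a \<in> obj C" "b \<in> obj C" and f: "f \<in> hom C a b"
  obtains d m where "d \<in> obj C" "is_mono C d b m" "\<And>M. ap d b m M ` pts d M = ap a b f M ` pts a M"
proof -
  let ?R = "\<lambda>M. (gr a b f M)\<inverse> O gr a b f M"
  have R: "drel b b ?R" by (intro drel_comp[of _ a] drel_conv drel_gr o f)
  obtain d m m' where sp: "span b b d m m' ?R" using span_exists[OF o(2,2) R] by blast
  note d = spanD[OF sp]
  have mm: "ap d b m M w = ap d b m' M w" if "w \<in> pts d M" for M w using d(4)[OF that] by auto
  have "is_mono C d b m" unfolding is_mono_iff[OF d(1) o(2)] inj_on_def using d(2,6) mm by metis
  moreover have "ap d b m M ` pts d M = ap a b f M ` pts a M" for M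
  proof
    show "ap d b m M ` pts d M \<subseteq> ap a b f M ` pts a M" using d(4) by fastforce
    show "ap a b f M ` pts a M \<subseteq> ap d b m M ` pts d M"
    proof
      fix y assume "y \<in> ap a b f M ` pts a M"
      then have "(y, y) \<in> ?R M" by auto
      from d(5)[OF this] show "y \<in> ap d b m M ` pts d M" by blast
    qed
  qed
  ultimately show ?thesis using that d(1) by blast
qed

text \<open>The factorisation sends \<open>x\<close> to the only point of \<open>d\<close> with the
  same image in \<open>b\<close>; its graph is a \<open>fib\<close>.\<close>

lemma mono_lift:
  assumes o: "a \<in> obj C" "b \<in> obj C" "d \<in> obj C" and f: "f \<in> hom C a b" and m: "is_mono C d b m"
    and sub: "\<And>M. ap a b f M ` pts a M \<subseteq> ap d b m M ` pts d M"
  obtains e where "e \<in> hom C a d" "comp C a d b e m = f"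
proof -
  have mh: "m \<in> hom C d b" and inj: "\<And>M. inj_on (ap d b m M) (pts d M)"
    using m is_mono_iff[OF o(3,2)] by auto
  let ?R = "fib a d b f m"
  have "\<exists>e\<in>hom C a d. \<forall>M. \<forall>x\<in>pts a M. (x, ap a d e M x) \<in> ?R M"
  proof (rule drel_fun[OF o(1,3) drel_fib[OF o(1,3,2) f mh]])
    fix M x assume x: "x \<in> pts a M"
    then obtain w where w: "w \<in> pts d M" "ap a b f M x = ap d b m M w" using sub by blast
    show "\<exists>!y. (x, y) \<in> ?R M"
      by (rule ex1I[of _ w]) (use x w inj[of M] in \<open>auto simp: fib_def inj_on_def\<close>)
  qed
  then obtain e where e: "e \<in> hom C a d" "\<And>M x. x \<in> pts a M \<Longrightarrow> ap d b m M (ap a d e M x) = ap a b f M x"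
    by (auto simp: fib_def)
  have "comp C a d b e m = f"
    by (rule ap_ext[OF o(1,2) comp_hom[OF o(1,3,2) e(1) mh] f])
      (simp add: ap_comp[OF o(1,3,2) e(1) mh] e(2))
  then show ?thesis using that e(1) by blast
qed

text \<open>A coequalizer factors through its own image; uniqueness of factorisations gives the
  monomorphism of that image a section, so the image is everything. Conversely, a map that is onto
  in every \<open>M\<close> is the coequalizer of its kernel pair, because maps constant on the
  fibres descend along the definable relation \<open>?R\<close>.\<close>

lemma is_regular_epi_iff:
  assumes o: "a \<in> obj C" "b \<in> obj C" and e: "e \<in> hom C a b"
  shows "is_regular_epi C a b e \<longleftrightarrow> (\<forall>M. ap a b e M ` pts a M = pts b M)"
proof
  assume "is_regular_epi C a b e"
  then obtain k f g where k: "k \<in> obj C" "f \<in> hom C k a" "g \<in> hom C k a" and ce: "is_coequalizer C k a b f g e"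
    unfolding is_regular_epi_def by blast
  have eq: "comp C k a b f e = comp C k a b g e"
    and lift: "\<And>x t. x \<in> obj C \<Longrightarrow> t \<in> hom C a x \<Longrightarrow> comp C k a x f t = comp C k a x g t \<Longrightarrow>
        \<exists>!h. h \<in> hom C b x \<and> comp C a b x e h = t"
    using ce unfolding is_coequalizer_def by blast+
  obtain d m where d: "d \<in> obj C" "is_mono C d b m" "\<And>M. ap d b m M ` pts d M = ap a b e M ` pts a M"
    using image_object[OF o e] by blast
  have m: "m \<in> hom C d b" using d(2) by (simp add: is_mono_def)
  obtain e' where e': "e' \<in> hom C a d" "comp C a d b e' m = e"
    by (rule mono_lift[OF o d(1) e d(2)]) (simp add: d(3))
  note assoc = categoryD(5)[OF category]
  have "comp C k d b (comp C k a d f e') m = comp C k d b (comp C k a d g e') m"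
    using assoc[OF k(1) o(1) d(1) o(2) k(2) e'(1) m] assoc[OF k(1) o(1) d(1) o(2) k(3) e'(1) m] e'(2) eq by simp
  then have "comp C k a d f e' = comp C k a d g e'"
    using d(2) k(1) comp_hom[OF k(1) o(1) d(1) k(2) e'(1)] comp_hom[OF k(1) o(1) d(1) k(3) e'(1)]
    unfolding is_mono_def by blast
  then obtain h where h: "h \<in> hom C b d" "comp C a b d e h = e'" using lift[OF d(1) e'(1)] by blast
  have hm: "comp C b d b h m \<in> hom C b b" by (rule comp_hom[OF o(2) d(1) o(2) h(1) m])
  have "comp C a b b e (comp C b d b h m) = e"
    using assoc[OF o d(1) o(2) e h(1) m] h(2) e'(2) by simp
  then have "comp C b d b h m = ident C b"
    using lift[OF o(2) e eq] hm ident_hom[OF o(2)] categoryD(4)[OF category o e] by blast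
  then have mh: "ap d b m M (ap b d h M y) = y" if "y \<in> pts b M" for M y
    using ap_comp[OF o(2) d(1) o(2) h(1) m that] ap_ident[OF o(2) that] by simp
  show "\<forall>M. ap a b e M ` pts a M = pts b M"
  proof (intro allI equalityI)
    fix M show "ap a b e M ` pts a M \<subseteq> pts b M" using ap_in[OF o e] by blast
    show "pts b M \<subseteq> ap a b e M ` pts a M"
    proof
      fix y assume y: "y \<in> pts b M"
      have "ap d b m M (ap b d h M y) \<in> ap d b m M ` pts d M" using ap_in[OF o(2) d(1) h(1) y] by blast
      then show "y \<in> ap a b e M ` pts a M" unfolding d(3) mh[OF y] .
    qed
  qed
next
  assume sur: "\<forall>M. ap a b e M ` pts a M = pts b M"
  obtain k f g where sp: "span a a k f g (fib a a b e e)"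
    using span_exists[OF o(1,1) drel_fib[OF o(1,1,2) e e]] by blast
  note k = spanD[OF sp]
  have eq: "comp C k a b f e = comp C k a b g e"
    using comp_eq_iff_fib[OF o(1,1,2) e e k(1-3)] k(4) by blast
  have "is_coequalizer C k a b f g e" unfolding is_coequalizer_def
  proof (intro conjI ballI impI e eq)
    fix x t assume x: "x \<in> obj C" and t: "t \<in> hom C a x" and eqt: "comp C k a x f t = comp C k a x g t"
    have const: "ap a x t M z = ap a x t M z'"
      if z: "z \<in> pts a M" "z' \<in> pts a M" "ap a b e M z = ap a b e M z'" for M z z'
    proof -
      obtain w where w: "w \<in> pts k M" "ap k a f M w = z" "ap k a g M w = z'"
        using k(5)[of z z' M] z by (auto simp: fib_def)
      then show ?thesis
        using ap_comp[OF k(1) o(1) x k(2) t w(1)] ap_comp[OF k(1) o(1) x k(3) t w(1)] eqt by simp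
    qed
    let ?R = "\<lambda>M. (gr a b e M)\<inverse> O gr a x t M"
    have R: "drel b x ?R" by (intro drel_comp[of _ a] drel_conv drel_gr o e x t)
    have "\<exists>h\<in>hom C b x. \<forall>M. \<forall>y\<in>pts b M. (y, ap b x h M y) \<in> ?R M"
    proof (rule drel_fun[OF o(2) x R])
      fix M y assume "y \<in> pts b M"
      then obtain z where z: "z \<in> pts a M" "y = ap a b e M z" using sur by blast
      show "\<exists>!w. (y, w) \<in> ?R M"
      proof (rule ex1I[of _ "ap a x t M z"])
        show "(y, ap a x t M z) \<in> ?R M" using z by auto
        fix w assume "(y, w) \<in> ?R M"
        then obtain z' where z': "z' \<in> pts a M" "y = ap a b e M z'" "w = ap a x t M z'" by auto
        show "w = ap a x t M z" unfolding z'(3) by (rule const[OF z'(1) z(1)]) (simp only: z'(2)[symmetric] z(2)[symmetric])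
      qed
    qed
    then obtain h where h: "h \<in> hom C b x" "\<And>M y. y \<in> pts b M \<Longrightarrow> (y, ap b x h M y) \<in> ?R M" by blast
    have he: "ap b x h M (ap a b e M z) = ap a x t M z" if z: "z \<in> pts a M" for M z
    proof -
      obtain z' where "z' \<in> pts a M" "ap a b e M z = ap a b e M z'" "ap b x h M (ap a b e M z) = ap a x t M z'"
        using h(2)[OF ap_in[OF o e z]] by auto
      then show ?thesis using const z by metis
    qed
    show "\<exists>!h. h \<in> hom C b x \<and> comp C a b x e h = t"
    proof (rule ex1I[of _ h], intro conjI h(1))
      show "comp C a b x e h = t"
        by (rule ap_ext[OF o(1) x comp_hom[OF o x e h(1)] t]) (simp add: ap_comp[OF o x e h(1)] he)
      fix h' assume h': "h' \<in> hom C b x \<and> comp C a b x e h' = t"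
      then have hh: "h' \<in> hom C b x" by blast
      show "h' = h"
      proof (rule ap_ext[OF o(2) x hh h(1)])
        fix M y assume "y \<in> pts b M"
        then obtain z where z: "z \<in> pts a M" "y = ap a b e M z" using sur by blast
        show "ap b x h' M y = ap b x h M y"
          using ap_comp[OF o x e hh z(1)] h' he[OF z(1)] z(2) by simp
      qed
    qed
  qed
  then show "is_regular_epi C a b e" unfolding is_regular_epi_def using k(1-3) by blast
qed

lemma regular_epi_hom: "is_regular_epi C a b e \<Longrightarrow> e \<in> hom C a b"
  unfolding is_regular_epi_def is_coequalizer_def by blast

text \<open>Covers are onto and monomorphisms injective on points, so an image is pinned down by the
  set of points that it reaches.\<close>

lemma is_image_iff:
  assumes o: "a \<in> obj C" "b \<in> obj C" and f: "f \<in> hom C a b"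
  shows "is_image C a b f d m \<longleftrightarrow> d \<in> obj C \<and> is_mono C d b m \<and>
    (\<forall>M. ap d b m M ` pts d M = ap a b f M ` pts a M)"
proof
  assume i: "is_image C a b f d m"
  then have d: "d \<in> obj C" and m: "is_mono C d b m" by (auto simp: is_image_def)
  obtain e where e: "is_regular_epi C a d e" "comp C a d b e m = f" using i unfolding is_image_def by blast
  have eh: "e \<in> hom C a d" and mh: "m \<in> hom C d b" using e(1) m by (auto simp: is_mono_def regular_epi_hom)
  have "ap d b m M ` pts d M = ap a b f M ` pts a M" for M
  proof -
    have "ap a b f M ` pts a M = (\<lambda>x. ap d b m M (ap a d e M x)) ` pts a M"
      using ap_comp[OF o(1) d o(2) eh mh] e(2) by (intro image_cong) auto
    also have "\<dots> = ap d b m M ` (ap a d e M ` pts a M)" by (simp add: image_image)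
    also have "ap a d e M ` pts a M = pts d M" using e(1) is_regular_epi_iff[OF o(1) d eh] by blast
    finally show ?thesis by simp
  qed
  then show "d \<in> obj C \<and> is_mono C d b m \<and> (\<forall>M. ap d b m M ` pts d M = ap a b f M ` pts a M)" using d m by blast
next
  assume r: "d \<in> obj C \<and> is_mono C d b m \<and> (\<forall>M. ap d b m M ` pts d M = ap a b f M ` pts a M)"
  then have d: "d \<in> obj C" and m: "is_mono C d b m" and im: "\<And>M. ap d b m M ` pts d M = ap a b f M ` pts a M" by auto
  obtain e where e: "e \<in> hom C a d" "comp C a d b e m = f"
    by (rule mono_lift[OF o d f m]) (simp add: im)
  have mh: "m \<in> hom C d b" and inj: "\<And>M. inj_on (ap d b m M) (pts d M)"
    using m is_mono_iff[OF d o(2)] by auto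
  have "ap a d e M ` pts a M = pts d M" for M
  proof (intro equalityI subsetI)
    fix w assume "w \<in> ap a d e M ` pts a M" then show "w \<in> pts d M" using ap_in[OF o(1) d e(1)] by blast
  next
    fix w assume w: "w \<in> pts d M"
    then have "ap d b m M w \<in> ap a b f M ` pts a M" using im by blast
    then obtain x where x: "x \<in> pts a M" "ap d b m M w = ap a b f M x" by blast
    then have "ap d b m M w = ap d b m M (ap a d e M x)" using ap_comp[OF o(1) d o(2) e(1) mh x(1)] e(2) by simp
    then have "w = ap a d e M x" using inj[of M] w ap_in[OF o(1) d e(1) x(1)] unfolding inj_on_def by blast
    then show "w \<in> ap a d e M ` pts a M" using x(1) by blast
  qed
  then have "is_regular_epi C a d e" using is_regular_epi_iff[OF o(1) d e(1)] by blast
  then show "is_image C a b f d m" unfolding is_image_def using d m e(2) by blast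
qed

theorem regular: "regular_category C"
  unfolding regular_category_def
proof (intro conjI ballI allI impI category)
  obtain t where t: "t \<in> obj C" "\<And>a M. a \<in> obj C \<Longrightarrow> pts a M \<noteq> {} \<Longrightarrow> \<exists>u. pts t M = {u}"
    using terminal by blast
  have "\<exists>!h. h \<in> hom C x t" if x: "x \<in> obj C" for x
  proof -
    have "\<exists>f\<in>hom C x t. \<forall>M. \<forall>w\<in>pts x M. (w, ap x t f M w) \<in> pts x M \<times> pts t M"
    proof (rule drel_fun[OF x t(1) drel_top[OF x t(1)]])
      fix M w assume w: "w \<in> pts x M"
      then obtain u where "pts t M = {u}" using t(2)[OF x, of M] by blast
      then show "\<exists>!y. (w, y) \<in> pts x M \<times> pts t M" using w by auto
    qed
    then obtain f where f: "f \<in> hom C x t" by blast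
    show ?thesis
    proof (rule ex1I[of _ f])
      show "f \<in> hom C x t" by (rule f)
      fix h assume h: "h \<in> hom C x t"
      show "h = f"
      proof (rule ap_ext[OF x t(1) h f])
        fix M w assume w: "w \<in> pts x M"
        then obtain u where "pts t M = {u}" using t(2)[OF x, of M] by blast
        then show "ap x t h M w = ap x t f M w" using ap_in[OF x t(1) h w] ap_in[OF x t(1) f w] by simp
      qed
    qed
  qed
  then show "\<exists>t. is_terminal C t" unfolding is_terminal_def using t(1) by blast
next
  fix a b c f g assume h: "a \<in> obj C" "b \<in> obj C" "c \<in> obj C" "f \<in> hom C a c" "g \<in> hom C b c"
  then show "\<exists>p u v. is_pullback C a b c f g p u v"
    unfolding is_pullback_iff[OF h] using span_exists[OF h(1,2) drel_fib[OF h]] by blast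
next
  fix a b f assume h: "a \<in> obj C" "b \<in> obj C" "f \<in> hom C a b"
  show "\<exists>d m. is_image C a b f d m"
    unfolding is_image_iff[OF h] using image_object[OF h] by metis
next
  fix a b c f g p u v assume h: "a \<in> obj C" "b \<in> obj C" "c \<in> obj C" "f \<in> hom C a c" "g \<in> hom C b c"
    and pb: "is_pullback C a b c f g p u v" and e: "is_regular_epi C b c g"
  note p = spanD[OF pb[unfolded is_pullback_iff[OF h]]]
  have sur: "ap b c g M ` pts b M = pts c M" for M using e is_regular_epi_iff[OF h(2,3,5)] by blast
  have "ap p a u M ` pts p M = pts a M" for M
  proof (intro equalityI subsetI)
    fix x assume "x \<in> ap p a u M ` pts p M" then show "x \<in> pts a M" using ap_in[OF p(1) h(1) p(2)] by blast
  next
    fix x assume x: "x \<in> pts a M"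
    have "ap a c f M x \<in> ap b c g M ` pts b M" unfolding sur by (rule ap_in[OF h(1,3,4) x])
    then obtain y where "y \<in> pts b M" "ap a c f M x = ap b c g M y" by blast
    then have "(x, y) \<in> fib a b c f g M" using x by (simp add: fib_def)
    from p(5)[OF this] show "x \<in> ap p a u M ` pts p M" by blast
  qed
  then show "is_regular_epi C p a u" using is_regular_epi_iff[OF p(1) h(1) p(2)] by blast
qed

end

context definable_category
begin

section \<open>Relations as subobjects\<close>

text \<open>The po-category from which both \<open>Syn\<close> and \<open>Rel\<close> are reached.
  Its morphisms are extensions rather than formulae, so equality and order are those of
  sets.\<close>

definition DRel :: "('o, 'm \<Rightarrow> ('e \<times> 'e) set) pocat" where
  "DRel = \<lparr>obj = obj C, hom = (\<lambda>a b. {R. drel a b R}), ident = (\<lambda>a M. Id_on (pts a M)),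
     comp = (\<lambda>a b c R S M. R M O S M), le = (\<lambda>a b R S. \<forall>M. R M \<subseteq> S M)\<rparr>"

lemma DRel_simps [simp]:
  "obj DRel = obj C" "R \<in> hom DRel a b \<longleftrightarrow> drel a b R" "ident DRel a = (\<lambda>M. Id_on (pts a M))"
  "comp DRel a b c R S = (\<lambda>M. R M O S M)" "le DRel a b R S \<longleftrightarrow> (\<forall>M. R M \<subseteq> S M)"
  by (simp_all add: DRel_def)

lemma drel_Id: "a \<in> obj C \<Longrightarrow> drel a a (\<lambda>M. Id_on (pts a M))"
proof -
  assume a: "a \<in> obj C"
  have "gr a a (ident C a) = (\<lambda>M. Id_on (pts a M))"
    by (auto simp: gr_def Id_on_def fun_eq_iff ap_ident[OF a] image_iff)
  then show ?thesis using drel_gr[OF a a ident_hom[OF a]] by simp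
qed

lemma po_category_DRel: "po_category DRel"
  unfolding po_category_def category_def poset_on_def DRel_simps
proof (intro conjI ballI allI impI)
  fix a assume "a \<in> obj C" then show "drel a a (\<lambda>M. Id_on (pts a M))" by (rule drel_Id)
next
  fix a b c R S assume "a \<in> obj C" "b \<in> obj C" "c \<in> obj C" "R \<in> hom DRel a b" "S \<in> hom DRel b c"
  then show "drel a c (\<lambda>M. R M O S M)" by (auto intro: drel_comp)
next
  fix a b R assume o: "a \<in> obj C" "b \<in> obj C" and R: "R \<in> hom DRel a b"
  have "R M \<subseteq> pts a M \<times> pts b M" for M using drel_sub[OF o] R by simp
  then show "(\<lambda>M. Id_on (pts a M) O R M) = R" "(\<lambda>M. R M O Id_on (pts b M)) = R"
    by (intro ext; fastforce)+
next
  fix a b c d and f g h :: "'m \<Rightarrow> ('e \<times> 'e) set"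
  show "(\<lambda>M. (f M O g M) O h M) = (\<lambda>M. f M O g M O h M)" by (simp add: O_assoc)
next
  fix x :: "'m \<Rightarrow> ('e \<times> 'e) set" and M show "x M \<subseteq> x M" by simp
next
  fix x y z :: "'m \<Rightarrow> ('e \<times> 'e) set" and M
  assume "\<forall>M. x M \<subseteq> y M" "\<forall>M. y M \<subseteq> z M" then show "x M \<subseteq> z M" by blast
next
  fix x y :: "'m \<Rightarrow> ('e \<times> 'e) set"
  assume "\<forall>M. x M \<subseteq> y M" "\<forall>M. y M \<subseteq> x M" then show "x = y" by (simp add: fun_eq_iff set_eq_subset)
next
  fix f f' g g' :: "'m \<Rightarrow> ('e \<times> 'e) set" and M
  assume "\<forall>M. f M \<subseteq> f' M" "\<forall>M. g M \<subseteq> g' M" then show "f M O g M \<subseteq> f' M O g' M" by (meson relcomp_mono)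
qed

text \<open>The unit provides a value with a way back, and the counit makes this value the only one.
  For the converse the right adjoint is the converse relation.\<close>

lemma left_adjoint_DRel_iff:
  assumes o: "a \<in> obj C" "b \<in> obj C"
  shows "left_adjoint DRel a b R \<longleftrightarrow> drel a b R \<and> (\<forall>M. \<forall>x\<in>pts a M. \<exists>!y. (x, y) \<in> R M)"
proof
  assume "left_adjoint DRel a b R"
  then obtain S where R: "drel a b R" and S: "drel b a S"
    and 1: "\<And>M. Id_on (pts a M) \<subseteq> R M O S M" and 2: "\<And>M. S M O R M \<subseteq> Id_on (pts b M)"
    unfolding left_adjoint_def DRel_simps by auto
  have "\<exists>!y. (x, y) \<in> R M" if x: "x \<in> pts a M" for M x
  proof -
    have "(x, x) \<in> R M O S M" using 1 x by blast
    then obtain y where y: "(x, y) \<in> R M" "(y, x) \<in> S M" by auto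
    have "z = y" if "(x, z) \<in> R M" for z
    proof -
      have "(y, z) \<in> S M O R M" using y(2) that by blast
      then have "(y, z) \<in> Id_on (pts b M)" using 2 by blast
      then show ?thesis by (auto simp: Id_on_def)
    qed
    with y(1) show ?thesis by blast
  qed
  then show "drel a b R \<and> (\<forall>M. \<forall>x\<in>pts a M. \<exists>!y. (x, y) \<in> R M)" using R by blast
next
  assume R: "drel a b R \<and> (\<forall>M. \<forall>x\<in>pts a M. \<exists>!y. (x, y) \<in> R M)"
  have sub: "R M \<subseteq> pts a M \<times> pts b M" for M using drel_sub[OF o] R by blast
  have "Id_on (pts a M) \<subseteq> R M O (R M)\<inverse>" for M using R by (force simp: Id_on_def)
  moreover have "(R M)\<inverse> O R M \<subseteq> Id_on (pts b M)" for M
  proof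
    fix z assume "z \<in> (R M)\<inverse> O R M"
    then obtain x y y' where z: "z = (y, y')" "(x, y) \<in> R M" "(x, y') \<in> R M" by auto
    moreover have "x \<in> pts a M" "y \<in> pts b M" using sub z by auto
    ultimately have "y = y'" using R by blast
    then show "z \<in> Id_on (pts b M)" using z \<open>y \<in> pts b M\<close> by auto
  qed
  moreover have "drel b a (\<lambda>M. (R M)\<inverse>)" using drel_conv[OF o] R by blast
  ultimately show "left_adjoint DRel a b R"
    unfolding left_adjoint_def DRel_simps using R by (intro conjI bexI[of _ "\<lambda>M. (R M)\<inverse>"]) auto
qed

lemma cat_onto_LAdj_DRel: "cat_onto C (LAdj DRel) (\<lambda>a. a) gr"
  unfolding cat_onto_def LAdj_def
proof (simp, intro conjI ballI)
  fix a b assume o: "a \<in> obj C" "b \<in> obj C"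
  show "bij_betw (gr a b) (hom C a b) {R. left_adjoint DRel a b R}"
  proof (rule bij_betw_imageI)
    show "inj_on (gr a b) (hom C a b)"
    proof (rule inj_onI)
      fix f g assume fg: "f \<in> hom C a b" "g \<in> hom C a b" "gr a b f = gr a b g"
      show "f = g"
      proof (rule ap_ext[OF o fg(1,2)])
        fix M x assume "x \<in> pts a M"
        then have "(x, ap a b f M x) \<in> gr a b g M" by (simp flip: fg(3))
        then show "ap a b f M x = ap a b g M x" by simp
      qed
    qed
    show "gr a b ` hom C a b = {R. left_adjoint DRel a b R}"
    proof (intro equalityI subsetI)
      fix R assume "R \<in> gr a b ` hom C a b"
      then show "R \<in> {R. left_adjoint DRel a b R}"
        using drel_gr[OF o] by (auto simp: left_adjoint_DRel_iff[OF o])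
    next
      fix R assume "R \<in> {R. left_adjoint DRel a b R}"
      then have R: "drel a b R" "\<And>M x. x \<in> pts a M \<Longrightarrow> \<exists>!y. (x, y) \<in> R M"
        by (auto simp: left_adjoint_DRel_iff[OF o])
      from drel_fun[OF o R] obtain f where f: "f \<in> hom C a b" "\<And>M x. x \<in> pts a M \<Longrightarrow> (x, ap a b f M x) \<in> R M"
        by blast
      have "gr a b f M = R M" for M
      proof (intro equalityI subrelI)
        fix x y assume "(x, y) \<in> gr a b f M" then show "(x, y) \<in> R M" using f(2) by simp
      next
        fix x y assume xy: "(x, y) \<in> R M"
        then have x: "x \<in> pts a M" using drel_sub[OF o R(1)] by blast
        then have "y = ap a b f M x" using R(2)[OF x] f(2)[OF x] xy by blast
        then show "(x, y) \<in> gr a b f M" using x by simp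
      qed
      then have "R = gr a b f" by (simp add: fun_eq_iff)
      then show "R \<in> gr a b ` hom C a b" using f(1) by blast
    qed
  qed
next
  fix a assume a: "a \<in> obj C"
  show "gr a a (ident C a) = (\<lambda>M. Id_on (pts a M))"
    by (auto simp: gr_def Id_on_def fun_eq_iff ap_ident[OF a] image_iff)
next
  fix a b c f g assume h: "a \<in> obj C" "b \<in> obj C" "c \<in> obj C" "f \<in> hom C a b" "g \<in> hom C b c"
  show "gr a c (comp C a b c f g) = (\<lambda>M. gr a b f M O gr b c g M)"
    by (rule ext, rule set_eqI, clarify) (use ap_comp[OF h] ap_in[OF h(1,2,4)] in auto)
qed

context
  fixes a b assumes o: "a \<in> obj C" "b \<in> obj C"
begin

text \<open>Tabulating the full relation shows that a product exists, so the choice in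
  \<open>chosen_product\<close> picks a genuine one.\<close>

lemma span_prd: "span a b (prd C a b) (prj1 C a b) (prj2 C a b) (\<lambda>M. pts a M \<times> pts b M)"
proof -
  obtain p u v where "is_product C a b p u v"
    unfolding is_product_iff[OF o] using span_exists[OF o drel_top[OF o]] by blast
  then have "case (p, u, v) of (p, u, v) \<Rightarrow> is_product C a b p u v" by simp
  then have "case chosen_product C a b of (p, u, v) \<Rightarrow> is_product C a b p u v"
    unfolding chosen_product_def by (rule someI)
  then show ?thesis unfolding is_product_iff[OF o, symmetric] prd_def prj1_def prj2_def
    by (simp add: case_prod_beta)
qed

lemmas prd = spanD[OF span_prd]

lemma pairing:
  assumes x: "x \<in> obj C" and f: "f \<in> hom C x a" and g: "g \<in> hom C x b"
  shows "pairing C x a b f g \<in> hom C x (prd C a b)"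
    "w \<in> pts x M \<Longrightarrow> ap (prd C a b) a (prj1 C a b) M (ap x (prd C a b) (pairing C x a b f g) M w) = ap x a f M w"
    "w \<in> pts x M \<Longrightarrow> ap (prd C a b) b (prj2 C a b) M (ap x (prd C a b) (pairing C x a b f g) M w) = ap x b g M w"
proof -
  have "\<exists>!h. h \<in> hom C x (prd C a b) \<and> comp C x (prd C a b) a h (prj1 C a b) = f \<and>
      comp C x (prd C a b) b h (prj2 C a b) = g"
    using span_lift[OF o x span_prd f g] ap_in[OF x] o f g by blast
  from theI'[OF this] have h: "pairing C x a b f g \<in> hom C x (prd C a b)"
    "comp C x (prd C a b) a (pairing C x a b f g) (prj1 C a b) = f"
    "comp C x (prd C a b) b (pairing C x a b f g) (prj2 C a b) = g"
    unfolding pairing_def by blast+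
  show "pairing C x a b f g \<in> hom C x (prd C a b)" by (rule h(1))
  show "w \<in> pts x M \<Longrightarrow> ap (prd C a b) a (prj1 C a b) M (ap x (prd C a b) (pairing C x a b f g) M w) = ap x a f M w"
    using ap_comp[OF x prd(1) o(1) h(1) prd(2)] h(2) by simp
  show "w \<in> pts x M \<Longrightarrow> ap (prd C a b) b (prj2 C a b) M (ap x (prd C a b) (pairing C x a b f g) M w) = ap x b g M w"
    using ap_comp[OF x prd(1) o(2) h(1) prd(3)] h(3) by simp
qed

text \<open>Defined for any arrow into the chosen product, monic or not, since the composite of
  relations is the image of a pairing that need not be monic.\<close>

definition img :: "'o \<times> 'a \<Rightarrow> 'm \<Rightarrow> ('e \<times> 'e) set" where
  "img s = (\<lambda>M. (\<lambda>w. (ap (prd C a b) a (prj1 C a b) M (ap (fst s) (prd C a b) (snd s) M w),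
     ap (prd C a b) b (prj2 C a b) M (ap (fst s) (prd C a b) (snd s) M w))) ` pts (fst s) M)"

lemma monos_into_iff: "s \<in> monos_into C (prd C a b) \<longleftrightarrow> fst s \<in> obj C \<and> is_mono C (fst s) (prd C a b) (snd s)"
  by (auto simp: monos_into_def)

lemma img_subset_iff:
  assumes s: "fst s \<in> obj C" "snd s \<in> hom C (fst s) (prd C a b)"
    and t: "fst t \<in> obj C" "snd t \<in> hom C (fst t) (prd C a b)"
  shows "img s M \<subseteq> img t M \<longleftrightarrow>
    ap (fst s) (prd C a b) (snd s) M ` pts (fst s) M \<subseteq> ap (fst t) (prd C a b) (snd t) M ` pts (fst t) M"
proof
  assume L: "img s M \<subseteq> img t M"
  show "ap (fst s) (prd C a b) (snd s) M ` pts (fst s) M \<subseteq> ap (fst t) (prd C a b) (snd t) M ` pts (fst t) M"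
  proof
    fix z assume "z \<in> ap (fst s) (prd C a b) (snd s) M ` pts (fst s) M"
    then obtain w where w: "w \<in> pts (fst s) M" "z = ap (fst s) (prd C a b) (snd s) M w" by blast
    then have "(ap (prd C a b) a (prj1 C a b) M z, ap (prd C a b) b (prj2 C a b) M z) \<in> img t M"
      using L unfolding img_def by blast
    then obtain w' where w': "w' \<in> pts (fst t) M"
      "ap (prd C a b) a (prj1 C a b) M z = ap (prd C a b) a (prj1 C a b) M (ap (fst t) (prd C a b) (snd t) M w')"
      "ap (prd C a b) b (prj2 C a b) M z = ap (prd C a b) b (prj2 C a b) M (ap (fst t) (prd C a b) (snd t) M w')"
      unfolding img_def by blast
    have "z = ap (fst t) (prd C a b) (snd t) M w'"
      using prd(6)[OF _ _ w'(2,3)] ap_in[OF s(1) prd(1) s(2) w(1)] ap_in[OF t(1) prd(1) t(2) w'(1)] w(2) by simp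
    then show "z \<in> ap (fst t) (prd C a b) (snd t) M ` pts (fst t) M" using w'(1) by blast
  qed
next
  assume "ap (fst s) (prd C a b) (snd s) M ` pts (fst s) M \<subseteq> ap (fst t) (prd C a b) (snd t) M ` pts (fst t) M"
  then show "img s M \<subseteq> img t M" unfolding img_def by (force simp: image_iff)
qed

lemma img_eq_iff:
  assumes s: "fst s \<in> obj C" "snd s \<in> hom C (fst s) (prd C a b)"
    and t: "fst t \<in> obj C" "snd t \<in> hom C (fst t) (prd C a b)"
  shows "img s M = img t M \<longleftrightarrow>
    ap (fst s) (prd C a b) (snd s) M ` pts (fst s) M = ap (fst t) (prd C a b) (snd t) M ` pts (fst t) M"
  unfolding set_eq_subset img_subset_iff[OF s t] img_subset_iff[OF t s] ..

lemma factors_iff: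
  assumes s: "s \<in> monos_into C (prd C a b)" and t: "t \<in> monos_into C (prd C a b)"
  shows "factors_through C (prd C a b) s t \<longleftrightarrow> (\<forall>M. img s M \<subseteq> img t M)"
proof -
  have so: "fst s \<in> obj C" "fst t \<in> obj C" and tm: "is_mono C (fst t) (prd C a b) (snd t)"
    and m: "snd s \<in> hom C (fst s) (prd C a b)" "snd t \<in> hom C (fst t) (prd C a b)"
    using s t unfolding monos_into_iff by (auto simp: is_mono_def)
  show ?thesis
    unfolding img_subset_iff[OF so(1) m(1) so(2) m(2)]
  proof
    assume "factors_through C (prd C a b) s t"
    then obtain h where h: "h \<in> hom C (fst s) (fst t)" "comp C (fst s) (fst t) (prd C a b) h (snd t) = snd s"
      unfolding factors_through_def by blast
    show "\<forall>M. ap (fst s) (prd C a b) (snd s) M ` pts (fst s) M \<subseteq> ap (fst t) (prd C a b) (snd t) M ` pts (fst t) M"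
      using ap_comp[OF so prd(1) h(1) m(2)] h(2) ap_in[OF so h(1)] by auto
  next
    assume "\<forall>M. ap (fst s) (prd C a b) (snd s) M ` pts (fst s) M \<subseteq> ap (fst t) (prd C a b) (snd t) M ` pts (fst t) M"
    then show "factors_through C (prd C a b) s t"
      using mono_lift[OF so(1) prd(1) so(2) m(1) tm] unfolding factors_through_def by blast
  qed
qed

definition rel_class :: "('m \<Rightarrow> ('e \<times> 'e) set) \<Rightarrow> ('o \<times> 'a) set" where
  "rel_class R = {s \<in> monos_into C (prd C a b). img s = R}"

lemma sub_class_eq: "s \<in> monos_into C (prd C a b) \<Longrightarrow> sub_class C (prd C a b) s = rel_class (img s)"
proof -
  assume s: "s \<in> monos_into C (prd C a b)"
  have "factors_through C (prd C a b) s t \<and> factors_through C (prd C a b) t s \<longleftrightarrow> img t = img s"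
    if "t \<in> monos_into C (prd C a b)" for t
    unfolding factors_iff[OF s that] factors_iff[OF that s] fun_eq_iff set_eq_subset by blast
  then show ?thesis unfolding sub_class_def rel_class_def by blast
qed

lemma drel_img:
  assumes "fst s \<in> obj C" "snd s \<in> hom C (fst s) (prd C a b)"
  shows "drel a b (img s)"
proof -
  let ?u = "comp C (fst s) (prd C a b) a (snd s) (prj1 C a b)" and ?v = "comp C (fst s) (prd C a b) b (snd s) (prj2 C a b)"
  have "(gr (fst s) a ?u M)\<inverse> O gr (fst s) b ?v M = img s M" for M
    using ap_comp[OF assms(1) prd(1) o(1) assms(2) prd(2)] ap_comp[OF assms(1) prd(1) o(2) assms(2) prd(3)]
    by (auto simp: img_def gr_def image_iff)
  moreover have "drel a b (\<lambda>M. (gr (fst s) a ?u M)\<inverse> O gr (fst s) b ?v M)"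
    by (intro drel_comp[of _ "fst s"] drel_conv drel_gr comp_hom[of _ "prd C a b"] assms prd(1-3) o)
  ultimately show ?thesis by simp
qed

text \<open>The legs of a tabulation are jointly injective, so their pairing into the product is a
  monomorphism.\<close>

lemma mono_of_drel:
  assumes R: "drel a b R" obtains s where "s \<in> monos_into C (prd C a b)" "img s = R"
proof -
  obtain t u v where sp: "span a b t u v R" using span_exists[OF o R] by blast
  note t = spanD[OF sp]
  let ?m = "pairing C t a b u v"
  note m = pairing[OF t(1-3)]
  have "inj_on (ap t (prd C a b) ?m M) (pts t M)" for M
  proof (rule inj_onI)
    fix w w' assume w: "w \<in> pts t M" "w' \<in> pts t M" "ap t (prd C a b) ?m M w = ap t (prd C a b) ?m M w'"
    then show "w = w'" using t(6) m(2)[OF w(1)] m(2)[OF w(2)] m(3)[OF w(1)] m(3)[OF w(2)] by simp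
  qed
  then have "(t, ?m) \<in> monos_into C (prd C a b)" using t(1) m(1) is_mono_iff[OF t(1) prd(1)] by (simp add: monos_into_def)
  moreover have "img (t, ?m) M = R M" for M
  proof (intro equalityI subrelI)
    fix x y assume "(x, y) \<in> img (t, ?m) M"
    then show "(x, y) \<in> R M" using m(2,3) t(4) by (auto simp: img_def)
  next
    fix x y assume "(x, y) \<in> R M"
    then obtain w where "w \<in> pts t M" "ap t a u M w = x" "ap t b v M w = y" using t(5) by blast
    then show "(x, y) \<in> img (t, ?m) M" using m(2,3) by (force simp: img_def image_iff)
  qed
  ultimately show ?thesis using that[of "(t, ?m)"] by (simp add: fun_eq_iff)
qed

lemma bij_rel_class: "bij_betw rel_class {R. drel a b R} (Sub C (prd C a b))"
proof (rule bij_betw_imageI)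
  show "inj_on rel_class {R. drel a b R}"
  proof (rule inj_onI)
    fix R S assume R: "R \<in> {R. drel a b R}" and eq: "rel_class R = rel_class S"
    obtain s where "s \<in> monos_into C (prd C a b)" "img s = R" using mono_of_drel R by blast
    then have "s \<in> rel_class S" using eq unfolding rel_class_def by blast
    then show "R = S" using \<open>img s = R\<close> by (simp add: rel_class_def)
  qed
  show "rel_class ` {R. drel a b R} = Sub C (prd C a b)"
  proof (intro equalityI subsetI)
    fix X assume "X \<in> rel_class ` {R. drel a b R}"
    then obtain R where R: "drel a b R" "X = rel_class R" by blast
    obtain s where "s \<in> monos_into C (prd C a b)" "img s = R" using mono_of_drel R by blast
    then show "X \<in> Sub C (prd C a b)" unfolding Sub_def using sub_class_eq[of s] R(2) by blast
  next
    fix X assume "X \<in> Sub C (prd C a b)"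
    then obtain s where s: "s \<in> monos_into C (prd C a b)" "X = sub_class C (prd C a b) s" unfolding Sub_def by blast
    then have "drel a b (img s)" unfolding monos_into_iff by (intro drel_img) (auto simp: is_mono_def)
    then show "X \<in> rel_class ` {R. drel a b R}" using sub_class_eq[OF s(1)] s(2) by blast
  qed
qed

lemma sub_le_rel_class:
  assumes "drel a b R" "drel a b S"
  shows "sub_le C (prd C a b) (rel_class R) (rel_class S) \<longleftrightarrow> (\<forall>M. R M \<subseteq> S M)"
proof -
  obtain s where s: "s \<in> monos_into C (prd C a b)" "img s = R" using mono_of_drel assms(1) by blast
  obtain t where t: "t \<in> monos_into C (prd C a b)" "img t = S" using mono_of_drel assms(2) by blast
  show ?thesis
  proof
    assume "sub_le C (prd C a b) (rel_class R) (rel_class S)"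
    then show "\<forall>M. R M \<subseteq> S M" unfolding sub_le_def rel_class_def using factors_iff by blast
  next
    assume "\<forall>M. R M \<subseteq> S M"
    then have "factors_through C (prd C a b) s t" using factors_iff[OF s(1) t(1)] s(2) t(2) by blast
    then show "sub_le C (prd C a b) (rel_class R) (rel_class S)"
      unfolding sub_le_def rel_class_def using s t by blast
  qed
qed

end

lemma ident_rel_class:
  assumes a: "a \<in> obj C"
  shows "sub_class C (prd C a a) (a, pairing C a a a (ident C a) (ident C a)) = rel_class a a (\<lambda>M. Id_on (pts a M))"
proof -
  let ?m = "pairing C a a a (ident C a) (ident C a)"
  note m = pairing[OF a a a ident_hom[OF a] ident_hom[OF a]]
  have "inj_on (ap a (prd C a a) ?m M) (pts a M)" for M
    using m(2) ap_ident[OF a] by (intro inj_onI) metis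
  then have mi: "(a, ?m) \<in> monos_into C (prd C a a)"
    using a m(1) is_mono_iff[OF a prd(1)[OF a a]] by (simp add: monos_into_def)
  have "img a a (a, ?m) M = (\<lambda>w. (w, w)) ` pts a M" for M
    unfolding img_def[OF a a] fst_conv snd_conv by (rule image_cong) (simp_all add: m(2,3) ap_ident[OF a])
  then have "img a a (a, ?m) = (\<lambda>M. Id_on (pts a M))" by (auto simp: fun_eq_iff Id_on_def)
  then show ?thesis using sub_class_eq[OF a a mi] by simp
qed

text \<open>Points of the pullback are pairs with matching middle component, and taking the image
  leaves the set of reached points alone. Hence every choice of representatives, pullback and image
  yields the relational composite; one inclusion uses this for all choices, the other needs only
  that one choice exists.\<close>

lemma rel_comp_rel_class:
  assumes o: "a \<in> obj C" "b \<in> obj C" "c \<in> obj C" and R: "drel a b R" and S: "drel b c S"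
  shows "rel_comp C a b c (rel_class a b R) (rel_class b c S) = rel_class a c (\<lambda>M. R M O S M)"
proof -
  note ab = prd[OF o(1,2)] and bc = prd[OF o(2,3)] and ac = prd[OF o(1,3)]
  let ?X = "\<lambda>r m s n p u v. is_pullback C r s b
       (comp C r (prd C a b) b m (prj2 C a b)) (comp C s (prd C b c) b n (prj1 C b c)) p u v"
  let ?h = "\<lambda>r m s n p u v. pairing C p a c
          (comp C p r a u (comp C r (prd C a b) a m (prj1 C a b)))
          (comp C p s c v (comp C s (prd C b c) c n (prj2 C b c)))"
  have key: "?h r m s n p u v \<in> hom C p (prd C a c) \<and> p \<in> obj C \<and>
      img a c (p, ?h r m s n p u v) = (\<lambda>M. R M O S M)"
    if rm: "(r, m) \<in> rel_class a b R" and sn: "(s, n) \<in> rel_class b c S" and pb: "?X r m s n p u v"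
    for r m s n p u v
  proof -
    have r: "r \<in> obj C" and m: "m \<in> hom C r (prd C a b)" and s: "s \<in> obj C" and n: "n \<in> hom C s (prd C b c)"
      and iR: "\<And>M. img a b (r, m) M = R M" and iS: "\<And>M. img b c (s, n) M = S M"
      using rm sn unfolding rel_class_def[OF o(1,2)] rel_class_def[OF o(2,3)] monos_into_def
      by (auto simp: is_mono_def)
    let ?m1 = "comp C r (prd C a b) a m (prj1 C a b)" and ?m2 = "comp C r (prd C a b) b m (prj2 C a b)"
    let ?n1 = "comp C s (prd C b c) b n (prj1 C b c)" and ?n2 = "comp C s (prd C b c) c n (prj2 C b c)"
    have m1: "?m1 \<in> hom C r a" and m2: "?m2 \<in> hom C r b" and n1: "?n1 \<in> hom C s b" and n2: "?n2 \<in> hom C s c"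
      using comp_hom[OF r ab(1) o(1) m ab(2)] comp_hom[OF r ab(1) o(2) m ab(3)]
        comp_hom[OF s bc(1) o(2) n bc(2)] comp_hom[OF s bc(1) o(3) n bc(3)] by auto
    have Rm: "R M = (\<lambda>w. (ap r a ?m1 M w, ap r b ?m2 M w)) ` pts r M" for M
      unfolding iR[symmetric] img_def[OF o(1,2)] fst_conv snd_conv
      by (rule image_cong) (simp_all add: ap_comp[OF r ab(1) o(1) m ab(2)] ap_comp[OF r ab(1) o(2) m ab(3)])
    have Sm: "S M = (\<lambda>w. (ap s b ?n1 M w, ap s c ?n2 M w)) ` pts s M" for M
      unfolding iS[symmetric] img_def[OF o(2,3)] fst_conv snd_conv
      by (rule image_cong) (simp_all add: ap_comp[OF s bc(1) o(2) n bc(2)] ap_comp[OF s bc(1) o(3) n bc(3)])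
    note p = spanD[OF pb[unfolded is_pullback_iff[OF r s o(2) m2 n1]]]
    have f: "comp C p r a u ?m1 \<in> hom C p a" and g: "comp C p s c v ?n2 \<in> hom C p c"
      using comp_hom[OF p(1) r o(1) p(2) m1] comp_hom[OF p(1) s o(3) p(3) n2] by auto
    note h = pairing[OF o(1,3) p(1) f g]
    have "img a c (p, ?h r m s n p u v) M = (\<lambda>w. (ap r a ?m1 M (ap p r u M w), ap s c ?n2 M (ap p s v M w))) ` pts p M" for M
      unfolding img_def[OF o(1,3)] fst_conv snd_conv
      by (rule image_cong)
        (simp_all add: h(2,3) ap_comp[OF p(1) r o(1) p(2) m1] ap_comp[OF p(1) s o(3) p(3) n2])
    moreover have "(\<lambda>w. (ap r a ?m1 M (ap p r u M w), ap s c ?n2 M (ap p s v M w))) ` pts p M = R M O S M" for M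
    proof (intro equalityI subrelI)
      fix x z assume "(x, z) \<in> (\<lambda>w. (ap r a ?m1 M (ap p r u M w), ap s c ?n2 M (ap p s v M w))) ` pts p M"
      then obtain w where w: "w \<in> pts p M" "x = ap r a ?m1 M (ap p r u M w)" "z = ap s c ?n2 M (ap p s v M w)" by blast
      have uv: "ap p r u M w \<in> pts r M" "ap p s v M w \<in> pts s M"
        "ap r b ?m2 M (ap p r u M w) = ap s b ?n1 M (ap p s v M w)"
        using p(4)[OF w(1)] unfolding fib_def by auto
      have "(x, ap r b ?m2 M (ap p r u M w)) \<in> R M" unfolding Rm w(2) using uv(1) by blast
      moreover have "(ap r b ?m2 M (ap p r u M w), z) \<in> S M" unfolding Sm w(3) uv(3) using uv(2) by blast
      ultimately show "(x, z) \<in> R M O S M" by blast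
    next
      fix x z assume "(x, z) \<in> R M O S M"
      then obtain y where y: "(x, y) \<in> R M" "(y, z) \<in> S M" by blast
      obtain w1 where w1: "w1 \<in> pts r M" "x = ap r a ?m1 M w1" "y = ap r b ?m2 M w1" using y(1) unfolding Rm by blast
      obtain w2 where w2: "w2 \<in> pts s M" "y = ap s b ?n1 M w2" "z = ap s c ?n2 M w2" using y(2) unfolding Sm by blast
      have "(w1, w2) \<in> fib r s b ?m2 ?n1 M" using w1(1,3) w2(1,2) by (simp add: fib_def)
      from p(5)[OF this] obtain w where "w \<in> pts p M" "ap p r u M w = w1" "ap p s v M w = w2" by blast
      then show "(x, z) \<in> (\<lambda>w. (ap r a ?m1 M (ap p r u M w), ap s c ?n2 M (ap p s v M w))) ` pts p M"
        using w1(2) w2(3) by (intro image_eqI[of _ _ w]) auto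
    qed
    ultimately show ?thesis using h(1) p(1) by (simp add: fun_eq_iff)
  qed
  have img_iff: "is_image C p (prd C a c) (?h r m s n p u v) d i \<longleftrightarrow> (d, i) \<in> rel_class a c (\<lambda>M. R M O S M)"
    if rm: "(r, m) \<in> rel_class a b R" and sn: "(s, n) \<in> rel_class b c S" and pb: "?X r m s n p u v"
    for r m s n p u v d i
  proof -
    note k = key[OF that]
    let ?q = "?h r m s n p u v"
    have q: "?q \<in> hom C p (prd C a c)" "p \<in> obj C" "img a c (p, ?q) = (\<lambda>M. R M O S M)" using k by blast+
    have eq: "ap d (prd C a c) i M ` pts d M = ap p (prd C a c) ?q M ` pts p M \<longleftrightarrow> img a c (d, i) M = R M O S M"
      if "d \<in> obj C" "is_mono C d (prd C a c) i" for M
    proof -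
      have "i \<in> hom C d (prd C a c)" using that(2) by (simp add: is_mono_def)
      then have "img a c (d, i) M = img a c (p, ?q) M \<longleftrightarrow>
          ap d (prd C a c) i M ` pts d M = ap p (prd C a c) ?q M ` pts p M"
        using img_eq_iff[OF o(1,3), of "(d, i)" "(p, ?q)" M] that(1) q(1,2) by simp
      then show ?thesis unfolding q(3) by blast
    qed
    have rc: "(d, i) \<in> rel_class a c (\<lambda>M. R M O S M) \<longleftrightarrow>
        d \<in> obj C \<and> is_mono C d (prd C a c) i \<and> (\<forall>M. img a c (d, i) M = R M O S M)"
      unfolding rel_class_def[OF o(1,3)] monos_into_def fun_eq_iff by simp
    show ?thesis unfolding is_image_iff[OF q(2) ac(1) q(1)] rc by (intro conj_cong refl all_cong1 eq)
  qed
  obtain r m where rm: "(r, m) \<in> rel_class a b R"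
    using mono_of_drel[OF o(1,2) R] unfolding rel_class_def[OF o(1,2)] by (metis (lifting) mem_Collect_eq surj_pair)
  obtain s n where sn: "(s, n) \<in> rel_class b c S"
    using mono_of_drel[OF o(2,3) S] unfolding rel_class_def[OF o(2,3)] by (metis (lifting) mem_Collect_eq surj_pair)
  have r: "r \<in> obj C" and m: "m \<in> hom C r (prd C a b)" and s: "s \<in> obj C" and n: "n \<in> hom C s (prd C b c)"
    using rm sn unfolding rel_class_def[OF o(1,2)] rel_class_def[OF o(2,3)] monos_into_def by (auto simp: is_mono_def)
  obtain p u v where pb: "?X r m s n p u v"
    using regular comp_hom[OF r ab(1) o(2) m ab(3)] comp_hom[OF s bc(1) o(2) n bc(2)] r s o(2)
    unfolding regular_category_def by blast
  show ?thesis
  proof (intro equalityI subsetI)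
    fix z assume "z \<in> rel_comp C a b c (rel_class a b R) (rel_class b c S)"
    then show "z \<in> rel_class a c (\<lambda>M. R M O S M)" unfolding rel_comp_def using img_iff by blast
  next
    fix z assume z: "z \<in> rel_class a c (\<lambda>M. R M O S M)"
    obtain d i where di: "z = (d, i)" by fastforce
    have "is_image C p (prd C a c) (?h r m s n p u v) d i" using img_iff[OF rm sn pb] z di by simp
    then show "z \<in> rel_comp C a b c (rel_class a b R) (rel_class b c S)"
      unfolding rel_comp_def di using rm sn pb by blast
  qed
qed

lemma po_onto_Rel: "po_onto DRel (Rel C) (\<lambda>a. a) rel_class"
  unfolding po_onto_def cat_onto_def Rel_def
  by (auto simp: DRel_def bij_rel_class ident_rel_class rel_comp_rel_class sub_le_rel_class)

end

section \<open>The syntactic category\<close>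

lemma app_app_fst [simp]: "app n (app n x z) y = app n x y"
  by (auto simp: app_def fun_eq_iff)

lemma app_empty [simp]: "app empty_ctx u z = z"
  by (auto simp: app_def fun_eq_iff empty_ctx_def)

lemma count_list_append_ctx: "count_list (ss @ ts) = count_list ss \<otimes> count_list ts"
  by (auto simp: fun_eq_iff count_list_append)

lemma sat_swap:
  "fm_in T (n \<otimes> m) \<theta> \<Longrightarrow> sat M (subst (swap_vars n m) \<theta>) (app m y x) \<longleftrightarrow> sat M \<theta> (app n x y)"
  by (rule sat_subst_cong) (auto simp: swap_vars_def app_def)

lemma fm_in_swap: "fm_in T (n \<otimes> m) \<theta> \<Longrightarrow> fm_in T (m \<otimes> n \<otimes> l) (subst (swap_vars n m) \<theta>)"
  by (erule fm_in_subst) (auto simp: swap_vars_def)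

text \<open>The renaming makes room for \<open>x\<close> in the matrix context
  \<open>y, x, z\<close> of a composite.\<close>

lemma sat_skip:
  "fm_in T (m \<otimes> l) \<chi> \<Longrightarrow>
   sat M (subst (\<lambda>\<sigma> j. if j < m \<sigma> then j else n \<sigma> + j) \<chi>) (app m y (app n x z)) \<longleftrightarrow> sat M \<chi> (app m y z)"
  by (rule sat_subst_cong) (auto simp: app_def)

lemma fm_in_skip:
  "fm_in T (m \<otimes> l) \<chi> \<Longrightarrow>
   fm_in T (m \<otimes> (n \<otimes> l)) (subst (\<lambda>\<sigma> j. if j < m \<sigma> then j else n \<sigma> + j) \<chi>)"
  by (erule fm_in_subst) auto

abbreviation cx :: "'s list \<times> ('s, 'r) fm \<Rightarrow> 's ctx" where
  "cx a \<equiv> count_list (fst a)"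

context regular
begin

text \<open>Structures that are not models get no points, which makes them irrelevant below.\<close>

definition pts :: "'s list \<times> ('s, 'r) fm \<Rightarrow> ('s, 'r) mdl \<Rightarrow> ('s, 'r) vl set" where
  "pts a M = {x. model T M \<and> env M (cx a) x \<and> sat M (snd a) x}"

definition ap ::
  "'s list \<times> ('s, 'r) fm \<Rightarrow> 's list \<times> ('s, 'r) fm \<Rightarrow> ('s, 'r) fm set \<Rightarrow>
   ('s, 'r) mdl \<Rightarrow> ('s, 'r) vl \<Rightarrow> ('s, 'r) vl" where
  "ap a b f M x = (THE y. y \<in> pts b M \<and> ev M f (app (cx a) x y))"

text \<open>The relation is cut down to points, so that \<open>\<theta>\<close> may be any formula
  in the joint context. The formulae of the two objects are conjoined again where a class is formed,
  in \<open>graph_hom\<close> and \<open>syn_hom_FT\<close>.\<close>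

definition frel ::
  "'s list \<times> ('s, 'r) fm \<Rightarrow> 's list \<times> ('s, 'r) fm \<Rightarrow> ('s, 'r) fm \<Rightarrow>
   ('s, 'r) mdl \<Rightarrow> (('s, 'r) vl \<times> ('s, 'r) vl) set" where
  "frel a b \<theta> M = {(x, y). x \<in> pts a M \<and> y \<in> pts b M \<and> sat M \<theta> (app (cx a) x y)}"

definition drel ::
  "'s list \<times> ('s, 'r) fm \<Rightarrow> 's list \<times> ('s, 'r) fm \<Rightarrow>
   (('s, 'r) mdl \<Rightarrow> (('s, 'r) vl \<times> ('s, 'r) vl) set) \<Rightarrow> bool" where
  "drel a b R \<longleftrightarrow> (\<exists>\<theta>. fm_in T (cx a \<otimes> cx b) \<theta> \<and> R = frel a b \<theta>)"

lemma Creg_obj: "a \<in> obj (Creg T) \<longleftrightarrow> set (fst a) \<subseteq> sorts T \<and> fm_in T (cx a) (snd a)"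
  by (auto simp: Creg_def)

lemma cx_ctxs: "a \<in> obj (Creg T) \<Longrightarrow> cx a \<in> ctxs T"
  unfolding Creg_obj by (auto intro: count_list_ctxs)

lemma cxx_ctxs: "a \<in> obj (Creg T) \<Longrightarrow> b \<in> obj (Creg T) \<Longrightarrow> cx a \<otimes> cx b \<in> ctxs T"
  by (intro ctxs_tensor cx_ctxs)

lemma obj_fm: "a \<in> obj (Creg T) \<Longrightarrow> fm_in T (cx a) (snd a)"
  by (simp add: Creg_obj)

text \<open>The meaning on points of the three clauses of \<open>functional\<close>.\<close>

definition total_functional ::
  "'s list \<times> ('s, 'r) fm \<Rightarrow> 's list \<times> ('s, 'r) fm \<Rightarrow>
   (('s, 'r) mdl \<Rightarrow> ('s, 'r) vl \<Rightarrow> ('s, 'r) vl \<Rightarrow> bool) \<Rightarrow> bool" where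
  "total_functional a b Q \<longleftrightarrow>
     (\<forall>M x y. model T M \<longrightarrow> env M (cx a) x \<longrightarrow> env M (cx b) y \<longrightarrow> Q M x y \<longrightarrow> x \<in> pts a M \<and> y \<in> pts b M) \<and>
     (\<forall>M. \<forall>x\<in>pts a M. \<exists>!y. y \<in> pts b M \<and> Q M x y)"

lemma all_env_split:
  "(\<forall>e. env M (n \<otimes> m) e \<longrightarrow> Q e) \<longleftrightarrow> (\<forall>x y. env M n x \<longrightarrow> env M m y \<longrightarrow> Q (app n x y))"
  using env_split[of M n m] env_app[of M n _ m] by blast

lemma prv_tensor_iff:
  "prv T (n \<otimes> m) \<phi> \<psi> \<longleftrightarrow> n \<otimes> m \<in> ctxs T \<and> fm_in T (n \<otimes> m) \<phi> \<and> fm_in T (n \<otimes> m) \<psi> \<and>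
    (\<forall>(M :: ('s, 'r) mdl) x y. model T M \<longrightarrow> env M n x \<longrightarrow> env M m y \<longrightarrow>
      sat M \<phi> (app n x y) \<longrightarrow> sat M \<psi> (app n x y))"
proof -
  have "(\<forall>e. model T M \<longrightarrow> env M (n \<otimes> m) e \<longrightarrow> sat M \<phi> e \<longrightarrow> sat M \<psi> e) \<longleftrightarrow>
      (\<forall>x y. model T M \<longrightarrow> env M n x \<longrightarrow> env M m y \<longrightarrow> sat M \<phi> (app n x y) \<longrightarrow> sat M \<psi> (app n x y))"
    for M :: "('s, 'r) mdl"
    using all_env_split[of M n m "\<lambda>e. sat M \<phi> e \<longrightarrow> sat M \<psi> e"] by blast
  then show ?thesis unfolding prv_iff by simp
qed

lemma ctx_eq_iff: "env M n x \<Longrightarrow> env M n y \<Longrightarrow> (\<forall>\<sigma> i. i < n \<sigma> \<longrightarrow> x \<sigma> i = y \<sigma> i) \<longleftrightarrow> x = y"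
  using env_eqI by blast

text \<open>The facts \<open>p1\<close>, \<open>p2\<close> and \<open>p3\<close> translate the three
  sequents by completeness. The value found by \<open>p2\<close> is merely a tuple of the right
  sorts; it is a point of \<open>b\<close> by \<open>p1\<close>.\<close>

lemma functional_iff:
  assumes a: "a \<in> obj (Creg T)" and b: "b \<in> obj (Creg T)"
  shows "functional T (fst a) (snd a) (fst b) (snd b) \<theta> \<longleftrightarrow>
    fm_in T (cx a \<otimes> cx b) \<theta> \<and> total_functional a b (\<lambda>M x y. sat M \<theta> (app (cx a) x y))"
proof (cases "fm_in T (cx a \<otimes> cx b) \<theta>")
  case \<theta>: True
  let ?n = "cx a" and ?m = "cx b"
  note fa = obj_fm[OF a] and fb = obj_fm[OF b] and n = cx_ctxs[OF a] and m = cx_ctxs[OF b]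
  have nm: "?n \<otimes> ?m \<in> ctxs T" and nmm: "?n \<otimes> ?m \<otimes> ?m \<in> ctxs T" using n m by (auto intro: ctxs_tensor)
  have p1: "prv T (?n \<otimes> ?m) \<theta> (Conj (snd a) (shift ?n (snd b))) \<longleftrightarrow>
      (\<forall>M x y. model T M \<longrightarrow> env M ?n x \<longrightarrow> env M ?m y \<longrightarrow> sat M \<theta> (app ?n x y) \<longrightarrow> x \<in> pts a M \<and> y \<in> pts b M)"
    unfolding prv_tensor_iff using nm \<theta> fm_in_left[OF fa] fm_in_shift[OF fb]
    by (auto simp: pts_def sat_app_fst[OF fa])
  have sb: "set (fst b) \<subseteq> sorts T" using b by (simp add: Creg_obj)
  have "fm_in T ?n (vec_ex (fst b) (subst (swap_vars ?n ?m) \<theta>))"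
    using fm_in_swap[OF \<theta>, of empty_ctx] by (intro fm_in_vec_ex[OF sb]) simp
  then have p2: "prv T ?n (snd a) (vec_ex (fst b) (subst (swap_vars ?n ?m) \<theta>)) \<longleftrightarrow>
      (\<forall>M x. x \<in> pts a M \<longrightarrow> (\<exists>y. env M ?m y \<and> sat M \<theta> (app ?n x y)))"
    unfolding prv_iff sat_vec_ex sat_swap[OF \<theta>] using n fa by (auto simp: pts_def)
  let ?r = "\<lambda>\<sigma> i. if i < ?n \<sigma> then i else ?m \<sigma> + i"
  have s3: "sat M (subst ?r \<theta>) (app (?n \<otimes> ?m) (app ?n x y) y') \<longleftrightarrow> sat M \<theta> (app ?n x y')" for M x y y'
    by (rule sat_subst_cong[OF \<theta>]) (auto simp: app_def)
  have f3: "fm_in T (?n \<otimes> ?m \<otimes> ?m) (subst ?r \<theta>)" by (rule fm_in_subst[OF \<theta>]) auto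
  have f4: "fm_in T (?n \<otimes> ?m \<otimes> ?m) (vec_eq (fst b) (\<lambda>\<sigma> j. ?n \<sigma> + j) (\<lambda>\<sigma> j. ?n \<sigma> + ?m \<sigma> + j))"
    by (rule fm_in_vec_eq) auto
  have s4: "sat M (vec_eq (fst b) (\<lambda>\<sigma> j. ?n \<sigma> + j) (\<lambda>\<sigma> j. ?n \<sigma> + ?m \<sigma> + j)) (app (?n \<otimes> ?m) (app ?n x y) y') \<longleftrightarrow> y = y'"
    if "env M ?m y" "env M ?m y'" for M x y y'
    unfolding sat_vec_eq ctx_eq_iff[OF that, symmetric] by (auto simp: app_def)
  \<comment> \<open>The context is \<open>x, y, y'\<close>, so its valuations are split
    twice.\<close>
  have p3: "prv T (?n \<otimes> ?m \<otimes> ?m) (Conj \<theta> (subst ?r \<theta>)) (vec_eq (fst b) (\<lambda>\<sigma> j. ?n \<sigma> + j) (\<lambda>\<sigma> j. ?n \<sigma> + ?m \<sigma> + j)) \<longleftrightarrow>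
      (\<forall>(M :: ('s, 'r) mdl) x y y'. model T M \<longrightarrow> env M ?n x \<longrightarrow> env M ?m y \<longrightarrow> env M ?m y' \<longrightarrow>
        sat M \<theta> (app ?n x y) \<longrightarrow> sat M \<theta> (app ?n x y') \<longrightarrow> y = y')"
  proof -
    have "prv T (?n \<otimes> ?m \<otimes> ?m) (Conj \<theta> (subst ?r \<theta>)) (vec_eq (fst b) (\<lambda>\<sigma> j. ?n \<sigma> + j) (\<lambda>\<sigma> j. ?n \<sigma> + ?m \<sigma> + j)) \<longleftrightarrow>
        (\<forall>(M :: ('s, 'r) mdl) e y'. model T M \<longrightarrow> env M (?n \<otimes> ?m) e \<longrightarrow> env M ?m y' \<longrightarrow>
          sat M (Conj \<theta> (subst ?r \<theta>)) (app (?n \<otimes> ?m) e y') \<longrightarrow>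
          sat M (vec_eq (fst b) (\<lambda>\<sigma> j. ?n \<sigma> + j) (\<lambda>\<sigma> j. ?n \<sigma> + ?m \<sigma> + j)) (app (?n \<otimes> ?m) e y'))"
      unfolding prv_tensor_iff[of "?n \<otimes> ?m"] using nmm fm_in_left[OF \<theta>] f3 f4 by simp
    also have "\<dots> \<longleftrightarrow> (\<forall>(M :: ('s, 'r) mdl) x y y'. model T M \<longrightarrow> env M ?n x \<longrightarrow> env M ?m y \<longrightarrow> env M ?m y' \<longrightarrow>
          sat M (Conj \<theta> (subst ?r \<theta>)) (app (?n \<otimes> ?m) (app ?n x y) y') \<longrightarrow>
          sat M (vec_eq (fst b) (\<lambda>\<sigma> j. ?n \<sigma> + j) (\<lambda>\<sigma> j. ?n \<sigma> + ?m \<sigma> + j)) (app (?n \<otimes> ?m) (app ?n x y) y'))"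
      using env_app[of _ ?n _ ?m] env_split[of _ ?n ?m] by blast
    also have "\<dots> \<longleftrightarrow> (\<forall>(M :: ('s, 'r) mdl) x y y'. model T M \<longrightarrow> env M ?n x \<longrightarrow> env M ?m y \<longrightarrow> env M ?m y' \<longrightarrow>
        sat M \<theta> (app ?n x y) \<longrightarrow> sat M \<theta> (app ?n x y') \<longrightarrow> y = y')"
      by (simp add: s3 s4 sat_app_fst[OF \<theta>] imp_conjL)
    finally show ?thesis .
  qed
  have pe: "env M ?m y" if "y \<in> pts b M" for M y using that by (simp add: pts_def)
  have pe': "model T M" "env M ?n x" if "x \<in> pts a M" for M x using that by (simp_all add: pts_def)
  show ?thesis
    unfolding functional_def Let_def p1 p2 p3 total_functional_def
    using \<theta> pe pe' by (safe; metis)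
qed (simp add: functional_def)

lemma Creg_hom:
  assumes a: "a \<in> obj (Creg T)" and b: "b \<in> obj (Creg T)"
  shows "f \<in> hom (Creg T) a b \<longleftrightarrow> f \<in> FT_obj T (cx a \<otimes> cx b) \<and>
    total_functional a b (\<lambda>M x y. ev M f (app (cx a) x y))"
proof -
  note nm = cxx_ctxs[OF a b]
  have h: "f \<in> hom (Creg T) a b \<longleftrightarrow> (\<exists>\<theta>. functional T (fst a) (snd a) (fst b) (snd b) \<theta> \<and>
      f = fm_class T (cx a \<otimes> cx b) \<theta>)"
    by (auto simp: Creg_def case_prod_beta)
  have tf: "total_functional a b (\<lambda>M x y. sat M \<theta> (app (cx a) x y)) \<longleftrightarrow>
      total_functional a b (\<lambda>M x y. ev M f (app (cx a) x y))"
    if "fm_in T (cx a \<otimes> cx b) \<theta>" "f = fm_class T (cx a \<otimes> cx b) \<theta>" for \<theta>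
  proof -
    have "ev M f (app (cx a) x y) \<longleftrightarrow> sat M \<theta> (app (cx a) x y)"
      if "model T M" "env M (cx a) x" "env M (cx b) y" for M x y
      using ev_class[OF nm \<open>fm_in T (cx a \<otimes> cx b) \<theta>\<close> that(1) env_app[OF that(2,3)]]
        \<open>f = fm_class T (cx a \<otimes> cx b) \<theta>\<close> by simp
    then have "x \<in> pts a M \<Longrightarrow> y \<in> pts b M \<and> sat M \<theta> (app (cx a) x y) \<longleftrightarrow> y \<in> pts b M \<and> ev M f (app (cx a) x y)"
      "model T M \<Longrightarrow> env M (cx a) x \<Longrightarrow> env M (cx b) y \<Longrightarrow> sat M \<theta> (app (cx a) x y) \<longleftrightarrow> ev M f (app (cx a) x y)" for M x y
      by (auto simp: pts_def)
    then show ?thesis unfolding total_functional_def by simp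
  qed
  show ?thesis unfolding h functional_iff[OF a b] using tf by (auto simp: FT_obj_def)
qed

lemma ap:
  assumes a: "a \<in> obj (Creg T)" and b: "b \<in> obj (Creg T)" and f: "f \<in> hom (Creg T) a b" and x: "x \<in> pts a M"
  shows ap_pts: "ap a b f M x \<in> pts b M" and ev_ap: "ev M f (app (cx a) x (ap a b f M x))"
    and ap_eq: "env M (cx b) y \<Longrightarrow> ev M f (app (cx a) x y) \<Longrightarrow> ap a b f M x = y"
proof -
  have tf: "total_functional a b (\<lambda>M x y. ev M f (app (cx a) x y))" using Creg_hom[OF a b] f by blast
  then have e: "\<exists>!y. y \<in> pts b M \<and> ev M f (app (cx a) x y)" using x unfolding total_functional_def by blast
  from theI'[OF e] show 1: "ap a b f M x \<in> pts b M" and 2: "ev M f (app (cx a) x (ap a b f M x))"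
    unfolding ap_def by auto
  assume y: "env M (cx b) y" "ev M f (app (cx a) x y)"
  have "model T M" "env M (cx a) x" using x by (auto simp: pts_def)
  then have "y \<in> pts b M" using tf y unfolding total_functional_def by blast
  then show "ap a b f M x = y" using e 1 2 y by blast
qed

lemma Creg_ident:
  assumes a: "a \<in> obj (Creg T)"
  shows "ident (Creg T) a \<in> FT_obj T (cx a \<otimes> cx a)"
    "model T M \<Longrightarrow> env M (cx a) x \<Longrightarrow> env M (cx a) y \<Longrightarrow>
      ev M (ident (Creg T) a) (app (cx a) x y) \<longleftrightarrow> x \<in> pts a M \<and> x = y"
proof -
  let ?\<phi> = "Conj (snd a) (vec_eq (fst a) (\<lambda>\<sigma> i. i) (\<lambda>\<sigma> i. cx a \<sigma> + i))"
  have i: "ident (Creg T) a = fm_class T (cx a \<otimes> cx a) ?\<phi>" by (simp add: Creg_def case_prod_beta)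
  have "fm_in T (cx a \<otimes> cx a) (vec_eq (fst a) (\<lambda>\<sigma> i. i) (\<lambda>\<sigma> i. cx a \<sigma> + i))" by (rule fm_in_vec_eq) auto
  then have fm: "fm_in T (cx a \<otimes> cx a) ?\<phi>" using fm_in_left[OF obj_fm[OF a]] by simp
  show "ident (Creg T) a \<in> FT_obj T (cx a \<otimes> cx a)" unfolding i FT_obj_def using fm by blast
  show "ev M (ident (Creg T) a) (app (cx a) x y) \<longleftrightarrow> x \<in> pts a M \<and> x = y"
    if M: "model T M" and x: "env M (cx a) x" and y: "env M (cx a) y"
    unfolding i ev_class[OF cxx_ctxs[OF a a] fm M env_app[OF x y]]
    using M x ctx_eq_iff[OF x y] by (simp add: sat_app_fst[OF obj_fm[OF a]] sat_vec_eq pts_def)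
qed

lemma Creg_comp:
  assumes o: "a \<in> obj (Creg T)" "b \<in> obj (Creg T)" "c \<in> obj (Creg T)"
    and f: "f \<in> FT_obj T (cx a \<otimes> cx b)" and g: "g \<in> FT_obj T (cx b \<otimes> cx c)"
  shows "comp (Creg T) a b c f g \<in> FT_obj T (cx a \<otimes> cx c)"
    "model T M \<Longrightarrow> env M (cx a) x \<Longrightarrow> env M (cx c) z \<Longrightarrow>
      ev M (comp (Creg T) a b c f g) (app (cx a) x z) \<longleftrightarrow>
      (\<exists>y. env M (cx b) y \<and> ev M f (app (cx a) x y) \<and> ev M g (app (cx b) y z))"
proof -
  let ?n = "cx a" and ?m = "cx b" and ?l = "cx c"
  let ?k = "\<lambda>\<theta> \<chi>. vec_ex (fst b) (Conj (subst (swap_vars ?n ?m) \<theta>)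
             (subst (\<lambda>\<sigma> j. if j < ?m \<sigma> then j else ?n \<sigma> + j) \<chi>))"
  define Q where "Q = (\<lambda>M e. \<exists>x z. env M ?n x \<and> env M ?l z \<and> e = app ?n x z \<and>
    (\<exists>y. env M ?m y \<and> ev M f (app ?n x y) \<and> ev M g (app ?m y z)))"
  note nm = cxx_ctxs[OF o(1,2)] and ml = cxx_ctxs[OF o(2,3)] and nl = cxx_ctxs[OF o(1,3)]
  have d: "denotes T (?n \<otimes> ?l) (?k \<theta> \<chi>) Q" if "\<theta> \<in> f" "\<chi> \<in> g" for \<theta> \<chi>
  proof -
    have d1: "denotes T (?n \<otimes> ?m) \<theta> (\<lambda>M. ev M f)" and d2: "denotes T (?m \<otimes> ?l) \<chi> (\<lambda>M. ev M g)"
      using FT_in[OF f nm that(1)] FT_in[OF g ml that(2)] .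
    then have fm: "fm_in T (?n \<otimes> ?m) \<theta>" "fm_in T (?m \<otimes> ?l) \<chi>" by (auto simp: denotes_def)
    have sb: "set (fst b) \<subseteq> sorts T" using o(2) by (simp add: Creg_obj)
    have "fm_in T (?n \<otimes> ?l) (?k \<theta> \<chi>)"
      by (rule fm_in_vec_ex[OF sb], simp only: fm_in.simps, intro conjI fm_in_skip fm)
        (use fm_in_swap[OF fm(1), of ?l] in \<open>simp only: tensor_assoc\<close>)
    moreover have "sat M (?k \<theta> \<chi>) e \<longleftrightarrow> Q M e" if M: "model T M" and e: "env M (?n \<otimes> ?l) e" for M e
    proof -
      obtain x z where xz: "env M ?n x" "env M ?l z" "e = app ?n x z" using env_split[OF e] by blast
      have "sat M (?k \<theta> \<chi>) e \<longleftrightarrow> (\<exists>y. env M ?m y \<and> sat M \<theta> (app ?n x y) \<and> sat M \<chi> (app ?m y z))"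
        unfolding sat_vec_ex sat.simps xz(3) sat_swap[OF fm(1)] sat_skip[OF fm(2)] by simp
      also have "\<dots> \<longleftrightarrow> (\<exists>y. env M ?m y \<and> ev M f (app ?n x y) \<and> ev M g (app ?m y z))"
        using d1 d2 M env_app[OF xz(1)] env_app[OF _ xz(2)] unfolding denotes_def by blast
      also have "\<dots> \<longleftrightarrow> Q M e" unfolding Q_def xz(3) using xz(1,2) app_inject by blast
      finally show ?thesis .
    qed
    ultimately show ?thesis by (simp add: denotes_def)
  qed
  obtain \<theta>0 \<chi>0 where 0: "\<theta>0 \<in> f" "\<chi>0 \<in> g" using FT_objE[OF f nm] FT_objE[OF g ml] by metis
  have "fm_class T (?n \<otimes> ?l) (?k \<theta> \<chi>) = cl T (?n \<otimes> ?l) Q" if "\<theta> \<in> f" "\<chi> \<in> g" for \<theta> \<chi>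
    using fm_class_cl[OF nl d[OF that]] .
  moreover have "comp (Creg T) a b c f g = (\<Union>\<theta>\<in>f. \<Union>\<chi>\<in>g. fm_class T (?n \<otimes> ?l) (?k \<theta> \<chi>))"
    by (simp add: Creg_def case_prod_beta Let_def)
  ultimately have k: "comp (Creg T) a b c f g = cl T (?n \<otimes> ?l) Q" using 0 by auto
  then show "comp (Creg T) a b c f g \<in> FT_obj T (?n \<otimes> ?l)" using cl_FT[OF nl d[OF 0]] by simp
  show "ev M (comp (Creg T) a b c f g) (app ?n x z) \<longleftrightarrow>
      (\<exists>y. env M ?m y \<and> ev M f (app ?n x y) \<and> ev M g (app ?m y z))"
    if M: "model T M" and xz: "env M ?n x" "env M ?l z"
  proof -
    have "ev M (comp (Creg T) a b c f g) (app ?n x z) \<longleftrightarrow> Q M (app ?n x z)"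
      unfolding k by (rule ev_cl[OF d[OF 0] M env_app[OF xz]])
    then show ?thesis unfolding Q_def using xz app_inject by blast
  qed
qed

lemma ptsD: "x \<in> pts a M \<Longrightarrow> model T M" "x \<in> pts a M \<Longrightarrow> env M (cx a) x"
  by (auto simp: pts_def)

lemma Creg_homI:
  assumes a: "a \<in> obj (Creg T)" and b: "b \<in> obj (Creg T)" and f: "f \<in> FT_obj T (cx a \<otimes> cx b)"
    and 1: "\<And>M x y. model T M \<Longrightarrow> env M (cx a) x \<Longrightarrow> env M (cx b) y \<Longrightarrow> ev M f (app (cx a) x y) \<Longrightarrow>
      x \<in> pts a M \<and> y \<in> pts b M"
    and 2: "\<And>M x. x \<in> pts a M \<Longrightarrow> \<exists>!y. y \<in> pts b M \<and> ev M f (app (cx a) x y)"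
  shows "f \<in> hom (Creg T) a b"
  unfolding Creg_hom[OF a b] total_functional_def using f 1 2 by blast

lemma hom_FT: "a \<in> obj (Creg T) \<Longrightarrow> b \<in> obj (Creg T) \<Longrightarrow> f \<in> hom (Creg T) a b \<Longrightarrow> f \<in> FT_obj T (cx a \<otimes> cx b)"
  using Creg_hom by blast

lemma hom_pts:
  assumes "a \<in> obj (Creg T)" "b \<in> obj (Creg T)" "f \<in> hom (Creg T) a b"
    "model T M" "env M (cx a) x" "env M (cx b) y" "ev M f (app (cx a) x y)"
  shows "x \<in> pts a M" "y \<in> pts b M"
  using assms unfolding Creg_hom[OF assms(1,2)] total_functional_def by blast+

lemma drelE:
  assumes "drel a b R" obtains \<theta> where "fm_in T (cx a \<otimes> cx b) \<theta>"
    "\<And>M x y. (x, y) \<in> R M \<longleftrightarrow> x \<in> pts a M \<and> y \<in> pts b M \<and> sat M \<theta> (app (cx a) x y)"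
  using assms unfolding drel_def frel_def by auto

lemma drelI:
  assumes "fm_in T (cx a \<otimes> cx b) \<theta>"
    "\<And>M x y. (x, y) \<in> R M \<longleftrightarrow> x \<in> pts a M \<and> y \<in> pts b M \<and> sat M \<theta> (app (cx a) x y)"
  shows "drel a b R"
  unfolding drel_def by (rule exI[of _ \<theta>]) (use assms in \<open>auto simp: frel_def fun_eq_iff\<close>)

text \<open>The formula is functional only between points; conjoining the formulae of source and
  target makes it a morphism.\<close>

lemma graph_hom:
  assumes a: "a \<in> obj (Creg T)" and b: "b \<in> obj (Creg T)" and \<theta>: "fm_in T (cx a \<otimes> cx b) \<theta>"
    and un: "\<And>M x. x \<in> pts a M \<Longrightarrow> \<exists>!y. y \<in> pts b M \<and> sat M \<theta> (app (cx a) x y)"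
  obtains f where "f \<in> hom (Creg T) a b"
    "\<And>M x. x \<in> pts a M \<Longrightarrow> ap a b f M x \<in> pts b M \<and> sat M \<theta> (app (cx a) x (ap a b f M x))"
proof -
  let ?\<phi> = "Conj (Conj (snd a) (shift (cx a) (snd b))) \<theta>"
  have fm: "fm_in T (cx a \<otimes> cx b) ?\<phi>"
    using \<theta> fm_in_left[OF obj_fm[OF a]] fm_in_shift[OF obj_fm[OF b]] by simp
  let ?f = "fm_class T (cx a \<otimes> cx b) ?\<phi>"
  have ev: "ev M ?f (app (cx a) x y) \<longleftrightarrow> x \<in> pts a M \<and> y \<in> pts b M \<and> sat M \<theta> (app (cx a) x y)"
    if "model T M" "env M (cx a) x" "env M (cx b) y" for M x y
    unfolding ev_class[OF cxx_ctxs[OF a b] fm that(1) env_app[OF that(2,3)]]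
    using that by (simp add: pts_def sat_app_fst[OF obj_fm[OF a]])
  have f: "?f \<in> hom (Creg T) a b"
  proof (rule Creg_homI[OF a b])
    show "?f \<in> FT_obj T (cx a \<otimes> cx b)" using fm by (auto simp: FT_obj_def)
    fix M x assume x: "x \<in> pts a M"
    have "y \<in> pts b M \<and> ev M ?f (app (cx a) x y) \<longleftrightarrow> y \<in> pts b M \<and> sat M \<theta> (app (cx a) x y)" for y
      using ev[OF ptsD[OF x], of y] ptsD(2)[of y b M] x by blast
    then show "\<exists>!y. y \<in> pts b M \<and> ev M ?f (app (cx a) x y)" using un[OF x] by simp
  qed (use ev in blast)
  show ?thesis
  proof (rule that[OF f])
    fix M x assume x: "x \<in> pts a M"
    show "ap a b ?f M x \<in> pts b M \<and> sat M \<theta> (app (cx a) x (ap a b ?f M x))"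
      using ev_ap[OF a b f x] ev[OF ptsD[OF x] ptsD(2)[OF ap_pts[OF a b f x]]] by blast
  qed
qed

text \<open>Each assumption is a closure property of regular formulae: composition uses the
  existential quantifier, converse a renaming, intersection a conjunction. Unlike in an arbitrary
  category of sets, a tabulation is available because a relation is itself a formula in context,
  thus an object.\<close>

sublocale definable_category "Creg T" pts ap drel
proof (unfold_locales)
  fix a assume a: "a \<in> obj (Creg T)"
  show "ident (Creg T) a \<in> hom (Creg T) a a"
  proof (rule Creg_homI[OF a a Creg_ident(1)[OF a]])
    fix M x assume x: "x \<in> pts a M"
    show "\<exists>!y. y \<in> pts a M \<and> ev M (ident (Creg T) a) (app (cx a) x y)"
      by (rule ex1I[of _ x]) (use x ptsD Creg_ident(2)[OF a] in blast)+
  qed (use Creg_ident(2)[OF a] in blast)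
  then show "ap a a (ident (Creg T) a) M x = x" if "x \<in> pts a M" for M x
    using ap_eq[OF a a _ that ptsD(2)[OF that]] Creg_ident(2)[OF a ptsD[OF that] ptsD(2)[OF that]] that by blast
next
  fix a b c f g assume o: "a \<in> obj (Creg T)" "b \<in> obj (Creg T)" "c \<in> obj (Creg T)"
    and f: "f \<in> hom (Creg T) a b" and g: "g \<in> hom (Creg T) b c"
  note k = Creg_comp[OF o hom_FT[OF o(1,2) f] hom_FT[OF o(2,3) g]]
  have ev: "ev M (comp (Creg T) a b c f g) (app (cx a) x z) \<longleftrightarrow> x \<in> pts a M \<and> z = ap b c g M (ap a b f M x)"
    if M: "model T M" and x: "env M (cx a) x" and z: "env M (cx c) z" for M x z
    unfolding k(2)[OF M x z]
  proof
    assume "\<exists>y. env M (cx b) y \<and> ev M f (app (cx a) x y) \<and> ev M g (app (cx b) y z)"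
    then obtain y where y: "env M (cx b) y" "ev M f (app (cx a) x y)" "ev M g (app (cx b) y z)" by blast
    note p = hom_pts[OF o(1,2) f M x y(1,2)]
    show "x \<in> pts a M \<and> z = ap b c g M (ap a b f M x)"
      using p(1) ap_eq[OF o(1,2) f p(1) y(1,2)] ap_eq[OF o(2,3) g p(2) z y(3)] by simp
  next
    assume "x \<in> pts a M \<and> z = ap b c g M (ap a b f M x)"
    then show "\<exists>y. env M (cx b) y \<and> ev M f (app (cx a) x y) \<and> ev M g (app (cx b) y z)"
      using ev_ap[OF o(1,2) f] ev_ap[OF o(2,3) g] ap_pts[OF o(1,2) f] ptsD(2) by metis
  qed
  have in_c: "ap b c g M (ap a b f M x) \<in> pts c M" if "x \<in> pts a M" for M x
    using ap_pts[OF o(2,3) g ap_pts[OF o(1,2) f that]] .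
  show h: "comp (Creg T) a b c f g \<in> hom (Creg T) a c"
  proof (rule Creg_homI[OF o(1,3) k(1)])
    fix M x assume x: "x \<in> pts a M"
    show "\<exists>!y. y \<in> pts c M \<and> ev M (comp (Creg T) a b c f g) (app (cx a) x y)"
      by (rule ex1I[of _ "ap b c g M (ap a b f M x)"])
        (use x in_c[OF x] ptsD(2)[of _ c M] ev[OF ptsD[OF x]] in blast)+
  qed (use ev in_c in blast)
  show "ap a c (comp (Creg T) a b c f g) M x = ap b c g M (ap a b f M x)" if x: "x \<in> pts a M" for M x
    by (rule ap_eq[OF o(1,3) h x ptsD(2)[OF in_c[OF x]]])
      (use x ev[OF ptsD[OF x] ptsD(2)[OF in_c[OF x]]] in blast)
next
  fix a b f M x assume "a \<in> obj (Creg T)" "b \<in> obj (Creg T)" "f \<in> hom (Creg T) a b" "x \<in> pts a M"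
  then show "ap a b f M x \<in> pts b M" by (rule ap_pts)
next
  fix a b f g assume o: "a \<in> obj (Creg T)" "b \<in> obj (Creg T)" and f: "f \<in> hom (Creg T) a b" and g: "g \<in> hom (Creg T) a b"
    and eq: "\<And>M x. x \<in> pts a M \<Longrightarrow> ap a b f M x = ap a b g M x"
  \<comment> \<open>One inclusion between two classes, stated generally since it is applied in both
    directions.\<close>
  have *: "ev M f' e" if f: "f \<in> hom (Creg T) a b" and f': "f' \<in> hom (Creg T) a b"
    and eq: "\<And>M x. x \<in> pts a M \<Longrightarrow> ap a b f M x = ap a b f' M x"
    and M: "model T M" and e: "env M (cx a \<otimes> cx b) e" and v: "ev M f e" for f f' M e
  proof -
    obtain x y where xy: "env M (cx a) x" "env M (cx b) y" "e = app (cx a) x y" using env_split[OF e] by blast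
    note p = hom_pts[OF o f M xy(1,2) v[unfolded xy(3)]]
    show ?thesis unfolding xy(3)
      using ev_ap[OF o f' p(1)] eq[OF p(1)] ap_eq[OF o f p(1) xy(2) v[unfolded xy(3)]] by simp
  qed
  show "f = g"
    by (rule FT_eqI[OF hom_FT[OF o f] hom_FT[OF o g] cxx_ctxs[OF o]])
      (use *[OF f g eq] *[OF g f eq[symmetric]] in blast)
next
  fix a b R M assume "drel a b R"
  then show "R M \<subseteq> pts a M \<times> pts b M" by (rule drelE) auto
next
  fix a b f assume o: "a \<in> obj (Creg T)" "b \<in> obj (Creg T)" and f: "f \<in> hom (Creg T) a b"
  obtain \<theta> where \<theta>: "denotes T (cx a \<otimes> cx b) \<theta> (\<lambda>M. ev M f)" using FT_objE[OF hom_FT[OF o f] cxx_ctxs[OF o]] by metis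
  then have fm: "fm_in T (cx a \<otimes> cx b) \<theta>" by (simp add: denotes_def)
  show "drel a b (\<lambda>M. (\<lambda>x. (x, ap a b f M x)) ` pts a M)"
  proof (rule drelI[OF fm])
    fix M x y
    have "sat M \<theta> (app (cx a) x y) \<longleftrightarrow> y = ap a b f M x" if x: "x \<in> pts a M" and y: "y \<in> pts b M"
      using \<theta> ptsD(1)[OF x] env_app[OF ptsD(2)[OF x] ptsD(2)[OF y]] ev_ap[OF o f x] ap_eq[OF o f x ptsD(2)[OF y]]
      unfolding denotes_def by metis
    then show "(x, y) \<in> (\<lambda>x. (x, ap a b f M x)) ` pts a M \<longleftrightarrow> x \<in> pts a M \<and> y \<in> pts b M \<and> sat M \<theta> (app (cx a) x y)"
      using ap_pts[OF o f] by auto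
  qed
next
  fix a b R assume o: "a \<in> obj (Creg T)" "b \<in> obj (Creg T)" and R: "drel a b R"
    and un: "\<And>M x. x \<in> pts a M \<Longrightarrow> \<exists>!y. (x, y) \<in> R M"
  obtain \<theta> where \<theta>: "fm_in T (cx a \<otimes> cx b) \<theta>"
    "\<And>M x y. (x, y) \<in> R M \<longleftrightarrow> x \<in> pts a M \<and> y \<in> pts b M \<and> sat M \<theta> (app (cx a) x y)"
    using R by (rule drelE) blast
  obtain f where "f \<in> hom (Creg T) a b"
    "\<And>M x. x \<in> pts a M \<Longrightarrow> ap a b f M x \<in> pts b M \<and> sat M \<theta> (app (cx a) x (ap a b f M x))"
    by (rule graph_hom[OF o \<theta>(1)]) (use un \<theta>(2) in auto)
  then show "\<exists>f\<in>hom (Creg T) a b. \<forall>M. \<forall>x\<in>pts a M. (x, ap a b f M x) \<in> R M" using \<theta>(2) by blast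
next
  fix a b c R S assume o: "a \<in> obj (Creg T)" "b \<in> obj (Creg T)" "c \<in> obj (Creg T)" and R: "drel a b R" and S: "drel b c S"
  obtain \<theta> where \<theta>: "fm_in T (cx a \<otimes> cx b) \<theta>"
    "\<And>M x y. (x, y) \<in> R M \<longleftrightarrow> x \<in> pts a M \<and> y \<in> pts b M \<and> sat M \<theta> (app (cx a) x y)"
    using R by (rule drelE) blast
  obtain \<chi> where \<chi>: "fm_in T (cx b \<otimes> cx c) \<chi>"
    "\<And>M x y. (x, y) \<in> S M \<longleftrightarrow> x \<in> pts b M \<and> y \<in> pts c M \<and> sat M \<chi> (app (cx b) x y)"
    using S by (rule drelE) blast
  \<comment> \<open>The conjunct \<open>snd b\<close> makes the middle tuple a point of
    \<open>b\<close>; the formulae \<open>\<theta>\<close> and \<open>\<chi>\<close> need not imply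
    this.\<close>
  let ?k = "vec_ex (fst b) (Conj (snd b) (Conj (subst (swap_vars (cx a) (cx b)) \<theta>)
      (subst (\<lambda>\<sigma> j. if j < cx b \<sigma> then j else cx a \<sigma> + j) \<chi>)))"
  have sb: "set (fst b) \<subseteq> sorts T" using o(2) by (simp add: Creg_obj)
  have fm: "fm_in T (cx a \<otimes> cx c) ?k"
  proof (rule fm_in_vec_ex[OF sb])
    have "fm_in T (cx b \<otimes> (cx a \<otimes> cx c)) (subst (swap_vars (cx a) (cx b)) \<theta>)"
      using fm_in_swap[OF \<theta>(1), of "cx c"] by (simp only: tensor_assoc)
    then show "fm_in T (cx b \<otimes> (cx a \<otimes> cx c)) (Conj (snd b) (Conj (subst (swap_vars (cx a) (cx b)) \<theta>)
        (subst (\<lambda>\<sigma> j. if j < cx b \<sigma> then j else cx a \<sigma> + j) \<chi>)))"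
      using fm_in_left[OF obj_fm[OF o(2)]] fm_in_skip[OF \<chi>(1)] by simp
  qed
  show "drel a c (\<lambda>M. R M O S M)"
  proof (rule drelI[OF fm])
    fix M :: "('s, 'r) mdl" and x z
    have "sat M ?k (app (cx a) x z) \<longleftrightarrow> (\<exists>y. env M (cx b) y \<and> sat M (snd b) y \<and>
        sat M \<theta> (app (cx a) x y) \<and> sat M \<chi> (app (cx b) y z))"
      unfolding sat_vec_ex sat.simps sat_swap[OF \<theta>(1)] sat_skip[OF \<chi>(1)] sat_app_fst[OF obj_fm[OF o(2)]] by simp
    then show "(x, z) \<in> R M O S M \<longleftrightarrow> x \<in> pts a M \<and> z \<in> pts c M \<and> sat M ?k (app (cx a) x z)"
      using \<theta>(2) \<chi>(2) by (auto simp: relcomp_unfold pts_def)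
  qed
next
  fix a b R assume o: "a \<in> obj (Creg T)" "b \<in> obj (Creg T)" and R: "drel a b R"
  obtain \<theta> where \<theta>: "fm_in T (cx a \<otimes> cx b) \<theta>"
    "\<And>M x y. (x, y) \<in> R M \<longleftrightarrow> x \<in> pts a M \<and> y \<in> pts b M \<and> sat M \<theta> (app (cx a) x y)"
    using R by (rule drelE) blast
  have fm: "fm_in T (cx b \<otimes> cx a) (subst (swap_vars (cx a) (cx b)) \<theta>)"
    using fm_in_swap[OF \<theta>(1), of empty_ctx] by simp
  show "drel b a (\<lambda>M. (R M)\<inverse>)"
    by (rule drelI[OF fm]) (auto simp: sat_swap[OF \<theta>(1)] \<theta>(2))
  fix S assume S: "drel a b S"
  obtain \<chi> where \<chi>: "fm_in T (cx a \<otimes> cx b) \<chi>"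
    "\<And>M x y. (x, y) \<in> S M \<longleftrightarrow> x \<in> pts a M \<and> y \<in> pts b M \<and> sat M \<chi> (app (cx a) x y)"
    using S by (rule drelE) blast
  show "drel a b (\<lambda>M. R M \<inter> S M)"
    by (rule drelI[of _ _ "Conj \<theta> \<chi>"]) (use \<theta> \<chi> in auto)
next
  fix a b show "drel a b (\<lambda>M. pts a M \<times> pts b M)" by (rule drelI[of _ _ Top]) auto
next
  fix a b R assume o: "a \<in> obj (Creg T)" "b \<in> obj (Creg T)" and R: "drel a b R"
  obtain \<theta> where \<theta>: "fm_in T (cx a \<otimes> cx b) \<theta>"
    "\<And>M x y. (x, y) \<in> R M \<longleftrightarrow> x \<in> pts a M \<and> y \<in> pts b M \<and> sat M \<theta> (app (cx a) x y)"
    using R by (rule drelE) blast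
  let ?\<chi> = "Conj (Conj (snd a) (shift (cx a) (snd b))) \<theta>"
  have fm: "fm_in T (cx a \<otimes> cx b) ?\<chi>"
    using \<theta>(1) fm_in_left[OF obj_fm[OF o(1)]] fm_in_shift[OF obj_fm[OF o(2)]] by simp
  \<comment> \<open>The tabulating object is the relation itself, as a formula in the concatenated
    context.\<close>
  define t where "t = (fst a @ fst b, ?\<chi>)"
  have ct: "cx t = cx a \<otimes> cx b" by (simp add: t_def count_list_append_ctx)
  have t: "t \<in> obj (Creg T)" using o fm unfolding Creg_obj ct by (simp add: t_def)
  have pt: "w \<in> pts t M \<longleftrightarrow> (\<exists>x y. (x, y) \<in> R M \<and> w = app (cx a) x y)" for w M
  proof
    assume w: "w \<in> pts t M"
    then obtain x y where xy: "env M (cx a) x" "env M (cx b) y" "w = app (cx a) x y"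
      using env_split[of M "cx a" "cx b" w] by (auto simp: pts_def ct)
    have "sat M ?\<chi> w" using w by (simp add: pts_def t_def)
    then have "(x, y) \<in> R M" using xy ptsD(1)[OF w] by (simp add: \<theta>(2) pts_def sat_app_fst[OF obj_fm[OF o(1)]])
    then show "\<exists>x y. (x, y) \<in> R M \<and> w = app (cx a) x y" using xy(3) by blast
  next
    assume "\<exists>x y. (x, y) \<in> R M \<and> w = app (cx a) x y"
    then obtain x y where xy: "x \<in> pts a M" "y \<in> pts b M" "sat M \<theta> (app (cx a) x y)" "w = app (cx a) x y"
      using \<theta>(2) by blast
    have "env M (cx t) w" unfolding ct xy(4) using ptsD(2) xy(1,2) by (intro env_app)
    then show "w \<in> pts t M" using xy by (simp add: pts_def t_def sat_app_fst[OF obj_fm[OF o(1)]])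
  qed
  \<comment> \<open>Graphs of the two projections, in the contexts \<open>x, y, x'\<close> and
    \<open>x, y, y'\<close>; this explains the offset \<open>cx a \<sigma> + cx b \<sigma>\<close>
    of the last block.\<close>
  let ?p = "vec_eq (fst a) (\<lambda>\<sigma> i. i) (\<lambda>\<sigma> i. cx a \<sigma> + cx b \<sigma> + i)"
  let ?q = "vec_eq (fst b) (\<lambda>\<sigma> i. cx a \<sigma> + i) (\<lambda>\<sigma> i. cx a \<sigma> + cx b \<sigma> + i)"
  have fp: "fm_in T (cx t \<otimes> cx a) ?p" and fq: "fm_in T (cx t \<otimes> cx b) ?q"
    unfolding ct by (auto intro!: fm_in_vec_eq)
  have sp: "sat M ?p (app (cx t) (app (cx a) x y) x') \<longleftrightarrow> x = x'" if "x \<in> pts a M" "x' \<in> pts a M" for M x y x'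
    unfolding sat_vec_eq ct ctx_eq_iff[OF ptsD(2)[OF that(1)] ptsD(2)[OF that(2)], symmetric] by (auto simp: app_def)
  have sq: "sat M ?q (app (cx t) (app (cx a) x y) y') \<longleftrightarrow> y = y'" if "y \<in> pts b M" "y' \<in> pts b M" for M x y y'
    unfolding sat_vec_eq ct ctx_eq_iff[OF ptsD(2)[OF that(1)] ptsD(2)[OF that(2)], symmetric] by (auto simp: app_def)
  obtain f where f: "f \<in> hom (Creg T) t a"
    "\<And>M w. w \<in> pts t M \<Longrightarrow> ap t a f M w \<in> pts a M \<and> sat M ?p (app (cx t) w (ap t a f M w))"
  proof (rule graph_hom[OF t o(1) fp])
    fix M w assume "w \<in> pts t M"
    then obtain x y where w: "x \<in> pts a M" "w = app (cx a) x y" using pt \<theta>(2) by blast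
    show "\<exists>!z. z \<in> pts a M \<and> sat M ?p (app (cx t) w z)"
      by (rule ex1I[of _ x]) (use w sp in auto)
  qed blast
  obtain g where g: "g \<in> hom (Creg T) t b"
    "\<And>M w. w \<in> pts t M \<Longrightarrow> ap t b g M w \<in> pts b M \<and> sat M ?q (app (cx t) w (ap t b g M w))"
  proof (rule graph_hom[OF t o(2) fq])
    fix M w assume "w \<in> pts t M"
    then obtain x y where w: "y \<in> pts b M" "w = app (cx a) x y" using pt \<theta>(2) by blast
    show "\<exists>!z. z \<in> pts b M \<and> sat M ?q (app (cx t) w z)"
      by (rule ex1I[of _ y]) (use w sq in auto)
  qed blast
  have fg: "ap t a f M (app (cx a) x y) = x" "ap t b g M (app (cx a) x y) = y" if xy: "(x, y) \<in> R M" for M x y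
  proof -
    have w: "app (cx a) x y \<in> pts t M" and x: "x \<in> pts a M" and y: "y \<in> pts b M" using xy pt \<theta>(2) by blast+
    show "ap t a f M (app (cx a) x y) = x" "ap t b g M (app (cx a) x y) = y"
      using f(2)[OF w] g(2)[OF w] sp[OF x] sq[OF y] by auto
  qed
  have "bij_betw (\<lambda>w. (ap t a f M w, ap t b g M w)) (pts t M) (R M)" for M
    by (rule bij_betw_byWitness[of _ "\<lambda>(x, y). app (cx a) x y"]) (use pt fg in auto)
  then show "\<exists>t\<in>obj (Creg T). \<exists>f\<in>hom (Creg T) t a. \<exists>g\<in>hom (Creg T) t b.
      \<forall>M. bij_betw (\<lambda>w. (ap t a f M w, ap t b g M w)) (pts t M) (R M)"
    using t f(1) g(1) by blast
next
  \<comment> \<open>In a model the empty tuple is the only point. Other structures give no points to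
    any object, which is why the assumption on the terminal object is restricted to nonempty sets of
    points.\<close>
  have "pts ([], Top) M = {\<lambda>_ _. undefined}" if "model T M" for M
    using that by (auto simp: pts_def env_def fun_eq_iff)
  then show "\<exists>t\<in>obj (Creg T). \<forall>a\<in>obj (Creg T). \<forall>M. pts a M \<noteq> {} \<longrightarrow> (\<exists>u. pts t M = {u})"
    by (intro bexI[of _ "([], Top)"]) (auto simp: Creg_obj dest: ptsD(1))
qed

end

section \<open>Duplication and cap as relations between tuples\<close>

lemma CT_del_hom: "n \<in> ctxs T \<Longrightarrow> CT_del n \<in> hom (CT T) n (n \<otimes> n)"
  unfolding CT_del_def
proof (rule CT_homI[of _ _ _ "{\<sigma>. n \<sigma> \<noteq> 0}"])
  fix \<sigma> show "W_del (n \<sigma>) \<in> hom Wcat (n \<sigma>) ((n \<otimes> n) \<sigma>)"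
    unfolding tensor_apply by (rule W_del[THEN conjunct1])
qed (auto simp: ctxs_def)

lemma ctrel_del: "ctrel n (n \<otimes> n) (CT_del n) M x (app n y z) \<longleftrightarrow>
    assigns M n x \<and> (\<forall>\<sigma> i. i < n \<sigma> \<longrightarrow> y \<sigma> i = x \<sigma> i \<and> z \<sigma> i = x \<sigma> i)"
  unfolding ctrel_def CT_del_def tensor_apply wrel_W_del assigns_def by auto

lemma CT_cap_hom: "n \<in> ctxs T \<Longrightarrow> CT_cap n \<in> hom (CT T) (n \<otimes> n) empty_ctx"
  unfolding CT_cap_def
proof (rule CT_homI[of _ _ _ "{\<sigma>. n \<sigma> \<noteq> 0}"])
  fix \<sigma> show "W_cap (n \<sigma>) \<in> hom Wcat ((n \<otimes> n) \<sigma>) (empty_ctx \<sigma>)"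
    unfolding tensor_apply empty_ctx_def by (rule W_cap_hom)
qed (auto simp: ctxs_def W_cap_def W_comp_id0)

lemma ctrel_cap: "ctrel (n \<otimes> n) empty_ctx (CT_cap n) M (app n x y) u \<longleftrightarrow>
    assigns M n x \<and> (\<forall>\<sigma> i. i < n \<sigma> \<longrightarrow> y \<sigma> i = x \<sigma> i)"
  unfolding ctrel_def CT_cap_def tensor_apply empty_ctx_def wrel_W_cap assigns_def by auto

lemma ctrel_CT_id: "env M n x \<Longrightarrow> env M n y \<Longrightarrow> ctrel n n (CT_id n) M x y \<longleftrightarrow> x = y"
  unfolding CT_id_def ctrel_ident using env_in[of M n y] env_eqI[of M n x y] by blast

context regular
begin

section \<open>The syntactic po-category\<close>

text \<open>The predicate must speak of a valuation of the joint context, which is therefore decoded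
  into its two halves; \<open>app_inject\<close> makes the decoding unique.\<close>

definition syn_hom ::
  "'s list \<times> ('s, 'r) fm \<Rightarrow> 's list \<times> ('s, 'r) fm \<Rightarrow>
   (('s, 'r) mdl \<Rightarrow> (('s, 'r) vl \<times> ('s, 'r) vl) set) \<Rightarrow> ('s, 'r) fm set" where
  "syn_hom a b R = cl T (cx a \<otimes> cx b)
     (\<lambda>M e. \<exists>x y. env M (cx a) x \<and> env M (cx b) y \<and> e = app (cx a) x y \<and> (x, y) \<in> R M)"

text \<open>Not injective: the order of the list is forgotten, and a formula is replaced by its
  class.\<close>

definition syn_obj :: "'s list \<times> ('s, 'r) fm \<Rightarrow> 's ctx \<times> ('s, 'r) fm set" where
  "syn_obj a = (cx a, fm_class T (cx a) (snd a))"

lemma class_FT: "a \<in> obj (Creg T) \<Longrightarrow> fm_class T (cx a) (snd a) \<in> FT_obj T (cx a)"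
  using obj_fm by (auto simp: FT_obj_def)

lemma ev_obj: "a \<in> obj (Creg T) \<Longrightarrow> model T M \<Longrightarrow> env M (cx a) x \<Longrightarrow>
    ev M (fm_class T (cx a) (snd a)) x \<longleftrightarrow> x \<in> pts a M"
  by (simp add: ev_class[OF cx_ctxs obj_fm] pts_def)

lemma
  assumes a: "a \<in> obj (Creg T)" and b: "b \<in> obj (Creg T)" and R: "drel a b R"
  shows syn_hom_FT: "syn_hom a b R \<in> FT_obj T (cx a \<otimes> cx b)"
    and ev_syn_hom: "model T M \<Longrightarrow> env M (cx a) x \<Longrightarrow> env M (cx b) y \<Longrightarrow>
      ev M (syn_hom a b R) (app (cx a) x y) \<longleftrightarrow> (x, y) \<in> R M"
proof -
  obtain \<theta> where \<theta>: "fm_in T (cx a \<otimes> cx b) \<theta>"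
    "\<And>M x y. (x, y) \<in> R M \<longleftrightarrow> x \<in> pts a M \<and> y \<in> pts b M \<and> sat M \<theta> (app (cx a) x y)"
    using R by (rule drelE) blast
  let ?Q = "\<lambda>M e. \<exists>x y. env M (cx a) x \<and> env M (cx b) y \<and> e = app (cx a) x y \<and> (x, y) \<in> R M"
  let ?\<phi> = "Conj (Conj (snd a) (shift (cx a) (snd b))) \<theta>"
  have Q: "?Q M (app (cx a) x y) \<longleftrightarrow> (x, y) \<in> R M" if "env M (cx a) x" "env M (cx b) y" for M x y
    using that app_inject by blast
  have d: "denotes T (cx a \<otimes> cx b) ?\<phi> ?Q" unfolding denotes_def
  proof (intro conjI allI impI)
    show "fm_in T (cx a \<otimes> cx b) ?\<phi>"
      using \<theta>(1) fm_in_left[OF obj_fm[OF a]] fm_in_shift[OF obj_fm[OF b]] by simp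
    fix M :: "('s, 'r) mdl" and e assume M: "model T M" and e: "env M (cx a \<otimes> cx b) e"
    obtain x y where xy: "env M (cx a) x" "env M (cx b) y" "e = app (cx a) x y" using env_split[OF e] by blast
    have q: "?Q M e \<longleftrightarrow> (x, y) \<in> R M" unfolding xy(3) by (rule Q[OF xy(1,2)])
    show "sat M ?\<phi> e \<longleftrightarrow> ?Q M e" unfolding q unfolding xy(3) \<theta>(2)
      using M xy(1,2) by (simp add: pts_def sat_app_fst[OF obj_fm[OF a]])
  qed
  show "syn_hom a b R \<in> FT_obj T (cx a \<otimes> cx b)" unfolding syn_hom_def by (rule cl_FT[OF cxx_ctxs[OF a b] d])
  show "model T M \<Longrightarrow> env M (cx a) x \<Longrightarrow> env M (cx b) y \<Longrightarrow>
      ev M (syn_hom a b R) (app (cx a) x y) \<longleftrightarrow> (x, y) \<in> R M"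
    unfolding syn_hom_def using ev_cl[OF d _ env_app] Q by blast
qed

lemma FT_tensor_eqI:
  assumes "p \<in> FT_obj T (n \<otimes> m)" "q \<in> FT_obj T (n \<otimes> m)" "n \<otimes> m \<in> ctxs T"
    "\<And>M x y. model T M \<Longrightarrow> env M n x \<Longrightarrow> env M m y \<Longrightarrow> ev M p (app n x y) \<longleftrightarrow> ev M q (app n x y)"
  shows "p = q"
  by (rule FT_eqI[OF assms(1-3)]) (use assms(4) env_split in blast)

lemma FT_tensor_le_iff:
  assumes "p \<in> FT_obj T (n \<otimes> m)" "q \<in> FT_obj T (n \<otimes> m)" "n \<otimes> m \<in> ctxs T"
  shows "FT_le T (n \<otimes> m) p q \<longleftrightarrow> (\<forall>M x y. model T M \<longrightarrow> env M n x \<longrightarrow> env M m y \<longrightarrow>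
    ev M p (app n x y) \<longrightarrow> ev M q (app n x y))"
  unfolding FT_le_iff[OF assms] using env_split[of _ n m] env_app[of _ n _ m] by blast

lemma Syn_hom:
  assumes a: "a \<in> obj (Creg T)" and b: "b \<in> obj (Creg T)"
  shows "\<theta> \<in> hom (Syn T act) (syn_obj a) (syn_obj b) \<longleftrightarrow> \<theta> \<in> FT_obj T (cx a \<otimes> cx b) \<and>
    (\<forall>M x y. model T M \<longrightarrow> env M (cx a) x \<longrightarrow> env M (cx b) y \<longrightarrow> ev M \<theta> (app (cx a) x y) \<longrightarrow>
      x \<in> pts a M \<and> y \<in> pts b M)"
proof -
  note ca = cx_ctxs[OF a] and cb = cx_ctxs[OF b]
  note bp = boxplus_FT[OF ca cb class_FT[OF a] class_FT[OF b]] and eb = ev_boxplus[OF ca cb class_FT[OF a] class_FT[OF b]]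
  have "\<theta> \<in> hom (Syn T act) (syn_obj a) (syn_obj b) \<longleftrightarrow> \<theta> \<in> FT_obj T (cx a \<otimes> cx b) \<and>
      FT_le T (cx a \<otimes> cx b) \<theta> (boxplus T (cx a) (cx b) (fm_class T (cx a) (snd a)) (fm_class T (cx b) (snd b)))"
    by (simp add: Syn_def syn_obj_def)
  also have "\<dots> \<longleftrightarrow> \<theta> \<in> FT_obj T (cx a \<otimes> cx b) \<and>
    (\<forall>M x y. model T M \<longrightarrow> env M (cx a) x \<longrightarrow> env M (cx b) y \<longrightarrow> ev M \<theta> (app (cx a) x y) \<longrightarrow>
      x \<in> pts a M \<and> y \<in> pts b M)"
    using FT_tensor_le_iff[OF _ bp cxx_ctxs[OF a b]] eb ev_obj[OF a] ev_obj[OF b] by blast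
  finally show ?thesis .
qed

text \<open>Duplication relates \<open>z\<close> to the pair \<open>(z, z)\<close>, so the image of
  the points of \<open>a\<close> is their diagonal.\<close>

lemma Syn_ident:
  assumes a: "a \<in> obj (Creg T)"
  shows "ident (Syn T act) (syn_obj a) = syn_hom a a (\<lambda>M. Id_on (pts a M))"
proof -
  note c = cx_ctxs[OF a] and cc = cxx_ctxs[OF a a] and h = CT_del_hom[OF cx_ctxs[OF a]]
  have i: "ident (Syn T act) (syn_obj a) = act (cx a) (cx a \<otimes> cx a) (CT_del (cx a)) (fm_class T (cx a) (snd a))"
    by (simp add: Syn_def syn_obj_def)
  show ?thesis unfolding i
  proof (rule FT_tensor_eqI[OF act_FT[OF c cc h class_FT[OF a]] syn_hom_FT[OF a a drel_Id[OF a]] cc])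
    fix M :: "('s, 'r) mdl" and x y assume M: "model T M" and x: "env M (cx a) x" and y: "env M (cx a) y"
    have "(\<exists>z. env M (cx a) z \<and> ev M (fm_class T (cx a) (snd a)) z \<and> ctrel (cx a) (cx a \<otimes> cx a) (CT_del (cx a)) M z (app (cx a) x y)) \<longleftrightarrow>
        (\<exists>z. z \<in> pts a M \<and> x = z \<and> y = z)"
    proof (rule ex_cong1)
      fix z
      have "(\<forall>\<sigma> i. i < cx a \<sigma> \<longrightarrow> x \<sigma> i = z \<sigma> i \<and> y \<sigma> i = z \<sigma> i) \<longleftrightarrow> x = z \<and> y = z" if "env M (cx a) z"
        using ctx_eq_iff[OF x that] ctx_eq_iff[OF y that] by blast
      then show "env M (cx a) z \<and> ev M (fm_class T (cx a) (snd a)) z \<and> ctrel (cx a) (cx a \<otimes> cx a) (CT_del (cx a)) M z (app (cx a) x y) \<longleftrightarrow>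
          z \<in> pts a M \<and> x = z \<and> y = z"
        unfolding ctrel_del using ev_obj[OF a M] env_assigns ptsD(2) by blast
    qed
    then show "ev M (act (cx a) (cx a \<otimes> cx a) (CT_del (cx a)) (fm_class T (cx a) (snd a))) (app (cx a) x y) \<longleftrightarrow>
        ev M (syn_hom a a (\<lambda>M. Id_on (pts a M))) (app (cx a) x y)"
      unfolding ev_act[OF c cc h class_FT[OF a] M env_app[OF x y]] ev_syn_hom[OF a a drel_Id[OF a] M x y]
      by (auto simp: Id_on_def)
  qed
qed

text \<open>The cap forces the two copies of the middle tuple to agree and then discards them, while
  the identities keep the outer tuples: the image is the relational composite.\<close>

lemma Syn_comp:
  assumes o: "a \<in> obj (Creg T)" "b \<in> obj (Creg T)" "c \<in> obj (Creg T)" and R: "drel a b R" and S: "drel b c S"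
  shows "comp (Syn T act) (syn_obj a) (syn_obj b) (syn_obj c) (syn_hom a b R) (syn_hom b c S) =
    syn_hom a c (\<lambda>M. R M O S M)"
proof -
  let ?n = "cx a" and ?m = "cx b" and ?l = "cx c"
  note n = cx_ctxs[OF o(1)] and m = cx_ctxs[OF o(2)] and l = cx_ctxs[OF o(3)]
  note nm = cxx_ctxs[OF o(1,2)] and ml = cxx_ctxs[OF o(2,3)] and nl = cxx_ctxs[OF o(1,3)]
  let ?r = "CT_tensor (?m \<otimes> ?m) empty_ctx ?l ?l (CT_cap ?m) (CT_id ?l)"
  let ?w = "CT_tensor ?n ?n (?m \<otimes> ?m \<otimes> ?l) ?l (CT_id ?n) ?r"
  let ?p = "boxplus T (?n \<otimes> ?m) (?m \<otimes> ?l) (syn_hom a b R) (syn_hom b c S)"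
  have k: "comp (Syn T act) (syn_obj a) (syn_obj b) (syn_obj c) (syn_hom a b R) (syn_hom b c S) =
      act (?n \<otimes> ?m \<otimes> (?m \<otimes> ?l)) (?n \<otimes> ?l) ?w ?p"
    by (simp add: Syn_def syn_obj_def)
  have idn: "CT_id ?n \<in> hom (CT T) ?n ?n" and idl: "CT_id ?l \<in> hom (CT T) ?l ?l"
    unfolding CT_id_def using CT_ident_hom n l by auto
  have r: "?r \<in> hom (CT T) (?m \<otimes> ?m \<otimes> ?l) ?l"
    using CT_tensor_hom[OF CT_cap_hom[OF m] idl] by simp
  \<comment> \<open>The tensor of contexts is strictly associative, so regrouping is an equation and
    needs no coherence morphism.\<close>
  have eq: "?n \<otimes> ?m \<otimes> (?m \<otimes> ?l) = ?n \<otimes> (?m \<otimes> ?m \<otimes> ?l)" by (simp only: tensor_assoc)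
  have w: "?w \<in> hom (CT T) (?n \<otimes> ?m \<otimes> (?m \<otimes> ?l)) (?n \<otimes> ?l)"
    unfolding eq by (rule CT_tensor_hom[OF idn r])
  have nmml: "?n \<otimes> ?m \<otimes> (?m \<otimes> ?l) \<in> ctxs T" using nm ml by (rule ctxs_tensor)
  note hR = syn_hom_FT[OF o(1,2) R] and hS = syn_hom_FT[OF o(2,3) S] and hRS = drel_comp[OF o R S]
  note p = boxplus_FT[OF nm ml hR hS]
  have rel: "ctrel (?n \<otimes> ?m \<otimes> (?m \<otimes> ?l)) (?n \<otimes> ?l) ?w M (app (?n \<otimes> ?m) (app ?n x' y) (app ?m y' z')) (app ?n x z) \<longleftrightarrow>
      x' = x \<and> y' = y \<and> z' = z"
    if e: "env M ?n x'" "env M ?n x" "env M ?m y" "env M ?m y'" "env M ?l z'" "env M ?l z"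
    for M :: "('s, 'r) mdl" and x x' y y' z z'
  proof -
    have e1: "app (?n \<otimes> ?m) (app ?n x' y) (app ?m y' z') = app ?n x' (app (?m \<otimes> ?m) (app ?m y y') z')"
      by (simp only: app_assoc)
    \<comment> \<open>The target of the cap is the empty context, so any valuation can stand for its
      tuple; \<open>z\<close> is taken.\<close>
    have "ctrel (?m \<otimes> ?m \<otimes> ?l) (empty_ctx \<otimes> ?l) ?r M (app (?m \<otimes> ?m) (app ?m y y') z') (app empty_ctx z z) \<longleftrightarrow>
        y' = y \<and> z' = z"
      unfolding ctrel_tensor[OF CT_cap_hom[OF m] idl] ctrel_cap ctrel_CT_id[OF e(5,6)] ctx_eq_iff[OF e(4,3)]
      using env_assigns[OF e(3)] by simp
    then show ?thesis
      unfolding e1 eq ctrel_tensor[OF idn r] ctrel_CT_id[OF e(1,2)] by simp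
  qed
  show ?thesis unfolding k
  proof (rule FT_tensor_eqI[OF act_FT[OF nmml nl w p] syn_hom_FT[OF o(1,3) hRS] nl])
    fix M :: "('s, 'r) mdl" and x z assume M: "model T M" and x: "env M ?n x" and z: "env M ?l z"
    have "(\<exists>e. env M (?n \<otimes> ?m \<otimes> (?m \<otimes> ?l)) e \<and> ev M ?p e \<and> ctrel (?n \<otimes> ?m \<otimes> (?m \<otimes> ?l)) (?n \<otimes> ?l) ?w M e (app ?n x z)) \<longleftrightarrow>
        (\<exists>y. (x, y) \<in> R M \<and> (y, z) \<in> S M)" (is "?L \<longleftrightarrow> ?R")
    proof
      assume ?L
      then obtain e where e: "env M (?n \<otimes> ?m \<otimes> (?m \<otimes> ?l)) e" "ev M ?p e"
        "ctrel (?n \<otimes> ?m \<otimes> (?m \<otimes> ?l)) (?n \<otimes> ?l) ?w M e (app ?n x z)" by blast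
      obtain e1 e2 where e12: "env M (?n \<otimes> ?m) e1" "env M (?m \<otimes> ?l) e2" "e = app (?n \<otimes> ?m) e1 e2"
        using env_split[OF e(1)] by blast
      obtain x' y where xy: "env M ?n x'" "env M ?m y" "e1 = app ?n x' y" using env_split[OF e12(1)] by blast
      obtain y' z' where yz: "env M ?m y'" "env M ?l z'" "e2 = app ?m y' z'" using env_split[OF e12(2)] by blast
      have "x' = x" "y' = y" "z' = z"
        using e(3) rel[OF xy(1) x xy(2) yz(1,2) z] unfolding e12(3) xy(3) yz(3) by auto
      moreover have "ev M (syn_hom a b R) e1" "ev M (syn_hom b c S) e2"
        using e(2) ev_boxplus[OF nm ml hR hS M e12(1,2)] unfolding e12(3) by auto
      ultimately show ?R
        using ev_syn_hom[OF o(1,2) R M x xy(2)] ev_syn_hom[OF o(2,3) S M xy(2) z] xy(3) yz(3) by blast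
    next
      assume ?R
      then obtain y where y: "(x, y) \<in> R M" "(y, z) \<in> S M" by blast
      then have ye: "env M ?m y" using drel_sub[OF o(1,2) R] ptsD(2) by blast
      have "ev M ?p (app (?n \<otimes> ?m) (app ?n x y) (app ?m y z))"
        using ev_boxplus[OF nm ml hR hS M env_app[OF x ye] env_app[OF ye z]]
          ev_syn_hom[OF o(1,2) R M x ye] ev_syn_hom[OF o(2,3) S M ye z] y by blast
      moreover have "env M (?n \<otimes> ?m \<otimes> (?m \<otimes> ?l)) (app (?n \<otimes> ?m) (app ?n x y) (app ?m y z))"
        by (intro env_app x ye z)
      ultimately show ?L using rel[OF x x ye ye z z] by blast
    qed
    then show "ev M (act (?n \<otimes> ?m \<otimes> (?m \<otimes> ?l)) (?n \<otimes> ?l) ?w ?p) (app ?n x z) \<longleftrightarrow>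
        ev M (syn_hom a c (\<lambda>M. R M O S M)) (app ?n x z)"
      unfolding ev_act[OF nmml nl w p M env_app[OF x z]] ev_syn_hom[OF o(1,3) hRS M x z] by auto
  qed
qed

lemma drel_of_Syn:
  assumes a: "a \<in> obj (Creg T)" and b: "b \<in> obj (Creg T)" and \<theta>: "\<theta> \<in> hom (Syn T act) (syn_obj a) (syn_obj b)"
  obtains R where "drel a b R" "\<theta> = syn_hom a b R"
proof -
  have FT: "\<theta> \<in> FT_obj T (cx a \<otimes> cx b)"
    and pt: "\<And>M x y. model T M \<Longrightarrow> env M (cx a) x \<Longrightarrow> env M (cx b) y \<Longrightarrow> ev M \<theta> (app (cx a) x y) \<Longrightarrow>
      x \<in> pts a M \<and> y \<in> pts b M"
    using \<theta> unfolding Syn_hom[OF a b] by blast+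
  obtain \<phi> where d: "denotes T (cx a \<otimes> cx b) \<phi> (\<lambda>M. ev M \<theta>)" using FT_objE[OF FT cxx_ctxs[OF a b]] by metis
  then have fm: "fm_in T (cx a \<otimes> cx b) \<phi>" by (simp add: denotes_def)
  have R: "drel a b (frel a b \<phi>)" unfolding drel_def using fm by blast
  have "\<theta> = syn_hom a b (frel a b \<phi>)"
  proof (rule FT_tensor_eqI[OF FT syn_hom_FT[OF a b R] cxx_ctxs[OF a b]])
    fix M :: "('s, 'r) mdl" and x y assume M: "model T M" and x: "env M (cx a) x" and y: "env M (cx b) y"
    have "ev M \<theta> (app (cx a) x y) \<longleftrightarrow> sat M \<phi> (app (cx a) x y)"
      using d M env_app[OF x y] unfolding denotes_def by blast
    then show "ev M \<theta> (app (cx a) x y) \<longleftrightarrow> ev M (syn_hom a b (frel a b \<phi>)) (app (cx a) x y)"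
      unfolding ev_syn_hom[OF a b R M x y] frel_def using pt[OF M x y] by blast
  qed
  with R show ?thesis by (rule that)
qed

lemma syn_hom_le:
  assumes a: "a \<in> obj (Creg T)" and b: "b \<in> obj (Creg T)" and R: "drel a b R" and S: "drel a b S"
  shows "FT_le T (cx a \<otimes> cx b) (syn_hom a b R) (syn_hom a b S) \<longleftrightarrow> (\<forall>M. R M \<subseteq> S M)"
proof -
  have pts: "model T M \<and> env M (cx a) x \<and> env M (cx b) y" if "(x, y) \<in> R M" for M x y
    using drel_sub[OF a b R] that ptsD by blast
  show ?thesis
    unfolding FT_tensor_le_iff[OF syn_hom_FT[OF a b R] syn_hom_FT[OF a b S] cxx_ctxs[OF a b]]
    using ev_syn_hom[OF a b R] ev_syn_hom[OF a b S] pts by (auto 0 3)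
qed

lemma po_onto_Syn: "po_onto DRel (Syn T act) syn_obj syn_hom"
  unfolding po_onto_def cat_onto_def DRel_simps
proof (intro conjI ballI)
  show "syn_obj ` obj (Creg T) = obj (Syn T act)"
  proof (intro equalityI subsetI)
    fix z assume "z \<in> syn_obj ` obj (Creg T)"
    then show "z \<in> obj (Syn T act)" using cx_ctxs class_FT by (auto simp: Syn_def syn_obj_def)
  next
    fix z assume "z \<in> obj (Syn T act)"
    then obtain n p where z: "z = (n, p)" "n \<in> ctxs T" "p \<in> FT_obj T n" by (auto simp: Syn_def)
    \<comment> \<open>Surjectivity on objects: some ordering of the variables and some formula of
      the class represent the given object.\<close>
    obtain ss where ss: "set ss \<subseteq> sorts T" "count_list ss = n" using ctx_list[OF z(2)] by blast
    obtain \<phi> where \<phi>: "fm_in T n \<phi>" "p = fm_class T n \<phi>" using z(3) unfolding FT_obj_def by blast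
    have "(ss, \<phi>) \<in> obj (Creg T)" "z = syn_obj (ss, \<phi>)" using ss \<phi> z(1) by (auto simp: Creg_obj syn_obj_def)
    then show "z \<in> syn_obj ` obj (Creg T)" by blast
  qed
next
  fix a b assume o: "a \<in> obj (Creg T)" "b \<in> obj (Creg T)"
  have hom: "syn_hom a b R \<in> hom (Syn T act) (syn_obj a) (syn_obj b)" if R: "drel a b R" for R
    unfolding Syn_hom[OF o] using syn_hom_FT[OF o R] ev_syn_hom[OF o R] drel_sub[OF o R] by blast
  have le: "le (Syn T act) (syn_obj a) (syn_obj b) p q \<longleftrightarrow> FT_le T (cx a \<otimes> cx b) p q" for p q
    by (simp add: Syn_def syn_obj_def)
  show "bij_betw (syn_hom a b) (hom DRel a b) (hom (Syn T act) (syn_obj a) (syn_obj b))"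
  proof (rule bij_betw_imageI)
    show "inj_on (syn_hom a b) (hom DRel a b)"
    proof (rule inj_onI)
      fix R S assume RS: "R \<in> hom DRel a b" "S \<in> hom DRel a b" and eq: "syn_hom a b R = syn_hom a b S"
      have R: "drel a b R" and S: "drel a b S" using RS by simp_all
      have "FT_le T (cx a \<otimes> cx b) (syn_hom a b S) (syn_hom a b S)"
        using poset_FT[OF cxx_ctxs[OF o]] syn_hom_FT[OF o S] unfolding poset_on_def by blast
      then have "\<forall>M. R M \<subseteq> S M" "\<forall>M. S M \<subseteq> R M"
        using syn_hom_le[OF o R S] syn_hom_le[OF o S R] eq by simp_all
      then show "R = S" by (simp add: fun_eq_iff set_eq_subset)
    qed
    show "syn_hom a b ` hom DRel a b = hom (Syn T act) (syn_obj a) (syn_obj b)"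
    proof (intro equalityI subsetI)
      fix \<theta> assume "\<theta> \<in> syn_hom a b ` hom DRel a b"
      then show "\<theta> \<in> hom (Syn T act) (syn_obj a) (syn_obj b)" using hom by auto
    next
      fix \<theta> assume "\<theta> \<in> hom (Syn T act) (syn_obj a) (syn_obj b)"
      then obtain R where "drel a b R" "\<theta> = syn_hom a b R" using drel_of_Syn[OF o] by blast
      then show "\<theta> \<in> syn_hom a b ` hom DRel a b" by simp
    qed
  qed
  fix R S assume RS: "R \<in> hom DRel a b" "S \<in> hom DRel a b"
  then show "le (Syn T act) (syn_obj a) (syn_obj b) (syn_hom a b R) (syn_hom a b S) \<longleftrightarrow> (\<forall>M. R M \<subseteq> S M)"
    unfolding le using syn_hom_le[OF o] by simp
next
  fix a assume "a \<in> obj (Creg T)"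
  then show "syn_hom a a (\<lambda>M. Id_on (pts a M)) = ident (Syn T act) (syn_obj a)" using Syn_ident by simp
next
  fix a b c R S assume "a \<in> obj (Creg T)" "b \<in> obj (Creg T)" "c \<in> obj (Creg T)" "R \<in> hom DRel a b" "S \<in> hom DRel b c"
  then show "syn_hom a c (\<lambda>M. R M O S M) =
      comp (Syn T act) (syn_obj a) (syn_obj b) (syn_obj c) (syn_hom a b R) (syn_hom b c S)"
    using Syn_comp by simp
qed

end

theorem theorem1:
  fixes T :: "('s, 'r) thy"
  assumes "regular_theory T"
  shows "(\<exists>!P. is_FT T P) \<and>
         regular_category (Creg T) \<and>
         po_equivalent (Syn T (FT T)) (Rel (Creg T)) \<and>
         cat_equivalent (Creg T) (LAdj (Syn T (FT T)))"
proof -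
  interpret regular T by unfold_locales (rule assms)
  \<comment> \<open>Morphisms of \<open>Creg\<close> are the left adjoints of \<open>DRel\<close> by
    their graphs, and the comparison from \<open>DRel\<close> to \<open>Syn\<close> preserves and
    reflects left adjoints.\<close>
  have "cat_onto (Creg T) (LAdj (Syn T act)) syn_obj (\<lambda>a b f. syn_hom a b (gr a b f))"
    using cat_onto_trans[OF cat_onto_LAdj_DRel po_onto_LAdj[OF _ po_onto_Syn]] po_category_DRel
    by (simp add: po_category_def)
  then have "cat_equivalent (Creg T) (LAdj (Syn T act))" by (rule cat_onto_equivalent[OF category])
  moreover have "po_equivalent (Syn T act) (Rel (Creg T))"
    by (rule po_onto_equivalent[OF po_category_DRel po_onto_Syn po_onto_Rel])
  ultimately show ?thesis using FT_unique regular unfolding FT_act by blast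
qed

end
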